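(* Let $\widetilde{\mathfrak G}$ be the group defined in the context, with the subgroups $\tilde N_m$, the modules $V_n$, their subspaces $V_n^r$, and the isomorphisms $\alpha\oplus\beta\oplus\gamma:\tilde N_m/\tilde N_{m+1}\to V_m\oplus V_m\oplus V_{m-1}$. Let $\widetilde{\mathfrak G}_n$ ($n\ge1$) denote the series of $\mathbb F_2$-dimension subgroups of $\widetilde{\mathfrak G}$. For all $m\ge1$: 1. $\widetilde{\mathfrak G}_{2^m+1}=\tilde N_m$. 2. $$\widetilde{\mathfrak G}_{2^m+1+r}=\begin{cases}\tilde N_{m+1}\,\alpha^{-1}(V_m^r)\,\beta^{-1}(V_m^r)\,\gamma^{-1}(V_{m-1}^{r/2})&\text{if }0\le r\le2^m\text{ is even},\\ \tilde N_{m+1}\,\alpha^{-1}(V_m^r)\,\beta^{-1}(V_m^r)\,\gamma^{-1}(V_{m-1}^{(r-1)/2})&\text{if }0\le r\le2^m\text{ is odd}.\end{cases}$$ 3. $$\operatorname{rank}(\widetilde{\mathfrak G}_i/\widetilde{\mathfrak G}_{i+1})=\begin{cases}4&\text{if }i=1,\\3&\text{if }i>1\text{ is even},\\2&\text{if }i>1\text{ is odd}.\end{cases}$$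
   Context: Let $\Sigma=\mathbb F_2=\{0,1\}$ and let $\Sigma^*$ be the set of finite words over $\Sigma$, viewed as a rooted binary tree. For $x\in\Sigma$ write $\overline x=1-x$. Define tree automorphisms $a,\tilde b,\tilde c,\tilde d$ of $\Sigma^*$ (acting on the left; words too short for a rule to apply are fixed) by $a(x\sigma)=\overline x\sigma$; $\tilde b(0x\sigma)=0\overline x\sigma$, $\tilde b(1\sigma)=1\tilde c(\sigma)$; $\tilde c(0\sigma)=0\sigma$, $\tilde c(1\sigma)=1\tilde d(\sigma)$; $\tilde d(0\sigma)=0\sigma$, $\tilde d(1\sigma)=1\tilde b(\sigma)$. Put $\widetilde{\mathfrak G}=\langle a,\tilde b,\tilde c,\tilde d\rangle$. The $\mathbb F_2$-dimension subgroups of a group $G$ are $G_n=\{g\in G: g-1\in\Delta^n\}$, where $\Delta$ is the augmentation ideal of $\mathbb F_2[G]$. An automorphism fixing all words of length $m$ is identified with the $2^m$-tuple $(g_\sigma)_{\sigma\in\Sigma^m}$ (lexicographic order) of its actions on the subtrees below the words of length $m$: $g(\sigma\tau)=\sigma g_\sigma(\tau)$. Conventions: $[g,h]=ghg^{-1}h^{-1}$. Let $x=[a,\tilde b]$, $y=[a,\tilde d]$, let $\tilde K$ be the normal closure of $\{x,y\}$ in $\widetilde{\mathfrak G}$, and let $\tilde T$ be the normal closure of $x^2$ in $\widetilde{\mathfrak G}$. One has $\tilde K\times\tilde K\le\tilde K$. For $Q\le\tilde K$ let $Q_m=Q\times\dots\times Q$ ($2^m$ copies), a subgroup of $\widetilde{\mathfrak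 G}$ acting on each subtree starting on level $m$ by the corresponding factor ($Q_0=Q$). For $m\ge1$ let $\tilde N_m=\tilde K_m\cdot\tilde T_{m-1}$. For $n\ge0$ let $V_n=\mathbb F_2[X_1,\dots,X_n]/(X_1^2-1,\dots,X_n^2-1)$ (so $V_0=\mathbb F_2$); the word $\sigma_1\cdots\sigma_n\in\Sigma^n$ corresponds to the monomial $X_1^{\sigma_1}\cdots X_n^{\sigma_n}$. For $0\le r\le 2^n-1$ with binary expansion $r=\sum_{i=1}^n r_i2^{i-1}$, $r_i\in\{0,1\}$, put $v_n^r=(1-X_1)^{r_1}\cdots(1-X_n)^{r_n}$ and let $V_n^r$ be the span of $v_n^r,v_n^{r+1},\dots,v_n^{2^n-1}$; put $V_n^r=0$ for $r\ge2^n$. For $m\ge1$ there is an isomorphism $\alpha\oplus\beta\oplus\gamma:\tilde N_m/\tilde N_{m+1}\to V_m\oplus V_m\oplus V_{m-1}$ in which $\alpha$ sends the class of $(1,\dots,x,\dots,1)\in\tilde K_m$ to the monomial of $V_m$ corresponding to the vertex at which $x$ stands, $\beta$ sends the class of $(1,\dots,y,\dots,1)\in\tilde K_m$ to the corresponding monomial of (the second copy of) $V_m$, and $\gamma$ sends the class of $(1,\dots,x^2,\dots,1)\in\tilde T_{m-1}$ to the corresponding monomial of $V_{m-1}$. For subspaces $V,V'\subseteq V_m$, $W\subseteq V_{m-1}$, $\tilde N_{m+1}\alpha^{-1}(V)\beta^{-1}(V')\gamma^{-1}(W)$ denotes the full preimage of $V\oplus V'\oplus W$ in $\tilde N_m$.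 The rank of an abelian group $M$ here means $\dim_{\mathbb F_2}(M\otimes\mathbb F_2)$. *)

theory Defs
  imports
    "HOL-Algebra.Algebra"
    "HOL-Library.Z2"
    "Jordan_Normal_Form.Missing_VectorSpace"
begin

text \<open>\<open>\<F>\<^sub>2\<close> is the type \<^typ>\<open>bit\<close>; words are lists of bits, the first letter being the one
  closest to the root.\<close>

definition F2 :: "bit ring" where
  "F2 = \<lparr>carrier = UNIV, monoid.mult = (*), one = 1, ring.zero = 0, ring.add = (+)\<rparr>"

section \<open>The group\<close>

type_synonym word = "bit list"

fun act_a :: "word \<Rightarrow> word" where
  "act_a [] = []"
| "act_a (x # w) = (1 - x) # w"

fun act_b act_c act_d :: "word \<Rightarrow> word" where
  "act_b [] = []"
| "act_b (z # w) = (if z = 0 then (case w of [] \<Rightarrow> [0] | x # u \<Rightarrow> 0 # (1 - x) # u)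
                    else 1 # act_c w)"
| "act_c [] = []"
| "act_c (z # w) = (if z = 0 then 0 # w else 1 # act_d w)"
| "act_d [] = []"
| "act_d (z # w) = (if z = 0 then 0 # w else 1 # act_b w)"

text \<open>Products in \<^term>\<open>BijGroup UNIV\<close> are compositions of functions, so that \<open>g \<otimes> h\<close> applies
  \<open>h\<close> first (left action).\<close>

definition Gt :: "(word \<Rightarrow> word) monoid" where
  "Gt = (BijGroup UNIV)\<lparr>carrier := generate (BijGroup UNIV) {act_a, act_b, act_c, act_d}\<rparr>"

lemma act_involutions:
  "act_a (act_a w) = w" "act_b (act_b w) = w" "act_c (act_c w) = w" "act_d (act_d w) = w"
proof -
  show "act_a (act_a w) = w" by (cases w) auto
  have "act_b (act_b w) = w \<and> act_c (act_c w) = w \<and> act_d (act_d w) = w"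
    by (induction w) (auto split: list.splits)
  then show "act_b (act_b w) = w" "act_c (act_c w) = w" "act_d (act_d w) = w" by auto
qed

lemma act_in_BijGroup: "{act_a, act_b, act_c, act_d} \<subseteq> carrier (BijGroup UNIV)"
  by (auto simp: BijGroup_def Bij_def intro!: o_bij act_involutions ext)

lemma group_Gt: "group Gt"
  unfolding Gt_def
  by (intro group.subgroup_imp_group group.generate_is_subgroup group_BijGroup act_in_BijGroup)

definition commutator :: "('a, 'b) monoid_scheme \<Rightarrow> 'a \<Rightarrow> 'a \<Rightarrow> 'a" where
  "commutator G g h = g \<otimes>\<^bsub>G\<^esub> h \<otimes>\<^bsub>G\<^esub> inv\<^bsub>G\<^esub> g \<otimes>\<^bsub>G\<^esub> inv\<^bsub>G\<^esub> h"

definition normal_closure :: "('a, 'b) monoid_scheme \<Rightarrow> 'a set \<Rightarrow> 'a set" where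
  "normal_closure G S = \<Inter>{N. N \<lhd> G \<and> S \<subseteq> N}"

definition xx :: "word \<Rightarrow> word" where "xx = commutator Gt act_a act_b"
definition yy :: "word \<Rightarrow> word" where "yy = commutator Gt act_a act_d"
definition xx2 :: "word \<Rightarrow> word" where "xx2 = xx [^]\<^bsub>Gt\<^esub> (2::nat)"

definition Kt :: "(word \<Rightarrow> word) set" where "Kt = normal_closure Gt {xx, yy}"
definition Tt :: "(word \<Rightarrow> word) set" where "Tt = normal_closure Gt {xx2}"

text \<open>The automorphism fixing the words of length \<open>m\<close> and acting by \<open>f \<sigma>\<close> below the word \<open>\<sigma>\<close>
  of length \<open>m\<close>, i.e. the tuple \<open>(f \<sigma>)\<^sub>\<sigma>\<close>.\<close>

definition tuple :: "nat \<Rightarrow> (word \<Rightarrow> word \<Rightarrow> word) \<Rightarrow> word \<Rightarrow> word" where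
  "tuple m f w = (if length w < m then w else take m w @ f (take m w) (drop m w))"

text \<open>The tuple \<open>(1, \<dots>, g, \<dots>, 1)\<close> with \<open>g\<close> at the vertex \<open>\<sigma>\<close>.\<close>

definition at_vertex :: "word \<Rightarrow> (word \<Rightarrow> word) \<Rightarrow> word \<Rightarrow> word" where
  "at_vertex \<sigma> g = tuple (length \<sigma>) (\<lambda>\<tau>. if \<tau> = \<sigma> then g else id)"

definition copies :: "nat \<Rightarrow> (word \<Rightarrow> word) set \<Rightarrow> (word \<Rightarrow> word) set" where
  "copies m Q = {tuple m f | f. \<forall>\<sigma>. length \<sigma> = m \<longrightarrow> f \<sigma> \<in> Q}"

text \<open>Only used for \<open>m \<ge> 1\<close>.\<close>

definition Nt :: "nat \<Rightarrow> (word \<Rightarrow> word) set" where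
  "Nt m = copies m Kt <#>\<^bsub>Gt\<^esub> copies (m - 1) Tt"

section \<open>Dimension subgroups\<close>

text \<open>The group algebra \<open>\<F>\<^sub>2[G]\<close>: finitely supported functions with convolution.\<close>

definition group_algebra :: "('a, 'b) monoid_scheme \<Rightarrow> ('a \<Rightarrow> bit) ring" where
  "group_algebra G =
    \<lparr>carrier = {f. finite {g. f g \<noteq> 0} \<and> {g. f g \<noteq> 0} \<subseteq> carrier G},
     monoid.mult = (\<lambda>f h g. \<Sum>(u, v) \<in> {(u, v). f u \<noteq> 0 \<and> h v \<noteq> 0 \<and> u \<otimes>\<^bsub>G\<^esub> v = g}. f u * h v),
     one = (\<lambda>g. if g = \<one>\<^bsub>G\<^esub> then 1 else 0),
     ring.zero = (\<lambda>g. 0),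
     ring.add = (\<lambda>f h g. f g + h g)\<rparr>"

definition aug_ideal :: "('a, 'b) monoid_scheme \<Rightarrow> ('a \<Rightarrow> bit) set" where
  "aug_ideal G = a_kernel (group_algebra G) F2 (\<lambda>f. \<Sum>g | f g \<noteq> 0. f g)"

text \<open>The power \<open>\<Delta>\<^sup>n\<close> is taken in the multiplicative monoid of ideals.\<close>

definition dim_subgroup :: "('a, 'b) monoid_scheme \<Rightarrow> nat \<Rightarrow> 'a set" where
  "dim_subgroup G n =
    {g \<in> carrier G.
      (\<lambda>h. if h = g then 1 else 0) \<ominus>\<^bsub>group_algebra G\<^esub> \<one>\<^bsub>group_algebra G\<^esub>
        \<in> aug_ideal G [^]\<^bsub>ideals_set (group_algebra G)\<^esub> n}"

section \<open>The modules \<open>V\<^sub>n\<close>\<close>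

text \<open>A polynomial in variables indexed by \<^typ>\<open>nat\<close> is a finitely supported map from
  exponent vectors to coefficients; the multiplication of \<^typ>\<open>(nat \<Rightarrow>\<^sub>0 nat) \<Rightarrow>\<^sub>0 bit\<close> is that of
  polynomials.\<close>

type_synonym mpoly2 = "(nat \<Rightarrow>\<^sub>0 nat) \<Rightarrow>\<^sub>0 bit"

definition Xv :: "nat \<Rightarrow> mpoly2" where
  "Xv i = Poly_Mapping.single (Poly_Mapping.single i 1) 1"

definition scalar :: "bit \<Rightarrow> mpoly2" where
  "scalar c = Poly_Mapping.single 0 c"

text \<open>The ring \<open>\<F>\<^sub>2[X\<^sub>1, \<dots>, X\<^sub>n]\<close>.\<close>

definition poly_ring :: "nat \<Rightarrow> mpoly2 ring" where
  "poly_ring n =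
    \<lparr>carrier = {p. \<forall>t \<in> Poly_Mapping.keys p. Poly_Mapping.keys t \<subseteq> {1..n}},
     monoid.mult = (*), one = 1, ring.zero = 0, ring.add = (+)\<rparr>"

definition V_ideal :: "nat \<Rightarrow> mpoly2 set" where
  "V_ideal n = genideal (poly_ring n) ((\<lambda>i. Xv i ^ 2 - 1) ` {1..n})"

definition V :: "nat \<Rightarrow> mpoly2 set ring" where
  "V n = poly_ring n Quot V_ideal n"

definition V_class :: "nat \<Rightarrow> mpoly2 \<Rightarrow> mpoly2 set" where
  "V_class n p = V_ideal n +>\<^bsub>poly_ring n\<^esub> p"

text \<open>Letter \<open>\<sigma>\<^sub>i\<close> of a word is \<open>\<sigma> ! (i - 1)\<close>.\<close>

definition V_monom :: "word \<Rightarrow> mpoly2 set" where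
  "V_monom \<sigma> = V_class (length \<sigma>) (\<Prod>i\<in>{i \<in> {1..length \<sigma>}. \<sigma> ! (i - 1) = 1}. Xv i)"

definition v_poly :: "nat \<Rightarrow> nat \<Rightarrow> mpoly2" where
  "v_poly n r = (\<Prod>i = 1..n. (1 - Xv i) ^ (r div 2 ^ (i - 1) mod 2))"

definition V_sub :: "nat \<Rightarrow> nat \<Rightarrow> mpoly2 set set" where
  "V_sub n r = {V_class n (\<Sum>j = r..<2 ^ n. scalar (c j) * v_poly n j) | c. True}"

section \<open>The isomorphisms \<open>\<alpha> \<oplus> \<beta> \<oplus> \<gamma>\<close>\<close>

definition is_abg :: "nat \<Rightarrow> ((word \<Rightarrow> word) set \<Rightarrow> mpoly2 set \<times> mpoly2 set \<times> mpoly2 set) \<Rightarrow> bool"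
where
  "is_abg m \<phi> \<longleftrightarrow>
    \<phi> \<in> iso (Gt\<lparr>carrier := Nt m\<rparr> Mod Nt (m + 1))
            (add_monoid (V m) \<times>\<times> add_monoid (V m) \<times>\<times> add_monoid (V (m - 1))) \<and>
    (\<forall>\<sigma>. length \<sigma> = m \<longrightarrow>
        \<phi> (Nt (m + 1) #>\<^bsub>Gt\<^esub> at_vertex \<sigma> xx) = (V_monom \<sigma>, \<zero>\<^bsub>V m\<^esub>, \<zero>\<^bsub>V (m - 1)\<^esub>)) \<and>
    (\<forall>\<sigma>. length \<sigma> = m \<longrightarrow>
        \<phi> (Nt (m + 1) #>\<^bsub>Gt\<^esub> at_vertex \<sigma> yy) = (\<zero>\<^bsub>V m\<^esub>, V_monom \<sigma>, \<zero>\<^bsub>V (m - 1)\<^esub>)) \<and>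
    (\<forall>\<sigma>. length \<sigma> = m - 1 \<longrightarrow>
        \<phi> (Nt (m + 1) #>\<^bsub>Gt\<^esub> at_vertex \<sigma> xx2) = (\<zero>\<^bsub>V m\<^esub>, \<zero>\<^bsub>V m\<^esub>, V_monom \<sigma>))"

text \<open>Such an isomorphism is unique on the quotient, since the prescribed values generate the
  target; so the choice below only selects it (its values elsewhere are never used).\<close>

definition abg :: "nat \<Rightarrow> (word \<Rightarrow> word) set \<Rightarrow> mpoly2 set \<times> mpoly2 set \<times> mpoly2 set" where
  "abg m = (SOME \<phi>. is_abg m \<phi>)"

text \<open>\<open>N\<^sub>m\<^sub>+\<^sub>1 \<alpha>\<^sup>-\<^sup>1(A) \<beta>\<^sup>-\<^sup>1(B) \<gamma>\<^sup>-\<^sup>1(C)\<close>\<close>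

definition abg_preimage ::
  "nat \<Rightarrow> mpoly2 set set \<Rightarrow> mpoly2 set set \<Rightarrow> mpoly2 set set \<Rightarrow> (word \<Rightarrow> word) set" where
  "abg_preimage m A B C = {g \<in> Nt m. abg m (Nt (m + 1) #>\<^bsub>Gt\<^esub> g) \<in> A \<times> B \<times> C}"

section \<open>Rank\<close>

text \<open>\<open>M \<otimes> \<F>\<^sub>2\<close> for a (multiplicatively written) abelian group \<open>M\<close>: the free abelian group on
  \<open>M \<times> \<F>\<^sub>2\<close> modulo the bilinearity relations, with scalars acting on the right-hand factor.\<close>

definition tensor_free :: "('a, 'b) monoid_scheme \<Rightarrow> ('a \<times> bit \<Rightarrow>\<^sub>0 int) monoid" where
  "tensor_free M = free_Abelian_group (carrier M \<times> UNIV)"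

definition tensor_rels :: "('a, 'b) monoid_scheme \<Rightarrow> ('a \<times> bit \<Rightarrow>\<^sub>0 int) set" where
  "tensor_rels M = generate (tensor_free M)
     ({frag_of (g \<otimes>\<^bsub>M\<^esub> h, t) - frag_of (g, t) - frag_of (h, t) | g h t.
         g \<in> carrier M \<and> h \<in> carrier M} \<union>
      {frag_of (g, s + t) - frag_of (g, s) - frag_of (g, t) | g s t. g \<in> carrier M})"

definition tensor_F2 :: "('a, 'b) monoid_scheme \<Rightarrow> (bit, ('a \<times> bit \<Rightarrow>\<^sub>0 int) set) module" where
  "tensor_F2 M =
    \<lparr>carrier = carrier (tensor_free M Mod tensor_rels M),
     monoid.mult = undefined, one = undefined,
     ring.zero = \<one>\<^bsub>tensor_free M Mod tensor_rels M\<^esub>,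
     ring.add = (\<otimes>\<^bsub>tensor_free M Mod tensor_rels M\<^esub>),
     smult = (\<lambda>c C. tensor_rels M <#>\<^bsub>tensor_free M\<^esub>
                     frag_extend (\<lambda>(g, t). frag_of (g, c * t)) ` C)\<rparr>"

definition rank :: "('a, 'b) monoid_scheme \<Rightarrow> nat" where
  "rank M = vectorspace.dim F2 (tensor_F2 M)"

end

theory Submission
  imports Defs
begin

text \<open>Let \<open>G = H\<^sub>1 \<ge> H\<^sub>2 \<ge> \<dots>\<close> be normal subgroups of a group with \<open>[H\<^sub>n, G] \<le> H\<^sub>n\<^sub>+\<^sub>1\<close>, such that
  \<open>H\<^sub>n\<close> is the least normal subgroup containing \<open>[H\<^sub>n\<^sub>-\<^sub>1, G]\<close> and the squares of
  \<open>H\<^bsub>\<lceil>n/2\<rceil>\<^esub>\<close>, and such that each \<open>H\<^sub>n\<close> is generated modulo \<open>H\<^sub>n\<^sub>+\<^sub>1\<close> by finitely many elements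
  whose squares lie in \<open>H\<^sub>2\<^sub>n\<close>. Then the \<open>H\<^sub>n\<close> are the dimension subgroups. One inclusion is formal;
  for the other, the powers of the augmentation ideal are compared with an explicit filtration of the
  group algebra, which is built up along a subnormal chain whose factors have order two.

  For \<open>\<sigma>\<close> of length \<open>m\<close>, the parities of the numbers of switches on the first two levels below
  \<open>\<sigma>0\<close> are additive functions on \<open>N\<^sub>m\<close>, and together with a third parity on words of length
  \<open>m - 1\<close> they identify \<open>N\<^sub>m/N\<^sub>m\<^sub>+\<^sub>1\<close> with triples of functions on words. Commutation with a
  generator \<open>t\<close> becomes the difference \<open>f \<circ> t - f\<close>, and these differences carry \<open>V\<^sub>n\<^sup>r\<close> onto
  \<open>V\<^sub>n\<^sup>r\<^sup>+\<^sup>1\<close>; squaring carries \<open>\<alpha>\<close> at one level to \<open>\<gamma>\<close> at the next. At the two ends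
  of a block the required elements come from commutators of the diagonal elements
  \<open>(x, \<dots>, x)\<close> and \<open>(y, \<dots>, y)\<close>.\<close>

text \<open>That commutators of H_i and H_j lie in H_(i+j), and squares of H_k in H_(2k), is not
  assumed of the series but derived, and each of the two claims needs the other; hence the
  interleaved inductions. The filtration of the group algebra is built for one bound N at a time,
  upwards from H_N, where two distinct layers are enough.

  The halved depth in the third coordinate is forced by the weights: doubling 2^m + 1 + r gives
  2^(m+1) + 1 + (2r + 1), so squares of elements of depth r appear at the odd offset 2r + 1 of the
  next block, and \<gamma> contributes to the rank only at such offsets.

  Differences of functions never reach depth zero, so commutation inside a block cannot fill the
  start of the next one. It can be entered nevertheless because K is the normal closure of x and y:
  one x and one y at single vertices of a level already yield all of K there. Commutators of
  diagonal elements with b, c or d reduce to entries at the end of the rightmost branch, since the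
  sections met beside that branch are 1 or a and commute with diagonal elements.\<close>

context group
begin

section \<open>Commutator identities, in a group and modulo a normal subgroup\<close>

lemma commutator_closed [simp, intro]:
  "g \<in> carrier G \<Longrightarrow> h \<in> carrier G \<Longrightarrow> commutator G g h \<in> carrier G"
  by (simp add: commutator_def)

lemma inv_mult_cancel:
  assumes "x \<in> carrier G" "y \<in> carrier G"
  shows "inv x \<otimes> (x \<otimes> y) = y" "x \<otimes> (inv x \<otimes> y) = y"
  using assms by (simp_all add: m_assoc[symmetric])

lemma right_inv_eq:
  assumes "x \<in> carrier G" "y \<in> carrier G"
  shows "x \<otimes> inv y = \<one> \<longleftrightarrow> x = y"
proof
  assume "x \<otimes> inv y = \<one>"
  then have "x \<otimes> inv y \<otimes> y = \<one> \<otimes> y" by (rule arg_cong)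
  then show "x = y" using assms by (simp add: m_assoc)
qed (use assms in simp)

lemma commutator_eq_one_iff:
  assumes "g \<in> carrier G" "h \<in> carrier G"
  shows "commutator G g h = \<one> \<longleftrightarrow> g \<otimes> h = h \<otimes> g"
proof -
  have "commutator G g h = (g \<otimes> h) \<otimes> inv (h \<otimes> g)"
    using assms by (simp add: commutator_def inv_mult_group m_assoc)
  then show ?thesis
    using assms by (simp add: right_inv_eq)
qed

lemma mult_commutator:
  assumes "g \<in> carrier G" "h \<in> carrier G"
  shows "commutator G g h \<otimes> (h \<otimes> g) = g \<otimes> h"
  using assms by (simp add: commutator_def m_assoc inv_mult_cancel)

text \<open>Elementwise substitute for the three subgroups lemma, made for use in quotients.
  Conjugation by \<open>h\<close> changes \<open>k\<close> and its conjugate by \<open>g\<close> by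
  one and the same factor, and this factor cancels in their quotient
  \<open>commutator G k g\<close>.\<close>

lemma commutator_commutes_three:
  assumes carr: "k \<in> carrier G" "g \<in> carrier G" "h \<in> carrier G"
    and u: "u = commutator G h g" and z: "z = commutator G h k"
    and uk: "u \<otimes> k = k \<otimes> u" and ugk: "u \<otimes> (g \<otimes> k \<otimes> inv g) = (g \<otimes> k \<otimes> inv g) \<otimes> u"
    and zg: "z \<otimes> g = g \<otimes> z"
    and zk: "z \<otimes> k = k \<otimes> z" and zh: "z \<otimes> h = h \<otimes> z"
  shows "commutator G k g \<otimes> h = h \<otimes> commutator G k g"
proof -
  have uc: "u \<in> carrier G" and zc: "z \<in> carrier G" using carr u z by auto
  define q where "q = g \<otimes> k \<otimes> inv g"
  have q: "q \<in> carrier G" using carr by (simp add: q_def)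
  have c: "commutator G k g = k \<otimes> inv q"
    using carr by (simp add: commutator_def q_def inv_mult_group m_assoc)
  have hg: "h \<otimes> g = u \<otimes> g \<otimes> h"
    using mult_commutator[of h g] carr u by (simp add: m_assoc)
  have hk: "h \<otimes> k = z \<otimes> k \<otimes> h"
    using mult_commutator[of h k] carr z by (simp add: m_assoc)
  have qg: "q \<otimes> g = g \<otimes> k" using carr by (simp add: q_def m_assoc)
  have "h \<otimes> q \<otimes> g = h \<otimes> g \<otimes> k" using qg q carr by (simp add: m_assoc)
  also have "\<dots> = u \<otimes> g \<otimes> (h \<otimes> k)" using hg carr uc by (simp add: m_assoc)
  also have "\<dots> = u \<otimes> (g \<otimes> z) \<otimes> (k \<otimes> h)" using hk carr uc zc by (simp add: m_assoc)
  also have "\<dots> = u \<otimes> (z \<otimes> (g \<otimes> k)) \<otimes> h" using zg[symmetric] carr uc zc by (simp add: m_assoc)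
  also have "\<dots> = u \<otimes> (z \<otimes> (q \<otimes> g)) \<otimes> h" using qg by simp
  also have "\<dots> = u \<otimes> z \<otimes> q \<otimes> (g \<otimes> h)" using carr uc zc q by (simp add: m_assoc)
  finally have 1: "h \<otimes> q \<otimes> g = u \<otimes> z \<otimes> q \<otimes> (g \<otimes> h)" .
  have zu: "z \<otimes> (u \<otimes> g) = (u \<otimes> g) \<otimes> z"
  proof -
    have "z \<otimes> (u \<otimes> g) \<otimes> h = z \<otimes> h \<otimes> g" using hg carr uc zc by (simp add: m_assoc)
    also have "\<dots> = h \<otimes> (g \<otimes> z)" using zh zg carr zc by (simp add: m_assoc)
    also have "\<dots> = u \<otimes> g \<otimes> (h \<otimes> z)" using hg carr uc zc by (simp add: m_assoc[symmetric])
    also have "\<dots> = (u \<otimes> g) \<otimes> z \<otimes> h" using zh[symmetric] carr uc zc by (simp add: m_assoc)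
    finally show ?thesis using carr uc zc by simp
  qed
  have zu': "z \<otimes> u = u \<otimes> z"
  proof -
    have "z \<otimes> u \<otimes> g = u \<otimes> z \<otimes> g" using zu zg carr uc zc by (simp add: m_assoc)
    then show ?thesis using carr uc zc by simp
  qed
  have zq: "z \<otimes> q = q \<otimes> z"
  proof -
    have "z \<otimes> q \<otimes> g = z \<otimes> g \<otimes> k" using qg carr zc q by (simp add: m_assoc)
    also have "\<dots> = g \<otimes> (z \<otimes> k)" using zg carr zc by (simp add: m_assoc)
    also have "\<dots> = (g \<otimes> k) \<otimes> z" using zk carr zc by (simp add: m_assoc)
    also have "\<dots> = q \<otimes> (g \<otimes> z)" using qg carr zc q by (simp add: m_assoc[symmetric])
    also have "\<dots> = q \<otimes> z \<otimes> g" using zg[symmetric] carr zc q by (simp add: m_assoc)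
    finally show ?thesis using carr zc q by simp
  qed
  have uq: "u \<otimes> q = q \<otimes> u" using ugk by (simp add: q_def)
  \<comment> \<open>both \<open>k\<close> and \<open>q = gkg\<inverse>\<close> are multiplied by \<open>z\<close> under conjugation by \<open>h\<close>\<close>
  have hq: "h \<otimes> q = z \<otimes> q \<otimes> h"
  proof -
    have "h \<otimes> q \<otimes> g = z \<otimes> q \<otimes> (u \<otimes> g \<otimes> h)"
    proof -
      have "u \<otimes> z \<otimes> q = z \<otimes> q \<otimes> u" using zu' uq uc zc q by (metis m_assoc)
      then show ?thesis using 1 carr uc zc q by (simp add: m_assoc)
    qed
    also have "\<dots> = z \<otimes> q \<otimes> h \<otimes> g" using hg[symmetric] carr zc q by (simp add: m_assoc)
    finally show ?thesis using carr zc q by simp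
  qed
  have "h \<otimes> (k \<otimes> inv q) \<otimes> q = h \<otimes> k" using carr q by (simp add: m_assoc)
  also have "\<dots> = k \<otimes> (z \<otimes> h)" using hk zk carr zc by (simp add: m_assoc)
  also have "\<dots> = k \<otimes> inv q \<otimes> (q \<otimes> (z \<otimes> h))"
    using carr zc q by (simp add: inv_mult_cancel m_assoc)
  also have "\<dots> = k \<otimes> inv q \<otimes> (h \<otimes> q)" using hq zq carr zc q by (simp add: m_assoc[symmetric])
  also have "\<dots> = k \<otimes> inv q \<otimes> h \<otimes> q" using carr q by (simp add: m_assoc)
  finally show ?thesis using carr q c by simp
qed

text \<open>Moving \<open>h\<close> past each of the two factors \<open>u\<close> contributes one
  copy of the commutator; as it commutes with \<open>u\<close>, the two copies meet and
  cancel.\<close>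

lemma square_commutes:
  assumes carr: "u \<in> carrier G" "h \<in> carrier G"
    and c2: "commutator G u h \<otimes> commutator G u h = \<one>"
    and uc: "u \<otimes> commutator G u h = commutator G u h \<otimes> u"
  shows "(u \<otimes> u) \<otimes> h = h \<otimes> (u \<otimes> u)"
proof -
  define c where "c = commutator G u h"
  have cc: "c \<in> carrier G" using carr by (simp add: c_def)
  have uh: "u \<otimes> h = c \<otimes> h \<otimes> u"
    using mult_commutator[of u h] carr by (simp add: c_def m_assoc)
  have "(u \<otimes> u) \<otimes> h = u \<otimes> c \<otimes> h \<otimes> u" using uh carr cc by (simp add: m_assoc)
  also have "\<dots> = c \<otimes> (u \<otimes> h) \<otimes> u" using uc carr cc by (simp add: c_def m_assoc)
  also have "\<dots> = (c \<otimes> c) \<otimes> h \<otimes> u \<otimes> u" using uh carr cc by (simp add: m_assoc)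
  also have "\<dots> = h \<otimes> (u \<otimes> u)" using c2 carr by (simp add: c_def m_assoc)
  finally show ?thesis .
qed

end

lemma (in group_hom) hom_commutator:
  "x \<in> carrier G \<Longrightarrow> y \<in> carrier G \<Longrightarrow> h (commutator G x y) = commutator H (h x) (h y)"
  by (simp add: commutator_def)

context normal
begin

text \<open>Membership of a commutator in \<open>H\<close> becomes an equation in the quotient, so
  the element identities above turn into statements modulo \<open>H\<close>. Exporting only a group
  and a map keeps cosets out of the later arguments.\<close>

lemma quotient_hom:
  obtains Q :: "'a set monoid" and q
  where "group_hom G Q q" "\<And>g. g \<in> carrier G \<Longrightarrow> g \<in> H \<longleftrightarrow> q g = \<one>\<^bsub>Q\<^esub>"
    "\<And>g h. g \<in> carrier G \<Longrightarrow> h \<in> carrier G \<Longrightarrow>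
      commutator G g h \<in> H \<longleftrightarrow> q g \<otimes>\<^bsub>Q\<^esub> q h = q h \<otimes>\<^bsub>Q\<^esub> q g"
proof -
  interpret Q: group_hom G "G Mod H" "\<lambda>g. H #> g"
    unfolding group_hom_def group_hom_axioms_def
    using is_group factorgroup_is_group r_coset_hom_Mod by blast
  have 1: "g \<in> H \<longleftrightarrow> H #> g = \<one>\<^bsub>G Mod H\<^esub>" if "g \<in> carrier G" for g
    using that by (metis coset_join1 coset_join2 one_FactGroup is_group subgroup_axioms subset)
  show thesis
    by (rule that[OF Q.group_hom_axioms 1])
      (simp_all only: 1 commutator_closed Q.hom_commutator Q.H.commutator_eq_one_iff Q.hom_closed)
qed

lemma commutator_mem_swap:
  assumes "g \<in> carrier G" "h \<in> carrier G"
  shows "commutator G g h \<in> H \<longleftrightarrow> commutator G h g \<in> H"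
proof -
  obtain Q :: "'a set monoid" and q where "group_hom G Q q" and
    Q: "\<And>g. g \<in> carrier G \<Longrightarrow> g \<in> H \<longleftrightarrow> q g = \<one>\<^bsub>Q\<^esub>"
    "\<And>g h. g \<in> carrier G \<Longrightarrow> h \<in> carrier G \<Longrightarrow>
      commutator G g h \<in> H \<longleftrightarrow> q g \<otimes>\<^bsub>Q\<^esub> q h = q h \<otimes>\<^bsub>Q\<^esub> q g"
    by (rule quotient_hom) blast
  show ?thesis using Q(2)[OF assms] Q(2)[OF assms(2,1)] by auto
qed

lemma commutator_mem_three:
  assumes carr: "k \<in> carrier G" "g \<in> carrier G" "h \<in> carrier G"
    and c: "commutator G (commutator G h g) k \<in> H"
      "commutator G (commutator G h g) (g \<otimes> k \<otimes> inv g) \<in> H"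
    and z: "\<And>x. x \<in> carrier G \<Longrightarrow> commutator G (commutator G h k) x \<in> H"
  shows "commutator G (commutator G k g) h \<in> H"
proof -
  obtain Q :: "'a set monoid" and q where hom: "group_hom G Q q" and
    Q: "\<And>g. g \<in> carrier G \<Longrightarrow> g \<in> H \<longleftrightarrow> q g = \<one>\<^bsub>Q\<^esub>"
    "\<And>g h. g \<in> carrier G \<Longrightarrow> h \<in> carrier G \<Longrightarrow>
      commutator G g h \<in> H \<longleftrightarrow> q g \<otimes>\<^bsub>Q\<^esub> q h = q h \<otimes>\<^bsub>Q\<^esub> q g"
    by (rule quotient_hom) blast
  interpret Q: group_hom G Q q by (rule hom)
  have "commutator Q (q k) (q g) \<otimes>\<^bsub>Q\<^esub> q h = q h \<otimes>\<^bsub>Q\<^esub> commutator Q (q k) (q g)"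
    by (rule Q.H.commutator_commutes_three[OF _ _ _ refl refl])
      (use carr c z[of g] z[of k] z[of h] in
        \<open>simp_all only: Q(2) Q.hom_commutator commutator_closed Q.hom_closed Q.hom_mult
          Q.hom_inv m_closed inv_closed\<close>)
  then show ?thesis using carr by (simp only: Q(2) Q.hom_commutator commutator_closed)
qed

lemma commutator_mem_square:
  assumes carr: "u \<in> carrier G" "h \<in> carrier G"
    and c: "commutator G u h \<otimes> commutator G u h \<in> H"
      "commutator G u (commutator G u h) \<in> H"
  shows "commutator G (u \<otimes> u) h \<in> H"
proof -
  obtain Q :: "'a set monoid" and q where hom: "group_hom G Q q" and
    Q: "\<And>g. g \<in> carrier G \<Longrightarrow> g \<in> H \<longleftrightarrow> q g = \<one>\<^bsub>Q\<^esub>"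
    "\<And>g h. g \<in> carrier G \<Longrightarrow> h \<in> carrier G \<Longrightarrow>
      commutator G g h \<in> H \<longleftrightarrow> q g \<otimes>\<^bsub>Q\<^esub> q h = q h \<otimes>\<^bsub>Q\<^esub> q g"
    by (rule quotient_hom) blast
  interpret Q: group_hom G Q q by (rule hom)
  have "(q u \<otimes>\<^bsub>Q\<^esub> q u) \<otimes>\<^bsub>Q\<^esub> q h = q h \<otimes>\<^bsub>Q\<^esub> (q u \<otimes>\<^bsub>Q\<^esub> q u)"
    using c[unfolded Q(1)[OF m_closed[OF commutator_closed[OF carr] commutator_closed[OF carr]]]
      Q(2)[OF carr(1) commutator_closed[OF carr]]] carr
    by (intro Q.H.square_commutes) (simp_all only: Q.hom_commutator Q.hom_mult Q.hom_closed commutator_closed)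
  then show ?thesis using carr by (simp only: Q(2) Q.hom_mult m_closed)
qed

text \<open>In the quotient \<open>g\<close> and \<open>h\<close> are commuting elements with
  trivial squares, so the square of the product is trivial too.\<close>

lemma square_mem_mult:
  assumes carr: "g \<in> carrier G" "h \<in> carrier G"
    and g2: "g \<otimes> g \<in> H" and h2: "h \<otimes> h \<in> H" and c: "commutator G g h \<in> H"
  shows "(g \<otimes> h) \<otimes> (g \<otimes> h) \<in> H"
proof -
  obtain Q :: "'a set monoid" and q where hom: "group_hom G Q q" and
    Q: "\<And>g. g \<in> carrier G \<Longrightarrow> g \<in> H \<longleftrightarrow> q g = \<one>\<^bsub>Q\<^esub>"
    "\<And>g h. g \<in> carrier G \<Longrightarrow> h \<in> carrier G \<Longrightarrow>
      commutator G g h \<in> H \<longleftrightarrow> q g \<otimes>\<^bsub>Q\<^esub> q h = q h \<otimes>\<^bsub>Q\<^esub> q g"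
    by (rule quotient_hom) blast
  interpret Q: group_hom G Q q by (rule hom)
  have qc: "q g \<in> carrier Q" "q h \<in> carrier Q" using carr by auto
  have c': "q g \<otimes>\<^bsub>Q\<^esub> q h = q h \<otimes>\<^bsub>Q\<^esub> q g" using c carr by (simp add: Q(2))
  have s: "q g \<otimes>\<^bsub>Q\<^esub> q g = \<one>\<^bsub>Q\<^esub>" "q h \<otimes>\<^bsub>Q\<^esub> q h = \<one>\<^bsub>Q\<^esub>"
    using g2 h2 carr by (simp_all add: Q(1))
  have "(q g \<otimes>\<^bsub>Q\<^esub> q h) \<otimes>\<^bsub>Q\<^esub> (q g \<otimes>\<^bsub>Q\<^esub> q h) = (q g \<otimes>\<^bsub>Q\<^esub> q h) \<otimes>\<^bsub>Q\<^esub> (q h \<otimes>\<^bsub>Q\<^esub> q g)"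
    by (simp only: c')
  also have "\<dots> = q g \<otimes>\<^bsub>Q\<^esub> (q h \<otimes>\<^bsub>Q\<^esub> q h) \<otimes>\<^bsub>Q\<^esub> q g"
    using qc by (simp add: Q.H.m_assoc)
  also have "\<dots> = \<one>\<^bsub>Q\<^esub>" using s qc by simp
  finally show ?thesis using carr by (simp add: Q(1))
qed

end

lemma (in group) conjugate_commutator:
  assumes "x \<in> carrier G" "g \<in> carrier G" "h \<in> carrier G"
  shows "x \<otimes> commutator G g (inv x \<otimes> h \<otimes> x) \<otimes> inv x = commutator G (x \<otimes> g \<otimes> inv x) h"
  using assms by (simp add: commutator_def inv_mult_group m_assoc inv_mult_cancel)

text \<open>The preimage of the centralizer of the image of \<open>M\<close> in the quotient by
  \<open>N\<close>. It is the test subgroup used whenever a commutator condition is to be checked on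
  generators of one argument only.\<close>

lemma (in group) centralizer_mod_normal:
  assumes M: "M \<lhd> G" and N: "N \<lhd> G"
  shows "{g \<in> carrier G. \<forall>h\<in>M. commutator G g h \<in> N} \<lhd> G" (is "?C \<lhd> G")
proof -
  interpret N: normal N G by (rule N)
  interpret M: normal M G by (rule M)
  obtain Q :: "'a set monoid" and q where hom: "group_hom G Q q" and
    Q: "\<And>g. g \<in> carrier G \<Longrightarrow> g \<in> N \<longleftrightarrow> q g = \<one>\<^bsub>Q\<^esub>"
    "\<And>g h. g \<in> carrier G \<Longrightarrow> h \<in> carrier G \<Longrightarrow>
      commutator G g h \<in> N \<longleftrightarrow> q g \<otimes>\<^bsub>Q\<^esub> q h = q h \<otimes>\<^bsub>Q\<^esub> q g"
    by (rule N.quotient_hom) blast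
  interpret Q: group_hom G Q q by (rule hom)
  have Mc: "h \<in> carrier G" if "h \<in> M" for h using M.subset that by auto
  have C: "g \<in> ?C \<longleftrightarrow> g \<in> carrier G \<and> (\<forall>h\<in>M. q g \<otimes>\<^bsub>Q\<^esub> q h = q h \<otimes>\<^bsub>Q\<^esub> q g)" for g
    using Mc Q(2) by auto
  show ?thesis
    unfolding normal_inv_iff
  proof (intro conjI ballI subgroupI)
    show "?C \<subseteq> carrier G" by auto
    have "\<one> \<in> ?C" unfolding C using Mc by simp
    then show "?C \<noteq> {}" by blast
  next
    fix g assume g: "g \<in> ?C"
    then have gc: "g \<in> carrier G" by simp
    show "inv g \<in> ?C" unfolding C
    proof (intro conjI ballI)
      fix h assume h: "h \<in> M"
      have e: "q g \<otimes>\<^bsub>Q\<^esub> q h = q h \<otimes>\<^bsub>Q\<^esub> q g" using g h unfolding C by blast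
      have "inv\<^bsub>Q\<^esub> (q g) \<otimes>\<^bsub>Q\<^esub> q h = inv\<^bsub>Q\<^esub> (q g) \<otimes>\<^bsub>Q\<^esub> (q h \<otimes>\<^bsub>Q\<^esub> q g) \<otimes>\<^bsub>Q\<^esub> inv\<^bsub>Q\<^esub> (q g)"
        using gc Mc[OF h] by (simp add: Q.H.m_assoc)
      also have "\<dots> = q h \<otimes>\<^bsub>Q\<^esub> inv\<^bsub>Q\<^esub> (q g)"
        using gc Mc[OF h] by (simp add: e[symmetric] Q.H.inv_mult_cancel)
      finally show "q (inv g) \<otimes>\<^bsub>Q\<^esub> q h = q h \<otimes>\<^bsub>Q\<^esub> q (inv g)"
        using gc by simp
    qed (use gc in auto)
  next
    fix g g' assume g: "g \<in> ?C" "g' \<in> ?C"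
    then have gc: "g \<in> carrier G" "g' \<in> carrier G" by auto
    show "g \<otimes> g' \<in> ?C" unfolding C
    proof (intro conjI ballI)
      fix h assume h: "h \<in> M"
      have e: "q g \<otimes>\<^bsub>Q\<^esub> q h = q h \<otimes>\<^bsub>Q\<^esub> q g" "q g' \<otimes>\<^bsub>Q\<^esub> q h = q h \<otimes>\<^bsub>Q\<^esub> q g'"
        using g h unfolding C by blast+
      have qc: "q g \<in> carrier Q" "q g' \<in> carrier Q" "q h \<in> carrier Q" using gc Mc[OF h] by auto
      have "q g \<otimes>\<^bsub>Q\<^esub> q g' \<otimes>\<^bsub>Q\<^esub> q h = q h \<otimes>\<^bsub>Q\<^esub> (q g \<otimes>\<^bsub>Q\<^esub> q g')"
        using qc e(1) by (simp add: Q.H.m_assoc e(2)) (simp add: Q.H.m_assoc[symmetric])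
      then show "q (g \<otimes> g') \<otimes>\<^bsub>Q\<^esub> q h = q h \<otimes>\<^bsub>Q\<^esub> q (g \<otimes> g')" using gc by simp
    qed (use gc in auto)
  next
    fix x g assume x: "x \<in> carrier G" and g: "g \<in> ?C"
    show "x \<otimes> g \<otimes> inv x \<in> ?C"
    proof (intro CollectI conjI ballI)
      fix h assume h: "h \<in> M"
      have "commutator G g (inv x \<otimes> h \<otimes> x) \<in> N" using g M.inv_op_closed1[OF x h] by auto
      then have "x \<otimes> commutator G g (inv x \<otimes> h \<otimes> x) \<otimes> inv x \<in> N" by (rule N.inv_op_closed2[OF x])
      then show "commutator G (x \<otimes> g \<otimes> inv x) h \<in> N"
        using conjugate_commutator[of x g h] x g Mc[OF h] by simp
    qed (use x g in auto)
  qed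
qed

section \<open>Restricted central series\<close>

text \<open>Index 0 repeats the whole group so that weight 0 makes sense in the inductions.
  \<open>H_generated\<close> expresses minimality as an elimination rule with a normal test subgroup
  \<open>R\<close>, and \<open>(n + 1) div 2\<close> is half of \<open>n\<close> rounded up.\<close>

locale restricted_series = group G for G (structure) +
  fixes H :: "nat \<Rightarrow> 'a set"
  assumes H_normal: "H n \<lhd> G"
    and H_0: "H 0 = carrier G" and H_1: "H (Suc 0) = carrier G"
    and H_Suc: "H (Suc n) \<subseteq> H n"
    and H_comm: "h \<in> H n \<Longrightarrow> g \<in> carrier G \<Longrightarrow> commutator G h g \<in> H (Suc n)"
    and H_generated: "2 \<le> n \<Longrightarrow> R \<lhd> G \<Longrightarrow>
      (\<And>h g. h \<in> H (n - 1) \<Longrightarrow> g \<in> carrier G \<Longrightarrow> commutator G h g \<in> R) \<Longrightarrow>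
      (\<And>u. u \<in> H ((n + 1) div 2) \<Longrightarrow> u \<otimes> u \<in> R) \<Longrightarrow> H n \<subseteq> R"
    and H_gens: "1 \<le> k \<Longrightarrow> \<exists>S. finite S \<and> S \<subseteq> H k \<and> H k \<subseteq> generate G (S \<union> H (Suc k)) \<and>
      (\<forall>u\<in>S. u \<otimes> u \<in> H (2 * k))"
begin

lemma H_antimono: "i \<le> j \<Longrightarrow> H j \<subseteq> H i"
  by (rule lift_Suc_antimono_le[of H]) (rule H_Suc)

lemma H_carrier: "h \<in> H n \<Longrightarrow> h \<in> carrier G"
  using H_antimono[of 0 n] H_0 by auto

lemma H_mult: "h \<in> H n \<Longrightarrow> k \<in> H n \<Longrightarrow> h \<otimes> k \<in> H n"
  by (rule subgroup.m_closed[OF normal_imp_subgroup[OF H_normal]])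

lemma H_inv: "h \<in> H n \<Longrightarrow> inv h \<in> H n"
  by (rule subgroup.m_inv_closed[OF normal_imp_subgroup[OF H_normal]])

lemma H_conj: "g \<in> carrier G \<Longrightarrow> h \<in> H n \<Longrightarrow> g \<otimes> h \<otimes> inv g \<in> H n"
  by (rule normal.inv_op_closed2[OF H_normal])

lemma H_commutator_normal: "g \<in> carrier G \<Longrightarrow> h \<in> H n \<Longrightarrow> commutator G g h \<in> H n"
  unfolding commutator_def by (intro H_mult H_conj H_inv)

lemma H_commutator_swap:
  "g \<in> carrier G \<Longrightarrow> h \<in> carrier G \<Longrightarrow> commutator G g h \<in> H n \<Longrightarrow> commutator G h g \<in> H n"
  using normal.commutator_mem_swap[OF H_normal] by blast

text \<open>Induction on the first index. \<open>H_generated\<close> reduces it to commutators of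
  elements of \<open>H (i - 1)\<close>, treated by the three subgroups argument, and to squares of
  elements of half the weight. Squares are controlled only above the threshold \<open>k\<close>; the
  second index never decreases in the recursion, so \<open>k \<le> j\<close> survives. This is what
  allows the lemma to be used inside the proof of the claim on squares.\<close>

lemma commutator_step:
  assumes prev: "\<forall>m i j. m < n \<longrightarrow> m \<le> i + j \<longrightarrow> (\<forall>h\<in>H i. \<forall>h'\<in>H j. commutator G h h' \<in> H m)"
    and sq: "\<forall>l>k. \<forall>u\<in>H l. u \<otimes> u \<in> H n"
  shows "n \<le> i + j \<Longrightarrow> k \<le> j \<Longrightarrow> h \<in> H i \<Longrightarrow> h' \<in> H j \<Longrightarrow> commutator G h h' \<in> H n"
proof (induction i arbitrary: j h h' rule: less_induct)
  case (less i)
  consider "i = 0" | "i = 1" | "2 \<le> i" by linarith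
  then show ?case
  proof cases
    case 1
    then have "h' \<in> H n" using less.prems H_antimono[of n j] by auto
    then show ?thesis using H_commutator_normal H_carrier[OF less.prems(3)] by blast
  next
    case 2
    have "commutator G h' h \<in> H (Suc j)" by (rule H_comm[OF less.prems(4) H_carrier[OF less.prems(3)]])
    then have "commutator G h' h \<in> H n" using H_antimono[of n "Suc j"] 2 less.prems by auto
    then show ?thesis using H_commutator_swap[OF H_carrier H_carrier] less.prems by blast
  next
    case 3
    define R where "R = {g \<in> carrier G. \<forall>x\<in>H j. commutator G g x \<in> H n}"
    have "H i \<subseteq> R"
    proof (rule H_generated[OF 3])
      show "R \<lhd> G" unfolding R_def by (rule centralizer_mod_normal[OF H_normal H_normal])
    next
      fix y g assume y: "y \<in> H (i - 1)" and g: "g \<in> carrier G"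
      have "commutator G (commutator G y g) x \<in> H n" if x: "x \<in> H j" for x
      proof (rule normal.commutator_mem_three[OF H_normal])
        have xg: "commutator G x g \<in> H (Suc j)" using H_comm x g by blast
        have *: "commutator G (commutator G x g) z \<in> H n" if "z \<in> H (i - 1)" for z
        proof -
          have "commutator G z (commutator G x g) \<in> H n"
            by (rule less.IH[of "i - 1" "Suc j"]) (use 3 less.prems that xg in auto)
          then show ?thesis using H_commutator_swap[OF H_carrier[OF that] H_carrier[OF xg]] by blast
        qed
        show "commutator G (commutator G x g) y \<in> H n" using * y .
        show "commutator G (commutator G x g) (g \<otimes> y \<otimes> inv g) \<in> H n" by (rule *[OF H_conj[OF g y]])
      next
        fix z assume z: "z \<in> carrier G"
        show "commutator G (commutator G x y) z \<in> H n"
        proof (cases n)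
          case 0
          then show ?thesis using H_0 H_carrier[OF x] H_carrier[OF y] z by auto
        next
          case (Suc n')
          have "commutator G x y \<in> H n'"
            using prev Suc 3 less.prems x y
            by (elim allE[where x = n'] allE[where x = j] allE[where x = "i - 1"] impE) auto
          then show ?thesis using H_comm z Suc by blast
        qed
      qed (use x y g in \<open>auto intro: H_carrier\<close>)
      then show "commutator G y g \<in> R" using H_carrier[OF y] g by (simp add: R_def)
    next
      fix u assume u: "u \<in> H ((i + 1) div 2)"
      define i' where "i' = (i + 1) div 2"
      have i': "i' < i" "1 \<le> i'" "i \<le> 2 * i'" using 3 by (auto simp: i'_def)
      have "commutator G (u \<otimes> u) x \<in> H n" if x: "x \<in> H j" for x
      proof (cases "n \<le> i' + j")
        case True
        have c: "commutator G u x \<in> H n"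
          by (rule less.IH[OF i'(1) True less.prems(2) _ x]) (use u in \<open>simp add: i'_def\<close>)
        show ?thesis
          by (rule normal.commutator_mem_square[OF H_normal])
            (use H_carrier[OF u] H_carrier[OF x] H_mult[OF c c] H_commutator_normal[OF _ c] in auto)
      \<comment> \<open>One commutator with \<open>u\<close> need not be deep enough here, but
        \<open>prev\<close> puts it into \<open>H (i' + j)\<close>. Commuting with \<open>u\<close>
        once more suffices because \<open>i \<le> 2 * i'\<close>, and its square is covered by
        \<open>sq\<close> because \<open>k < i' + j\<close>.\<close>
      next
        case False
        have c: "commutator G u x \<in> H (i' + j)"
          using prev False u x unfolding i'_def[symmetric]
          by (elim allE[where x = "i' + j"] allE[where x = i'] allE[where x = j] impE) auto
        have c': "commutator G u (commutator G u x) \<in> H n"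
          by (rule less.IH[OF i'(1), of "i' + j"])
            (use c u i' less.prems in \<open>auto simp: i'_def\<close>)
        have c2: "commutator G u x \<otimes> commutator G u x \<in> H n"
        proof -
          have "k < i' + j" using i' less.prems by linarith
          then show ?thesis using sq c by blast
        qed
        show ?thesis
          by (rule normal.commutator_mem_square[OF H_normal H_carrier[OF u] H_carrier[OF x] c2 c'])
      qed
      then show "u \<otimes> u \<in> R" using H_carrier[OF u] by (simp add: R_def)
    qed
    then show ?thesis using less.prems by (auto simp: R_def)
  qed
qed

text \<open>Descending induction on \<open>k\<close>. The claim for larger indices is the hypothesis
  on squares in \<open>commutator_step\<close>, which then shows that \<open>H k\<close> is
  commutative modulo \<open>H n\<close>; hence having a square in \<open>H n\<close> passes from the
  generators given by \<open>H_gens\<close> to all of \<open>H k\<close>.\<close>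

lemma square_step:
  assumes prev: "\<forall>m i j. m < n \<longrightarrow> m \<le> i + j \<longrightarrow> (\<forall>h\<in>H i. \<forall>h'\<in>H j. commutator G h h' \<in> H m)"
  shows "n \<le> 2 * k \<Longrightarrow> u \<in> H k \<Longrightarrow> u \<otimes> u \<in> H n"
proof (induction "n - k" arbitrary: k u rule: less_induct)
  case less
  show ?case
  proof (cases "n \<le> k")
    case True
    then show ?thesis using H_mult[OF less.prems(2) less.prems(2)] H_antimono by blast
  next
    case False
    then have k1: "1 \<le> k" using less.prems by linarith
    have sq: "w \<otimes> w \<in> H n" if "k < l" "w \<in> H l" for l w
      by (rule less.hyps[of l]) (use that False less.prems in auto)
    have comm: "commutator G h h' \<in> H n" if "h \<in> H k" "h' \<in> H k" for h h'
      by (rule commutator_step[OF prev, of k k k]) (use sq that less.prems in auto)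
    obtain S where S: "S \<subseteq> H k" "H k \<subseteq> generate G (S \<union> H (Suc k))" "\<forall>u\<in>S. u \<otimes> u \<in> H (2 * k)"
      using H_gens[OF k1] by blast
    have gen: "w \<in> H k \<and> w \<otimes> w \<in> H n" if "w \<in> S \<union> H (Suc k)" for w
      using that S(1,3) H_Suc H_antimono[OF less.prems(1)] sq[of "Suc k" w] by auto
    have "w \<in> H k \<and> w \<otimes> w \<in> H n" if "w \<in> generate G (S \<union> H (Suc k))" for w
      using that
    proof induction
      case one
      then show ?case using subgroup.one_closed[OF normal_imp_subgroup[OF H_normal]] by simp
    next
      case (incl w)
      then show ?case by (rule gen)
    next
      case (inv w)
      then have w: "w \<in> H k" "w \<otimes> w \<in> H n" using gen by auto
      have "inv w \<otimes> inv w = inv (w \<otimes> w)" using H_carrier[OF w(1)] by (simp add: inv_mult_group)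
      then show ?case using w H_inv by simp
    next
      case (eng w v)
      then show ?case
        using H_mult[of w k v] normal.square_mem_mult[OF H_normal, of w v n] H_carrier[of w k]
          H_carrier[of v k] comm[of w v] by blast
    qed
    then show ?thesis using S(2) less.prems by blast
  qed
qed

text \<open>One of the two indices is at least half of \<open>n\<close>, the threshold above which
  squares are known to lie in \<open>H n\<close>. Swapping the arguments makes it the second
  index.\<close>

lemma commutator_mem_ge: "n \<le> i + j \<Longrightarrow> h \<in> H i \<Longrightarrow> h' \<in> H j \<Longrightarrow> commutator G h h' \<in> H n"
proof (induction n arbitrary: i j h h' rule: less_induct)
  case (less n)
  have prev: "\<forall>m i j. m < n \<longrightarrow> m \<le> i + j \<longrightarrow> (\<forall>h\<in>H i. \<forall>h'\<in>H j. commutator G h h' \<in> H m)"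
    using less.IH by blast
  have sq: "\<forall>l>(n + 1) div 2. \<forall>w\<in>H l. w \<otimes> w \<in> H n"
    by (intro allI impI ballI square_step[OF prev]) auto
  show ?case
  proof (cases "(n + 1) div 2 \<le> j")
    case True
    show ?thesis by (rule commutator_step[OF prev sq less.prems(1) True less.prems(2,3)])
  next
    case False
    have "commutator G h' h \<in> H n"
      by (rule commutator_step[OF prev sq _ _ less.prems(3,2)]) (use False less.prems in auto)
    then show ?thesis using H_commutator_swap[OF H_carrier H_carrier] less.prems by blast
  qed
qed

lemma H_commutator: "h \<in> H i \<Longrightarrow> h' \<in> H j \<Longrightarrow> commutator G h h' \<in> H (i + j)"
  by (rule commutator_mem_ge) auto

lemma H_square: "u \<in> H k \<Longrightarrow> u \<otimes> u \<in> H (2 * k)"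
  by (rule square_step[of "2 * k" k]) (auto intro: commutator_mem_ge)

end

section \<open>Group algebras over the field with two elements\<close>

declare add_bit_eq_xor [simp del] mult_bit_eq_and [simp del]

lemma bit_add_self [simp]: "(x::bit) + x = 0"
  by (cases x) (auto simp: add_bit_eq_xor)

definition dirac :: "'a \<Rightarrow> 'a \<Rightarrow> bit" where
  "dirac g = (\<lambda>h. if h = g then 1 else 0)"

definition aug :: "('a \<Rightarrow> bit) \<Rightarrow> bit" where
  "aug f = (\<Sum>g | f g \<noteq> 0. f g)"

lemma aug_eq_sum: "finite B \<Longrightarrow> {g. f g \<noteq> 0} \<subseteq> B \<Longrightarrow> aug f = sum f B"
  unfolding aug_def by (rule sum.mono_neutral_left) auto

lemma aug_dirac [simp]: "aug (dirac g) = 1"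
  by (subst aug_eq_sum[of "{g}"]) (auto simp: dirac_def)

locale group_alg = group G for G (structure)
begin

abbreviation A where "A \<equiv> group_algebra G"

abbreviation star :: "('a \<Rightarrow> bit) \<Rightarrow> ('a \<Rightarrow> bit) \<Rightarrow> 'a \<Rightarrow> bit"  (infixl "\<star>" 75)
  where "star \<equiv> monoid.mult A"

abbreviation box_plus :: "('a \<Rightarrow> bit) \<Rightarrow> ('a \<Rightarrow> bit) \<Rightarrow> 'a \<Rightarrow> bit"  (infixl "\<boxplus>" 65)
  where "box_plus \<equiv> ring.add A"

lemma A_carrier: "carrier A = {f. finite {g. f g \<noteq> 0} \<and> {g. f g \<noteq> 0} \<subseteq> carrier G}"
  by (simp add: group_algebra_def)

lemma A_apply: "(f \<boxplus> h) g = f g + h g" "\<zero>\<^bsub>A\<^esub> g = 0"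
  by (simp_all add: group_algebra_def)

lemma A_one: "\<one>\<^bsub>A\<^esub> = dirac \<one>"
  by (simp add: group_algebra_def dirac_def)

lemma A_add_self [simp]: "f \<boxplus> f = \<zero>\<^bsub>A\<^esub>"
  by (rule ext) (simp add: A_apply)

lemma A_add_zero [simp]: "f \<boxplus> \<zero>\<^bsub>A\<^esub> = f" "\<zero>\<^bsub>A\<^esub> \<boxplus> f = f"
  by (rule ext, simp add: A_apply)+

lemma A_add_assoc: "(f \<boxplus> g) \<boxplus> h = f \<boxplus> (g \<boxplus> h)"
  by (rule ext) (simp add: A_apply add.assoc)

lemma A_add_comm: "f \<boxplus> g = g \<boxplus> f"
  by (rule ext) (simp add: A_apply add.commute)

lemma A_add_left_comm: "f \<boxplus> (g \<boxplus> h) = g \<boxplus> (f \<boxplus> h)"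
  by (rule ext) (simp add: A_apply add.left_commute)

lemmas A_add_ac = A_add_assoc A_add_comm A_add_left_comm

lemma A_add_cancel [simp]: "f \<boxplus> (f \<boxplus> g) = g"
  by (simp add: A_add_assoc[symmetric])

lemma aug_zero [simp]: "aug \<zero>\<^bsub>A\<^esub> = 0"
  by (simp add: aug_def A_apply)

lemma A_zero [simp, intro]: "\<zero>\<^bsub>A\<^esub> \<in> carrier A"
  by (simp add: A_carrier A_apply)

lemma A_dirac [simp, intro]: "u \<in> carrier G \<Longrightarrow> dirac u \<in> carrier A"
  by (auto simp: A_carrier dirac_def)

lemma A_add [simp, intro]:
  assumes "f \<in> carrier A" "h \<in> carrier A"
  shows "f \<boxplus> h \<in> carrier A"
proof -
  have "{g. (f \<boxplus> h) g \<noteq> 0} \<subseteq> {g. f g \<noteq> 0} \<union> {g. h g \<noteq> 0}" by (auto simp: A_apply)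
  then show ?thesis using assms unfolding A_carrier
    by (auto intro: finite_subset)
qed

lemma star_eq_sum:
  assumes "f \<in> carrier A" "h \<in> carrier A" "finite B" "finite C"
    "{g. f g \<noteq> 0} \<subseteq> B" "{g. h g \<noteq> 0} \<subseteq> C"
  shows "(f \<star> h) g = (\<Sum>u\<in>B. \<Sum>v\<in>C. if u \<otimes> v = g then f u * h v else 0)"
proof -
  have "(\<Sum>u\<in>B. \<Sum>v\<in>C. if u \<otimes> v = g then f u * h v else 0)
      = (\<Sum>p\<in>B \<times> C. if fst p \<otimes> snd p = g then f (fst p) * h (snd p) else 0)"
    using assms by (simp add: sum.cartesian_product case_prod_beta)
  also have "\<dots> = (\<Sum>(u, v) \<in> {(u, v). f u \<noteq> 0 \<and> h v \<noteq> 0 \<and> u \<otimes> v = g}. f u * h v)"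
    using assms by (intro sum.mono_neutral_cong_right) (auto split: if_splits)
  finally show ?thesis by (simp add: group_algebra_def)
qed

lemma star_add_left:
  assumes "f \<in> carrier A" "f' \<in> carrier A" "h \<in> carrier A"
  shows "(f \<boxplus> f') \<star> h = f \<star> h \<boxplus> f' \<star> h"
proof
  fix g
  let ?B = "{g. f g \<noteq> 0} \<union> {g. f' g \<noteq> 0}" and ?C = "{g. h g \<noteq> 0}"
  have fin: "finite ?B" "finite ?C" using assms by (auto simp: A_carrier)
  have "((f \<boxplus> f') \<star> h) g = (\<Sum>u\<in>?B. \<Sum>v\<in>?C. if u \<otimes> v = g then (f \<boxplus> f') u * h v else 0)"
    by (rule star_eq_sum) (use assms fin in \<open>auto simp: A_apply\<close>)
  also have "\<dots> = (\<Sum>u\<in>?B. \<Sum>v\<in>?C. (if u \<otimes> v = g then f u * h v else 0)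
        + (if u \<otimes> v = g then f' u * h v else 0))"
    by (intro sum.cong refl) (simp add: A_apply distrib_right)
  also have "\<dots> = (f \<star> h) g + (f' \<star> h) g"
    using assms fin by (simp add: sum.distrib star_eq_sum[where B = ?B and C = ?C])
  finally show "((f \<boxplus> f') \<star> h) g = (f \<star> h \<boxplus> f' \<star> h) g" by (simp add: A_apply)
qed

lemma star_add_right:
  assumes "f \<in> carrier A" "f' \<in> carrier A" "h \<in> carrier A"
  shows "h \<star> (f \<boxplus> f') = h \<star> f \<boxplus> h \<star> f'"
proof
  fix g
  let ?B = "{g. f g \<noteq> 0} \<union> {g. f' g \<noteq> 0}" and ?C = "{g. h g \<noteq> 0}"
  have fin: "finite ?B" "finite ?C" using assms by (auto simp: A_carrier)
  have "(h \<star> (f \<boxplus> f')) g = (\<Sum>u\<in>?C. \<Sum>v\<in>?B. if u \<otimes> v = g then h u * (f \<boxplus> f') v else 0)"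
    by (rule star_eq_sum) (use assms fin in \<open>auto simp: A_apply\<close>)
  also have "\<dots> = (\<Sum>u\<in>?C. \<Sum>v\<in>?B. (if u \<otimes> v = g then h u * f v else 0)
        + (if u \<otimes> v = g then h u * f' v else 0))"
    by (intro sum.cong refl) (simp add: A_apply distrib_left)
  also have "\<dots> = (h \<star> f) g + (h \<star> f') g"
    using assms fin by (simp add: sum.distrib star_eq_sum[where B = ?C and C = ?B])
  finally show "(h \<star> (f \<boxplus> f')) g = (h \<star> f \<boxplus> h \<star> f') g" by (simp add: A_apply)
qed

lemma star_dirac_dirac:
  assumes "u \<in> carrier G" "v \<in> carrier G"
  shows "dirac u \<star> dirac v = dirac (u \<otimes> v)"
proof
  fix g
  have "(dirac u \<star> dirac v) g
      = (\<Sum>x\<in>{u}. \<Sum>y\<in>{v}. if x \<otimes> y = g then dirac u x * dirac v y else 0)"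
    by (rule star_eq_sum) (use assms in \<open>simp_all\<close>, simp_all add: dirac_def)
  then show "(dirac u \<star> dirac v) g = dirac (u \<otimes> v) g" by (auto simp: dirac_def)
qed

lemma star_zero [simp]:
  "f \<in> carrier A \<Longrightarrow> \<zero>\<^bsub>A\<^esub> \<star> f = \<zero>\<^bsub>A\<^esub>" "f \<in> carrier A \<Longrightarrow> f \<star> \<zero>\<^bsub>A\<^esub> = \<zero>\<^bsub>A\<^esub>"
  using star_add_left[of "\<zero>\<^bsub>A\<^esub>" "\<zero>\<^bsub>A\<^esub>" f] star_add_right[of "\<zero>\<^bsub>A\<^esub>" "\<zero>\<^bsub>A\<^esub>" f] by simp_all

text \<open>Over the field with two elements a finitely supported function is a sum of distinct
  group elements, so additive identities need to be checked on \<open>dirac\<close> only.\<close>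

lemma A_induct [consumes 1, case_names zero add]:
  assumes f: "f \<in> carrier A"
    and P0: "P \<zero>\<^bsub>A\<^esub>"
    and P_add: "\<And>u f. u \<in> carrier G \<Longrightarrow> f \<in> carrier A \<Longrightarrow> P f \<Longrightarrow> P (dirac u \<boxplus> f)"
  shows "P f"
proof -
  have "P f" if "finite S" "S = {g. f g \<noteq> 0}" "S \<subseteq> carrier G" for S f
    using that
  proof (induction S arbitrary: f rule: finite_induct)
    case empty
    then have "f = \<zero>\<^bsub>A\<^esub>" by (intro ext) (auto simp: A_apply)
    then show ?case using P0 by simp
  next
    case (insert u S)
    have "f u \<noteq> 0" using insert.prems(1) by blast
    then have f1: "f u = 1" by simp
    have S: "S = {g. (dirac u \<boxplus> f) g \<noteq> 0}"
    proof (rule Set.set_eqI)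
      fix x
      show "x \<in> S \<longleftrightarrow> x \<in> {g. (dirac u \<boxplus> f) g \<noteq> 0}"
      proof (cases "x = u")
        case False
        then have "x \<in> S \<longleftrightarrow> f x \<noteq> 0" using insert.prems(1) by blast
        then show ?thesis using False by (simp add: dirac_def A_apply)
      qed (use insert.hyps f1 in \<open>simp add: dirac_def A_apply\<close>)
    qed
    have "P (dirac u \<boxplus> f)" by (rule insert.IH[OF S]) (use insert.prems in auto)
    moreover have "dirac u \<boxplus> f \<in> carrier A"
      unfolding A_carrier using S insert.hyps insert.prems by auto
    ultimately have "P (dirac u \<boxplus> (dirac u \<boxplus> f))" using P_add insert.prems by blast
    then show ?case by simp
  qed
  then show ?thesis using f by (auto simp: A_carrier)
qed

lemma star_closed [simp, intro]: "f \<in> carrier A \<Longrightarrow> h \<in> carrier A \<Longrightarrow> f \<star> h \<in> carrier A"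
proof (induction f rule: A_induct)
  case (add u f)
  have "dirac u \<star> h \<in> carrier A"
    using add.prems
  proof (induction h rule: A_induct)
    case (add v h)
    then show ?case using \<open>u \<in> carrier G\<close> by (simp add: star_add_right star_dirac_dirac)
  qed (simp add: add.hyps)
  then show ?case using add by (simp add: star_add_left)
qed simp

lemma star_assoc:
  assumes "f \<in> carrier A" "h \<in> carrier A" "k \<in> carrier A"
  shows "f \<star> h \<star> k = f \<star> (h \<star> k)"
proof -
  have 1: "dirac u \<star> dirac v \<star> k = dirac u \<star> (dirac v \<star> k)"
    if "u \<in> carrier G" "v \<in> carrier G" for u v
    using assms(3)
    by (induction k rule: A_induct) (use that in \<open>simp_all add: star_add_right star_dirac_dirac m_assoc\<close>)
  have 2: "dirac u \<star> h \<star> k = dirac u \<star> (h \<star> k)" if "u \<in> carrier G" for u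
    using assms(2)
    by (induction h rule: A_induct)
      (use that assms(3) in \<open>simp_all add: star_add_right star_add_left 1\<close>)
  show ?thesis
    using assms(1)
    by (induction f rule: A_induct) (use assms in \<open>simp_all add: star_add_left 2\<close>)
qed

lemma star_one [simp]:
  assumes "f \<in> carrier A"
  shows "dirac \<one> \<star> f = f" "f \<star> dirac \<one> = f"
  using assms
  by (induction f rule: A_induct, simp_all add: star_add_right star_add_left star_dirac_dirac)

lemma ring_A: "ring A"
proof (rule ringI)
  show "abelian_group A"
  proof (rule abelian_groupI)
    fix f assume "f \<in> carrier A"
    then show "\<exists>h\<in>carrier A. h \<oplus>\<^bsub>A\<^esub> f = \<zero>\<^bsub>A\<^esub>"
      by (intro bexI[of _ f]) simp_all
  qed (simp_all add: A_add_ac)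
  show "monoid A"
    by (rule monoidI) (simp_all add: A_one star_assoc)
qed (simp_all add: star_add_left star_add_right)

sublocale A: ring A by (rule ring_A)

lemma A_minus: "f \<in> carrier A \<Longrightarrow> h \<in> carrier A \<Longrightarrow> f \<ominus>\<^bsub>A\<^esub> h = f \<boxplus> h"
proof -
  assume fh: "f \<in> carrier A" "h \<in> carrier A"
  have "\<ominus>\<^bsub>A\<^esub> h = h" by (rule A.minus_equality) (use fh in simp_all)
  then show ?thesis by (simp add: A.minus_eq)
qed

lemma aug_add [simp]:
  assumes "f \<in> carrier A" "h \<in> carrier A"
  shows "aug (f \<boxplus> h) = aug f + aug h"
proof -
  let ?B = "{g. f g \<noteq> 0} \<union> {g. h g \<noteq> 0}"
  have "finite ?B" using assms by (auto simp: A_carrier)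
  then show ?thesis by (subst (1 2 3) aug_eq_sum[of ?B]) (auto simp: A_apply sum.distrib)
qed

lemma aug_star [simp]:
  assumes "f \<in> carrier A" "h \<in> carrier A"
  shows "aug (f \<star> h) = aug f * aug h"
proof -
  have 1: "aug (dirac u \<star> h) = aug h" if "u \<in> carrier G" for u
    using assms(2)
    by (induction h rule: A_induct) (use that in \<open>simp_all add: star_add_right star_dirac_dirac\<close>)
  show ?thesis
    using assms(1)
    by (induction f rule: A_induct) (use assms in \<open>simp_all add: star_add_left 1 distrib_right\<close>)
qed

section \<open>Powers of the augmentation ideal\<close>

lemma aug_ideal_eq: "aug_ideal G = {f \<in> carrier A. aug f = 0}"
  by (simp add: aug_ideal_def a_kernel_def' aug_def F2_def)

abbreviation Dpow :: "nat \<Rightarrow> ('a \<Rightarrow> bit) set" where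
  "Dpow n \<equiv> aug_ideal G [^]\<^bsub>ideals_set A\<^esub> n"

lemma ideals_set_one [simp]: "\<one>\<^bsub>ideals_set A\<^esub> = carrier A"
  by (simp add: ideals_set_def)

lemma Dpow_0: "Dpow 0 = carrier A"
  by simp

lemma Dpow_Suc: "Dpow (Suc n) = ideal_prod A (Dpow n) (aug_ideal G)"
  by (simp add: nat_pow_def ideals_set_def)

lemma Dpow_add: "f \<in> Dpow n \<Longrightarrow> h \<in> Dpow n \<Longrightarrow> f \<boxplus> h \<in> Dpow n"
  by (cases n) (simp_all only: Dpow_0 Dpow_Suc A_add ideal_prod.sum)

lemma Dpow_carrier: "f \<in> Dpow n \<Longrightarrow> f \<in> carrier A"
proof (induction n arbitrary: f)
  case (Suc n)
  from Suc.prems show ?case unfolding Dpow_Suc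
    by (induction rule: ideal_prod.induct) (use Suc.IH in \<open>auto simp: aug_ideal_eq\<close>)
qed (simp add: Dpow_0)

lemma Dpow_right: "f \<in> Dpow n \<Longrightarrow> h \<in> carrier A \<Longrightarrow> f \<star> h \<in> Dpow n"
proof (cases n)
  case (Suc n')
  assume f: "f \<in> Dpow n" and h: "h \<in> carrier A"
  have "f \<in> carrier A \<and> f \<star> h \<in> Dpow n"
    using f unfolding Suc Dpow_Suc
  proof (induction rule: ideal_prod.induct)
    case (prod i j)
    have ij: "i \<in> carrier A" "j \<in> carrier A" "aug j = 0"
      using prod Dpow_carrier by (auto simp: aug_ideal_eq)
    then have "i \<star> (j \<star> h) \<in> ideal_prod A (Dpow n') (aug_ideal G)"
      using h prod by (intro ideal_prod.prod) (auto simp: aug_ideal_eq)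
    then show ?case using ij h by (simp add: star_assoc)
  next
    case (sum s t)
    then show ?case using h by (auto simp: star_add_left intro: ideal_prod.sum)
  qed
  then show ?thesis by simp
qed (simp add: Dpow_0)

lemma Dpow_mult: "f \<in> Dpow m \<Longrightarrow> h \<in> Dpow n \<Longrightarrow> f \<star> h \<in> Dpow (m + n)"
proof (induction n arbitrary: h)
  case 0
  then show ?case using Dpow_right by (simp add: Dpow_0)
next
  case (Suc n)
  have f: "f \<in> carrier A" using Suc.prems Dpow_carrier by blast
  from Suc.prems(2) have "h \<in> carrier A \<and> f \<star> h \<in> Dpow (m + Suc n)"
    unfolding Dpow_Suc add_Suc_right
  proof (induction rule: ideal_prod.induct)
    case (prod i j)
    have ij: "i \<in> carrier A" "j \<in> carrier A"
      using prod Dpow_carrier by (auto simp: aug_ideal_eq)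
    have "f \<star> i \<star> j \<in> ideal_prod A (Dpow (m + n)) (aug_ideal G)"
      using Suc.IH Suc.prems(1) prod by (intro ideal_prod.prod) auto
    then show ?case using f ij by (simp add: star_assoc)
  next
    case (sum s t)
    then show ?case using f by (auto simp: star_add_right intro: ideal_prod.sum)
  qed
  then show ?case by blast
qed

lemma Dpow_1: "f \<in> aug_ideal G \<Longrightarrow> f \<in> Dpow (Suc 0)"
  using ideal_prod.prod[of "dirac \<one>" "Dpow 0" f "aug_ideal G" A]
  by (simp only: Dpow_Suc Dpow_0) (simp add: aug_ideal_eq)

lemma Dpow_left: "f \<in> Dpow n \<Longrightarrow> h \<in> carrier A \<Longrightarrow> h \<star> f \<in> Dpow n"
  using Dpow_mult[of h 0 f n] by (simp add: Dpow_0)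

lemma Dpow_antimono: "f \<in> Dpow (Suc n) \<Longrightarrow> f \<in> Dpow n"
  unfolding Dpow_Suc
proof (induction rule: ideal_prod.induct)
  case (prod i j)
  then show ?case using Dpow_right by (simp add: aug_ideal_eq)
next
  case (sum s t)
  then show ?case using Dpow_add by simp
qed

lemma dim_subgroup_iff:
  "g \<in> dim_subgroup G n \<longleftrightarrow> g \<in> carrier G \<and> dirac g \<boxplus> dirac \<one> \<in> Dpow n"
  unfolding dim_subgroup_def using A_minus[of "dirac g" "dirac \<one>"]
  by (auto simp: A_one dirac_def[symmetric])

end

section \<open>Dimension subgroups of a restricted series\<close>

context group_alg
begin

text \<open>The reduction modulo a subgroup of index two: an element of the group algebra of
  \<open>Q \<union> Qx\<close> is uniquely \<open>e\<^sub>0 + e\<^sub>1 (x - 1)\<close> with \<open>e\<^sub>0, e\<^sub>1\<close> in the group algebra of \<open>Q\<close>.\<close>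

definition span_on :: "'a set \<Rightarrow> ('a \<Rightarrow> bit) set" where
  "span_on P = {f \<in> carrier A. \<forall>g. f g \<noteq> 0 \<longrightarrow> g \<in> P}"

lemma span_on_carrier: "f \<in> span_on P \<Longrightarrow> f \<in> carrier A"
  by (simp add: span_on_def)

lemma span_on_add:
  assumes "f \<in> span_on P" "h \<in> span_on P"
  shows "f \<boxplus> h \<in> span_on P"
  unfolding span_on_def
proof (intro CollectI conjI allI impI)
  fix g assume "(f \<boxplus> h) g \<noteq> 0"
  then have "f g \<noteq> 0 \<or> h g \<noteq> 0" unfolding A_apply by auto
  then show "g \<in> P" using assms unfolding span_on_def by blast
qed (use assms in \<open>auto simp: span_on_def\<close>)

lemma span_on_dirac: "P \<subseteq> carrier G \<Longrightarrow> g \<in> P \<Longrightarrow> dirac g \<in> span_on P"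
  by (auto simp: span_on_def) (simp add: dirac_def split: if_splits)

lemma span_on_zero: "\<zero>\<^bsub>A\<^esub> \<in> span_on P"
  by (simp add: span_on_def A_apply)

lemma star_dirac_apply:
  assumes "f \<in> carrier A" "x \<in> carrier G" "g \<in> carrier G"
  shows "(f \<star> dirac x) g = f (g \<otimes> inv x)"
  using assms(1)
proof (induction f rule: A_induct)
  case zero
  have "\<zero>\<^bsub>A\<^esub> \<star> dirac x = \<zero>\<^bsub>A\<^esub>" using assms by simp
  then show ?case by (simp only: A_apply(2)[of g] A_apply(2)[of "g \<otimes> inv x"])
next
  case (add u f)
  have "dirac (u \<otimes> x) g = dirac u (g \<otimes> inv x)"
    using add.hyps(1) assms(2,3) inv_solve_right[of u g x] by (auto simp: dirac_def)
  moreover have "(dirac u \<boxplus> f) \<star> dirac x = dirac (u \<otimes> x) \<boxplus> f \<star> dirac x"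
    using add.hyps assms by (simp add: star_add_left star_dirac_dirac)
  ultimately show ?case using add.IH
    by (simp only: A_apply(1)[of _ _ g] A_apply(1)[of _ _ "g \<otimes> inv x"])
qed

lemma A_support: "f \<in> carrier A \<Longrightarrow> f g \<noteq> 0 \<Longrightarrow> g \<in> carrier G"
  by (auto simp: A_carrier)

lemma A_outside: "f \<in> carrier A \<Longrightarrow> g \<notin> carrier G \<Longrightarrow> f g = 0"
  using A_support by blast

lemma span_on_star_dirac:
  assumes f: "f \<in> span_on Q" and x: "x \<in> carrier G"
    and P: "\<And>q. q \<in> Q \<Longrightarrow> q \<otimes> x \<in> P"
  shows "f \<star> dirac x \<in> span_on P"
  unfolding span_on_def
proof (intro CollectI conjI allI impI)
  show fx: "f \<star> dirac x \<in> carrier A" using f x span_on_carrier by blast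
  fix g assume g: "(f \<star> dirac x) g \<noteq> 0"
  then have gc: "g \<in> carrier G" using A_support fx by blast
  then have "f (g \<otimes> inv x) \<noteq> 0" using g star_dirac_apply[OF span_on_carrier[OF f] x] by simp
  then have "g \<otimes> inv x \<in> Q" using f by (simp add: span_on_def)
  then have "g \<otimes> inv x \<otimes> x \<in> P" by (rule P)
  then show "g \<in> P" using gc x by (simp add: m_assoc)
qed

text \<open>Evaluate the relation at \<open>h \<otimes> x\<close> with \<open>h\<close> in
  \<open>Q\<close>. This point lies outside \<open>Q\<close>, so of the three terms only the
  translate of \<open>e1\<close> can be nonzero there.\<close>

lemma span_on_unique:
  assumes Q: "subgroup Q G" and x: "x \<in> carrier G" "x \<notin> Q"
    and e: "e0 \<in> span_on Q" "e1 \<in> span_on Q"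
    and eq: "e0 \<boxplus> (e1 \<star> dirac x \<boxplus> e1) = \<zero>\<^bsub>A\<^esub>"
  shows "e0 = \<zero>\<^bsub>A\<^esub>" "e1 = \<zero>\<^bsub>A\<^esub>"
proof -
  interpret Q: subgroup Q G by (rule Q)
  have e1: "e1 h = 0" for h
  proof (cases "h \<in> Q")
    case True
    have "h \<otimes> x \<notin> Q"
    proof
      assume "h \<otimes> x \<in> Q"
      then have "inv h \<otimes> (h \<otimes> x) \<in> Q" using True by simp
      then show False using x True Q.subset inv_mult_cancel(1)[of h x] by auto
    qed
    then have "e0 (h \<otimes> x) = 0" "e1 (h \<otimes> x) = 0" using e by (auto simp: span_on_def)
    moreover have "(e0 \<boxplus> (e1 \<star> dirac x \<boxplus> e1)) (h \<otimes> x) = 0" using eq by (simp add: A_apply)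
    moreover have "(e1 \<star> dirac x) (h \<otimes> x) = e1 h"
      using True x Q.subset e by (subst star_dirac_apply) (auto simp: span_on_carrier m_assoc)
    ultimately show ?thesis by (simp add: A_apply)
  next
    case False
    then show ?thesis using e by (auto simp: span_on_def)
  qed
  show e10: "e1 = \<zero>\<^bsub>A\<^esub>" by (rule ext) (simp add: e1 A_apply)
  show "e0 = \<zero>\<^bsub>A\<^esub>" using eq x(1) by (simp add: e10)
qed

end

locale series_alg = restricted_series + group_alg
begin

text \<open>A filtration of the group algebra of \<open>P\<close> adapted to the weights: right
  multiplication by \<open>g - 1\<close> raises the degree by the weight of \<open>g\<close>. The
  last two clauses make degrees up to \<open>N\<close> detect membership in the series, and force
  augmentation zero in positive degree.\<close>

definition filtered :: "nat \<Rightarrow> 'a set \<Rightarrow> (nat \<Rightarrow> ('a \<Rightarrow> bit) set) \<Rightarrow> bool" where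
  "filtered N P E \<longleftrightarrow>
    E 0 = span_on P \<and> (\<forall>n. E (Suc n) \<subseteq> E n) \<and>
    (\<forall>n. \<zero>\<^bsub>A\<^esub> \<in> E n) \<and> (\<forall>n. \<forall>e\<in>E n. \<forall>f\<in>E n. e \<boxplus> f \<in> E n) \<and>
    (\<forall>n i. \<forall>e\<in>E n. \<forall>g\<in>P \<inter> H i. e \<star> dirac g \<boxplus> e \<in> E (n + i)) \<and>
    (\<forall>n\<le>N. \<forall>g\<in>P. dirac g \<boxplus> dirac \<one> \<in> E n \<longrightarrow> g \<in> H n) \<and>
    (\<forall>n. \<forall>e\<in>E (Suc n). aug e = 0)"

text \<open>All positive degrees carry the augmentation kernel, which is stable under right
  multiplication. Detection is automatic at this stage because \<open>H N\<close> lies in every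
  \<open>H n\<close> with \<open>n \<le> N\<close>.\<close>

lemma filtered_bottom: "filtered N (H N) (\<lambda>n. if n = 0 then span_on (H N) else {e \<in> span_on (H N). aug e = 0})"
proof -
  have HN: "H N \<subseteq> carrier G" using H_carrier by blast
  have st: "e \<star> dirac g \<boxplus> e \<in> span_on (H N) \<and> aug (e \<star> dirac g \<boxplus> e) = 0"
    if "e \<in> span_on (H N)" "g \<in> H N" for e g
  proof -
    have g: "g \<in> carrier G" and e: "e \<in> carrier A" using that HN span_on_carrier by auto
    have "e \<star> dirac g \<in> span_on (H N)"
      by (rule span_on_star_dirac[OF that(1) g]) (rule H_mult[OF _ that(2)])
    then show ?thesis using that e g by (simp add: span_on_add)
  qed
  let ?E = "\<lambda>n. if n = 0 then span_on (H N) else {e \<in> span_on (H N). aug e = 0}"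
  show ?thesis
    unfolding filtered_def
  proof (intro conjI allI ballI impI)
    show "e \<boxplus> f \<in> ?E n" if "e \<in> ?E n" "f \<in> ?E n" for n e f
      using that by (auto simp: span_on_add span_on_carrier split: if_splits)
    show "e \<star> dirac g \<boxplus> e \<in> ?E (n + i)" if "e \<in> ?E n" "g \<in> H N \<inter> H i" for n i e g
      using that st[of e g] by (auto split: if_splits)
    show "g \<in> H n" if "n \<le> N" "g \<in> H N" for n g
      using that H_antimono by blast
  qed (auto simp: span_on_zero)
qed

section \<open>Adjoining one element of weight w to a filtered subgroup\<close>

context
  fixes N w :: nat and Q :: "'a set" and E :: "nat \<Rightarrow> ('a \<Rightarrow> bit) set" and x :: 'a
  assumes E: "filtered N Q E" and Q: "subgroup Q G"
    and w: "1 \<le> w" and HQ: "H (Suc w) \<subseteq> Q" "Q \<subseteq> H w" and x: "x \<in> H w" "x \<notin> Q"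
begin

lemma E_facts:
  "E 0 = span_on Q" "i \<le> j \<Longrightarrow> e \<in> E j \<Longrightarrow> e \<in> E i" "\<zero>\<^bsub>A\<^esub> \<in> E n"
  "e \<in> E n \<Longrightarrow> f \<in> E n \<Longrightarrow> e \<boxplus> f \<in> E n"
  "e \<in> E n \<Longrightarrow> g \<in> Q \<Longrightarrow> g \<in> H i \<Longrightarrow> e \<star> dirac g \<boxplus> e \<in> E (n + i)"
  "n \<le> N \<Longrightarrow> g \<in> Q \<Longrightarrow> dirac g \<boxplus> dirac \<one> \<in> E n \<Longrightarrow> g \<in> H n"
  "e \<in> E (Suc n) \<Longrightarrow> aug e = 0"
proof -
  note D = E[unfolded filtered_def]
  have "E (Suc n) \<subseteq> E n" for n using D by blast
  then show "i \<le> j \<Longrightarrow> e \<in> E j \<Longrightarrow> e \<in> E i" using lift_Suc_antimono_le[of E i j] by blast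
  show "E 0 = span_on Q" using D by blast
  show "\<zero>\<^bsub>A\<^esub> \<in> E n" using D by blast
  show "e \<in> E n \<Longrightarrow> f \<in> E n \<Longrightarrow> e \<boxplus> f \<in> E n" using D by blast
  show "e \<in> E n \<Longrightarrow> g \<in> Q \<Longrightarrow> g \<in> H i \<Longrightarrow> e \<star> dirac g \<boxplus> e \<in> E (n + i)" using D by blast
  show "n \<le> N \<Longrightarrow> g \<in> Q \<Longrightarrow> dirac g \<boxplus> dirac \<one> \<in> E n \<Longrightarrow> g \<in> H n" using D by blast
  show "e \<in> E (Suc n) \<Longrightarrow> aug e = 0" using D by blast
qed

lemma E_carrier: "e \<in> E n \<Longrightarrow> e \<in> carrier A"
  using E_facts(1) E_facts(2)[of 0 n e] span_on_carrier by auto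

lemma xc: "x \<in> carrier G" using x H_carrier by blast

lemma Qc: "g \<in> Q \<Longrightarrow> g \<in> carrier G" using subgroup.subset[OF Q] by blast

lemma E_star: "e \<in> E n \<Longrightarrow> g \<in> Q \<Longrightarrow> e \<star> dirac g \<in> E n"
proof -
  assume e: "e \<in> E n" and g: "g \<in> Q"
  have "e \<star> dirac g \<boxplus> e \<in> E n"
    using E_facts(5)[OF e g, of 0] Qc[OF g] H_0 by simp
  then have "(e \<star> dirac g \<boxplus> e) \<boxplus> e \<in> E n" using E_facts(4) e by blast
  then show ?thesis by (simp add: A_add_assoc)
qed

lemma xx_mem: "x \<otimes> x \<in> Q" "x \<otimes> x \<in> H (2 * w)"
proof -
  show 1: "x \<otimes> x \<in> H (2 * w)" using H_square x by blast
  then show "x \<otimes> x \<in> Q" using HQ(1) H_antimono[of "Suc w" "2 * w"] w by auto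
qed

lemma x_conj:
  assumes "g \<in> Q"
  shows "commutator G x g \<in> Q" "x \<otimes> g \<otimes> inv x \<in> Q" "g \<in> H i \<Longrightarrow> commutator G x g \<in> H (w + i)"
    "g \<in> H i \<Longrightarrow> x \<otimes> g \<otimes> inv x \<in> H i"
proof -
  have "commutator G x g \<in> H (w + w)" using H_commutator x assms HQ by blast
  then show 1: "commutator G x g \<in> Q" using HQ(1) H_antimono[of "Suc w" "w + w"] w by auto
  have "commutator G x g \<otimes> g = x \<otimes> g \<otimes> inv x"
    using xc Qc[OF assms] by (simp add: commutator_def m_assoc)
  then show "x \<otimes> g \<otimes> inv x \<in> Q" using subgroup.m_closed[OF Q 1 assms] by simp
qed (use H_commutator x H_conj xc in auto)

lemma Qx_notin: "h \<in> Q \<Longrightarrow> h \<otimes> x \<notin> Q"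
proof
  assume h: "h \<in> Q" and hx: "h \<otimes> x \<in> Q"
  have "inv h \<otimes> (h \<otimes> x) \<in> Q" by (intro subgroup.m_closed[OF Q] subgroup.m_inv_closed[OF Q] h hx)
  then show False using x(2) inv_mult_cancel(1)[OF Qc[OF h] xc] by simp
qed

text \<open>The element \<open>x - 1\<close> receives degree \<open>w\<close>. Truncated subtraction
  yields \<open>E 0\<close> for \<open>n \<le> w\<close>, so in these degrees the coefficient of
  \<open>x - 1\<close> is an arbitrary element of the group algebra of \<open>Q\<close>.\<close>

definition F :: "nat \<Rightarrow> ('a \<Rightarrow> bit) set" where
  "F n = {e0 \<boxplus> (e1 \<star> dirac x \<boxplus> e1) | e0 e1. e0 \<in> E n \<and> e1 \<in> E (n - w)}"

lemma F_I: "e0 \<in> E n \<Longrightarrow> e1 \<in> E (n - w) \<Longrightarrow> e0 \<boxplus> (e1 \<star> dirac x \<boxplus> e1) \<in> F n"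
  unfolding F_def by blast

lemma F_E: "e \<in> E n \<Longrightarrow> e \<in> F n"
  using F_I[of e n "\<zero>\<^bsub>A\<^esub>"] E_facts(3) xc by simp

lemma F_antimono: "i \<le> j \<Longrightarrow> f \<in> F j \<Longrightarrow> f \<in> F i"
proof -
  assume ij: "i \<le> j" and "f \<in> F j"
  then obtain e0 e1 where "f = e0 \<boxplus> (e1 \<star> dirac x \<boxplus> e1)" "e0 \<in> E j" "e1 \<in> E (j - w)"
    unfolding F_def by blast
  then show ?thesis using F_I[of e0 i e1] E_facts(2)[OF ij] E_facts(2)[OF diff_le_mono[OF ij, of w]] by blast
qed

lemma F_add: "f \<in> F n \<Longrightarrow> f' \<in> F n \<Longrightarrow> f \<boxplus> f' \<in> F n"
proof -
  assume "f \<in> F n" "f' \<in> F n"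
  then obtain e0 e1 d0 d1 where e: "f = e0 \<boxplus> (e1 \<star> dirac x \<boxplus> e1)" "e0 \<in> E n" "e1 \<in> E (n - w)"
    and d: "f' = d0 \<boxplus> (d1 \<star> dirac x \<boxplus> d1)" "d0 \<in> E n" "d1 \<in> E (n - w)"
    unfolding F_def by blast
  have "f \<boxplus> f' = (e0 \<boxplus> d0) \<boxplus> ((e1 \<boxplus> d1) \<star> dirac x \<boxplus> (e1 \<boxplus> d1))"
    using e d E_carrier xc by (simp add: star_add_left A_add_ac)
  then show ?thesis using F_I[of "e0 \<boxplus> d0" n "e1 \<boxplus> d1"] E_facts(4) e d by simp
qed

lemma F_carrier: "f \<in> F n \<Longrightarrow> f \<in> carrier A"
  unfolding F_def using E_carrier xc by auto

lemma F_x: "f \<in> F n \<Longrightarrow> f \<star> dirac x \<boxplus> f \<in> F (n + w)"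
proof -
  assume "f \<in> F n"
  then obtain e0 e1 where e: "f = e0 \<boxplus> (e1 \<star> dirac x \<boxplus> e1)" "e0 \<in> E n" "e1 \<in> E (n - w)"
    unfolding F_def by blast
  have c: "e0 \<in> carrier A" "e1 \<in> carrier A" using e E_carrier by auto
  \<comment> \<open>In characteristic two the square of \<open>x - 1\<close> is
    \<open>x \<otimes> x - 1\<close>, and \<open>x \<otimes> x\<close> lies in \<open>Q\<close> with
    weight \<open>2 * w\<close>.\<close>
  have "f \<star> dirac x \<boxplus> f = (e1 \<star> dirac (x \<otimes> x) \<boxplus> e1) \<boxplus> (e0 \<star> dirac x \<boxplus> e0)"
    using c xc by (simp add: e(1) star_add_left star_assoc star_dirac_dirac A_add_ac)
  moreover have "e1 \<star> dirac (x \<otimes> x) \<boxplus> e1 \<in> E (n + w)"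
    by (rule E_facts(2)[OF _ E_facts(5)[OF e(3) xx_mem]]) simp
  ultimately show ?thesis using F_I[of _ "n + w" e0] e by simp
qed

lemma F_Q:
  assumes f: "f \<in> F n" and g: "g \<in> Q" "g \<in> H i"
  shows "f \<star> dirac g \<boxplus> f \<in> F (n + i)"
proof -
  obtain e0 e1 where e: "f = e0 \<boxplus> (e1 \<star> dirac x \<boxplus> e1)" "e0 \<in> E n" "e1 \<in> E (n - w)"
    using f unfolding F_def by blast
  have c: "e0 \<in> carrier A" "e1 \<in> carrier A" using e E_carrier by auto
  have gc: "g \<in> carrier G" using g Qc by blast
  define g' where "g' = x \<otimes> g \<otimes> inv x"
  define k where "k = commutator G x g"
  have g': "g' \<in> Q" "g' \<in> H i" "g' \<in> carrier G" and k: "k \<in> Q" "k \<in> H (w + i)" "k \<in> carrier G"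
    using x_conj g Qc by (auto simp: g'_def k_def)
  have xg: "x \<otimes> g = g' \<otimes> x" using gc xc by (simp add: g'_def m_assoc)
  have g'k: "g' = k \<otimes> g" using gc xc by (simp add: g'_def k_def commutator_def m_assoc)
  let ?d = "e1 \<star> dirac g' \<boxplus> e1"
  let ?c = "e1 \<star> dirac k \<boxplus> e1"
  \<comment> \<open>Moving \<open>x\<close> past \<open>g\<close> turns \<open>g\<close> into
    \<open>g'\<close>, that is \<open>k \<otimes> g\<close>. The correction \<open>?c\<close> comes
    from \<open>k\<close>, whose weight \<open>w + i\<close> makes up for the lower degree
    \<open>n - w\<close> of \<open>e1\<close>.\<close>
  have "f \<star> dirac g \<boxplus> f = ((e0 \<star> dirac g \<boxplus> e0) \<boxplus> ?c \<star> dirac g) \<boxplus> (?d \<star> dirac x \<boxplus> ?d)"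
  proof -
    have "e1 \<star> dirac k \<star> dirac g = e1 \<star> dirac g'"
      using c gc k by (simp add: star_assoc star_dirac_dirac g'k)
    then show ?thesis
      using c gc xc g' k
      by (simp add: e(1) star_add_left star_assoc star_dirac_dirac xg A_add_ac)
  qed
  moreover have "?c \<star> dirac g \<in> E (n + i)"
    by (rule E_star[OF _ g(1)], rule E_facts(2)[OF _ E_facts(5)[OF e(3) k(1,2)]]) simp
  moreover have "e0 \<star> dirac g \<boxplus> e0 \<in> E (n + i)" by (rule E_facts(5)[OF e(2) g])
  moreover have "?d \<in> E (n + i - w)"
    by (rule E_facts(2)[OF _ E_facts(5)[OF e(3) g'(1,2)]]) simp
  ultimately show ?thesis using F_I[of _ "n + i" ?d] E_facts(4) by simp
qed

lemma F_Qx: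
  assumes f: "f \<in> F n" and h: "h \<in> Q" and g: "h \<otimes> x \<in> H i"
  shows "f \<star> dirac (h \<otimes> x) \<boxplus> f \<in> F (n + i)"
proof -
  \<comment> \<open>An element of the new coset cannot have weight above \<open>w\<close>. Hence
    both factors have weight at least \<open>i\<close>, and hx - 1 is expanded as (h - 1)(x - 1) +
    (h - 1) + (x - 1).\<close>
  have iw: "i \<le> w"
  proof (rule ccontr)
    assume "\<not> i \<le> w"
    then have "h \<otimes> x \<in> Q" using HQ(1) H_antimono[of "Suc w" i] g by auto
    then show False using Qx_notin[OF h] by simp
  qed
  have xi: "x \<in> H i" using x(1) H_antimono[OF iw] by blast
  have hi: "h \<in> H i" using H_antimono[OF iw] h HQ(2) by blast
  have c: "f \<in> carrier A" "h \<in> carrier G" using f F_carrier h Qc by auto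
  let ?f = "f \<star> dirac h \<boxplus> f"
  have fh: "?f \<in> F (n + i)" by (rule F_Q[OF f h hi])
  have "f \<star> dirac (h \<otimes> x) \<boxplus> f = (?f \<star> dirac x \<boxplus> ?f) \<boxplus> (?f \<boxplus> (f \<star> dirac x \<boxplus> f))"
    using c xc by (simp add: star_add_left star_assoc star_dirac_dirac A_add_ac)
  moreover have "?f \<star> dirac x \<boxplus> ?f \<in> F (n + i)"
    by (rule F_antimono[OF _ F_x[OF fh]]) simp
  moreover have "f \<star> dirac x \<boxplus> f \<in> F (n + i)"
    by (rule F_antimono[OF _ F_x[OF f]]) (use iw in simp)
  ultimately show ?thesis using fh F_add by simp
qed

lemma F_0: "F 0 = span_on (Q \<union> {h \<otimes> x | h. h \<in> Q})" (is "_ = span_on ?P")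
proof
  have sub: "span_on Q \<subseteq> span_on ?P" by (auto simp: span_on_def)
  show "F 0 \<subseteq> span_on ?P"
  proof
    fix f assume "f \<in> F 0"
    then obtain e0 e1 where e: "f = e0 \<boxplus> (e1 \<star> dirac x \<boxplus> e1)" "e0 \<in> span_on Q" "e1 \<in> span_on Q"
      unfolding F_def E_facts(1) diff_0_eq_0 by blast
    have "e1 \<star> dirac x \<in> span_on ?P" by (rule span_on_star_dirac[OF e(3) xc]) blast
    then show "f \<in> span_on ?P" unfolding e(1) using e(2,3) sub by (blast intro: span_on_add)
  qed
  show "span_on ?P \<subseteq> F 0"
  proof
    fix f assume f: "f \<in> span_on ?P"
    define e1 where "e1 = (\<lambda>h. if h \<in> Q then f (h \<otimes> x) else 0)"
    define e0 where "e0 = (\<lambda>h. if h \<in> Q then f h + f (h \<otimes> x) else 0)"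
    have fin: "finite {g. f g \<noteq> 0}" using f by (simp add: span_on_def A_carrier)
    have "{h. e1 h \<noteq> 0} \<subseteq> (\<lambda>g. g \<otimes> inv x) ` {g. f g \<noteq> 0}"
    proof
      fix h assume "h \<in> {h. e1 h \<noteq> 0}"
      then have "f (h \<otimes> x) \<noteq> 0" "h \<in> Q" by (auto simp: e1_def split: if_splits)
      moreover have "h = h \<otimes> x \<otimes> inv x" using \<open>h \<in> Q\<close> Qc xc by (simp add: m_assoc)
      ultimately show "h \<in> (\<lambda>g. g \<otimes> inv x) ` {g. f g \<noteq> 0}" by blast
    qed
    then have fin1: "finite {h. e1 h \<noteq> 0}" using fin finite_surj by blast
    have "{h. e0 h \<noteq> 0} \<subseteq> {h. e1 h \<noteq> 0} \<union> {g. f g \<noteq> 0}"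
      by (auto simp: e0_def e1_def split: if_splits)
    then have fin0: "finite {h. e0 h \<noteq> 0}" using fin fin1 finite_subset by blast
    have e1: "e1 \<in> span_on Q"
      using fin1 Qc by (auto simp: span_on_def A_carrier e1_def split: if_splits)
    have e0: "e0 \<in> span_on Q"
      using fin0 Qc by (auto simp: span_on_def A_carrier e0_def split: if_splits)
    have "f = e0 \<boxplus> (e1 \<star> dirac x \<boxplus> e1)"
    proof
      fix g
      show "f g = (e0 \<boxplus> (e1 \<star> dirac x \<boxplus> e1)) g"
      proof (cases "g \<in> carrier G")
        case False
        then have "g \<notin> Q" "f g = 0" using Qc A_outside[OF span_on_carrier[OF f]] by auto
        moreover have "(e1 \<star> dirac x) g = 0"
          by (rule A_outside[OF star_closed[OF span_on_carrier[OF e1] A_dirac[OF xc]] False])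
        ultimately show ?thesis by (simp add: A_apply(1)[of _ _ g] e0_def e1_def)
      next
        case True
        have *: "(e1 \<star> dirac x) g = e1 (g \<otimes> inv x)"
          by (rule star_dirac_apply[OF span_on_carrier[OF e1] xc True])
        have gx: "g \<otimes> inv x \<otimes> x = g" using True xc by (simp add: m_assoc)
        show ?thesis
        proof (cases "g \<in> Q")
          case gQ: True
          then have "g \<otimes> inv x \<notin> Q" using Qx_notin[of "g \<otimes> inv x"] gx by auto
          then show ?thesis using gQ * by (simp add: A_apply(1)[of _ _ g] e0_def e1_def add.assoc)
        next
          case gQ: False
          show ?thesis
          proof (cases "g \<otimes> inv x \<in> Q")
            case True
            then show ?thesis using gQ * gx by (simp add: A_apply(1)[of _ _ g] e0_def e1_def)
          next
            case False
            have "g \<notin> ?P"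
            proof
              assume "g \<in> ?P"
              then obtain h where "h \<in> Q" "g = h \<otimes> x" using gQ by blast
              then show False using False Qc xc by (simp add: m_assoc)
            qed
            then have "f g = 0" using f by (auto simp: span_on_def)
            then show ?thesis using gQ * False by (simp add: A_apply(1)[of _ _ g] e0_def e1_def)
          qed
        qed
      qed
    qed
    then show "f \<in> F 0" using F_I[of e0 0 e1] e0 e1 E_facts(1) by simp
  qed
qed

text \<open>The decomposition of \<open>g - 1\<close> is unique: it is \<open>g - 1\<close> alone
  for \<open>g\<close> in \<open>Q\<close>, and (h - 1) + h(x - 1) for
  \<open>g = h \<otimes> x\<close>. In the second case the coefficient \<open>h\<close> has
  augmentation one, so it occurs in degree zero only, which forces \<open>n \<le> w\<close>.\<close>

lemma F_detects:
  assumes n: "n \<le> N" and g: "g \<in> Q \<union> {h \<otimes> x | h. h \<in> Q}"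
    and f: "dirac g \<boxplus> dirac \<one> \<in> F n"
  shows "g \<in> H n"
proof -
  obtain e0 e1 where e: "dirac g \<boxplus> dirac \<one> = e0 \<boxplus> (e1 \<star> dirac x \<boxplus> e1)"
    and en: "e0 \<in> E n" "e1 \<in> E (n - w)"
    using f unfolding F_def by blast
  have c: "e0 \<in> carrier A" "e1 \<in> carrier A" using en E_carrier by auto
  have sp: "e0 \<in> span_on Q" "e1 \<in> span_on Q"
    using en E_facts(1) E_facts(2)[of 0] by auto
  have Qsub: "Q \<subseteq> carrier G" and Q1: "\<one> \<in> Q" using Q subgroup.subset subgroup.one_closed by auto
  have eq: "d0 = e0 \<and> d1 = e1"
    if d: "d0 \<in> span_on Q" "d1 \<in> span_on Q" "dirac g \<boxplus> dirac \<one> = d0 \<boxplus> (d1 \<star> dirac x \<boxplus> d1)" for d0 d1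
  proof -
    have dc: "d0 \<in> carrier A" "d1 \<in> carrier A" using d span_on_carrier by auto
    have "(d0 \<boxplus> e0) \<boxplus> ((d1 \<boxplus> e1) \<star> dirac x \<boxplus> (d1 \<boxplus> e1))
        = (d0 \<boxplus> (d1 \<star> dirac x \<boxplus> d1)) \<boxplus> (e0 \<boxplus> (e1 \<star> dirac x \<boxplus> e1))"
      using c dc xc by (simp add: star_add_left A_add_ac)
    also have "\<dots> = \<zero>\<^bsub>A\<^esub>" unfolding d(3)[symmetric] e[symmetric] by simp
    finally have "d0 \<boxplus> e0 = \<zero>\<^bsub>A\<^esub>" "d1 \<boxplus> e1 = \<zero>\<^bsub>A\<^esub>"
      by (rule span_on_unique[OF Q xc x(2) span_on_add[OF d(1) sp(1)] span_on_add[OF d(2) sp(2)]])+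
    then show ?thesis using A_add_cancel[of d0 e0] A_add_cancel[of d1 e1] by simp
  qed
  from g consider "g \<in> Q" | h where "h \<in> Q" "g = h \<otimes> x" by blast
  then show ?thesis
  proof cases
    case 1
    have "dirac g \<boxplus> dirac \<one> = e0 \<and> \<zero>\<^bsub>A\<^esub> = e1"
      by (rule eq) (use 1 Q1 Qsub xc in \<open>auto intro: span_on_add span_on_dirac span_on_zero\<close>)
    then show ?thesis using E_facts(6)[OF n 1] en by simp
  next
    case 2
    have "dirac h \<boxplus> dirac \<one> = e0 \<and> dirac h = e1"
    proof (rule eq)
      show "dirac g \<boxplus> dirac \<one> = (dirac h \<boxplus> dirac \<one>) \<boxplus> (dirac h \<star> dirac x \<boxplus> dirac h)"
        using 2 Qc xc by (simp add: star_dirac_dirac A_add_ac)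
    qed (use 2 Q1 Qsub xc in \<open>auto intro: span_on_add span_on_dirac span_on_zero\<close>)
    then have h: "dirac h \<boxplus> dirac \<one> \<in> E n" "dirac h \<in> E (n - w)" using en by auto
    have "n \<le> w"
    proof (rule ccontr)
      assume "\<not> n \<le> w"
      then have "n - w = Suc (n - Suc w)" by simp
      then have "aug (dirac h) = 0" using E_facts(7)[of "dirac h" "n - Suc w"] h by simp
      then show False by simp
    qed
    then show ?thesis
      using E_facts(6)[OF n 2(1) h(1)] 2(2) H_mult x(1) H_antimono[of n w] by blast
  qed
qed

lemma filtered_step: "filtered N (Q \<union> {h \<otimes> x | h. h \<in> Q}) F"
  unfolding filtered_def
proof (intro conjI allI ballI impI)
  show "F 0 = span_on (Q \<union> {h \<otimes> x | h. h \<in> Q})" by (rule F_0)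
  show "F (Suc n) \<subseteq> F n" for n using F_antimono[of n "Suc n"] by auto
  show "\<zero>\<^bsub>A\<^esub> \<in> F n" for n using F_E E_facts(3) by blast
  show "e \<boxplus> f \<in> F n" if "e \<in> F n" "f \<in> F n" for n e f using F_add that by blast
  show "e \<star> dirac g \<boxplus> e \<in> F (n + i)"
    if e: "e \<in> F n" and g: "g \<in> (Q \<union> {h \<otimes> x | h. h \<in> Q}) \<inter> H i" for n i e g
  proof -
    consider "g \<in> Q" | h where "h \<in> Q" "g = h \<otimes> x" using g by blast
    then show ?thesis using F_Q[OF e] F_Qx[OF e] g by cases blast+
  qed
  show "g \<in> H n" if "n \<le> N" "g \<in> Q \<union> {h \<otimes> x | h. h \<in> Q}" "dirac g \<boxplus> dirac \<one> \<in> F n" for n g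
    using F_detects that by blast
  show "aug e = 0" if e: "e \<in> F (Suc n)" for n e
  proof -
    obtain e0 e1 where "e = e0 \<boxplus> (e1 \<star> dirac x \<boxplus> e1)" "e0 \<in> E (Suc n)" "e1 \<in> E (Suc n - w)"
      using e unfolding F_def by blast
    then show ?thesis using E_carrier E_facts(7)[of e0 n] xc by simp
  qed
qed

text \<open>Two cosets suffice because \<open>x\<close> normalizes \<open>Q\<close> and its square
  lies in \<open>Q\<close>; both facts come from the weights.\<close>

lemma subgroup_step: "subgroup (Q \<union> {h \<otimes> x | h. h \<in> Q}) G" (is "subgroup ?P G")
proof -
  interpret Q: subgroup Q G by (rule Q)
  have inter: "h \<otimes> x \<otimes> (k \<otimes> x) = h \<otimes> (x \<otimes> k \<otimes> inv x) \<otimes> (x \<otimes> x)"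
    "h \<otimes> x \<otimes> k = h \<otimes> (x \<otimes> k \<otimes> inv x) \<otimes> x" "h \<otimes> (k \<otimes> x) = h \<otimes> k \<otimes> x"
    if "h \<in> Q" "k \<in> Q" for h k
    using that Qc xc by (simp_all add: m_assoc inv_mult_cancel)
  have m: "p \<otimes> q \<in> ?P" if pq: "p \<in> ?P" "q \<in> ?P" for p q
  proof -
    consider "p \<in> Q" "q \<in> Q" | k where "p \<in> Q" "k \<in> Q" "q = k \<otimes> x"
      | h where "h \<in> Q" "p = h \<otimes> x" "q \<in> Q" | h k where "h \<in> Q" "p = h \<otimes> x" "k \<in> Q" "q = k \<otimes> x"
      using pq by blast
    then show ?thesis
    proof cases
      case 1
      then show ?thesis by simp
    next
      case 2
      then have "p \<otimes> q = p \<otimes> k \<otimes> x" "p \<otimes> k \<in> Q" using inter(3)[OF 2(1,2)] Q.m_closed[OF 2(1,2)] by simp_all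
      then show ?thesis by blast
    next
      case 3
      have "p \<otimes> q = h \<otimes> (x \<otimes> q \<otimes> inv x) \<otimes> x" "h \<otimes> (x \<otimes> q \<otimes> inv x) \<in> Q"
        unfolding 3(2) by (rule inter(2)[OF 3(1,3)], rule Q.m_closed[OF 3(1) x_conj(2)[OF 3(3)]])
      then show ?thesis by blast
    next
      case 4
      have "h \<otimes> (x \<otimes> k \<otimes> inv x) \<otimes> (x \<otimes> x) \<in> Q"
        by (rule Q.m_closed[OF Q.m_closed[OF 4(1) x_conj(2)[OF 4(3)]] xx_mem(1)])
      then show ?thesis unfolding 4(2,4) inter(1)[OF 4(1,3)] by (rule UnI1)
    qed
  qed
  have "\<one> \<otimes> x \<in> ?P" using Q.one_closed by blast
  then have xP: "x \<in> ?P" using xc by simp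
  have ix: "inv x \<in> ?P"
  proof -
    have "inv x = inv (x \<otimes> x) \<otimes> x" using xc by (simp add: inv_mult_group m_assoc)
    moreover have "inv (x \<otimes> x) \<in> Q" using xx_mem by simp
    ultimately show ?thesis by blast
  qed
  show ?thesis
  proof (rule subgroupI)
    show "?P \<subseteq> carrier G" using Qc xc by auto
    show "?P \<noteq> {}" using xP by blast
    show "inv p \<in> ?P" if p: "p \<in> ?P" for p
    proof (cases "p \<in> Q")
      case False
      then obtain h where h: "h \<in> Q" "p = h \<otimes> x" using p by blast
      then have "inv p = inv x \<otimes> inv h" using Qc xc by (simp add: inv_mult_group)
      moreover have "inv h \<in> ?P" using h(1) by simp
      ultimately show ?thesis using m[OF ix] by simp
    qed simp
    show "p \<otimes> q \<in> ?P" if "p \<in> ?P" "q \<in> ?P" for p q by (rule m[OF that])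
  qed
qed

end

text \<open>Between consecutive members of the series the generators are adjoined one after the
  other; one that is already present changes nothing, any other doubles the subgroup.\<close>

lemma filtered_generated:
  assumes w: "1 \<le> w" and E: "\<exists>E. filtered N (H (Suc w)) E"
    and S: "finite S" "S \<subseteq> H w"
  shows "\<exists>P E. filtered N P E \<and> subgroup P G \<and> S \<union> H (Suc w) \<subseteq> P \<and> P \<subseteq> H w"
  using S
proof (induction S)
  case empty
  show ?case
    using E H_Suc[of w] normal_imp_subgroup[OF H_normal[of "Suc w"]] by blast
next
  case (insert x S)
  then obtain P E where P: "filtered N P E" "subgroup P G" "S \<union> H (Suc w) \<subseteq> P" "P \<subseteq> H w"
    using insert.IH insert.prems by blast
  show ?case
  proof (cases "x \<in> P")
    case True
    then show ?thesis using P by blast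
  next
    case False
    have x: "x \<in> H w" using insert.prems by blast
    let ?P = "P \<union> {h \<otimes> x | h. h \<in> P}"
    have HP: "H (Suc w) \<subseteq> P" and SP: "S \<subseteq> P" using P(3) by blast+
    have "\<one> \<otimes> x \<in> ?P" using subgroup.one_closed[OF P(2)] by blast
    then have "x \<in> ?P" using H_carrier[OF x] by simp
    then have "insert x S \<union> H (Suc w) \<subseteq> ?P" using SP HP by blast
    moreover have "?P \<subseteq> H w" using P(4) H_mult[OF _ x] by blast
    moreover note filtered_step[OF P(1,2) w HP P(4) x False] subgroup_step[OF P(1,2) w HP P(4) x False]
    ultimately show ?thesis by blast
  qed
qed

lemma filtered_H: "1 \<le> w \<Longrightarrow> w \<le> N \<Longrightarrow> \<exists>E. filtered N (H w) E"
proof (induction "N - w" arbitrary: w)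
  case 0
  then have "w = N" by simp
  then show ?case using filtered_bottom by blast
next
  case (Suc k)
  then have E: "\<exists>E. filtered N (H (Suc w)) E" by simp
  obtain S where S: "finite S" "S \<subseteq> H w" "H w \<subseteq> generate G (S \<union> H (Suc w))"
    using H_gens[OF Suc.prems(1)] by blast
  obtain P E where P: "filtered N P E" "subgroup P G" "S \<union> H (Suc w) \<subseteq> P" "P \<subseteq> H w"
    using filtered_generated[OF Suc.prems(1) E S(1,2)] by blast
  have "generate G (S \<union> H (Suc w)) \<subseteq> P" by (rule generate_subgroup_incl[OF P(3,2)])
  then have "P = H w" using S(3) P(4) by blast
  then show ?case using P(1) by blast
qed

theorem dim_subgroup_subset: "1 \<le> N \<Longrightarrow> dim_subgroup G N \<subseteq> H N"
proof -
  assume N: "1 \<le> N"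
  obtain E where E: "filtered N (carrier G) E"
    using filtered_H[of 1 N] N H_1 by auto
  have E0: "E 0 = carrier A" using E A_support by (auto simp: filtered_def span_on_def)
  have Esub: "E n \<subseteq> carrier A" for n
  proof -
    have "E (Suc n) \<subseteq> E n" for n using E by (simp add: filtered_def)
    then show ?thesis using lift_Suc_antimono_le[of E 0 n] E0 by auto
  qed
  have E_add: "e \<boxplus> f \<in> E n" if "e \<in> E n" "f \<in> E n" for e f n using E that by (simp add: filtered_def)
  \<comment> \<open>Both branches say that e(d - aug d) has degree n + 1. In this form the claim is
    additive in \<open>d\<close> and reduces to a single group element, which has weight at least
    one.\<close>
  have E_aug: "(if aug d = 0 then e \<star> d else e \<star> d \<boxplus> e) \<in> E (Suc n)" if e: "e \<in> E n" and d: "d \<in> carrier A" for e d n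
    using d
  proof (induction d rule: A_induct)
    case zero
    have "\<zero>\<^bsub>A\<^esub> \<in> E (Suc n)" using E by (simp only: filtered_def)
    moreover have "e \<star> \<zero>\<^bsub>A\<^esub> = \<zero>\<^bsub>A\<^esub>" using star_zero(2)[of e] e Esub[of n] by blast
    ultimately show ?case by simp
  next
    case (add u f)
    have ec: "e \<in> carrier A" using e Esub by blast
    have "\<forall>g\<in>carrier G \<inter> H (Suc 0). e \<star> dirac g \<boxplus> e \<in> E (n + Suc 0)"
      using E e unfolding filtered_def by blast
    then have "e \<star> dirac u \<boxplus> e \<in> E (Suc n)" using add.hyps(1) H_1 by simp
    from E_add[OF this add.IH] show ?case
      using add.hyps ec by (cases "aug f = 0") (simp_all add: star_add_right A_add_ac)
  qed
  have D: "f \<in> E n" if "f \<in> Dpow n" for f n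
    using that
  proof (induction n arbitrary: f)
    case 0
    then show ?case by (simp add: E0)
  next
    case (Suc n)
    from Suc.prems show ?case
      unfolding Dpow_Suc
    proof (induction rule: ideal_prod.induct)
      case (prod i j)
      then show ?case using E_aug[OF Suc.IH[OF prod(1)], of j] by (simp add: aug_ideal_eq)
    next
      case (sum s t)
      then show ?case using E_add by blast
    qed
  qed
  show ?thesis
  proof
    fix g assume "g \<in> dim_subgroup G N"
    then have "g \<in> carrier G" "dirac g \<boxplus> dirac \<one> \<in> E N" using D by (auto simp: dim_subgroup_iff)
    then show "g \<in> H N" using E by (simp add: filtered_def)
  qed
qed

section \<open>Dimension subgroups contain the series\<close>

lemma dirac_one_star:
  assumes "g \<in> carrier G" "h \<in> carrier G"
  shows "(dirac g \<boxplus> dirac \<one>) \<star> dirac h = dirac (g \<otimes> h) \<boxplus> dirac h"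
    "dirac h \<star> (dirac g \<boxplus> dirac \<one>) = dirac (h \<otimes> g) \<boxplus> dirac h"
  using assms by (simp_all add: star_add_left star_add_right star_dirac_dirac)

lemma Dpow_zero: "\<zero>\<^bsub>A\<^esub> \<in> Dpow n"
proof (induction n)
  case (Suc n)
  have "\<zero>\<^bsub>A\<^esub> \<star> \<zero>\<^bsub>A\<^esub> \<in> ideal_prod A (Dpow n) (aug_ideal G)"
    by (rule ideal_prod.prod[OF Suc]) (simp add: aug_ideal_eq)
  then show ?case by (simp only: Dpow_Suc star_zero A_zero)
qed simp

lemma dim_subgroup_normal: "dim_subgroup G n \<lhd> G"
  unfolding normal_inv_iff
proof (intro conjI ballI subgroupI)
  show "dim_subgroup G n \<subseteq> carrier G" by (auto simp: dim_subgroup_iff)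
  have "\<one> \<in> dim_subgroup G n" by (simp add: dim_subgroup_iff Dpow_zero)
  then show "dim_subgroup G n \<noteq> {}" by blast
next
  fix g assume g: "g \<in> dim_subgroup G n"
  then have gc: "g \<in> carrier G" "dirac g \<boxplus> dirac \<one> \<in> Dpow n" by (auto simp: dim_subgroup_iff)
  have "(dirac g \<boxplus> dirac \<one>) \<star> dirac (inv g) \<in> Dpow n" by (rule Dpow_right[OF gc(2)]) (use gc(1) in simp)
  then show "inv g \<in> dim_subgroup G n"
    using gc(1) by (simp add: dim_subgroup_iff dirac_one_star A_add_comm)
next
  fix g h assume "g \<in> dim_subgroup G n" "h \<in> dim_subgroup G n"
  then have c: "g \<in> carrier G" "dirac g \<boxplus> dirac \<one> \<in> Dpow n" "h \<in> carrier G" "dirac h \<boxplus> dirac \<one> \<in> Dpow n"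
    by (auto simp: dim_subgroup_iff)
  have "(dirac g \<boxplus> dirac \<one>) \<star> dirac h \<boxplus> (dirac h \<boxplus> dirac \<one>) \<in> Dpow n"
    by (intro Dpow_add Dpow_right A_dirac c)
  then show "g \<otimes> h \<in> dim_subgroup G n"
    using c(1,3) by (simp add: dim_subgroup_iff dirac_one_star A_add_ac)
next
  fix k g assume k: "k \<in> carrier G" and "g \<in> dim_subgroup G n"
  then have c: "g \<in> carrier G" "dirac g \<boxplus> dirac \<one> \<in> Dpow n" by (auto simp: dim_subgroup_iff)
  have "dirac k \<star> (dirac g \<boxplus> dirac \<one>) \<star> dirac (inv k) \<in> Dpow n"
    by (rule Dpow_right[OF Dpow_left]) (use c k in auto)
  then show "k \<otimes> g \<otimes> inv k \<in> dim_subgroup G n"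
    using c(1) k by (simp add: dim_subgroup_iff dirac_one_star star_add_left star_dirac_dirac)
qed

text \<open>With a = h - 1 and b = g - 1 one has ab - ba = hg - gh, and right multiplication by the
  inverse of gh turns this into [h, g] - 1.\<close>

lemma dim_subgroup_commutator:
  assumes "h \<in> dim_subgroup G n" "g \<in> carrier G"
  shows "commutator G h g \<in> dim_subgroup G (Suc n)"
proof -
  let ?a = "dirac h \<boxplus> dirac \<one>" and ?b = "dirac g \<boxplus> dirac \<one>"
  have c: "h \<in> carrier G" "?a \<in> Dpow n" using assms by (auto simp: dim_subgroup_iff)
  have b: "?b \<in> Dpow (Suc 0)" using assms(2) by (intro Dpow_1) (simp add: aug_ideal_eq)
  have "?a \<star> ?b \<boxplus> ?b \<star> ?a \<in> Dpow (Suc n)"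
    by (rule Dpow_add) (use Dpow_mult[OF c(2) b] Dpow_mult[OF b c(2)] in \<open>simp_all only: add_Suc_right add_Suc add_0 add_0_right\<close>)
  then have "(?a \<star> ?b \<boxplus> ?b \<star> ?a) \<star> dirac (inv h \<otimes> inv g) \<in> Dpow (Suc n)"
    by (rule Dpow_right) (use c assms in simp)
  moreover have "?a \<star> ?b \<boxplus> ?b \<star> ?a = dirac (h \<otimes> g) \<boxplus> dirac (g \<otimes> h)"
    using c assms by (simp add: star_add_left star_add_right star_dirac_dirac A_add_ac)
  moreover have "(dirac (h \<otimes> g) \<boxplus> dirac (g \<otimes> h)) \<star> dirac (inv h \<otimes> inv g)
      = dirac (commutator G h g) \<boxplus> dirac \<one>"
    using c assms
    by (simp add: star_add_left star_dirac_dirac commutator_def m_assoc inv_mult_cancel)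
  ultimately show ?thesis using c assms by (simp only: dim_subgroup_iff commutator_closed simp_thms)
qed

lemma dim_subgroup_square:
  assumes "u \<in> dim_subgroup G n"
  shows "u \<otimes> u \<in> dim_subgroup G (n + n)"
proof -
  let ?a = "dirac u \<boxplus> dirac \<one>"
  have c: "u \<in> carrier G" "?a \<in> Dpow n" using assms by (auto simp: dim_subgroup_iff)
  have "?a \<star> ?a = dirac (u \<otimes> u) \<boxplus> dirac \<one>"
    using c by (simp add: star_add_left star_add_right star_dirac_dirac A_add_ac)
  then show ?thesis using Dpow_mult[OF c(2) c(2)] c by (simp only: dim_subgroup_iff m_closed simp_thms)
qed

lemma dim_subgroup_antimono: "i \<le> j \<Longrightarrow> dim_subgroup G j \<subseteq> dim_subgroup G i"
proof (rule lift_Suc_antimono_le[of "dim_subgroup G"])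
  show "dim_subgroup G (Suc n) \<subseteq> dim_subgroup G n" for n
    unfolding dim_subgroup_iff subset_iff using Dpow_antimono by blast
qed

text \<open>Dimension subgroups are admissible test subgroups in \<open>H_generated\<close>:
  commutators add one to the index and squares double it. For \<open>n \<ge> 2\<close> both n - 1
  and the rounded-up half are smaller than n.\<close>

lemma subset_dim_subgroup: "H n \<subseteq> dim_subgroup G n"
proof (induction n rule: less_induct)
  case (less n)
  show ?case
  proof (cases "2 \<le> n")
    case True
    show ?thesis
    proof (rule H_generated[OF True dim_subgroup_normal])
      fix h g assume "h \<in> H (n - 1)" "g \<in> carrier G"
      then show "commutator G h g \<in> dim_subgroup G n"
        using dim_subgroup_commutator[of h "n - 1" g] less.IH[of "n - 1"] True
        by (simp add: subset_iff)
    next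
      fix u assume u: "u \<in> H ((n + 1) div 2)"
      have "(n + 1) div 2 < n" using True by linarith
      then have "u \<in> dim_subgroup G ((n + 1) div 2)" using less.IH u by blast
      from dim_subgroup_square[OF this]
      have "u \<otimes> u \<in> dim_subgroup G ((n + 1) div 2 + (n + 1) div 2)" .
      moreover have "n \<le> (n + 1) div 2 + (n + 1) div 2" by linarith
      ultimately show "u \<otimes> u \<in> dim_subgroup G n" using dim_subgroup_antimono by blast
    qed
  next
    case False
    then consider "n = 0" | "n = Suc 0" by linarith
    then show ?thesis
    proof cases
      case 1
      have "dim_subgroup G 0 = carrier G" by (auto simp: dim_subgroup_iff)
      then show ?thesis unfolding 1 H_0 by simp
    next
      case 2
      show ?thesis
      proof
        fix g assume "g \<in> H n"
        then have g: "g \<in> carrier G" by (rule H_carrier)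
        then have "dirac g \<boxplus> dirac \<one> \<in> aug_ideal G" by (simp add: aug_ideal_eq)
        then show "g \<in> dim_subgroup G n"
          unfolding 2 dim_subgroup_iff using Dpow_1 g by blast
      qed
    qed
  qed
qed

theorem dim_subgroup_eq: "1 \<le> n \<Longrightarrow> dim_subgroup G n = H n"
  using dim_subgroup_subset subset_dim_subgroup by blast

end

section \<open>The filtration of functions on words\<close>

text \<open>V_n^r as a condition on functions on words. The first letter belongs to the lowest
  binary digit of the index, so in terms of the two halves v_(n+1)^(2s) is (v_n^s, 0) and
  v_(n+1)^(2s+1) is (v_n^s, v_n^s). This is why odd depth adds a condition on the sum of the
  halves.\<close>

fun Wfil :: "nat \<Rightarrow> nat \<Rightarrow> (word \<Rightarrow> bit) \<Rightarrow> bool" where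
  "Wfil 0 r f \<longleftrightarrow> (1 \<le> r \<longrightarrow> f [] = 0)"
| "Wfil (Suc n) r f \<longleftrightarrow> Wfil n (r div 2) (\<lambda>\<sigma>. f (0 # \<sigma>)) \<and> Wfil n (r div 2) (\<lambda>\<sigma>. f (1 # \<sigma>)) \<and>
    (odd r \<longrightarrow> Wfil n (Suc (r div 2)) (\<lambda>\<sigma>. f (0 # \<sigma>) + f (1 # \<sigma>)))"

lemma bit_add_cancel [simp]: "(x::bit) + (x + y) = y" "x + (y + x) = y"
  by (cases x; cases y; simp add: add_bit_eq_xor)+

lemma bit_cases01: "(z::bit) = 0 \<or> z = 1"
  by (cases z) auto

lemma bit_all: "(\<forall>z::bit. P z) \<longleftrightarrow> P 0 \<and> P 1"
proof (intro iffI allI)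
  fix z assume "P 0 \<and> P 1"
  then show "P z" using bit_cases01[of z] by auto
qed simp

lemma Wfil_cong: "(\<And>\<sigma>. length \<sigma> = n \<Longrightarrow> f \<sigma> = g \<sigma>) \<Longrightarrow> Wfil n r f = Wfil n r g"
proof (induction n arbitrary: r f g)
  case (Suc n)
  have e: "f (z # \<sigma>) = g (z # \<sigma>)" if "length \<sigma> = n" for z \<sigma> using Suc.prems that by simp
  have "Wfil n s (\<lambda>\<sigma>. f (z # \<sigma>)) = Wfil n s (\<lambda>\<sigma>. g (z # \<sigma>))" for s z
    by (rule Suc.IH) (rule e)
  moreover have "Wfil n s (\<lambda>\<sigma>. f (0 # \<sigma>) + f (1 # \<sigma>)) = Wfil n s (\<lambda>\<sigma>. g (0 # \<sigma>) + g (1 # \<sigma>))" for s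
    by (rule Suc.IH) (simp only: e)
  ultimately show ?case by (simp only: Wfil.simps)
qed simp

lemma Wfil_zero [simp]: "Wfil n r (\<lambda>\<sigma>. 0)"
  by (induction n arbitrary: r) auto

lemma Wfil_add: "Wfil n r f \<Longrightarrow> Wfil n r g \<Longrightarrow> Wfil n r (\<lambda>\<sigma>. f \<sigma> + g \<sigma>)"
proof (induction n arbitrary: r f g)
  case (Suc n)
  have "(\<lambda>\<sigma>. f (0 # \<sigma>) + g (0 # \<sigma>) + (f (1 # \<sigma>) + g (1 # \<sigma>)))
      = (\<lambda>\<sigma>. (f (0 # \<sigma>) + f (1 # \<sigma>)) + (g (0 # \<sigma>) + g (1 # \<sigma>)))"
    by (simp add: add_ac)
  then show ?case using Suc.prems
      Suc.IH[of "r div 2" "\<lambda>\<sigma>. f (0 # \<sigma>)" "\<lambda>\<sigma>. g (0 # \<sigma>)"]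
      Suc.IH[of "r div 2" "\<lambda>\<sigma>. f (1 # \<sigma>)" "\<lambda>\<sigma>. g (1 # \<sigma>)"]
      Suc.IH[of "Suc (r div 2)" "\<lambda>\<sigma>. f (0 # \<sigma>) + f (1 # \<sigma>)" "\<lambda>\<sigma>. g (0 # \<sigma>) + g (1 # \<sigma>)"]
    by (simp only: Wfil.simps) blast
qed simp

lemma Wfil_double: "Wfil (Suc n) (2 * s) f \<longleftrightarrow>
    Wfil n s (\<lambda>\<sigma>. f (0 # \<sigma>)) \<and> Wfil n s (\<lambda>\<sigma>. f (1 # \<sigma>))"
  by simp

lemma Wfil_double1: "Wfil (Suc n) (Suc (2 * s)) f \<longleftrightarrow>
    Wfil n s (\<lambda>\<sigma>. f (0 # \<sigma>)) \<and> Wfil n s (\<lambda>\<sigma>. f (1 # \<sigma>)) \<and>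
    Wfil n (Suc s) (\<lambda>\<sigma>. f (0 # \<sigma>) + f (1 # \<sigma>))"
  by simp

lemma Wfil_double2: "Wfil (Suc n) (Suc (Suc (2 * s))) f \<longleftrightarrow>
    Wfil n (Suc s) (\<lambda>\<sigma>. f (0 # \<sigma>)) \<and> Wfil n (Suc s) (\<lambda>\<sigma>. f (1 # \<sigma>))"
  using Wfil_double[of n "Suc s" f] by simp

declare Wfil.simps(2) [simp del]

lemma even_odd_cases [case_names even odd]:
  obtains s where "r = 2 * s" | s where "r = Suc (2 * (s::nat))"
  by (cases "even r") (auto elim: evenE oddE)

lemma Wfil_Suc_imp: "Wfil n (Suc r) f \<Longrightarrow> Wfil n r f"
proof (induction n arbitrary: r f)
  case (Suc n)
  show ?case
  proof (cases r rule: even_odd_cases)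
    case (even s)
    then show ?thesis using Suc.prems by (simp add: Wfil_double Wfil_double1)
  next
    case (odd s)
    then have w: "Wfil n (Suc s) (\<lambda>\<sigma>. f (0 # \<sigma>))" "Wfil n (Suc s) (\<lambda>\<sigma>. f (1 # \<sigma>))"
      using Suc.prems by (simp_all add: Wfil_double2)
    then show ?thesis using odd Suc.IH Wfil_add[OF w] by (simp add: Wfil_double1)
  qed
qed simp

lemma Wfil_antimono: "r \<le> s \<Longrightarrow> Wfil n s f \<Longrightarrow> Wfil n r f"
  by (induction s rule: dec_induct) (auto dest: Wfil_Suc_imp)

lemma Wfil_0 [simp]: "Wfil n 0 f"
  by (induction n arbitrary: f) (simp_all add: Wfil.simps)

lemma Wfil_top: "2 ^ n \<le> r \<Longrightarrow> Wfil n r f \<longleftrightarrow> (\<forall>\<sigma>. length \<sigma> = n \<longrightarrow> f \<sigma> = 0)"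
proof (induction n arbitrary: r f)
  case 0
  then show ?case by auto
next
  case (Suc n)
  have 1: "2 ^ n \<le> r div 2" using Suc.prems by simp
  then have 2: "2 ^ n \<le> Suc (r div 2)" by simp
  have "Wfil (Suc n) r f \<longleftrightarrow> (\<forall>z \<sigma>. length \<sigma> = n \<longrightarrow> f (z # \<sigma>) = 0)"
    unfolding Wfil.simps Suc.IH[OF 1] Suc.IH[OF 2] bit_all by auto
  also have "\<dots> \<longleftrightarrow> (\<forall>\<sigma>. length \<sigma> = Suc n \<longrightarrow> f \<sigma> = 0)"
    by (auto simp: length_Suc_conv)
  finally show ?case .
qed

section \<open>The generators acting on the depth filtration\<close>

definition gens :: "(word \<Rightarrow> word) set" where
  "gens = {act_a, act_b, act_c, act_d}"

lemma act_Cons [simp]: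
  "act_b (0 # \<sigma>) = 0 # act_a \<sigma>" "act_b (1 # \<sigma>) = 1 # act_c \<sigma>"
  "act_c (0 # \<sigma>) = 0 # \<sigma>" "act_c (1 # \<sigma>) = 1 # act_d \<sigma>"
  "act_d (0 # \<sigma>) = 0 # \<sigma>" "act_d (1 # \<sigma>) = 1 # act_b \<sigma>"
  by (auto split: list.splits)

declare act_b.simps(2) [simp del] act_c.simps(2) [simp del] act_d.simps(2) [simp del]

lemma length_act [simp]:
  "length (act_a \<sigma>) = length \<sigma>" "length (act_b \<sigma>) = length \<sigma>"
  "length (act_c \<sigma>) = length \<sigma>" "length (act_d \<sigma>) = length \<sigma>"
proof -
  show a: "length (act_a \<sigma>) = length \<sigma>" for \<sigma> by (cases \<sigma>) auto
  have "length (act_b \<sigma>) = length \<sigma> \<and> length (act_c \<sigma>) = length \<sigma> \<and> length (act_d \<sigma>) = length \<sigma>"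
  proof (induction \<sigma>)
    case (Cons z \<sigma>)
    then show ?case using bit_cases01[of z] a by auto
  qed simp
  then show "length (act_b \<sigma>) = length \<sigma>" "length (act_c \<sigma>) = length \<sigma>" "length (act_d \<sigma>) = length \<sigma>"
    by auto
qed

text \<open>Both halves of the difference gain one step. For odd depth 2s + 1 this is precisely what
  depth 2s + 2 requires; for even depth it is more than required.\<close>

lemma Wfil_act_pair:
  assumes t: "\<And>\<sigma>. t (0 # \<sigma>) = 0 # t0 \<sigma>" "\<And>\<sigma>. t (1 # \<sigma>) = 1 # t1 \<sigma>"
    and t0: "\<And>r f. Wfil n r f \<Longrightarrow> Wfil n (Suc r) (\<lambda>\<sigma>. f (t0 \<sigma>) + f \<sigma>)"
    and t1: "\<And>r f. Wfil n r f \<Longrightarrow> Wfil n (Suc r) (\<lambda>\<sigma>. f (t1 \<sigma>) + f \<sigma>)"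
    and f: "Wfil (Suc n) r f"
  shows "Wfil (Suc n) (Suc r) (\<lambda>\<sigma>. f (t \<sigma>) + f \<sigma>)"
proof (cases r rule: even_odd_cases)
  case (even s)
  then have "Wfil n s (\<lambda>\<sigma>. f (0 # \<sigma>))" "Wfil n s (\<lambda>\<sigma>. f (1 # \<sigma>))"
    using f by (simp_all add: Wfil_double)
  from t0[OF this(1)] t1[OF this(2)] show ?thesis
    unfolding even using Wfil_add by (auto simp: Wfil_double1 t intro: Wfil_Suc_imp)
next
  case (odd s)
  then have "Wfil n s (\<lambda>\<sigma>. f (0 # \<sigma>))" "Wfil n s (\<lambda>\<sigma>. f (1 # \<sigma>))"
    using f by (simp_all add: Wfil_double1)
  from t0[OF this(1)] t1[OF this(2)] show ?thesis
    unfolding odd by (simp add: Wfil_double2 t)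
qed

text \<open>Both halves of the difference equal the sum of the halves of \<open>f\<close>, so their
  own sum vanishes; at odd depth that sum of halves is one step deeper by definition.\<close>

lemma Wfil_act_a: "Wfil n r f \<Longrightarrow> Wfil n (Suc r) (\<lambda>\<sigma>. f (act_a \<sigma>) + f \<sigma>)"
proof (cases n)
  case (Suc n')
  assume f: "Wfil n r f"
  show ?thesis
  proof (cases r rule: even_odd_cases)
    case (even s)
    then have w: "Wfil n' s (\<lambda>\<sigma>. f (0 # \<sigma>))" "Wfil n' s (\<lambda>\<sigma>. f (1 # \<sigma>))"
      using f Suc by (simp_all add: Wfil_double)
    show ?thesis unfolding even Suc
      using Wfil_add[OF w] by (simp add: Wfil_double1 add.commute)
  next
    case (odd s)
    then have w: "Wfil n' (Suc s) (\<lambda>\<sigma>. f (0 # \<sigma>) + f (1 # \<sigma>))"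
      using f Suc by (simp add: Wfil_double1)
    then show ?thesis unfolding odd Suc by (simp add: Wfil_double2 add.commute)
  qed
qed simp

lemma Wfil_act_id: "Wfil n r f \<Longrightarrow> Wfil n (Suc r) (\<lambda>\<sigma>. f \<sigma> + f \<sigma>)"
  by simp

lemma Wfil_act_bcd:
  "Wfil n r f \<Longrightarrow> Wfil n (Suc r) (\<lambda>\<sigma>. f (act_b \<sigma>) + f \<sigma>)"
  "Wfil n r f \<Longrightarrow> Wfil n (Suc r) (\<lambda>\<sigma>. f (act_c \<sigma>) + f \<sigma>)"
  "Wfil n r f \<Longrightarrow> Wfil n (Suc r) (\<lambda>\<sigma>. f (act_d \<sigma>) + f \<sigma>)"
proof (induction n arbitrary: r f)
  case (Suc n)
  {
    case 1
    show ?case by (rule Wfil_act_pair[OF _ _ Wfil_act_a Suc.IH(2) 1]) simp_all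
  next
    case 2
    show ?case by (rule Wfil_act_pair[OF _ _ Wfil_act_id Suc.IH(3) 2]) simp_all
  next
    case 3
    show ?case by (rule Wfil_act_pair[OF _ _ Wfil_act_id Suc.IH(1) 3]) simp_all
  }
qed simp_all

lemma Wfil_act: "t \<in> gens \<Longrightarrow> Wfil n r f \<Longrightarrow> Wfil n (Suc r) (\<lambda>\<sigma>. f (t \<sigma>) + f \<sigma>)"
  using Wfil_act_a Wfil_act_bcd by (auto simp: gens_def)

lemma Wfil_act_stable: "t \<in> gens \<Longrightarrow> Wfil n r f \<Longrightarrow> Wfil n r (\<lambda>\<sigma>. f (t \<sigma>))"
  using Wfil_add[OF Wfil_Suc_imp[OF Wfil_act], of t n r f f] by (simp add: add.assoc)

text \<open>The additive span of the generator differences of functions of depth \<open>r\<close>.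
  The rule \<open>cong\<close> reflects that values on words of length other than \<open>n\<close>
  carry no meaning.\<close>

inductive Wdiff :: "nat \<Rightarrow> nat \<Rightarrow> (word \<Rightarrow> bit) \<Rightarrow> bool" where
  base: "Wfil n r f \<Longrightarrow> t \<in> gens \<Longrightarrow> Wdiff n r (\<lambda>\<sigma>. f (t \<sigma>) + f \<sigma>)"
| add: "Wdiff n r f \<Longrightarrow> Wdiff n r g \<Longrightarrow> Wdiff n r (\<lambda>\<sigma>. f \<sigma> + g \<sigma>)"
| cong: "Wdiff n r f \<Longrightarrow> (\<And>\<sigma>. length \<sigma> = n \<Longrightarrow> f \<sigma> = g \<sigma>) \<Longrightarrow> Wdiff n r g"

lemma Wdiff_zero: "Wdiff n r (\<lambda>\<sigma>. 0)"
  using Wdiff.base[of n r "\<lambda>\<sigma>. 0" act_a] by (simp add: gens_def)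

definition join :: "(word \<Rightarrow> bit) \<Rightarrow> (word \<Rightarrow> bit) \<Rightarrow> word \<Rightarrow> bit" where
  "join f g w = (case w of [] \<Rightarrow> 0 | z # \<sigma> \<Rightarrow> if z = 0 then f \<sigma> else g \<sigma>)"

lemma join_Cons [simp]: "join f g (0 # \<sigma>) = f \<sigma>" "join f g (1 # \<sigma>) = g \<sigma>"
  by (simp_all add: join_def)

lemma Wdiff_congI:
  assumes "Wdiff (Suc n) r f"
    "\<And>\<sigma>. length \<sigma> = n \<Longrightarrow> f (0 # \<sigma>) = g (0 # \<sigma>)" "\<And>\<sigma>. length \<sigma> = n \<Longrightarrow> f (1 # \<sigma>) = g (1 # \<sigma>)"
  shows "Wdiff (Suc n) r g"
proof (rule Wdiff.cong[OF assms(1)])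
  fix \<sigma> :: word assume "length \<sigma> = Suc n"
  then obtain z \<tau> where "\<sigma> = z # \<tau>" "length \<tau> = n" by (auto simp: length_Suc_conv)
  then show "f \<sigma> = g \<sigma>" using assms(2,3) bit_cases01[of z] by auto
qed

lemma gens_mem: "act_a \<in> gens" "act_b \<in> gens" "act_c \<in> gens" "act_d \<in> gens"
  by (auto simp: gens_def)

lemma Wdiff_diag:
  assumes "Wfil (Suc n) r (join k (\<lambda>\<sigma>. 0))"
  shows "Wdiff (Suc n) r (join k k)"
  by (rule Wdiff_congI[OF Wdiff.base[OF assms gens_mem(1)]]) simp_all

text \<open>(0, k) = (k, 0) + (k, k), and the diagonal function is the a-difference of (k,
  0).\<close>

lemma Wdiff_swap:
  assumes "Wfil (Suc n) r (join k (\<lambda>\<sigma>. 0))"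
    and "Wdiff (Suc n) r (join k (\<lambda>\<sigma>. 0))"
  shows "Wdiff (Suc n) r (join (\<lambda>\<sigma>. 0) k)"
  by (rule Wdiff_congI[OF Wdiff.add[OF assms(2) Wdiff_diag[OF assms(1)]]]) simp_all

text \<open>Each generator must be found among the sections of the generators on the second half: d,
  b and c act there as b, c and d, while a is only available as the first section of b and is moved
  over by a swap.\<close>

lemma Wdiff_lift_even: "Wdiff n s g \<Longrightarrow> Wdiff (Suc n) (2 * s) (join (\<lambda>\<sigma>. 0) g)"
proof (induction n s g rule: Wdiff.induct)
  case (base n s h t)
  let ?J = "join (\<lambda>\<sigma>. 0) h"
  have J: "Wfil (Suc n) (2 * s) ?J" and J': "Wfil (Suc n) (2 * s) (join h (\<lambda>\<sigma>. 0))"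
    using base by (simp_all add: Wfil_double)
  from base(2) consider "t = act_a" | "t = act_b" | "t = act_c" | "t = act_d" by (auto simp: gens_def)
  then show ?case
  proof cases
    case 1
    show ?thesis unfolding 1
    proof (rule Wdiff_swap)
      show "Wfil (Suc n) (2 * s) (join (\<lambda>\<sigma>. h (act_a \<sigma>) + h \<sigma>) (\<lambda>\<sigma>. 0))"
        using Wfil_Suc_imp[OF Wfil_act_a[OF base(1)]] by (simp add: Wfil_double)
      show "Wdiff (Suc n) (2 * s) (join (\<lambda>\<sigma>. h (act_a \<sigma>) + h \<sigma>) (\<lambda>\<sigma>. 0))"
        by (rule Wdiff_congI[OF Wdiff.base[OF J' gens_mem(2)]]) simp_all
    qed
  next
    case 2
    show ?thesis unfolding 2 by (rule Wdiff_congI[OF Wdiff.base[OF J gens_mem(4)]]) simp_all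
  next
    case 3
    show ?thesis unfolding 3 by (rule Wdiff_congI[OF Wdiff.base[OF J gens_mem(2)]]) simp_all
  next
    case 4
    show ?thesis unfolding 4 by (rule Wdiff_congI[OF Wdiff.base[OF J gens_mem(3)]]) simp_all
  qed
next
  case (add n s f g)
  show ?case by (rule Wdiff_congI[OF Wdiff.add[OF add.IH]]) simp_all
next
  case (cong n s f g)
  show ?case by (rule Wdiff_congI[OF cong.IH]) (simp_all add: cong.hyps)
qed

text \<open>The \<open>a\<close>-differences of \<open>h = (p, q)\<close> are those of \<open>(p + q, 0)\<close>, on which \<open>c\<close> acts trivially.\<close>

lemma Wdiff_lift_odd_a:
  assumes h: "Wfil n s h"
  shows "Wdiff (Suc n) (Suc (2 * s)) (join (\<lambda>\<sigma>. h (act_a \<sigma>) + h \<sigma>) (\<lambda>\<sigma>. 0))"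
proof (cases n)
  case 0
  then show ?thesis by (intro Wdiff_congI[OF Wdiff_zero]) simp_all
next
  case (Suc m)
  define k where "k = join (\<lambda>\<sigma>. h (0 # \<sigma>) + h (1 # \<sigma>)) (\<lambda>\<sigma>. 0)"
  have k: "Wfil n s k"
  proof (cases s rule: even_odd_cases)
    case (even u)
    then show ?thesis using h Suc Wfil_add by (simp add: k_def Wfil_double)
  next
    case (odd u)
    then have w: "Wfil m (Suc u) (\<lambda>\<sigma>. h (0 # \<sigma>) + h (1 # \<sigma>))"
      using h Suc by (simp add: Wfil_double1)
    then show ?thesis using Wfil_Suc_imp[OF w] odd Suc by (simp add: k_def Wfil_double1)
  qed
  have kk: "Wfil (Suc n) (Suc (2 * s)) (join k k)" using k by (simp add: Wfil_double1)
  show ?thesis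
  proof (rule Wdiff_congI[OF Wdiff.base[OF kk gens_mem(2)]])
    fix \<sigma> :: word assume "length \<sigma> = n"
    then obtain z \<tau> where "\<sigma> = z # \<tau>" using Suc by (auto simp: length_Suc_conv)
    then show "join k k (act_b (0 # \<sigma>)) + join k k (0 # \<sigma>)
        = join (\<lambda>\<sigma>. h (act_a \<sigma>) + h \<sigma>) (\<lambda>\<sigma>. 0) (0 # \<sigma>)"
      "join k k (act_b (1 # \<sigma>)) + join k k (1 # \<sigma>)
        = join (\<lambda>\<sigma>. h (act_a \<sigma>) + h \<sigma>) (\<lambda>\<sigma>. 0) (1 # \<sigma>)"
      using bit_cases01[of z] by (auto simp: k_def add.commute)
  qed
qed

lemma Wdiff_lift_odd: "Wdiff n s g \<Longrightarrow> Wdiff (Suc n) (Suc (2 * s)) (join (\<lambda>\<sigma>. 0) g)"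
proof (induction n s g rule: Wdiff.induct)
  case (base n s h t)
  have J: "Wfil (Suc n) (Suc (2 * s)) (join h h)" using base by (simp add: Wfil_double1)
  note a = Wdiff_lift_odd_a[OF base(1)]
  from base(2) consider "t = act_a" | "t = act_b" | "t = act_c" | "t = act_d" by (auto simp: gens_def)
  then show ?case
  proof cases
    case 1
    show ?thesis unfolding 1
    proof (rule Wdiff_swap[OF _ a])
      show "Wfil (Suc n) (Suc (2 * s)) (join (\<lambda>\<sigma>. h (act_a \<sigma>) + h \<sigma>) (\<lambda>\<sigma>. 0))"
        using Wfil_act_a[OF base(1)] Wfil_Suc_imp[OF Wfil_act_a[OF base(1)]]
        by (simp add: Wfil_double1)
    qed
  next
    case 2
    show ?thesis unfolding 2 by (rule Wdiff_congI[OF Wdiff.base[OF J gens_mem(4)]]) simp_all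
  next
    case 3
    show ?thesis unfolding 3
      by (rule Wdiff_congI[OF Wdiff.add[OF a Wdiff.base[OF J gens_mem(2)]]]) simp_all
  next
    case 4
    show ?thesis unfolding 4 by (rule Wdiff_congI[OF Wdiff.base[OF J gens_mem(3)]]) simp_all
  qed
next
  case (add n s f g)
  show ?case by (rule Wdiff_congI[OF Wdiff.add[OF add.IH]]) simp_all
next
  case (cong n s f g)
  show ?case by (rule Wdiff_congI[OF cong.IH]) (simp_all add: cong.hyps)
qed

text \<open>Write f as (f0, f0) + (0, f0 + f1). The diagonal part is a single a-difference, and the
  second part is lifted from shorter words.\<close>

lemma Wfil_imp_Wdiff: "Wfil n (Suc r) f \<Longrightarrow> Wdiff n r f"
proof (induction n arbitrary: r f)
  case 0
  then show ?case by (intro Wdiff.cong[OF Wdiff_zero]) simp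
next
  case (Suc n)
  let ?f0 = "\<lambda>\<sigma>. f (0 # \<sigma>)" and ?f1 = "\<lambda>\<sigma>. f (1 # \<sigma>)"
  show ?case
  proof (cases r rule: even_odd_cases)
    case (even s)
    then have f: "Wfil n s ?f0" "Wfil n (Suc s) (\<lambda>\<sigma>. f (0 # \<sigma>) + f (1 # \<sigma>))"
      using Suc.prems by (simp_all add: Wfil_double1)
    have 1: "Wdiff (Suc n) (2 * s) (join ?f0 ?f0)"
      by (rule Wdiff_diag) (simp add: Wfil_double f)
    have 2: "Wdiff (Suc n) (2 * s) (join (\<lambda>\<sigma>. 0) (\<lambda>\<sigma>. f (0 # \<sigma>) + f (1 # \<sigma>)))"
      by (rule Wdiff_lift_even[OF Suc.IH[OF f(2)]])
    show ?thesis unfolding even by (rule Wdiff_congI[OF Wdiff.add[OF 1 2]]) simp_all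
  next
    case (odd s)
    then have f: "Wfil n (Suc s) ?f0" "Wfil n (Suc s) ?f1"
      using Suc.prems by (simp_all add: Wfil_double2)
    have 0: "Wdiff (Suc n) (Suc (2 * s)) (join ?f0 ?f0)"
      by (rule Wdiff_diag) (simp add: Wfil_double1 f Wfil_Suc_imp)
    have 1: "Wdiff (Suc n) (Suc (2 * s)) (join (\<lambda>\<sigma>. 0) (\<lambda>\<sigma>. f (0 # \<sigma>) + f (1 # \<sigma>)))"
      by (rule Wdiff_lift_odd[OF Suc.IH[OF Wfil_add[OF f]]])
    show ?thesis unfolding odd by (rule Wdiff_congI[OF Wdiff.add[OF 0 1]]) simp_all
  qed
qed

section \<open>The vectors v_n^r as functions on words\<close>

fun vfun :: "nat \<Rightarrow> nat \<Rightarrow> word \<Rightarrow> bit" where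
  "vfun 0 r \<sigma> = 1"
| "vfun (Suc n) r \<sigma> = (if even r \<and> hd \<sigma> = 1 then 0 else vfun n (r div 2) (tl \<sigma>))"

lemma Wfil_vfun: "Wfil n r (vfun n r)" if "r < 2 ^ n"
  using that
proof (induction n arbitrary: r)
  case (Suc n)
  show ?case
  proof (cases r rule: even_odd_cases)
    case (even s)
    then show ?thesis using Suc by (simp add: Wfil_double)
  next
    case (odd s)
    then show ?thesis using Suc by (simp add: Wfil_double1)
  qed
qed simp

lemma not_Wfil_vfun: "r < 2 ^ n \<Longrightarrow> \<not> Wfil n (Suc r) (vfun n r)"
proof (induction n arbitrary: r)
  case (Suc n)
  show ?case
  proof (cases r rule: even_odd_cases)
    case (even s)
    then show ?thesis using Suc by (simp add: Wfil_double1)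
  next
    case (odd s)
    then show ?thesis using Suc by (simp add: Wfil_double2)
  qed
qed simp

text \<open>Consecutive depths differ by one dimension: modulo depth r + 1 a function of depth r is
  0 or \<open>vfun n r\<close>.\<close>

lemma Wfil_step:
  "r < 2 ^ n \<Longrightarrow> Wfil n r f \<Longrightarrow> Wfil n (Suc r) f \<or> Wfil n (Suc r) (\<lambda>\<sigma>. f \<sigma> + vfun n r \<sigma>)"
proof (induction n arbitrary: r f)
  case 0
  then show ?case using bit_cases01[of "f []"] by auto
next
  case (Suc n)
  show ?case
  proof (cases r rule: even_odd_cases)
    case (even s)
    then have f: "Wfil n s (\<lambda>\<sigma>. f (0 # \<sigma>))" "Wfil n s (\<lambda>\<sigma>. f (1 # \<sigma>))" and s: "s < 2 ^ n"
      using Suc.prems by (simp_all add: Wfil_double)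
    note v = Wfil_vfun[OF s]
    show ?thesis
      using Suc.IH[OF s Wfil_add[OF f]] f Wfil_add[OF f(1) v] unfolding even
      by (auto simp: Wfil_double1 add_ac)
  next
    case (odd s)
    then have f: "Wfil n s (\<lambda>\<sigma>. f (0 # \<sigma>))" "Wfil n s (\<lambda>\<sigma>. f (1 # \<sigma>))"
        "Wfil n (Suc s) (\<lambda>\<sigma>. f (0 # \<sigma>) + f (1 # \<sigma>))" and s: "s < 2 ^ n"
      using Suc.prems by (simp_all add: Wfil_double1)
    from Suc.IH[OF s f(1)] show ?thesis
    proof
      assume w: "Wfil n (Suc s) (\<lambda>\<sigma>. f (0 # \<sigma>))"
      show ?thesis unfolding odd using w Wfil_add[OF w f(3)] by (simp add: Wfil_double2)
    next
      assume w: "Wfil n (Suc s) (\<lambda>\<sigma>. f (0 # \<sigma>) + vfun n s \<sigma>)"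
      have "(\<lambda>\<sigma>. f (0 # \<sigma>) + vfun n s \<sigma> + (f (0 # \<sigma>) + f (1 # \<sigma>))) = (\<lambda>\<sigma>. f (1 # \<sigma>) + vfun n s \<sigma>)"
        by (rule ext) (simp add: add_ac)
      then show ?thesis unfolding odd using w Wfil_add[OF w f(3)] by (simp add: Wfil_double2)
    qed
  qed
qed

lemma Wfil_span:
  "Wfil n r f \<longleftrightarrow> (\<exists>c. \<forall>\<sigma>. length \<sigma> = n \<longrightarrow> f \<sigma> = (\<Sum>j = r..<2 ^ n. c j * vfun n j \<sigma>))"
proof
  show "Wfil n r f \<Longrightarrow> \<exists>c. \<forall>\<sigma>. length \<sigma> = n \<longrightarrow> f \<sigma> = (\<Sum>j = r..<2 ^ n. c j * vfun n j \<sigma>)"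
  proof (induction "2 ^ n - r" arbitrary: r f)
    case 0
    then have "2 ^ n \<le> r" by simp
    then show ?case using Wfil_top[of n r f] 0 by (intro exI[of _ "\<lambda>j. 0"]) simp
  next
    case (Suc d)
    then have r: "r < 2 ^ n" "d = 2 ^ n - Suc r" by auto
    have "\<exists>b. Wfil n (Suc r) (\<lambda>\<sigma>. f \<sigma> + b * vfun n r \<sigma>)"
    proof (cases "Wfil n (Suc r) f")
      case True
      then show ?thesis by (intro exI[of _ 0]) simp
    next
      case False
      then show ?thesis using Wfil_step[OF r(1) Suc.prems] by (intro exI[of _ 1]) simp
    qed
    then obtain b where "Wfil n (Suc r) (\<lambda>\<sigma>. f \<sigma> + b * vfun n r \<sigma>)" by blast
    from Suc.hyps(1)[OF r(2) this] obtain c where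
      c: "length \<sigma> = n \<Longrightarrow> f \<sigma> + b * vfun n r \<sigma> = (\<Sum>j = Suc r..<2 ^ n. c j * vfun n j \<sigma>)" for \<sigma>
      by blast
    have "f \<sigma> = (\<Sum>j = r..<2 ^ n. (c(r := b)) j * vfun n j \<sigma>)" if "length \<sigma> = n" for \<sigma>
    proof -
      have "(\<Sum>j = r..<2 ^ n. (c(r := b)) j * vfun n j \<sigma>)
          = b * vfun n r \<sigma> + (\<Sum>j = Suc r..<2 ^ n. (c(r := b)) j * vfun n j \<sigma>)"
        using r(1) by (simp add: sum.atLeast_Suc_lessThan)
      also have "(\<Sum>j = Suc r..<2 ^ n. (c(r := b)) j * vfun n j \<sigma>) = f \<sigma> + b * vfun n r \<sigma>"
        unfolding c[OF that] by (rule sum.cong) auto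
      finally show ?thesis by simp
    qed
    then show ?case by blast
  qed
next
  have W: "Wfil n r (\<lambda>\<sigma>. \<Sum>j\<in>J. c j * vfun n j \<sigma>)" if "finite J" "J \<subseteq> {r..<2 ^ n}" for c J
    using that
  proof (induction J)
    case (insert j J)
    have "Wfil n r (vfun n j)" using insert.prems by (intro Wfil_antimono[OF _ Wfil_vfun]) auto
    then have "Wfil n r (\<lambda>\<sigma>. c j * vfun n j \<sigma>)" using bit_cases01[of "c j"] by auto
    from Wfil_add[OF this insert.IH] show ?case using insert by simp
  qed simp
  assume "\<exists>c. \<forall>\<sigma>. length \<sigma> = n \<longrightarrow> f \<sigma> = (\<Sum>j = r..<2 ^ n. c j * vfun n j \<sigma>)"
  then obtain c where c: "length \<sigma> = n \<Longrightarrow> f \<sigma> = (\<Sum>j = r..<2 ^ n. c j * vfun n j \<sigma>)" for \<sigma> by blast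
  have "Wfil n r f = Wfil n r (\<lambda>\<sigma>. \<Sum>j = r..<2 ^ n. c j * vfun n j \<sigma>)"
    by (rule Wfil_cong) (rule c)
  then show "Wfil n r f" using W[of "{r..<2 ^ n}" c] by simp
qed

section \<open>Tree automorphisms\<close>

declare comp_apply [simp del] id_apply [simp del]

interpretation Gt: group Gt by (rule group_Gt)

abbreviation GG :: "(word \<Rightarrow> word) set" where "GG \<equiv> carrier Gt"

lemma act_comp_self [simp]:
  "act_a \<circ> act_a = id" "act_b \<circ> act_b = id" "act_c \<circ> act_c = id" "act_d \<circ> act_d = id"
  by (simp_all add: fun_eq_iff act_involutions comp_apply id_apply)

lemma gens_self: "t \<in> gens \<Longrightarrow> t \<circ> t = id"
  by (auto simp: gens_def)

lemma gens_GG: "t \<in> gens \<Longrightarrow> t \<in> GG"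
  by (auto simp: gens_def Gt_def intro: generate.incl)

lemma act_GG [simp]: "act_a \<in> GG" "act_b \<in> GG" "act_c \<in> GG" "act_d \<in> GG"
  by (simp_all add: gens_GG gens_mem)

lemma Gt_mult_bij: "bij g \<Longrightarrow> bij h \<Longrightarrow> g \<otimes>\<^bsub>Gt\<^esub> h = g \<circ> h"
  by (simp add: Gt_def BijGroup_def Bij_def compose_def fun_eq_iff comp_apply id_apply)

lemma GG_bij: "g \<in> GG \<Longrightarrow> bij g"
proof -
  assume "g \<in> GG"
  then have "g \<in> carrier (BijGroup UNIV)"
    using group.generate_in_carrier[OF group_BijGroup act_in_BijGroup] by (simp add: Gt_def)
  then show ?thesis by (simp add: BijGroup_def Bij_def)
qed

lemma Gt_mult: "g \<in> GG \<Longrightarrow> h \<in> GG \<Longrightarrow> g \<otimes>\<^bsub>Gt\<^esub> h = g \<circ> h"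
  by (simp add: Gt_mult_bij GG_bij)

lemma Gt_one: "\<one>\<^bsub>Gt\<^esub> = id"
  by (simp add: Gt_def BijGroup_def fun_eq_iff comp_apply id_apply)

lemma GG_comp [simp, intro]: "g \<in> GG \<Longrightarrow> h \<in> GG \<Longrightarrow> g \<circ> h \<in> GG"
  using Gt.m_closed[of g h] by (simp add: Gt_mult)

lemma GG_id [simp, intro]: "id \<in> GG"
  using Gt.one_closed by (simp add: Gt_one)

lemma Gt_inv_eq: "g \<in> GG \<Longrightarrow> h \<in> GG \<Longrightarrow> h \<circ> g = id \<Longrightarrow> inv\<^bsub>Gt\<^esub> g = h"
  by (rule Gt.inv_equality) (simp_all add: Gt_mult Gt_one)

lemma Gt_inv_comp: "g \<in> GG \<Longrightarrow> inv\<^bsub>Gt\<^esub> g \<circ> g = id" "g \<in> GG \<Longrightarrow> g \<circ> inv\<^bsub>Gt\<^esub> g = id"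
  using Gt.l_inv[of g] Gt.r_inv[of g] by (simp_all add: Gt_mult Gt_one)

lemma gens_inv: "t \<in> gens \<Longrightarrow> inv\<^bsub>Gt\<^esub> t = t"
  by (rule Gt_inv_eq) (auto simp: gens_GG gens_self)

lemma act_inv [simp]:
  "inv\<^bsub>Gt\<^esub> act_a = act_a" "inv\<^bsub>Gt\<^esub> act_b = act_b" "inv\<^bsub>Gt\<^esub> act_c = act_c" "inv\<^bsub>Gt\<^esub> act_d = act_d"
  by (simp_all add: gens_inv gens_mem)

text \<open>The generators are involutions, so the inverse of a generator is again a generator. The
  claim is strengthened to products with an arbitrary right factor in order to pass through the
  product rule of \<open>generate\<close>.\<close>

lemma GG_left_induct [consumes 1, case_names id comp]:
  assumes "g \<in> GG" "P id"
    and step: "\<And>t g. t \<in> gens \<Longrightarrow> g \<in> GG \<Longrightarrow> P g \<Longrightarrow> P (t \<circ> g)"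
  shows "P g"
proof -
  have GG: "GG = generate (BijGroup UNIV) gens" by (simp add: Gt_def gens_def)
  interpret B: group "BijGroup (UNIV :: word set)" by (rule group_BijGroup)
  have sub: "gens \<subseteq> carrier (BijGroup UNIV)" using act_in_BijGroup by (simp add: gens_def)
  have "\<forall>h. h \<in> GG \<longrightarrow> P h \<longrightarrow> g \<circ> h \<in> GG \<and> P (g \<circ> h)" if "g \<in> generate (BijGroup UNIV) gens" for g
    using that
  proof induction
    case one
    have "\<one>\<^bsub>BijGroup UNIV\<^esub> = (id :: word \<Rightarrow> word)" by (simp add: BijGroup_def fun_eq_iff comp_apply id_apply)
    then show ?case by simp
  next
    case (incl t)
    then show ?case using step gens_GG by blast
  next
    case (inv t)
    have "inv\<^bsub>BijGroup UNIV\<^esub> t = t"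
    proof (rule B.inv_equality)
      have "bij t" using GG_bij gens_GG inv by blast
      then show "t \<otimes>\<^bsub>BijGroup UNIV\<^esub> t = \<one>\<^bsub>BijGroup UNIV\<^esub>"
        using gens_self[OF inv] by (simp add: BijGroup_def Bij_def compose_def fun_eq_iff comp_apply id_apply)
    qed (use inv sub in auto)
    then show ?case using step gens_GG inv by simp
  next
    case (eng g g')
    have "bij g" "bij g'" using GG_bij eng(1,2) GG by auto
    then have "g \<otimes>\<^bsub>BijGroup UNIV\<^esub> g' = g \<circ> g'"
      by (simp add: BijGroup_def Bij_def compose_def fun_eq_iff comp_apply id_apply)
    then show ?case using eng.IH by (simp add: comp_assoc)
  qed
  then have "P (g \<circ> id)" using assms(1,2) GG GG_id by blast
  then show ?thesis by simp
qed

lemma GG_right_induct [consumes 1, case_names id comp]: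
  assumes "g \<in> GG" "P id"
    and step: "\<And>g t. g \<in> GG \<Longrightarrow> t \<in> gens \<Longrightarrow> P g \<Longrightarrow> P (g \<circ> t)"
  shows "P g"
proof -
  have "\<forall>h. h \<in> GG \<longrightarrow> P h \<longrightarrow> P (h \<circ> g)"
    using assms(1)
  proof (induction g rule: GG_left_induct)
    case (comp t g)
    show ?case
    proof (intro allI impI)
      fix h assume h: "h \<in> GG" "P h"
      have "P (h \<circ> t)" by (rule step[OF h(1) comp(1) h(2)])
      moreover have "h \<circ> t \<in> GG" by (rule GG_comp[OF h(1) gens_GG[OF comp(1)]])
      ultimately have "P (h \<circ> t \<circ> g)" using comp(3) by blast
      then show "P (h \<circ> (t \<circ> g))" by (simp add: comp_assoc)
    qed
  qed simp
  then have "P (id \<circ> g)" using assms(2) GG_id by blast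
  then show ?thesis by simp
qed

lemma normal_gensI:
  assumes N: "subgroup N Gt" and conj: "\<And>t n. t \<in> gens \<Longrightarrow> n \<in> N \<Longrightarrow> t \<circ> n \<circ> t \<in> N"
  shows "N \<lhd> Gt"
  unfolding Gt.normal_inv_iff
proof (intro conjI N ballI)
  fix g n assume g: "g \<in> GG" and n: "n \<in> N"
  have nG: "N \<subseteq> GG" by (rule subgroup.subset[OF N])
  show "g \<otimes>\<^bsub>Gt\<^esub> n \<otimes>\<^bsub>Gt\<^esub> inv\<^bsub>Gt\<^esub> g \<in> N"
    using g
  proof (induction g rule: GG_left_induct)
    case id
    show ?case using Gt.inv_one n subsetD[OF nG n] by (simp add: Gt_one Gt_mult)
  next
    case (comp t g)
    have t: "t \<in> GG" using comp gens_GG by blast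
    have "inv\<^bsub>Gt\<^esub> (t \<circ> g) = inv\<^bsub>Gt\<^esub> g \<circ> t"
      using Gt.inv_mult_group[OF t comp(2)] t comp(1,2) by (simp add: Gt_mult gens_inv)
    then have "(t \<circ> g) \<otimes>\<^bsub>Gt\<^esub> n \<otimes>\<^bsub>Gt\<^esub> inv\<^bsub>Gt\<^esub> (t \<circ> g)
        = t \<circ> (g \<otimes>\<^bsub>Gt\<^esub> n \<otimes>\<^bsub>Gt\<^esub> inv\<^bsub>Gt\<^esub> g) \<circ> t"
      using t comp(2) subsetD[OF nG n] by (simp add: Gt_mult comp_assoc)
    then show ?case using conj[OF comp(1,3)] by simp
  qed
qed

lemma subgroup_GtI:
  assumes "N \<subseteq> GG" "id \<in> N" "\<And>g h. g \<in> N \<Longrightarrow> h \<in> N \<Longrightarrow> g \<circ> h \<in> N"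
    "\<And>g. g \<in> N \<Longrightarrow> inv\<^bsub>Gt\<^esub> g \<in> N"
  shows "subgroup N Gt"
proof (rule Gt.subgroupI)
  show "g \<otimes>\<^bsub>Gt\<^esub> h \<in> N" if "g \<in> N" "h \<in> N" for g h
    using assms(3)[OF that] subsetD[OF assms(1) that(1)] subsetD[OF assms(1) that(2)] by (simp add: Gt_mult)
qed (use assms in blast)+

lemma normal_comp: "N \<lhd> Gt \<Longrightarrow> g \<in> N \<Longrightarrow> h \<in> N \<Longrightarrow> g \<circ> h \<in> N"
  using subgroup.m_closed[OF normal_imp_subgroup, of N Gt g h]
    subgroup.subset[OF normal_imp_subgroup, of N Gt] by (simp add: Gt_mult subset_iff)

lemma normal_inv: "N \<lhd> Gt \<Longrightarrow> g \<in> N \<Longrightarrow> inv\<^bsub>Gt\<^esub> g \<in> N"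
  by (rule subgroup.m_inv_closed[OF normal_imp_subgroup])

lemma normal_id: "N \<lhd> Gt \<Longrightarrow> id \<in> N"
  using subgroup.one_closed[OF normal_imp_subgroup, of N Gt] by (simp add: Gt_one)

lemma normal_GG: "N \<lhd> Gt \<Longrightarrow> g \<in> N \<Longrightarrow> g \<in> GG"
  using subgroup.subset[OF normal_imp_subgroup, of N Gt] by auto

lemma normal_conj: "N \<lhd> Gt \<Longrightarrow> g \<in> GG \<Longrightarrow> n \<in> N \<Longrightarrow> g \<circ> n \<circ> inv\<^bsub>Gt\<^esub> g \<in> N"
  using normal.inv_op_closed2[of N Gt g n] normal_GG[of N n] by (simp add: Gt_mult)

lemma normal_conj_gen: "N \<lhd> Gt \<Longrightarrow> t \<in> gens \<Longrightarrow> n \<in> N \<Longrightarrow> t \<circ> n \<circ> t \<in> N"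
  using normal_conj[of N t n] by (simp add: gens_GG gens_inv)

lemma commutator_Gt:
  "g \<in> GG \<Longrightarrow> h \<in> GG \<Longrightarrow> commutator Gt g h = g \<circ> h \<circ> inv\<^bsub>Gt\<^esub> g \<circ> inv\<^bsub>Gt\<^esub> h"
  by (simp add: commutator_def Gt_mult)

section \<open>Pairs, sections, and switch parities on levels\<close>

definition pr :: "(word \<Rightarrow> word) \<Rightarrow> (word \<Rightarrow> word) \<Rightarrow> word \<Rightarrow> word" where
  "pr g h w = (case w of [] \<Rightarrow> [] | z # \<sigma> \<Rightarrow> if z = 0 then 0 # g \<sigma> else 1 # h \<sigma>)"

lemma pr_simps [simp]: "pr g h [] = []" "pr g h (0 # \<sigma>) = 0 # g \<sigma>" "pr g h (1 # \<sigma>) = 1 # h \<sigma>"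
  by (simp_all add: pr_def)

lemma word_ext:
  assumes "f [] = g []" "\<And>\<sigma>. f (0 # \<sigma>) = g (0 # \<sigma>)" "\<And>\<sigma>. f (1 # \<sigma>) = g (1 # \<sigma>)"
  shows "f = (g :: word \<Rightarrow> 'b)"
proof
  fix w show "f w = g w"
  proof (cases w)
    case (Cons z \<sigma>)
    then show ?thesis using assms bit_cases01[of z] by auto
  qed (simp add: assms)
qed

lemma act_pr: "act_b = pr act_a act_c" "act_c = pr id act_d" "act_d = pr id act_b"
  by (rule word_ext; simp add: comp_apply id_apply)+

lemma pr_comp [simp]: "pr g h \<circ> pr g' h' = pr (g \<circ> g') (h \<circ> h')"
  by (rule word_ext) (simp_all add: comp_apply id_apply)

lemma pr_comp_left [simp]: "pr g h \<circ> (pr g' h' \<circ> k) = pr (g \<circ> g') (h \<circ> h') \<circ> k"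
  by (simp add: comp_assoc[symmetric])

lemma pr_id [simp]: "pr id id = id"
  by (rule word_ext) (simp_all add: comp_apply id_apply)

lemma pr_eq_iff [simp]: "pr g h = pr g' h' \<longleftrightarrow> g = g' \<and> h = h'"
proof
  assume e: "pr g h = pr g' h'"
  have "g \<sigma> = g' \<sigma>" "h \<sigma> = h' \<sigma>" for \<sigma>
    using fun_cong[OF e, of "0 # \<sigma>"] fun_cong[OF e, of "1 # \<sigma>"] by simp_all
  then show "g = g' \<and> h = h'" by auto
qed simp

lemma a_pr_a [simp]: "act_a \<circ> pr g h \<circ> act_a = pr h g"
  by (rule word_ext) (simp_all add: comp_apply id_apply)

definition sec :: "bit \<Rightarrow> (word \<Rightarrow> word) \<Rightarrow> word \<Rightarrow> word" where
  "sec z g \<sigma> = tl (g (z # \<sigma>))"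

lemma sec_pr [simp]: "sec 0 (pr g h) = g" "sec 1 (pr g h) = h"
  by (simp_all add: sec_def fun_eq_iff comp_apply id_apply)

text \<open>The parity of the number of switches on level \<open>k\<close>. It is additive on the
  group because the right-hand factor only permutes the vertices at which the left-hand factor is
  evaluated.\<close>

fun sg :: "nat \<Rightarrow> (word \<Rightarrow> word) \<Rightarrow> bit" where
  "sg 0 g = hd (g [0])"
| "sg (Suc k) g = sg k (sec 0 g) + sg k (sec 1 g)"

lemma sg_pr_0 [simp]: "sg 0 (pr g h) = 0"
  by simp

declare sg.simps(1) [simp del]

lemma sec_id [simp]: "sec z id = id"
  by (simp add: sec_def fun_eq_iff comp_apply id_apply)

lemma sec_a [simp]: "sec z act_a = id"
  by (simp add: sec_def fun_eq_iff comp_apply id_apply)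

lemma sg_id [simp]: "sg k id = 0"
proof (induction k)
  case 0
  show ?case by (simp add: sg.simps(1) id_apply[of "[0]"])
qed simp

lemma sec_act [simp]:
  "sec 0 act_b = act_a" "sec 1 act_b = act_c" "sec 0 act_c = id" "sec 1 act_c = act_d"
  "sec 0 act_d = id" "sec 1 act_d = act_b"
  by (subst act_pr, simp)+

lemma sg_a [simp]: "sg k act_a = (if k = 0 then 1 else 0)"
  by (cases k) (simp_all add: sg.simps(1))

lemma sg_0_act [simp]: "sg 0 act_b = 0" "sg 0 act_c = 0" "sg 0 act_d = 0"
  by (simp_all add: sg.simps(1))

text \<open>Self-similarity of the group. The three claims are proved together because the section
  of a product is computed from the root actions of both factors.\<close>

lemma GG_act: "g \<in> GG \<Longrightarrow> g [] = [] \<and> (\<forall>z \<sigma>. g (z # \<sigma>) = (z + sg 0 g) # sec z g \<sigma>) \<and> (\<forall>z. sec z g \<in> GG)"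
proof (induction g rule: GG_right_induct)
  case id
  show ?case
  proof (intro conjI allI)
    show "id (z # \<sigma>) = (z + sg 0 id) # sec z id \<sigma>" for z \<sigma> by (simp add: id_apply)
    show "sec z id \<in> GG" for z by simp
  qed (simp add: id_apply)
next
  case (comp g t)
  have t: "t [] = []" "t (z # \<sigma>) = (z + sg 0 t) # sec z t \<sigma>" "sec z t \<in> GG" for z \<sigma>
  proof -
    show "t [] = []" using \<open>t \<in> gens\<close> by (auto simp: gens_def)
    from \<open>t \<in> gens\<close> consider "t = act_a" | "t = act_b" | "t = act_c" | "t = act_d"
      by (auto simp: gens_def)
    then show "t (z # \<sigma>) = (z + sg 0 t) # sec z t \<sigma>" "sec z t \<in> GG"
      using bit_cases01[of z] by (cases; auto simp: id_apply[of \<sigma>])+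
  qed
  note g = comp.IH
  have sec: "sec z (g \<circ> t) = sec (z + sg 0 t) g \<circ> sec z t" for z
    using g t by (simp add: sec_def[of _ "g \<circ> t"] fun_eq_iff comp_apply id_apply)
  have s0: "sg 0 (g \<circ> t) = sg 0 t + sg 0 g" using g t by (simp add: sg.simps(1)[of "g \<circ> t"] comp_apply[of g t "[0]"])
  show ?case
  proof (intro conjI allI)
    show "(g \<circ> t) [] = []" using g t(1) by (simp add: comp_apply)
    show "(g \<circ> t) (z # \<sigma>) = (z + sg 0 (g \<circ> t)) # sec z (g \<circ> t) \<sigma>" for z \<sigma>
      using g t(2) by (simp add: s0 sec comp_apply[of g t "z # \<sigma>"] comp_apply[of "sec (z + sg 0 t) g" "sec z t" \<sigma>] add_ac)
    show "sec z (g \<circ> t) \<in> GG" for z using g t(3) by (simp add: sec)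
  qed
qed

lemma GG_Nil [simp]: "g \<in> GG \<Longrightarrow> g [] = []" using GG_act by blast

lemma GG_Cons: "g \<in> GG \<Longrightarrow> g (z # \<sigma>) = (z + sg 0 g) # sec z g \<sigma>" using GG_act by blast

lemma sec_GG [simp, intro]: "g \<in> GG \<Longrightarrow> sec z g \<in> GG" using GG_act by blast

lemma sec_comp: "g \<in> GG \<Longrightarrow> h \<in> GG \<Longrightarrow> sec z (g \<circ> h) = sec (z + sg 0 h) g \<circ> sec z h"
  by (simp add: sec_def[of _ "g \<circ> h"] fun_eq_iff comp_apply GG_Cons[of g] GG_Cons[of h])

lemma GG_pr: "g \<in> GG \<Longrightarrow> sg 0 g = 0 \<Longrightarrow> g = pr (sec 0 g) (sec 1 g)"
  by (rule word_ext) (simp_all add: GG_Cons[of g])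

lemma GG_pr_obtain:
  assumes "g \<in> GG" "sg 0 g = 0"
  obtains g0 g1 where "g = pr g0 g1" "g0 \<in> GG" "g1 \<in> GG"
  using GG_pr[OF assms] sec_GG[OF assms(1)] by blast

lemma sg_comp: "g \<in> GG \<Longrightarrow> h \<in> GG \<Longrightarrow> sg k (g \<circ> h) = sg k g + sg k h"
proof (induction k arbitrary: g h)
  case 0
  then show ?case by (simp add: sg.simps(1)[of "g \<circ> h"] GG_Cons[of g] GG_Cons[of h] add_ac comp_apply[of g h "[0]"])
next
  case (Suc k)
  have "sg (Suc k) (g \<circ> h) = sg k (sec (sg 0 h) g) + sg k (sec 0 h) + (sg k (sec (1 + sg 0 h) g) + sg k (sec 1 h))"
    using Suc by (simp add: sec_comp)
  also have "\<dots> = sg (Suc k) g + sg (Suc k) h"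
    using bit_cases01[of "sg 0 h"] by (auto simp: add_ac)
  finally show ?case .
qed

lemma sg_numeral [simp]:
  "sg 2 g = sg 1 (sec 0 g) + sg 1 (sec 1 g)" "sg 3 g = sg 2 (sec 0 g) + sg 2 (sec 1 g)"
  by (simp_all add: numeral_2_eq_2 numeral_3_eq_3)

lemma sg_inv: "g \<in> GG \<Longrightarrow> sg k (inv\<^bsub>Gt\<^esub> g) = sg k g"
proof -
  assume g: "g \<in> GG"
  have "sg k (inv\<^bsub>Gt\<^esub> g \<circ> g) = 0" using g by (simp add: Gt_inv_comp)
  then have "sg k (inv\<^bsub>Gt\<^esub> g) + sg k g = 0" using g by (simp add: sg_comp)
  then have "sg k (inv\<^bsub>Gt\<^esub> g) + (sg k (inv\<^bsub>Gt\<^esub> g) + sg k g) = sg k (inv\<^bsub>Gt\<^esub> g)" by simp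
  then show ?thesis by simp
qed

declare sg.simps(2) [simp del] sg_numeral [simp del]

section \<open>The subgroups of small index\<close>

lemma bit_add_eq_0: "(x::bit) + y = 0 \<longleftrightarrow> x = y"
  using bit_cases01[of x] bit_cases01[of y] by auto

lemmas sg_eval = sg.simps(2) sg_numeral

lemma sg_table [simp]:
  "sg (Suc 0) act_b = 1" "sg (Suc 0) act_c = 0" "sg (Suc 0) act_d = 0"
  "sg 2 act_b = 0" "sg 2 act_c = 0" "sg 2 act_d = 1"
  "sg 3 act_b = 0" "sg 3 act_c = 1" "sg 3 act_d = 0"
  by (simp_all add: sg_eval)

lemma gens_cases:
  assumes "t \<in> gens"
  obtains "t = act_a" | t0 t1 where "t = pr t0 t1" "t0 \<in> GG" "t1 \<in> GG" "t0 \<circ> t0 = id" "t1 \<circ> t1 = id"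
    "t0 = id \<or> t0 \<in> gens" "t1 = id \<or> t1 \<in> gens"
proof -
  from assms consider "t = act_a" | "t = act_b" | "t = act_c" | "t = act_d" by (auto simp: gens_def)
  then show thesis
  proof cases
    case 1 then show ?thesis by (rule that(1))
  next
    case 2 show ?thesis by (rule that(2)[OF 2[unfolded act_pr(1)]]) (simp_all add: gens_mem)
  next
    case 3 show ?thesis by (rule that(2)[OF 3[unfolded act_pr(2)]]) (simp_all add: gens_mem)
  next
    case 4 show ?thesis by (rule that(2)[OF 4[unfolded act_pr(3)]]) (simp_all add: gens_mem)
  qed
qed

text \<open>The common kernel of four homomorphisms to the field with two elements; levels 0, 1, 2,
  3 are dual to a, b, d, c in this order.\<close>

definition H2 :: "(word \<Rightarrow> word) set" where
  "H2 = {g \<in> GG. sg 0 g = 0 \<and> sg (Suc 0) g = 0 \<and> sg 2 g = 0 \<and> sg 3 g = 0}"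

text \<open>On \<open>H2\<close> the parities of the two sections on level k agree for k \<le> 2,
  because the parity of the element on level k + 1 vanishes. Conditions on the section at 0 are
  therefore invariant under exchanging the halves, and so under conjugation.\<close>

definition HI :: "nat set \<Rightarrow> (word \<Rightarrow> word) set" where
  "HI I = {g \<in> H2. \<forall>k\<in>I. sg k (sec 0 g) = 0}"

lemma H2_GG: "g \<in> H2 \<Longrightarrow> g \<in> GG" by (simp add: H2_def)

lemma sg_conj: "g \<in> GG \<Longrightarrow> t \<in> GG \<Longrightarrow> sg k (t \<circ> g \<circ> t) = sg k g"
  by (simp add: sg_comp add_ac)

lemma ssg_comp:
  "g \<in> GG \<Longrightarrow> h \<in> GG \<Longrightarrow> sg 0 h = 0 \<Longrightarrow> sg k (sec z (g \<circ> h)) = sg k (sec z g) + sg k (sec z h)"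
  by (simp add: sec_comp sg_comp)

lemma ssg_inv: "g \<in> GG \<Longrightarrow> sg 0 g = 0 \<Longrightarrow> sg k (sec z (inv\<^bsub>Gt\<^esub> g)) = sg k (sec z g)"
  using ssg_comp[of "inv\<^bsub>Gt\<^esub> g" g k z] by (simp add: Gt_inv_comp) (metis bit_add_eq_0)

lemma H2_sec:
  assumes "g \<in> H2" "k \<in> {0, Suc 0, 2}"
  shows "sg k (sec 1 g) = sg k (sec 0 g)"
proof -
  have "sg k (sec 0 g) + sg k (sec 1 g) = 0" using assms sg.simps(2)[of 0 g] sg_numeral[of g]
    by (auto simp: H2_def)
  then show ?thesis by (simp add: bit_add_eq_0)
qed

lemma ssg_conj:
  assumes g: "g \<in> H2" and t: "t \<in> gens" and k: "k \<in> {0, Suc 0, 2}"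
  shows "sg k (sec 0 (t \<circ> g \<circ> t)) = sg k (sec 0 g)"
proof -
  obtain g0 g1 where gp: "g = pr g0 g1" "g0 \<in> GG" "g1 \<in> GG"
    using GG_pr_obtain[of g] g by (auto simp: H2_def)
  from t show ?thesis
  proof (cases rule: gens_cases)
    case 1
    then show ?thesis using H2_sec[OF g k] unfolding gp(1) by simp
  next
    case (2 t0 t1)
    then show ?thesis using sg_conj[of g0 t0 k] gp by simp
  qed
qed

lemma H2_normal: "H2 \<lhd> Gt"
proof (rule normal_gensI[OF subgroup_GtI])
  show "t \<circ> n \<circ> t \<in> H2" if "t \<in> gens" "n \<in> H2" for t n
    using that gens_GG[of t] by (simp add: H2_def sg_conj)
qed (auto simp: H2_def sg_comp sg_inv)

lemma HI_normal: "I \<subseteq> {0, Suc 0, 2} \<Longrightarrow> HI I \<lhd> Gt"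
proof (rule normal_gensI[OF subgroup_GtI])
  assume I: "I \<subseteq> {0, Suc 0, 2}"
  show "t \<circ> n \<circ> t \<in> HI I" if "t \<in> gens" "n \<in> HI I" for t n
    using that normal_conj_gen[OF H2_normal] ssg_conj[of n t] I by (auto simp: HI_def)
  show "g \<circ> h \<in> HI I" if "g \<in> HI I" "h \<in> HI I" for g h
    using that normal_comp[OF H2_normal, of g h] ssg_comp[of g h] by (simp add: HI_def H2_def)
  show "inv\<^bsub>Gt\<^esub> g \<in> HI I" if "g \<in> HI I" for g
    using that normal_inv[OF H2_normal, of g] ssg_inv[of g] by (simp add: HI_def H2_def)
qed (auto simp: HI_def H2_def)

section \<open>Relations between the two sections of an element\<close>

abbreviation ee :: "(word \<Rightarrow> word) \<Rightarrow> bit" where "ee g \<equiv> sg 2 (sec 0 g)"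

abbreviation Kc :: "(word \<Rightarrow> word) set" where "Kc \<equiv> HI {2}"

definition N1 :: "(word \<Rightarrow> word) set" where "N1 = HI {0, Suc 0, 2}"

lemma Kc_normal: "Kc \<lhd> Gt" by (rule HI_normal) simp

lemma N1_normal: "N1 \<lhd> Gt" unfolding N1_def by (rule HI_normal) simp

text \<open>The only generator with section a is b = (a, c), and its other section is c. Level 0
  counts the letters a and level 3 the letters c, so the counts match across the two
  sections.\<close>

lemma sg_sec_exchange:
  assumes "g \<in> GG"
  shows "sg 3 (sec 0 g) = sg 0 (sec 1 g) \<and> sg 3 (sec 1 g) = sg 0 (sec 0 g)"
  using assms
proof (induction g rule: GG_right_induct)
  case id
  show "sg 3 (sec 0 id) = sg 0 (sec 1 id) \<and> sg 3 (sec 1 id) = sg 0 (sec 0 id)" by simp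
next
  case (comp g t)
  from comp(2) consider "t = act_a" | "t = act_b" | "t = act_c" | "t = act_d" by (auto simp: gens_def)
  then show "sg 3 (sec 0 (g \<circ> t)) = sg 0 (sec 1 (g \<circ> t)) \<and> sg 3 (sec 1 (g \<circ> t)) = sg 0 (sec 0 (g \<circ> t))"
    using comp(1,3) by cases (simp_all add: sec_comp sg_comp)
qed

text \<open>If \<open>h\<close> switches the root, the section of the product at 0 involves the
  section of \<open>g\<close> at 1, whose level 2 parity differs from that at 0 by the level 3
  parity of \<open>g\<close>. Thus \<open>ee\<close> is additive where root switches are absent, in
  particular on \<open>H2\<close>.\<close>

lemma ee_comp:
  assumes "g \<in> GG" "h \<in> GG"
  shows "ee (g \<circ> h) = ee g + ee h + sg 0 h * sg 3 g"
  using assms bit_cases01[of "sg 0 h"]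
  by (auto simp: sec_comp sg_comp sg_numeral(2) add_ac)

text \<open>The product term compensates the failure of additivity recorded in
  \<open>ee_comp\<close>. When both sections lie in \<open>H2\<close> it vanishes and
  \<open>ee\<close> must agree on them; by \<open>pr_N1\<close> this is the only condition on such a
  pair.\<close>

lemma ee_sec:
  assumes "g \<in> GG"
  shows "ee (sec 1 g) = ee (sec 0 g) + sg 0 (sec 0 g) * sg 0 (sec 1 g)"
  using assms
proof (induction g rule: GG_right_induct)
  case id
  show "ee (sec 1 id) = ee (sec 0 id) + sg 0 (sec 0 id) * sg 0 (sec 1 id)" by simp
next
  case (comp g t)
  have s: "sg 2 (sec 1 (sec 0 g)) = sg 3 (sec 0 g) + ee (sec 0 g)"
    using sg_numeral(2)[of "sec 0 g"] by (simp add: add_ac)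
  from comp(2) consider "t = act_a" | "t = act_b" | "t = act_c" | "t = act_d" by (auto simp: gens_def)
  then show "ee (sec 1 (g \<circ> t)) = ee (sec 0 (g \<circ> t)) + sg 0 (sec 0 (g \<circ> t)) * sg 0 (sec 1 (g \<circ> t))"
    using comp(1,3) sg_sec_exchange[OF comp(1)]
    by cases (simp_all add: s sec_comp ee_comp sg_comp add_ac mult.commute distrib_left)
qed

text \<open>The commutator of a and c, equal to (d, d). It represents the coset of K in
  \<open>H2\<close> on which \<open>ee\<close> is 1.\<close>

definition zz :: "word \<Rightarrow> word" where "zz = act_a \<circ> act_c \<circ> act_a \<circ> act_c"

lemma bcd_commute: "act_b \<circ> act_c = act_c \<circ> act_b" "act_b \<circ> act_d = act_d \<circ> act_b"
  "act_c \<circ> act_d = act_d \<circ> act_c"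
proof -
  have "act_b (act_c \<sigma>) = act_c (act_b \<sigma>) \<and> act_b (act_d \<sigma>) = act_d (act_b \<sigma>) \<and>
      act_c (act_d \<sigma>) = act_d (act_c \<sigma>)" for \<sigma>
  proof (induction \<sigma>)
    case (Cons z \<sigma>)
    then show ?case using bit_cases01[of z] by auto
  qed simp
  then show "act_b \<circ> act_c = act_c \<circ> act_b" "act_b \<circ> act_d = act_d \<circ> act_b"
    "act_c \<circ> act_d = act_d \<circ> act_c" by (auto simp: fun_eq_iff comp_apply)
qed

lemma zz_pr: "zz = pr act_d act_d"
  unfolding zz_def by (rule word_ext) (simp_all add: comp_apply)

lemma zz_self [simp]: "zz \<circ> zz = id" by (simp add: zz_pr)

lemma caca: "act_c \<circ> act_a \<circ> act_c \<circ> act_a = zz"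
  unfolding zz_pr by (rule word_ext) (simp_all add: comp_apply)

lemma zz_H2: "zz \<in> H2" unfolding H2_def zz_def by (simp add: sg_comp)

lemma ee_zz: "ee zz = 1" by (simp add: zz_pr)

lemma xx_eq: "xx = act_a \<circ> act_b \<circ> act_a \<circ> act_b"
  by (simp add: xx_def commutator_Gt)

lemma yy_eq: "yy = act_a \<circ> act_d \<circ> act_a \<circ> act_d"
  by (simp add: yy_def commutator_Gt)

lemma xx_pr: "xx = pr (act_c \<circ> act_a) (act_a \<circ> act_c)"
  unfolding xx_eq by (rule word_ext) (simp_all add: comp_apply)

lemma yy_pr: "yy = pr act_b act_b"
  unfolding yy_eq by (rule word_ext) (simp_all add: comp_apply)

lemma xx_Kc: "xx \<in> Kc" and yy_Kc: "yy \<in> Kc"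
proof -
  have "xx \<in> H2" "yy \<in> H2" unfolding H2_def xx_eq yy_eq by (simp_all add: sg_comp)
  moreover have "ee xx = 0" "ee yy = 0" unfolding xx_pr yy_pr by (simp_all add: sg_comp)
  ultimately show "xx \<in> Kc" "yy \<in> Kc" by (simp_all add: HI_def)
qed

section \<open>The quotient by K and the description of K by parities\<close>

lemma normal_closure_normal:
  assumes "S \<subseteq> GG"
  shows "normal_closure Gt S \<lhd> Gt"
proof -
  have mem: "g \<in> normal_closure Gt S \<longleftrightarrow> (\<forall>N. N \<lhd> Gt \<longrightarrow> S \<subseteq> N \<longrightarrow> g \<in> N)" for g
    by (auto simp: normal_closure_def)
  have "GG \<lhd> Gt" by (rule normal_gensI[OF Gt.subgroup_self]) (auto simp: gens_GG)
  then have sub: "normal_closure Gt S \<subseteq> GG" using assms mem by blast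
  show ?thesis
    by (rule normal_gensI[OF subgroup_GtI[OF sub]]; unfold mem)
      (blast intro: normal_id normal_comp normal_inv normal_conj_gen)+
qed

lemma normal_closure_least: "N \<lhd> Gt \<Longrightarrow> S \<subseteq> N \<Longrightarrow> normal_closure Gt S \<subseteq> N"
  by (auto simp: normal_closure_def)

lemma normal_closure_incl: "S \<subseteq> normal_closure Gt S"
  by (auto simp: normal_closure_def)

lemma xx_GG [simp]: "xx \<in> GG" "yy \<in> GG"
  by (simp_all add: xx_eq yy_eq)

lemma Kt_normal: "Kt \<lhd> Gt"
  unfolding Kt_def by (rule normal_closure_normal) simp

lemma Kt_xx: "xx \<in> Kt" "yy \<in> Kt"
  unfolding Kt_def using normal_closure_incl[of "{xx, yy}"] by simp_all

lemma Kt_sub_Kc: "Kt \<subseteq> Kc"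
  unfolding Kt_def by (rule normal_closure_least[OF Kc_normal]) (use xx_Kc yy_Kc in auto)

text \<open>The dihedral group of order eight generated by a and c; its central element is
  \<open>zz\<close>.\<close>

definition Dset :: "(word \<Rightarrow> word) set" where
  "Dset = {id, act_a, act_c, act_a \<circ> act_c, act_c \<circ> act_a, act_a \<circ> (act_c \<circ> act_a),
    act_c \<circ> (act_a \<circ> act_c), zz}"

lemma act_left_cancel [simp]: "act_a \<circ> (act_a \<circ> g) = g" "act_b \<circ> (act_b \<circ> g) = g"
    "act_c \<circ> (act_c \<circ> g) = g" "act_d \<circ> (act_d \<circ> g) = g"
  by (simp_all add: comp_assoc[symmetric])

lemma Dset_left: "p \<in> Dset \<Longrightarrow> act_a \<circ> p \<in> Dset" "p \<in> Dset \<Longrightarrow> act_c \<circ> p \<in> Dset"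
proof -
  have z1: "zz = act_a \<circ> (act_c \<circ> (act_a \<circ> act_c))" by (simp add: zz_def comp_assoc)
  have z2: "zz = act_c \<circ> (act_a \<circ> (act_c \<circ> act_a))" by (simp add: caca[symmetric] comp_assoc)
  have a: "act_a \<circ> (act_c \<circ> (act_a \<circ> act_c)) \<in> Dset" "act_a \<circ> zz \<in> Dset"
    unfolding z1[symmetric] by (simp add: Dset_def, subst z1, simp add: Dset_def)
  have c: "act_c \<circ> (act_a \<circ> (act_c \<circ> act_a)) \<in> Dset" "act_c \<circ> zz \<in> Dset"
    unfolding z2[symmetric] by (simp add: Dset_def, subst z2, simp add: Dset_def)
  show "p \<in> Dset \<Longrightarrow> act_a \<circ> p \<in> Dset"
    using a by (subst (asm) (3) Dset_def) (auto simp: Dset_def)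
  show "p \<in> Dset \<Longrightarrow> act_c \<circ> p \<in> Dset"
    using c by (subst (asm) (3) Dset_def) (auto simp: Dset_def)
qed

definition Qset :: "(word \<Rightarrow> word) set" where
  "Qset = {id, act_b, act_d, act_b \<circ> act_d}"

lemma Qset_left: "q \<in> Qset \<Longrightarrow> act_b \<circ> q \<in> Qset" "q \<in> Qset \<Longrightarrow> act_d \<circ> q \<in> Qset"
proof -
  have e: "act_d \<circ> (act_b \<circ> act_d) = act_b"
    using bcd_commute(2) by (simp add: comp_assoc[symmetric])
  show "q \<in> Qset \<Longrightarrow> act_b \<circ> q \<in> Qset" "q \<in> Qset \<Longrightarrow> act_d \<circ> q \<in> Qset"
    by (auto simp: Qset_def e bcd_commute(2)[symmetric])
qed

definition commK :: "(word \<Rightarrow> word) \<Rightarrow> (word \<Rightarrow> word) \<Rightarrow> bool" where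
  "commK t p \<longleftrightarrow> (\<exists>k\<in>Kt. t \<circ> p = k \<circ> p \<circ> t)"

lemma Kt_conj_pull: "k \<in> Kt \<Longrightarrow> t \<in> gens \<Longrightarrow> \<exists>k'\<in>Kt. t \<circ> k = k' \<circ> t"
  using normal_conj_gen[OF Kt_normal, of t k] gens_self[of t]
  by (intro bexI[of _ "t \<circ> k \<circ> t"]) (simp_all add: comp_assoc)

lemma commK_comp:
  assumes s: "s \<in> gens" and c: "commK t s" "commK t p"
  shows "commK t (s \<circ> p)"
proof -
  obtain k where k: "k \<in> Kt" "t \<circ> s = k \<circ> s \<circ> t" using c(1) by (auto simp: commK_def)
  obtain k' where k': "k' \<in> Kt" "t \<circ> p = k' \<circ> p \<circ> t" using c(2) by (auto simp: commK_def)
  obtain l where l: "l \<in> Kt" "s \<circ> k' = l \<circ> s" using Kt_conj_pull[OF k'(1) s] by blast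
  have "t \<circ> (s \<circ> p) = k \<circ> s \<circ> (t \<circ> p)" unfolding comp_assoc[symmetric] k(2) ..
  also have "\<dots> = k \<circ> (s \<circ> k') \<circ> p \<circ> t" unfolding k'(2) by (simp add: comp_assoc)
  also have "\<dots> = (k \<circ> l) \<circ> (s \<circ> p) \<circ> t" unfolding l(2) by (simp add: comp_assoc)
  finally show ?thesis using normal_comp[OF Kt_normal k(1) l(1)] unfolding commK_def by blast
qed

lemma commK_base:
  assumes "t \<in> {act_b, act_d}"
  shows "commK t act_a" "commK t act_c" "commK t id"
proof -
  have "t \<circ> act_a = (t \<circ> act_a \<circ> t \<circ> act_a) \<circ> act_a \<circ> t" using assms by (auto simp: comp_assoc)
  moreover have "t \<circ> act_a \<circ> t \<circ> act_a \<in> Kt"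
  proof -
    obtain x where x: "x \<in> Kt" "x = act_a \<circ> t \<circ> act_a \<circ> t" using Kt_xx assms by (auto simp: xx_eq yy_eq)
    have "act_a \<circ> x \<circ> act_a \<in> Kt" by (rule normal_conj_gen[OF Kt_normal gens_mem(1) x(1)])
    then show ?thesis unfolding x(2) by (simp add: comp_assoc)
  qed
  ultimately show "commK t act_a" unfolding commK_def by blast
  have "t \<circ> act_c = id \<circ> act_c \<circ> t" using bcd_commute assms by auto
  then show "commK t act_c" unfolding commK_def using normal_id[OF Kt_normal] by blast
  show "commK t id" unfolding commK_def using normal_id[OF Kt_normal] by (intro bexI[of _ id]) simp_all
qed

lemma commK_Dset: "t \<in> {act_b, act_d} \<Longrightarrow> p \<in> Dset \<Longrightarrow> commK t p"
proof -
  assume t: "t \<in> {act_b, act_d}"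
  note b = commK_base[OF t]
  note ca = commK_comp[OF gens_mem(1) b(1)] and cc = commK_comp[OF gens_mem(3) b(2)]
  have "commK t (act_a \<circ> (act_c \<circ> (act_a \<circ> act_c)))" by (intro ca cc b)
  then have "commK t zz" by (simp add: zz_def comp_assoc)
  moreover assume "p \<in> Dset"
  ultimately show ?thesis unfolding Dset_def by (auto intro: ca cc b)
qed

text \<open>b and d commute with c, and modulo K also with a, since x and y lie in K. So a new
  factor b or d on the left can be carried through the dihedral part, and the quotient by K has at
  most 32 elements.\<close>

lemma GG_factor: "g \<in> GG \<Longrightarrow> \<exists>k\<in>Kt. \<exists>p\<in>Dset. \<exists>q\<in>Qset. g = k \<circ> p \<circ> q"
proof (induction g rule: GG_left_induct)
  case id
  have "id = id \<circ> id \<circ> (id :: word \<Rightarrow> word)" by simp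
  moreover have "id \<in> Dset" "id \<in> Qset" by (simp_all add: Dset_def Qset_def)
  ultimately show "\<exists>k\<in>Kt. \<exists>p\<in>Dset. \<exists>q\<in>Qset. id = k \<circ> p \<circ> q"
    using normal_id[OF Kt_normal] by blast
next
  case (comp t g)
  obtain k p q where g: "k \<in> Kt" "p \<in> Dset" "q \<in> Qset" "g = k \<circ> p \<circ> q" using comp(3) by blast
  obtain k' where k': "k' \<in> Kt" "t \<circ> k = k' \<circ> t" using Kt_conj_pull[OF g(1) comp(1)] by blast
  have tg: "t \<circ> g = k' \<circ> (t \<circ> p) \<circ> q" unfolding g(4) using k'(2) by (simp add: comp_assoc[symmetric])
  consider "t \<in> {act_a, act_c}" | "t \<in> {act_b, act_d}" using comp(1) by (auto simp: gens_def)
  then show "\<exists>k\<in>Kt. \<exists>p\<in>Dset. \<exists>q\<in>Qset. t \<circ> g = k \<circ> p \<circ> q"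
  proof cases
    case 1
    then have "t \<circ> p \<in> Dset" using Dset_left g(2) by auto
    then show ?thesis using tg k'(1) g(3) by blast
  next
    case 2
    then obtain l where l: "l \<in> Kt" "t \<circ> p = l \<circ> p \<circ> t" using commK_Dset g(2) by (auto simp: commK_def)
    have "t \<circ> g = (k' \<circ> l) \<circ> p \<circ> (t \<circ> q)" unfolding tg l(2) by (simp add: comp_assoc)
    moreover have "t \<circ> q \<in> Qset" using 2 Qset_left g(3) by auto
    ultimately show ?thesis using normal_comp[OF Kt_normal k'(1) l(1)] g(2) by blast
  qed
qed

text \<open>The parities on levels 1 and 2 detect the part in \<open>Qset\<close>; then levels 0 and
  3 leave only \<open>id\<close> and \<open>zz\<close> in \<open>Dset\<close>, and \<open>ee\<close>
  separates these two.\<close>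

theorem Kt_eq: "Kt = Kc"
proof
  show "Kc \<subseteq> Kt"
  proof
    fix g assume g: "g \<in> Kc"
    then have gG: "g \<in> GG" by (simp add: HI_def H2_def)
    obtain k p q where f: "k \<in> Kt" "p \<in> Dset" "q \<in> Qset" "g = k \<circ> p \<circ> q" using GG_factor[OF gG] by blast
    have k: "k \<in> Kc" using f(1) Kt_sub_Kc by blast
    have kG: "k \<in> GG" using k by (simp add: HI_def H2_def)
    have zG: "zz \<in> GG" using zz_H2 H2_GG by blast
    have pq: "p \<in> GG" "q \<in> GG" using f(2,3) zG by (auto simp: Dset_def Qset_def)
    have "inv\<^bsub>Gt\<^esub> k \<circ> g = p \<circ> q" unfolding f(4) using Gt_inv_comp[OF kG] by (simp add: comp_assoc[symmetric])
    then have h: "p \<circ> q \<in> Kc" using normal_comp[OF Kc_normal normal_inv[OF Kc_normal k] g] by simp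
    have s: "sg n p + sg n q = 0" if "n \<in> {0, Suc 0, 2, 3}" for n
      using h that pq by (auto simp: HI_def H2_def sg_comp)
    have zs: "sg 0 zz = 0" "sg (Suc 0) zz = 0" "sg 2 zz = 0" "sg 3 zz = 0"
      using zz_H2 by (simp_all add: H2_def)
    have p0: "sg (Suc 0) p = 0" "sg 2 p = 0" using f(2) zs by (auto simp: Dset_def sg_comp)
    have q0: "sg (Suc 0) q = 0" "sg 2 q = 0" using s[of "Suc 0"] s[of 2] p0 by simp_all
    have q: "q = id" using f(3) q0 by (auto simp: Qset_def sg_comp)
    have "p \<in> {id, zz}" using f(2) s[of 0] s[of 3] unfolding q by (auto simp: Dset_def sg_comp)
    moreover have "p \<noteq> zz" using h ee_zz unfolding q by (auto simp: HI_def)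
    ultimately have "p = id" by simp
    then show "g \<in> Kt" using f(1,4) q by simp
  qed
qed (rule Kt_sub_Kc)

section \<open>Geometric powers\<close>

lemma tuple_0: "tuple 0 f = f []"
  by (rule ext) (simp add: tuple_def)

lemma tuple_Suc: "tuple (Suc m) f = pr (tuple m (\<lambda>\<sigma>. f (0 # \<sigma>))) (tuple m (\<lambda>\<sigma>. f (1 # \<sigma>)))"
  by (rule word_ext) (simp_all add: tuple_def)

lemma copies_0 [simp]: "copies 0 Q = Q"
  unfolding copies_def tuple_0 by (auto intro: exI[of _ "\<lambda>_. q" for q])

lemma copies_Suc: "copies (Suc m) Q = {pr g h | g h. g \<in> copies m Q \<and> h \<in> copies m Q}"
proof
  show "copies (Suc m) Q \<subseteq> {pr g h | g h. g \<in> copies m Q \<and> h \<in> copies m Q}"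
    unfolding copies_def tuple_Suc by fastforce
  show "{pr g h | g h. g \<in> copies m Q \<and> h \<in> copies m Q} \<subseteq> copies (Suc m) Q"
  proof
    fix p assume "p \<in> {pr g h | g h. g \<in> copies m Q \<and> h \<in> copies m Q}"
    then obtain f f' where f: "p = pr (tuple m f) (tuple m f')"
      "\<forall>\<sigma>. length \<sigma> = m \<longrightarrow> f \<sigma> \<in> Q" "\<forall>\<sigma>. length \<sigma> = m \<longrightarrow> f' \<sigma> \<in> Q"
      by (auto simp: copies_def)
    define F where "F = (\<lambda>w. if hd w = 0 then f (tl w) else f' (tl w))"
    have "p = tuple (Suc m) F" unfolding tuple_Suc f(1) by (simp add: F_def)
    moreover have "\<forall>\<sigma>. length \<sigma> = Suc m \<longrightarrow> F \<sigma> \<in> Q" using f(2,3) by (simp add: F_def)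
    ultimately show "p \<in> copies (Suc m) Q" unfolding copies_def by blast
  qed
qed

lemma copies_SucE:
  assumes "p \<in> copies (Suc m) Q"
  obtains g h where "p = pr g h" "g \<in> copies m Q" "h \<in> copies m Q"
  using assms by (auto simp: copies_Suc)

lemma copies_SucI: "g \<in> copies m Q \<Longrightarrow> h \<in> copies m Q \<Longrightarrow> pr g h \<in> copies (Suc m) Q"
  by (auto simp: copies_Suc)

lemma copies_Suc_inner: "copies (Suc m) Q = copies m (copies (Suc 0) Q)"
  by (induction m) (simp_all add: copies_Suc)

lemma copies_mono: "Q \<subseteq> R \<Longrightarrow> copies m Q \<subseteq> copies m R"
  by (induction m) (auto simp: copies_Suc)

fun secw :: "word \<Rightarrow> (word \<Rightarrow> word) \<Rightarrow> word \<Rightarrow> word" where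
  "secw [] g = g"
| "secw (z # \<sigma>) g = secw \<sigma> (sec z g)"

lemma secw_append: "secw (\<sigma> @ [z]) g = sec z (secw \<sigma> g)"
  by (induction \<sigma> arbitrary: g) simp_all

lemma secw_copies: "g \<in> copies (length \<sigma>) Q \<Longrightarrow> secw \<sigma> g \<in> Q"
proof (induction \<sigma> arbitrary: g)
  case (Cons z \<sigma>)
  from Cons.prems obtain g0 g1 where "g = pr g0 g1" "g0 \<in> copies (length \<sigma>) Q" "g1 \<in> copies (length \<sigma>) Q"
    by (auto elim: copies_SucE)
  then show ?case using Cons.IH bit_cases01[of z] by auto
qed simp

lemma secw_imp_copies:
  "g \<in> copies m Q \<Longrightarrow> (\<And>\<sigma>. length \<sigma> = m \<Longrightarrow> secw \<sigma> g \<in> R) \<Longrightarrow> g \<in> copies m R"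
proof (induction m arbitrary: g)
  case 0
  show ?case using 0(2)[of "[]"] by simp
next
  case (Suc m)
  from Suc.prems(1) obtain g0 g1 where g: "g = pr g0 g1" "g0 \<in> copies m Q" "g1 \<in> copies m Q"
    by (rule copies_SucE)
  have "g0 \<in> copies m R" by (rule Suc.IH[OF g(2)]) (use Suc.prems(2)[of "0 # \<sigma>" for \<sigma>] g in simp)
  moreover have "g1 \<in> copies m R" by (rule Suc.IH[OF g(3)]) (use Suc.prems(2)[of "1 # \<sigma>" for \<sigma>] g in simp)
  ultimately show ?case unfolding g(1) by (rule copies_SucI)
qed

lemma copies_comp:
  assumes "\<And>g h. g \<in> Q \<Longrightarrow> h \<in> Q \<Longrightarrow> g \<circ> h \<in> Q"
  shows "g \<in> copies m Q \<Longrightarrow> h \<in> copies m Q \<Longrightarrow> g \<circ> h \<in> copies m Q"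
proof (induction m arbitrary: g h)
  case (Suc m)
  then obtain g0 g1 h0 h1 where "g = pr g0 g1" "g0 \<in> copies m Q" "g1 \<in> copies m Q"
    "h = pr h0 h1" "h0 \<in> copies m Q" "h1 \<in> copies m Q" by (auto elim!: copies_SucE)
  then show ?case using Suc.IH copies_SucI by simp
qed (simp add: assms)

lemma secw_comp:
  "g \<in> copies (length \<sigma>) UNIV \<Longrightarrow> h \<in> copies (length \<sigma>) UNIV \<Longrightarrow> secw \<sigma> (g \<circ> h) = secw \<sigma> g \<circ> secw \<sigma> h"
proof (induction \<sigma> arbitrary: g h)
  case (Cons z \<sigma>)
  then obtain g0 g1 h0 h1 where "g = pr g0 g1" "g0 \<in> copies (length \<sigma>) UNIV" "g1 \<in> copies (length \<sigma>) UNIV"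
    "h = pr h0 h1" "h0 \<in> copies (length \<sigma>) UNIV" "h1 \<in> copies (length \<sigma>) UNIV"
    by (auto elim!: copies_SucE)
  then show ?case using Cons.IH bit_cases01[of z] by auto
qed simp

text \<open>Conjugation by a generator permutes the vertices of a level and conjugates the sections
  there by sections of that generator. These are trivial or again generators, and \<open>id\<close>
  is included so that the induction closes.\<close>

lemma conj_copies_secw:
  assumes "t \<in> insert id gens"
  shows "g \<in> copies (length \<sigma>) UNIV \<Longrightarrow> \<exists>t'\<in>insert id gens. secw \<sigma> (t \<circ> g \<circ> t) = t' \<circ> secw (t \<sigma>) g \<circ> t'"
  using assms
proof (induction \<sigma> arbitrary: g t)
  case Nil
  have "t [] = []" using Nil by (auto simp: gens_def id_apply)
  then show ?case using Nil by auto
next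
  case (Cons z \<sigma>)
  then obtain g0 g1 where g: "g = pr g0 g1" "g0 \<in> copies (length \<sigma>) UNIV" "g1 \<in> copies (length \<sigma>) UNIV"
    by (auto elim!: copies_SucE)
  have a: ?case if "t = act_a"
    unfolding that g(1) using bit_cases01[of z] by (intro bexI[of _ id]) auto
  have p: ?case if t: "t = pr t0 t1" "t0 \<in> insert id gens" "t1 \<in> insert id gens" for t0 t1
    unfolding t(1) g(1) using bit_cases01[of z] Cons.IH[OF g(2) t(2)] Cons.IH[OF g(3) t(3)]
    by auto
  from Cons.prems(2) consider "t = act_a" | t0 t1 where "t = pr t0 t1" "t0 \<in> insert id gens" "t1 \<in> insert id gens"
  proof
    assume "t = id"
    then have "t = pr id id" by simp
    then show ?thesis by (rule that(2)) simp_all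
  next
    assume "t \<in> gens"
    then show ?thesis
    proof (cases rule: gens_cases)
      case 1 then show ?thesis by (rule that(1))
    next
      case (2 t0 t1) show ?thesis by (rule that(2)[OF 2(1)]) (use 2 in auto)
    qed
  qed
  then show ?case using a p by cases
qed

lemma conj_copies:
  assumes Q: "\<And>t q. t \<in> gens \<Longrightarrow> q \<in> Q \<Longrightarrow> t \<circ> q \<circ> t \<in> Q" and t: "t \<in> gens" and g: "g \<in> copies m Q"
  shows "t \<circ> g \<circ> t \<in> copies m Q"
proof -
  have "t \<circ> g \<circ> t \<in> copies m UNIV" if "t \<in> insert id gens" "g \<in> copies m UNIV" for t g
    using that
  proof (induction m arbitrary: g t)
    case (Suc m)
    from Suc.prems obtain g0 g1 where g: "g = pr g0 g1" "g0 \<in> copies m UNIV" "g1 \<in> copies m UNIV"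
      by (auto elim!: copies_SucE)
    show ?case
    proof (cases "t = id")
      case True
      then show ?thesis using Suc.prems by simp
    next
      case False
      then have "t \<in> gens" using Suc.prems by simp
      then show ?thesis
      proof (cases rule: gens_cases)
        case 1 then show ?thesis using g copies_SucI by simp
      next
        case (2 t0 t1)
        then show ?thesis using g Suc.IH[of t0 g0] Suc.IH[of t1 g1] copies_SucI by auto
      qed
    qed
  qed simp
  moreover have gU: "g \<in> copies m UNIV" using g copies_mono[of Q UNIV m] by auto
  ultimately have "t \<circ> g \<circ> t \<in> copies m UNIV" using t by blast
  then show ?thesis
  proof (rule secw_imp_copies)
    fix \<sigma> :: word assume l: "length \<sigma> = m"
    have lt: "length (t \<sigma>) = m" using l t by (auto simp: gens_def)
    obtain t' where t': "t' \<in> insert id gens" "secw \<sigma> (t \<circ> g \<circ> t) = t' \<circ> secw (t \<sigma>) g \<circ> t'"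
    proof -
      have "\<exists>t'\<in>insert id gens. secw \<sigma> (t \<circ> g \<circ> t) = t' \<circ> secw (t \<sigma>) g \<circ> t'"
        by (rule conj_copies_secw) (use t gU l in simp_all)
      then show thesis using that by blast
    qed
    have "secw (t \<sigma>) g \<in> Q" using secw_copies[of g "t \<sigma>" Q] g lt by simp
    then show "secw \<sigma> (t \<circ> g \<circ> t) \<in> Q" unfolding t'(2) using t'(1) Q by auto
  qed
qed

section \<open>Single entries and normal subgroups\<close>

lemma at_vertex_simps [simp]:
  "at_vertex [] g = g" "at_vertex (0 # \<sigma>) g = pr (at_vertex \<sigma> g) id"
  "at_vertex (1 # \<sigma>) g = pr id (at_vertex \<sigma> g)"
proof -
  have i: "tuple m (\<lambda>\<tau>. id) = id" for m
    by (induction m) (simp_all add: tuple_0 tuple_Suc)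
  show "at_vertex [] g = g" by (simp add: at_vertex_def tuple_0)
  show "at_vertex (0 # \<sigma>) g = pr (at_vertex \<sigma> g) id" "at_vertex (1 # \<sigma>) g = pr id (at_vertex \<sigma> g)"
    by (simp_all add: at_vertex_def tuple_Suc i)
qed

text \<open>A tuple is the product of its single entries. The induction keeps \<open>R\<close>
  arbitrary so that it applies to the sets of all g with (g, 1) or (1, g) in
  \<open>R\<close>.\<close>

lemma copies_subset:
  "(\<And>g h. g \<in> R \<Longrightarrow> h \<in> R \<Longrightarrow> g \<circ> h \<in> R) \<Longrightarrow>
    (\<And>\<sigma> q. length \<sigma> = m \<Longrightarrow> q \<in> Q \<Longrightarrow> at_vertex \<sigma> q \<in> R) \<Longrightarrow> copies m Q \<subseteq> R"
proof (induction m arbitrary: R)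
  case 0
  show ?case using 0(2)[of "[]"] by auto
next
  case (Suc m)
  show ?case
  proof
    fix p assume "p \<in> copies (Suc m) Q"
    then obtain g h where p: "p = pr g h" "g \<in> copies m Q" "h \<in> copies m Q" by (rule copies_SucE)
    have "copies m Q \<subseteq> {g. pr g id \<in> R}"
      by (rule Suc.IH) (use Suc.prems(1)[of "pr g id" "pr h id" for g h] Suc.prems(2)[of "0 # \<sigma>" for \<sigma>] in simp_all)
    moreover have "copies m Q \<subseteq> {g. pr id g \<in> R}"
      by (rule Suc.IH) (use Suc.prems(1)[of "pr id g" "pr id h" for g h] Suc.prems(2)[of "1 # \<sigma>" for \<sigma>] in simp_all)
    ultimately have "pr g id \<circ> pr id h \<in> R" using p by (intro Suc.prems(1)) auto
    then show "p \<in> R" using p(1) by simp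
  qed
qed

lemma normal_pr_swap: "R \<lhd> Gt \<Longrightarrow> pr g h \<in> R \<Longrightarrow> pr h g \<in> R"
  using normal_conj_gen[OF _ gens_mem(1), of R "pr g h"] by simp

lemma pr_GG: "pr g h \<in> GG \<Longrightarrow> g \<in> GG \<and> h \<in> GG"
  using sec_GG[of "pr g h" 0] sec_GG[of "pr g h" 1] by simp

lemma pr_inv: "pr g h \<in> GG \<Longrightarrow> inv\<^bsub>Gt\<^esub> (pr g h) = pr (inv\<^bsub>Gt\<^esub> g) (inv\<^bsub>Gt\<^esub> h)"
proof -
  assume p: "pr g h \<in> GG"
  then have gh: "g \<in> GG" "h \<in> GG" using pr_GG[OF p] by simp_all
  obtain p0 p1 where q: "inv\<^bsub>Gt\<^esub> (pr g h) = pr p0 p1" "p0 \<in> GG" "p1 \<in> GG"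
    by (rule GG_pr_obtain[of "inv\<^bsub>Gt\<^esub> (pr g h)"]) (use p sg_inv[OF p, of 0] in auto)
  have "pr p0 p1 \<circ> pr g h = pr id id" using Gt_inv_comp(1)[OF p] q by simp
  then have "p0 \<circ> g = id" "p1 \<circ> h = id" by (simp_all only: pr_comp pr_eq_iff)
  then show ?thesis using q Gt_inv_eq gh by simp
qed

text \<open>Each generator is the second section of an involution fixing the first level: a of aba =
  (c, a), b of d, c of b, and d of c. Conjugating by that involution conjugates the second
  coordinate by the generator and keeps the first coordinate trivial.\<close>

lemma normal_second:
  assumes R: "R \<lhd> Gt"
  shows "{k \<in> GG. pr id k \<in> R} \<lhd> Gt" (is "?R' \<lhd> Gt")
proof (rule normal_gensI[OF subgroup_GtI])
  show "id \<in> ?R'" using normal_id[OF R] by simp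
  show "g \<circ> h \<in> ?R'" if "g \<in> ?R'" "h \<in> ?R'" for g h
    using that normal_comp[OF R, of "pr id g" "pr id h"] by simp
  show "inv\<^bsub>Gt\<^esub> g \<in> ?R'" if "g \<in> ?R'" for g
    using that normal_inv[OF R, of "pr id g"] pr_inv[of id g] normal_GG[OF R] Gt.inv_one by (simp add: Gt_one)
  show "t \<circ> n \<circ> t \<in> ?R'" if t: "t \<in> gens" and n: "n \<in> ?R'" for t n
  proof -
    have s: "\<exists>s\<in>GG. s \<circ> pr id n \<circ> inv\<^bsub>Gt\<^esub> s = pr id (t \<circ> n \<circ> t)"
      if "s = pr s0 t" "s \<in> GG" "s0 \<circ> s0 = id" for s s0
    proof -
      have "s \<circ> s = id" using that(1,3) gens_self[OF t] by simp
      then have "inv\<^bsub>Gt\<^esub> s = s" using Gt_inv_eq[OF that(2,2)] by blast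
      then show ?thesis using that by (intro bexI[of _ s]) simp_all
    qed
    have a: "act_a \<circ> act_b \<circ> act_a = pr act_c act_a" by (subst act_pr(1)) simp
    have aG: "act_a \<circ> act_b \<circ> act_a \<in> GG" by simp
    from t consider "t = act_a" | "t = act_b" | "t = act_c" | "t = act_d" by (auto simp: gens_def)
    then have "\<exists>s\<in>GG. s \<circ> pr id n \<circ> inv\<^bsub>Gt\<^esub> s = pr id (t \<circ> n \<circ> t)"
    proof cases
      case 1 show ?thesis by (rule s[of "act_a \<circ> act_b \<circ> act_a" act_c]) (unfold 1, rule a, rule aG, simp)
    next
      case 2 show ?thesis by (rule s[of act_d id]) (unfold 2, rule act_pr(3), simp_all)
    next
      case 3 show ?thesis by (rule s[of act_b act_a]) (unfold 3, rule act_pr(1), simp_all)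
    next
      case 4 show ?thesis by (rule s[of act_c id]) (unfold 4, rule act_pr(2), simp_all)
    qed
    then obtain s where "s \<in> GG" "s \<circ> pr id n \<circ> inv\<^bsub>Gt\<^esub> s = pr id (t \<circ> n \<circ> t)" by blast
    then have "pr id (t \<circ> n \<circ> t) \<in> R" using normal_conj[OF R, of s "pr id n"] n by simp
    moreover have "t \<circ> n \<circ> t \<in> GG" using n gens_GG[OF t] by simp
    ultimately show ?thesis by simp
  qed
qed auto

text \<open>At the root the claim is that K is a normal closure. Below it, one passes to the normal
  subgroup of second coordinates, moving entries to the second half with a; this is why the vertices
  of x, of y and of k may be chosen independently on the level.\<close>

lemma Kt_at_vertex:
  "length \<sigma>1 = length \<sigma>2 \<Longrightarrow> R \<lhd> Gt \<Longrightarrow> at_vertex \<sigma>1 xx \<in> R \<Longrightarrow> at_vertex \<sigma>2 yy \<in> R \<Longrightarrow>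
    k \<in> Kt \<Longrightarrow> length \<sigma> = length \<sigma>1 \<Longrightarrow> at_vertex \<sigma> k \<in> R"
proof (induction \<sigma>1 \<sigma>2 arbitrary: R \<sigma> rule: list_induct2)
  case Nil
  have "Kt \<subseteq> R" unfolding Kt_def by (rule normal_closure_least) (use Nil in auto)
  then show ?case using Nil by auto
next
  case (Cons z1 \<sigma>1 z2 \<sigma>2)
  let ?R' = "{k \<in> GG. pr id k \<in> R}"
  have R: "R \<lhd> Gt" by fact
  have in': "u \<in> ?R'" if "pr id u \<in> R \<or> pr u id \<in> R" for u
  proof -
    have "pr id u \<in> R" using that normal_pr_swap[OF R] by blast
    then show ?thesis using pr_GG[of id u] normal_GG[OF R] by simp
  qed
  obtain z' \<sigma>' where s: "\<sigma> = z' # \<sigma>'" "length \<sigma>' = length \<sigma>1" using Cons.prems(5) by (cases \<sigma>) auto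
  have "at_vertex \<sigma>' k \<in> ?R'"
    by (rule Cons.IH[OF normal_second[OF R] _ _ Cons.prems(4) s(2)]; rule in')
      (use Cons.prems(2,3) bit_cases01[of z1] bit_cases01[of z2] in auto)
  then have "pr id (at_vertex \<sigma>' k) \<in> R" by simp
  then show ?case using bit_cases01[of z'] s(1) normal_pr_swap[OF R] by auto
qed

text \<open>With b = (a, c) and y = (b, b) the coordinates are the commutators of a with b and of c
  with b, and the latter commute.\<close>

lemma commutator_yy_b: "act_b \<circ> yy \<circ> act_b \<circ> yy = pr xx id"
proof -
  have "act_c \<circ> act_b \<circ> act_c \<circ> act_b = id" using bcd_commute(1) by (simp add: comp_assoc)
  then have "pr act_a act_c \<circ> pr act_b act_b \<circ> pr act_a act_c \<circ> pr act_b act_b = pr xx id"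
    by (simp add: xx_eq comp_assoc)
  then show ?thesis unfolding yy_pr act_pr(1)[symmetric] .
qed

lemma yy_self [simp]: "yy \<circ> yy = id"
  by (simp add: yy_pr)

lemma inv_xx: "inv\<^bsub>Gt\<^esub> xx = pr (act_a \<circ> act_c) (act_c \<circ> act_a)"
proof -
  have "act_b \<circ> act_a \<circ> act_b \<circ> act_a = pr (act_a \<circ> act_c) (act_c \<circ> act_a)"
    by (rule word_ext) (simp_all add: comp_apply)
  moreover have "act_b \<circ> act_a \<circ> act_b \<circ> act_a \<circ> xx = id" by (simp add: xx_eq comp_assoc)
  moreover have "act_b \<circ> act_a \<circ> act_b \<circ> act_a \<in> GG" by simp
  ultimately show ?thesis using Gt_inv_eq[of xx] by simp
qed

text \<open>With x = (ca, ac) and c = (1, d) the second coordinate is (ac) d (ca) d; as c commutes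
  with d this is adad.\<close>

lemma commutator_xx_c: "xx \<circ> act_c \<circ> inv\<^bsub>Gt\<^esub> xx \<circ> act_c = pr id yy"
proof -
  have "act_c \<circ> (act_d \<circ> act_c) = act_d" unfolding bcd_commute(3)[symmetric] by simp
  then have "act_c \<circ> (act_d \<circ> (act_c \<circ> k)) = act_d \<circ> k" for k :: "word \<Rightarrow> word" by (simp add: comp_assoc[symmetric])
  then have "pr (act_c \<circ> act_a) (act_a \<circ> act_c) \<circ> pr id act_d \<circ> pr (act_a \<circ> act_c) (act_c \<circ> act_a)
      \<circ> pr id act_d = pr id yy"
    by (simp add: yy_eq comp_assoc)
  then show ?thesis unfolding xx_pr[symmetric] inv_xx[symmetric] act_pr(2)[symmetric] .
qed

lemma Kt_pair: "k \<in> Kt \<Longrightarrow> k' \<in> Kt \<Longrightarrow> pr k k' \<in> Kt"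
proof -
  have "act_b \<circ> yy \<circ> act_b \<circ> yy \<in> Kt"
    by (intro normal_comp[OF Kt_normal] normal_conj_gen[OF Kt_normal] gens_mem Kt_xx)
  then have x: "at_vertex [1] xx \<in> Kt" unfolding commutator_yy_b using normal_pr_swap[OF Kt_normal] by simp
  have "act_c \<circ> inv\<^bsub>Gt\<^esub> xx \<circ> act_c \<in> Kt"
    by (intro normal_conj_gen[OF Kt_normal] gens_mem normal_inv[OF Kt_normal] Kt_xx)
  then have "xx \<circ> (act_c \<circ> inv\<^bsub>Gt\<^esub> xx \<circ> act_c) \<in> Kt" by (rule normal_comp[OF Kt_normal Kt_xx(1)])
  then have y: "at_vertex [1] yy \<in> Kt" using commutator_xx_c by (simp add: comp_assoc)
  assume k: "k \<in> Kt" "k' \<in> Kt"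
  have "at_vertex [0] k \<in> Kt" "at_vertex [1] k' \<in> Kt"
    by (rule Kt_at_vertex[OF _ Kt_normal x y]; simp add: k)+
  then have "pr k id \<in> Kt" "pr id k' \<in> Kt" by simp_all
  from normal_comp[OF Kt_normal this] show ?thesis by simp
qed

lemma copies_Kt: "copies m Kt \<subseteq> Kt"
  by (induction m) (auto simp: copies_Suc intro!: Kt_pair)

section \<open>The square of x and the groups N_m as geometric powers\<close>

lemma xx2_eq: "xx2 = xx \<circ> xx"
proof -
  have "xx2 = xx \<otimes>\<^bsub>Gt\<^esub> xx" by (simp add: xx2_def numeral_2_eq_2)
  then show ?thesis by (simp add: Gt_mult)
qed

lemma xx2_pr: "xx2 = pr zz zz"
proof -
  have "act_c \<circ> (act_a \<circ> (act_c \<circ> act_a)) = zz" using caca by (simp add: comp_assoc)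
  moreover have "act_a \<circ> (act_c \<circ> (act_a \<circ> act_c)) = zz" by (simp add: zz_def comp_assoc)
  ultimately show ?thesis unfolding xx2_eq xx_pr by (simp add: comp_assoc)
qed

lemma Kt_H2: "k \<in> Kt \<longleftrightarrow> k \<in> H2 \<and> ee k = 0"
  unfolding Kt_eq by (simp add: HI_def)

lemma H2_zz: "g \<in> H2 \<Longrightarrow> ee g = 1 \<Longrightarrow> g \<circ> zz \<in> Kt"
  unfolding Kt_H2 using normal_comp[OF H2_normal _ zz_H2] ssg_comp[of g zz 2 0] zz_H2 ee_zz
  by (simp add: H2_def)

text \<open>Membership in \<open>N1\<close> speaks of levels 0, 1, 2 of the sections; level 3
  follows from \<open>sg_sec_exchange\<close> and the equality from \<open>ee_sec\<close>.
  Conversely a pair with \<open>ee\<close> zero lies in K x K, and a pair with \<open>ee\<close> one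
  is brought there by x^2 = (\<open>zz\<close>, \<open>zz\<close>).\<close>

lemma pr_N1: "pr g h \<in> N1 \<longleftrightarrow> g \<in> H2 \<and> h \<in> H2 \<and> ee g = ee h"
proof
  assume p: "pr g h \<in> N1"
  then have pG: "pr g h \<in> GG" using N1_normal normal_GG by blast
  then have gh: "g \<in> GG" "h \<in> GG" using pr_GG[OF pG] by simp_all
  have p2: "pr g h \<in> H2" and g0: "sg 0 g = 0" "sg (Suc 0) g = 0" "sg 2 g = 0"
    using p by (auto simp: N1_def HI_def)
  have h0: "sg 0 h = 0" "sg (Suc 0) h = 0" "sg 2 h = 0"
    using H2_sec[OF p2, of 0] H2_sec[OF p2, of "Suc 0"] H2_sec[OF p2, of 2] g0 by simp_all
  show "g \<in> H2 \<and> h \<in> H2 \<and> ee g = ee h"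
    using sg_sec_exchange[OF pG] ee_sec[OF pG] g0 h0 gh by (simp add: H2_def)
next
  assume a: "g \<in> H2 \<and> h \<in> H2 \<and> ee g = ee h"
  have pG: "pr g h \<in> GG"
  proof (cases "ee g = 0")
    case True
    then have "pr g h \<in> Kt" using a by (intro Kt_pair) (simp_all add: Kt_H2)
    then show ?thesis using Kt_normal normal_GG by blast
  next
    case False
    then have e: "ee g = 1" "ee h = 1" using a by simp_all
    have "pr (g \<circ> zz) (h \<circ> zz) \<in> Kt" using e a by (intro Kt_pair H2_zz) auto
    then have "pr (g \<circ> zz) (h \<circ> zz) \<in> GG" using Kt_normal normal_GG by blast
    moreover have "xx2 \<in> GG" by (simp add: xx2_eq)
    ultimately have "pr (g \<circ> zz) (h \<circ> zz) \<circ> xx2 \<in> GG" by (rule GG_comp)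
    then show ?thesis by (simp add: xx2_pr comp_assoc)
  qed
  then show "pr g h \<in> N1" using a by (simp add: N1_def HI_def H2_def sg.simps(2) sg_numeral)
qed

lemma N1_pr:
  assumes "g \<in> N1"
  obtains g0 g1 where "g = pr g0 g1" "g0 \<in> H2" "g1 \<in> H2" "ee g0 = ee g1"
proof -
  have "g \<in> GG" "sg 0 g = 0" using assms by (auto simp: N1_def HI_def H2_def)
  then obtain g0 g1 where "g = pr g0 g1" by (rule GG_pr_obtain)
  then show thesis using that assms pr_N1 by blast
qed

lemma N1_Kt: "N1 \<subseteq> Kt"
  by (auto simp: Kt_H2 N1_def HI_def)

text \<open>The entries of a geometric power of T are at first only known to give bijections. For
  bijections the product of \<open>Gt\<close> is already composition, even outside its
  carrier.\<close>

lemma set_mult_bij: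
  assumes A: "\<And>g. g \<in> A \<Longrightarrow> bij g" and B: "\<And>g. g \<in> B \<Longrightarrow> bij g"
  shows "A <#>\<^bsub>Gt\<^esub> B = {g \<circ> h | g h. g \<in> A \<and> h \<in> B}"
proof -
  have "A <#>\<^bsub>Gt\<^esub> B = (\<Union>g\<in>A. \<Union>h\<in>B. {g \<circ> h})"
    unfolding set_mult_def by (intro SUP_cong refl) (simp add: Gt_mult_bij A B)
  also have "\<dots> = {g \<circ> h | g h. g \<in> A \<and> h \<in> B}" by blast
  finally show ?thesis .
qed

lemma copies_bij: "(\<And>g. g \<in> Q \<Longrightarrow> bij g) \<Longrightarrow> g \<in> copies m Q \<Longrightarrow> bij g"
proof (induction m arbitrary: g)
  case (Suc m)
  from Suc.prems(2) obtain g0 g1 where g: "g = pr g0 g1" "g0 \<in> copies m Q" "g1 \<in> copies m Q"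
    by (rule copies_SucE)
  have b: "bij g0" "bij g1" using Suc g by auto
  have "g0 \<circ> inv_into UNIV g0 = id" "inv_into UNIV g0 \<circ> g0 = id" "g1 \<circ> inv_into UNIV g1 = id" "inv_into UNIV g1 \<circ> g1 = id"
    using b by (simp_all add: fun_eq_iff comp_apply id_apply bij_is_surj bij_is_inj surj_f_inv_f inv_f_f)
  then have "pr (inv_into UNIV g0) (inv_into UNIV g1) \<circ> pr g0 g1 = id" "pr g0 g1 \<circ> pr (inv_into UNIV g0) (inv_into UNIV g1) = id" by simp_all
  then show ?case unfolding g(1) using o_bij by blast
qed simp

lemma Tt_normal: "Tt \<lhd> Gt"
  unfolding Tt_def by (rule normal_closure_normal) (simp add: xx2_eq)

lemma xx2_N1: "xx2 \<in> N1"
  by (simp add: xx2_pr pr_N1 zz_H2)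

lemma Tt_N1: "Tt \<subseteq> N1"
  unfolding Tt_def by (rule normal_closure_least[OF N1_normal]) (simp add: xx2_N1)

lemma xx2_Tt: "xx2 \<in> Tt"
  unfolding Tt_def using normal_closure_incl[of "{xx2}"] by simp

text \<open>A pair in \<open>N1\<close> has both entries in K or both in the coset of
  \<open>zz\<close>, and x^2 = (\<open>zz\<close>, \<open>zz\<close>) exchanges these kinds. All of
  T lies in \<open>N1\<close> since x^2 does.\<close>

lemma Nt_1: "Nt (Suc 0) = N1"
proof -
  have bK: "bij g" if "g \<in> copies (Suc 0) Kt" for g
    by (rule GG_bij[OF normal_GG[OF Kt_normal subsetD[OF copies_Kt that]]])
  have bT: "bij g" if "g \<in> Tt" for g by (rule GG_bij[OF normal_GG[OF Tt_normal that]])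
  have "Nt (Suc 0) = {g \<circ> h | g h. g \<in> copies (Suc 0) Kt \<and> h \<in> Tt}"
    unfolding Nt_def diff_Suc_1 copies_0 using set_mult_bij[OF bK bT] by simp
  also have "\<dots> = N1"
  proof
    show "{g \<circ> h | g h. g \<in> copies (Suc 0) Kt \<and> h \<in> Tt} \<subseteq> N1"
    proof
      fix p assume "p \<in> {g \<circ> h | g h. g \<in> copies (Suc 0) Kt \<and> h \<in> Tt}"
      then obtain k k' h where p: "p = pr k k' \<circ> h" "k \<in> Kt" "k' \<in> Kt" "h \<in> Tt" by (auto simp: copies_Suc)
      have "pr k k' \<in> N1" using p(2,3) by (simp add: pr_N1 Kt_H2)
      then show "p \<in> N1" unfolding p(1) using p(4) Tt_N1 by (blast intro: normal_comp[OF N1_normal])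
    qed
    show "N1 \<subseteq> {g \<circ> h | g h. g \<in> copies (Suc 0) Kt \<and> h \<in> Tt}"
    proof
      fix p assume "p \<in> N1"
      then obtain g h where p: "p = pr g h" "g \<in> H2" "h \<in> H2" "ee g = ee h" by (rule N1_pr)
      show "p \<in> {g \<circ> h | g h. g \<in> copies (Suc 0) Kt \<and> h \<in> Tt}"
      proof (cases "ee g = 0")
        case True
        then have "pr g h \<in> copies (Suc 0) Kt" using p by (auto simp: copies_Suc Kt_H2)
        moreover have "p = pr g h \<circ> id" using p(1) by simp
        ultimately show ?thesis using normal_id[OF Tt_normal] by blast
      next
        case False
        then have e: "ee g = 1" "ee h = 1" using p by simp_all
        have "pr (g \<circ> zz) (h \<circ> zz) \<in> copies (Suc 0) Kt" using H2_zz e p by (auto simp: copies_Suc)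
        moreover have "p = pr (g \<circ> zz) (h \<circ> zz) \<circ> xx2" unfolding p(1) xx2_pr by (simp add: comp_assoc)
        ultimately show ?thesis using xx2_Tt by blast
      qed
    qed
  qed
  finally show ?thesis .
qed

text \<open>Products of geometric powers are formed coordinatewise, so the first level determines
  all others. From here on N_m is handled as a geometric power of a single subgroup.\<close>

theorem Nt_Suc: "Nt (Suc m) = copies m N1"
proof -
  have bK: "bij g" if "g \<in> copies n Kt" for g n
    by (rule GG_bij[OF normal_GG[OF Kt_normal subsetD[OF copies_Kt that]]])
  have bT: "bij g" if "g \<in> copies n Tt" for g n
    by (rule copies_bij[OF _ that]) (rule GG_bij[OF normal_GG[OF Tt_normal]])
  have N: "Nt (Suc n) = {g \<circ> h | g h. g \<in> copies (Suc n) Kt \<and> h \<in> copies n Tt}" for n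
    unfolding Nt_def diff_Suc_1 by (rule set_mult_bij[OF bK bT])
  show ?thesis
  proof (induction m)
    case 0
    then show ?case by (simp add: Nt_1)
  next
    case (Suc m)
    have "Nt (Suc (Suc m)) = {pr g h | g h. g \<in> Nt (Suc m) \<and> h \<in> Nt (Suc m)}"
    proof
      show "Nt (Suc (Suc m)) \<subseteq> {pr g h | g h. g \<in> Nt (Suc m) \<and> h \<in> Nt (Suc m)}"
        unfolding N copies_Suc[of "Suc m"] copies_Suc[of m Tt] by fastforce
      show "{pr g h | g h. g \<in> Nt (Suc m) \<and> h \<in> Nt (Suc m)} \<subseteq> Nt (Suc (Suc m))"
      proof
        fix p assume "p \<in> {pr g h | g h. g \<in> Nt (Suc m) \<and> h \<in> Nt (Suc m)}"
        then obtain k k' t t' where p: "p = pr (k \<circ> t) (k' \<circ> t')" "k \<in> copies (Suc m) Kt"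
          "k' \<in> copies (Suc m) Kt" "t \<in> copies m Tt" "t' \<in> copies m Tt"
          unfolding N by blast
        have "p = pr k k' \<circ> pr t t'" using p(1) by simp
        then show "p \<in> Nt (Suc (Suc m))"
          unfolding N using p copies_SucI[of k "Suc m" Kt k'] copies_SucI[of t m Tt t'] by blast
      qed
    qed
    then show ?case unfolding Suc.IH copies_Suc[of m N1] .
  qed
qed

section \<open>The series inside a block\<close>

lemma id_copies: "id \<in> Q \<Longrightarrow> id \<in> copies m Q"
proof (induction m)
  case (Suc m)
  then have "pr id id \<in> copies (Suc m) Q" by (intro copies_SucI) auto
  then show ?case by simp
qed simp

lemma copies_N1_Kt: "copies m N1 \<subseteq> Kt"
  using copies_mono[OF N1_Kt] copies_Kt by blast

lemma copies_N1_GG: "g \<in> copies m N1 \<Longrightarrow> g \<in> GG"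
  using copies_N1_Kt normal_GG[OF Kt_normal] by blast

lemma copies_N1_inv: "g \<in> copies m N1 \<Longrightarrow> inv\<^bsub>Gt\<^esub> g \<in> copies m N1"
proof (induction m arbitrary: g)
  case 0
  then show ?case using normal_inv[OF N1_normal] by simp
next
  case (Suc m)
  from Suc.prems obtain g0 g1 where g: "g = pr g0 g1" "g0 \<in> copies m N1" "g1 \<in> copies m N1"
    by (rule copies_SucE)
  show ?case
    unfolding g(1) pr_inv[OF copies_N1_GG[OF Suc.prems, unfolded g(1)]]
    by (intro copies_SucI Suc.IH g)
qed

lemma copies_N1_comp: "g \<in> copies m N1 \<Longrightarrow> h \<in> copies m N1 \<Longrightarrow> g \<circ> h \<in> copies m N1"
  by (rule copies_comp[OF normal_comp[OF N1_normal]])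

lemma copies_N1_conj: "t \<in> gens \<Longrightarrow> g \<in> copies m N1 \<Longrightarrow> t \<circ> g \<circ> t \<in> copies m N1"
  by (rule conj_copies[OF normal_conj_gen[OF N1_normal]])

lemma N1_copies_H2: "N1 \<subseteq> copies (Suc 0) H2"
proof
  fix p assume "p \<in> N1"
  then obtain g h where "p = pr g h" "g \<in> H2" "h \<in> H2" by (rule N1_pr)
  then show "p \<in> copies (Suc 0) H2" by (simp add: copies_Suc)
qed

lemma copies_N1_H2: "g \<in> copies m N1 \<Longrightarrow> g \<in> copies (Suc m) H2"
  unfolding copies_Suc_inner[of m H2] using copies_mono[OF N1_copies_H2] by blast

lemma copies_Kt_N1: "g \<in> copies (Suc m) Kt \<Longrightarrow> g \<in> copies m N1"
proof -
  have "copies (Suc 0) Kt \<subseteq> N1" by (auto simp: copies_Suc pr_N1 Kt_H2)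
  then show "g \<in> copies (Suc m) Kt \<Longrightarrow> g \<in> copies m N1"
    unfolding copies_Suc_inner[of m Kt] using copies_mono by blast
qed

text \<open>For \<open>g\<close> in N_(n+1) and words of length n + 1 the section lies in
  \<open>H2\<close>, where these parities are additive. k = 0 gives \<alpha>, being 1 on x and 0 on
  y, and k = 1 gives \<beta>.\<close>

definition val :: "nat \<Rightarrow> (word \<Rightarrow> word) \<Rightarrow> word \<Rightarrow> bit" where
  "val k g \<sigma> = sg k (sec 0 (secw \<sigma> g))"

text \<open>The coordinate \<gamma>, on words one letter shorter: both entries of x^2 =
  (\<open>zz\<close>, \<open>zz\<close>) have \<open>ee\<close> equal to 1. By \<open>N1_sec\<close>
  the entry at 1 would give the same value.\<close>

definition val2 :: "(word \<Rightarrow> word) \<Rightarrow> word \<Rightarrow> bit" where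
  "val2 g \<tau> = ee (sec 0 (secw \<tau> g))"

definition vals :: "nat \<Rightarrow> (word \<Rightarrow> word) \<Rightarrow> (word \<Rightarrow> bit) \<Rightarrow> (word \<Rightarrow> bit) \<Rightarrow> (word \<Rightarrow> bit) \<Rightarrow> bool" where
  "vals n g f0 f1 f2 \<longleftrightarrow> g \<in> copies n N1 \<and>
    (\<forall>\<sigma>. length \<sigma> = Suc n \<longrightarrow> val 0 g \<sigma> = f0 \<sigma> \<and> val (Suc 0) g \<sigma> = f1 \<sigma>) \<and>
    (\<forall>\<tau>. length \<tau> = n \<longrightarrow> val2 g \<tau> = f2 \<tau>)"

lemma vals_self: "g \<in> copies n N1 \<Longrightarrow> vals n g (val 0 g) (val (Suc 0) g) (val2 g)"
  by (simp add: vals_def)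

lemma vals_copies: "vals n g f0 f1 f2 \<Longrightarrow> g \<in> copies n N1"
  by (simp add: vals_def)

lemma copies_UNIV: "g \<in> copies n Q \<Longrightarrow> g \<in> copies n UNIV"
  using copies_mono[of Q UNIV n] by auto

lemma val_comp:
  assumes "g \<in> copies n N1" "h \<in> copies n N1" "length \<sigma> = Suc n"
  shows "val k (g \<circ> h) \<sigma> = val k g \<sigma> + val k h \<sigma>"
proof -
  have gh: "g \<in> copies (length \<sigma>) H2" "h \<in> copies (length \<sigma>) H2" using assms copies_N1_H2 by simp_all
  have "secw \<sigma> (g \<circ> h) = secw \<sigma> g \<circ> secw \<sigma> h" by (rule secw_comp[OF copies_UNIV[OF gh(1)] copies_UNIV[OF gh(2)]])
  then show ?thesis
    using secw_copies[OF gh(1)] secw_copies[OF gh(2)] ssg_comp[of "secw \<sigma> g" "secw \<sigma> h" k 0]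
    by (simp add: val_def H2_def)
qed

lemma N1_sec: "q \<in> N1 \<Longrightarrow> sec z q \<in> H2 \<and> ee (sec z q) = ee (sec 0 q)"
  using bit_cases01[of z] by (auto elim!: N1_pr)

lemma val2_comp:
  assumes "g \<in> copies n N1" "h \<in> copies n N1" "length \<tau> = n"
  shows "val2 (g \<circ> h) \<tau> = val2 g \<tau> + val2 h \<tau>"
proof -
  have gh: "g \<in> copies (length \<tau>) N1" "h \<in> copies (length \<tau>) N1" using assms by simp_all
  have e: "secw \<tau> (g \<circ> h) = secw \<tau> g \<circ> secw \<tau> h"
    by (rule secw_comp[OF copies_UNIV[OF gh(1)] copies_UNIV[OF gh(2)]])
  have q: "secw \<tau> g \<in> N1" "secw \<tau> h \<in> N1" using secw_copies gh by blast+
  have qq: "secw \<tau> g \<in> GG" "secw \<tau> h \<in> GG" "sg 0 (secw \<tau> h) = 0"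
    using q by (simp_all add: N1_def HI_def H2_def)
  have s: "sec 0 (secw \<tau> g \<circ> secw \<tau> h) = sec 0 (secw \<tau> g) \<circ> sec 0 (secw \<tau> h)"
    using sec_comp[OF qq(1,2), of 0] qq(3) by simp
  show ?thesis unfolding val2_def e s
    using N1_sec[OF q(1), of 0] N1_sec[OF q(2), of 0] by (intro ssg_comp) (auto simp: H2_def)
qed

lemma val_id: "val k id \<sigma> = 0" and val2_id: "val2 id \<tau> = 0"
proof -
  have "secw \<sigma> id = id" for \<sigma> by (induction \<sigma>) simp_all
  then show "val k id \<sigma> = 0" "val2 id \<tau> = 0" by (simp_all add: val_def val2_def)
qed

lemma vals_id: "vals n id (\<lambda>_. 0) (\<lambda>_. 0) (\<lambda>_. 0)"
  by (simp add: vals_def val_id val2_id id_copies normal_id[OF N1_normal])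

lemma vals_comp:
  "vals n g f0 f1 f2 \<Longrightarrow> vals n h k0 k1 k2 \<Longrightarrow>
    vals n (g \<circ> h) (\<lambda>\<sigma>. f0 \<sigma> + k0 \<sigma>) (\<lambda>\<sigma>. f1 \<sigma> + k1 \<sigma>) (\<lambda>\<sigma>. f2 \<sigma> + k2 \<sigma>)"
  by (simp add: vals_def val_comp[of g n h] val2_comp[of g n h] copies_N1_comp)

lemma vals_inv: "vals n g f0 f1 f2 \<Longrightarrow> vals n (inv\<^bsub>Gt\<^esub> g) f0 f1 f2"
proof -
  assume v: "vals n g f0 f1 f2"
  then have g: "g \<in> copies n N1" by (rule vals_copies)
  have i: "inv\<^bsub>Gt\<^esub> g \<circ> g = id" using copies_N1_GG[OF g] by (rule Gt_inv_comp)
  have "val k (inv\<^bsub>Gt\<^esub> g) \<sigma> = val k g \<sigma>" if "length \<sigma> = Suc n" for k \<sigma>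
    using val_comp[OF copies_N1_inv[OF g] g that, of k] unfolding i val_id by (metis bit_add_eq_0)
  moreover have "val2 (inv\<^bsub>Gt\<^esub> g) \<sigma> = val2 g \<sigma>" if "length \<sigma> = n" for \<sigma>
    using val2_comp[OF copies_N1_inv[OF g] g that] unfolding i val2_id by (metis bit_add_eq_0)
  ultimately show ?thesis using v copies_N1_inv[OF g] by (simp add: vals_def)
qed

lemma length_gens: "t \<in> gens \<Longrightarrow> length (t \<sigma>) = length \<sigma>"
  by (auto simp: gens_def)

text \<open>The parities involved do not change when a section is conjugated, so conjugation only
  moves the coordinates along the permutation of the vertices.\<close>

lemma vals_conj:
  assumes v: "vals n g f0 f1 f2" and t: "t \<in> gens"
  shows "vals n (t \<circ> g \<circ> t) (\<lambda>\<sigma>. f0 (t \<sigma>)) (\<lambda>\<sigma>. f1 (t \<sigma>)) (\<lambda>\<sigma>. f2 (t \<sigma>))"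
proof -
  have g: "g \<in> copies n N1" using v by (rule vals_copies)
  have a: "val k (t \<circ> g \<circ> t) \<sigma> = val k g (t \<sigma>)" if l: "length \<sigma> = Suc n" and k: "k \<in> {0, Suc 0, 2}" for k \<sigma>
  proof -
    have gl: "g \<in> copies (length \<sigma>) H2" using copies_N1_H2[OF g] l by simp
    have "\<exists>t'\<in>insert id gens. secw \<sigma> (t \<circ> g \<circ> t) = t' \<circ> secw (t \<sigma>) g \<circ> t'"
      by (rule conj_copies_secw[OF _ copies_UNIV[OF gl]]) (simp add: t)
    then obtain t' where t': "t' \<in> insert id gens" "secw \<sigma> (t \<circ> g \<circ> t) = t' \<circ> secw (t \<sigma>) g \<circ> t'" by blast
    have q: "secw (t \<sigma>) g \<in> H2" by (rule secw_copies) (simp add: gl length_gens[OF t])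
    show ?thesis
    proof (cases "t' = id")
      case True then show ?thesis unfolding val_def t'(2) by simp
    next
      case False
      then show ?thesis unfolding val_def t'(2) using ssg_conj[OF q _ k] t'(1) by simp
    qed
  qed
  have b: "val2 (t \<circ> g \<circ> t) \<tau> = val2 g (t \<tau>)" if l: "length \<tau> = n" for \<tau>
  proof -
    have gl: "g \<in> copies (length \<tau>) N1" using g l by simp
    have "\<exists>t'\<in>insert id gens. secw \<tau> (t \<circ> g \<circ> t) = t' \<circ> secw (t \<tau>) g \<circ> t'"
      by (rule conj_copies_secw[OF _ copies_UNIV[OF gl]]) (simp add: t)
    then obtain t' where t': "t' \<in> insert id gens" "secw \<tau> (t \<circ> g \<circ> t) = t' \<circ> secw (t \<tau>) g \<circ> t'" by blast
    have "secw (t \<tau>) g \<in> N1" by (rule secw_copies) (simp add: gl length_gens[OF t])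
    then obtain q0 q1 where q: "secw (t \<tau>) g = pr q0 q1" "q0 \<in> H2" "q1 \<in> H2" "ee q0 = ee q1" by (rule N1_pr)
    show ?thesis
    proof (cases "t' = id")
      case True then show ?thesis unfolding val2_def t'(2) by simp
    next
      case False
      then have "t' \<in> gens" using t'(1) by simp
      then show ?thesis
      proof (cases rule: gens_cases)
        case 1 then show ?thesis unfolding val2_def t'(2) q(1) using q(4) by simp
      next
        case (2 t0 t1)
        then show ?thesis unfolding val2_def t'(2) q(1) using ssg_conj[OF q(2), of t0 2] by auto
      qed
    qed
  qed
  show ?thesis using v copies_N1_conj[OF t g] length_gens[OF t] by (simp add: vals_def a b)
qed

text \<open>Vanishing \<gamma> puts both entries below each word of length \<open>n\<close> into K;
  vanishing \<alpha> and \<beta> then put them into \<open>N1\<close>.\<close>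

lemma vals_ker:
  assumes "vals n g (\<lambda>_. 0) (\<lambda>_. 0) (\<lambda>_. 0)"
  shows "g \<in> copies (Suc n) N1"
proof -
  have g: "g \<in> copies n N1" and v: "length \<sigma> = Suc n \<Longrightarrow> val 0 g \<sigma> = 0 \<and> val (Suc 0) g \<sigma> = 0"
    "length \<tau> = n \<Longrightarrow> val2 g \<tau> = 0" for \<sigma> \<tau> using assms by (auto simp: vals_def)
  have "g \<in> copies n (copies (Suc 0) N1)"
  proof (rule secw_imp_copies[OF g])
    fix \<tau> :: word assume l: "length \<tau> = n"
    then have "secw \<tau> g \<in> N1" using secw_copies[of g \<tau> N1] g by simp
    then obtain q0 q1 where q: "secw \<tau> g = pr q0 q1" "q0 \<in> H2" "q1 \<in> H2" "ee q0 = ee q1" by (rule N1_pr)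
    have "ee q0 = 0" using v(2)[OF l] q(1) by (simp add: val2_def)
    moreover have "sg 0 (sec 0 q0) = 0 \<and> sg (Suc 0) (sec 0 q0) = 0"
      using v(1)[of "\<tau> @ [0]"] l q(1) by (simp add: val_def secw_append)
    moreover have "sg 0 (sec 0 q1) = 0 \<and> sg (Suc 0) (sec 0 q1) = 0"
      using v(1)[of "\<tau> @ [1]"] l q(1) by (simp add: val_def secw_append)
    ultimately have "q0 \<in> N1" "q1 \<in> N1" using q by (simp_all add: N1_def HI_def)
    then show "secw \<tau> g \<in> copies (Suc 0) N1" unfolding q(1) by (intro copies_SucI) simp_all
  qed
  then show ?thesis by (simp add: copies_Suc_inner[of n])
qed

lemma vals_of_ker:
  assumes "g \<in> copies (Suc n) N1"
  shows "vals n g (\<lambda>_. 0) (\<lambda>_. 0) (\<lambda>_. 0)"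
proof -
  have gK: "g \<in> copies (Suc n) Kt" using assms copies_mono[OF N1_Kt] by blast
  have s: "secw \<sigma> g \<in> N1" if "length \<sigma> = Suc n" for \<sigma>
    by (rule secw_copies) (simp add: assms that)
  have "val2 g \<tau> = 0" if "length \<tau> = n" for \<tau>
    using s[of "\<tau> @ [0]"] that by (simp add: secw_append val2_def N1_def HI_def)
  then show ?thesis using copies_Kt_N1[OF gK] s by (simp add: vals_def val_def N1_def HI_def)
qed

lemma vals_cong:
  "vals n g f0 f1 f2 \<Longrightarrow> (\<And>\<sigma>. length \<sigma> = Suc n \<Longrightarrow> f0 \<sigma> = k0 \<sigma>) \<Longrightarrow>
    (\<And>\<sigma>. length \<sigma> = Suc n \<Longrightarrow> f1 \<sigma> = k1 \<sigma>) \<Longrightarrow> (\<And>\<sigma>. length \<sigma> = n \<Longrightarrow> f2 \<sigma> = k2 \<sigma>) \<Longrightarrow> vals n g k0 k1 k2"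
  by (simp add: vals_def)

lemma vals_quot:
  assumes "vals n g f0 f1 f2" "vals n h f0 f1 f2"
  shows "inv\<^bsub>Gt\<^esub> h \<circ> g \<in> copies (Suc n) N1"
  by (rule vals_ker, rule vals_cong[OF vals_comp[OF vals_inv[OF assms(2)] assms(1)]]) simp_all

lemma vals_commutator:
  assumes v: "vals n g f0 f1 f2" and t: "t \<in> gens"
  shows "vals n (commutator Gt g t) (\<lambda>\<sigma>. f0 (t \<sigma>) + f0 \<sigma>) (\<lambda>\<sigma>. f1 (t \<sigma>) + f1 \<sigma>) (\<lambda>\<sigma>. f2 (t \<sigma>) + f2 \<sigma>)"
proof -
  have g: "g \<in> GG" using copies_N1_GG[OF vals_copies[OF v]] .
  have "commutator Gt g t = g \<circ> (t \<circ> inv\<^bsub>Gt\<^esub> g \<circ> t)"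
    using commutator_Gt[OF g gens_GG[OF t]] gens_inv[OF t] by (simp add: comp_assoc)
  then show ?thesis
    using vals_cong[OF vals_comp[OF v vals_conj[OF vals_inv[OF v] t]]] by (simp add: add.commute)
qed

text \<open>The tuple with \<open>u\<close> at the vertices where \<open>f\<close> is 1 and trivial
  entries elsewhere: the way back from functions to group elements.\<close>

fun fp :: "nat \<Rightarrow> (word \<Rightarrow> word) \<Rightarrow> (word \<Rightarrow> bit) \<Rightarrow> word \<Rightarrow> word" where
  "fp 0 u f = (if f [] = 1 then u else id)"
| "fp (Suc m) u f = pr (fp m u (\<lambda>\<sigma>. f (0 # \<sigma>))) (fp m u (\<lambda>\<sigma>. f (1 # \<sigma>)))"

lemma fp_copies: "u \<in> Q \<Longrightarrow> id \<in> Q \<Longrightarrow> fp m u f \<in> copies m Q"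
  by (induction m arbitrary: f) (simp_all add: copies_SucI)

lemma secw_fp: "secw \<sigma> (fp (length \<sigma>) u f) = (if f \<sigma> = 1 then u else id)"
proof (induction \<sigma> arbitrary: f)
  case (Cons z \<sigma>)
  then show ?case using bit_cases01[of z] by auto
qed simp

lemma fp_square: "fp m u f \<circ> fp m u f = fp m (u \<circ> u) f"
  by (induction m arbitrary: f) simp_all

lemma fp_id [simp]: "fp m id f = id"
  by (induction m arbitrary: f) simp_all

lemma fp_zero [simp]: "fp m u (\<lambda>\<sigma>. 0) = id"
  by (induction m) simp_all

lemma at_vertex_fp: "at_vertex \<sigma> u = fp (length \<sigma>) u (\<lambda>\<tau>. if \<tau> = \<sigma> then 1 else 0)"
proof (induction \<sigma>)
  case (Cons z \<sigma>)
  then show ?case using bit_cases01[of z] by auto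
qed simp

lemma fp_Kt: "fp (Suc n) xx f \<in> copies n N1" "fp (Suc n) yy f \<in> copies n N1"
  by (intro copies_Kt_N1 fp_copies Kt_xx normal_id[OF Kt_normal])+

lemma xx_vals [simp]: "sg 0 (sec 0 xx) = 1" "sg (Suc 0) (sec 0 xx) = 0" "ee xx = 0"
  unfolding xx_pr by (simp_all add: sg_comp)

lemma yy_vals [simp]: "sg 0 (sec 0 yy) = 0" "sg (Suc 0) (sec 0 yy) = 1" "ee yy = 0"
  unfolding yy_pr by simp_all

lemma zz_vals [simp]: "sg 0 (sec 0 zz) = 0" "sg (Suc 0) (sec 0 zz) = 0" "ee zz = 1"
  unfolding zz_pr by simp_all

lemma vals_X: "vals n (fp (Suc n) xx f) f (\<lambda>_. 0) (\<lambda>_. 0)"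
  unfolding vals_def
proof (intro conjI allI impI)
  show "val 0 (fp (Suc n) xx f) \<sigma> = f \<sigma>" "val (Suc 0) (fp (Suc n) xx f) \<sigma> = 0" if "length \<sigma> = Suc n" for \<sigma>
    unfolding val_def that[symmetric] secw_fp using bit_cases01[of "f \<sigma>"] by auto
  show "val2 (fp (Suc n) xx f) \<tau> = 0" if "length \<tau> = n" for \<tau>
    unfolding val2_def secw_append[of \<tau> 0, symmetric] using secw_fp[of "\<tau> @ [0]" xx f] that by simp
qed (rule fp_Kt)

lemma vals_Y: "vals n (fp (Suc n) yy f) (\<lambda>_. 0) f (\<lambda>_. 0)"
  unfolding vals_def
proof (intro conjI allI impI)
  show "val 0 (fp (Suc n) yy f) \<sigma> = 0" "val (Suc 0) (fp (Suc n) yy f) \<sigma> = f \<sigma>" if "length \<sigma> = Suc n" for \<sigma>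
    unfolding val_def that[symmetric] secw_fp using bit_cases01[of "f \<sigma>"] by auto
  show "val2 (fp (Suc n) yy f) \<tau> = 0" if "length \<tau> = n" for \<tau>
    unfolding val2_def secw_append[of \<tau> 0, symmetric] using secw_fp[of "\<tau> @ [0]" yy f] that by simp
qed (rule fp_Kt)

lemma vals_Z: "vals n (fp n xx2 f) (\<lambda>_. 0) (\<lambda>_. 0) f"
  unfolding vals_def
proof (intro conjI allI impI)
  have s: "secw \<tau> (fp n xx2 f) = (if f \<tau> = 1 then xx2 else id)" if "length \<tau> = n" for \<tau>
    using secw_fp[of \<tau> xx2 f] that by simp
  show "val2 (fp n xx2 f) \<tau> = f \<tau>" if "length \<tau> = n" for \<tau>
    unfolding val2_def s[OF that] using bit_cases01[of "f \<tau>"] by (auto simp: xx2_pr)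
  have z: "secw \<sigma> (fp n xx2 f) \<in> {zz, id}" if "length \<sigma> = Suc n" for \<sigma>
  proof -
    obtain \<tau> z where t: "\<sigma> = \<tau> @ [z]" "length \<tau> = n" using \<open>length \<sigma> = Suc n\<close> by (metis length_Suc_conv_rev)
    show ?thesis unfolding t(1) secw_append s[OF t(2)] using bit_cases01[of z] by (auto simp: xx2_pr)
  qed
  show "val 0 (fp n xx2 f) \<sigma> = 0" "val (Suc 0) (fp n xx2 f) \<sigma> = 0" if "length \<sigma> = Suc n" for \<sigma>
    using z[OF that] by (auto simp: val_def)
  show "fp n xx2 f \<in> copies n N1" by (rule fp_copies[OF xx2_N1 normal_id[OF N1_normal]])
qed

lemma vals_XYZ:
  "vals n (fp (Suc n) xx f0 \<circ> fp (Suc n) yy f1 \<circ> fp n xx2 f2) f0 f1 f2"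
  by (rule vals_cong[OF vals_comp[OF vals_comp[OF vals_X vals_Y] vals_Z]]) simp_all

text \<open>The candidate at offset \<open>r\<close> in the block of N_m, where m = n + 1. The
  quotient \<open>r div 2\<close> covers even and odd offsets at once.\<close>

definition HB :: "nat \<Rightarrow> nat \<Rightarrow> (word \<Rightarrow> word) set" where
  "HB n r = {g \<in> copies n N1. Wfil (Suc n) r (val 0 g) \<and> Wfil (Suc n) r (val (Suc 0) g) \<and>
     Wfil n (r div 2) (val2 g)}"

lemma HB_vals:
  assumes "vals n g f0 f1 f2"
  shows "g \<in> HB n r \<longleftrightarrow> Wfil (Suc n) r f0 \<and> Wfil (Suc n) r f1 \<and> Wfil n (r div 2) f2"
proof -
  have v: "length \<sigma> = Suc n \<Longrightarrow> val 0 g \<sigma> = f0 \<sigma>" "length \<sigma> = Suc n \<Longrightarrow> val (Suc 0) g \<sigma> = f1 \<sigma>"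
    "length \<sigma> = n \<Longrightarrow> val2 g \<sigma> = f2 \<sigma>" for \<sigma> using assms by (simp_all add: vals_def)
  show ?thesis
    using vals_copies[OF assms] Wfil_cong[OF v(1)] Wfil_cong[OF v(2)] Wfil_cong[OF v(3)] by (simp add: HB_def)
qed

lemma HB_copies: "g \<in> HB n r \<Longrightarrow> g \<in> copies n N1" by (simp add: HB_def)

lemma HB_obtain:
  assumes "g \<in> HB n r"
  obtains f0 f1 f2 where "vals n g f0 f1 f2" "Wfil (Suc n) r f0" "Wfil (Suc n) r f1" "Wfil n (r div 2) f2"
  using vals_self[OF HB_copies[OF assms]] assms that by (auto simp: HB_def)

lemma HB_normal: "HB n r \<lhd> Gt"
proof (rule normal_gensI[OF subgroup_GtI])
  show "HB n r \<subseteq> GG" using HB_copies copies_N1_GG by blast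
  show "id \<in> HB n r" by (simp add: HB_vals[OF vals_id])
  show "g \<circ> h \<in> HB n r" if "g \<in> HB n r" "h \<in> HB n r" for g h
    using that(1)
  proof (rule HB_obtain)
    fix f0 f1 f2 assume f: "vals n g f0 f1 f2" "Wfil (Suc n) r f0" "Wfil (Suc n) r f1" "Wfil n (r div 2) f2"
    show ?thesis using that(2)
    proof (rule HB_obtain)
      fix k0 k1 k2 assume k: "vals n h k0 k1 k2" "Wfil (Suc n) r k0" "Wfil (Suc n) r k1" "Wfil n (r div 2) k2"
      show ?thesis unfolding HB_vals[OF vals_comp[OF f(1) k(1)]] by (intro conjI Wfil_add f k)
    qed
  qed
  show "inv\<^bsub>Gt\<^esub> g \<in> HB n r" if "g \<in> HB n r" for g
    using that by (rule HB_obtain) (simp add: HB_vals[OF vals_inv])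
  show "t \<circ> g \<circ> t \<in> HB n r" if "t \<in> gens" "g \<in> HB n r" for t g
    using that(2) by (rule HB_obtain) (simp add: HB_vals[OF vals_conj[OF _ that(1)]] Wfil_act_stable[OF that(1)])
qed

lemma HB_Suc: "HB n (Suc r) \<subseteq> HB n r"
proof
  fix g assume "g \<in> HB n (Suc r)"
  then show "g \<in> HB n r"
    unfolding HB_def using Wfil_Suc_imp Wfil_antimono[of "r div 2" "Suc r div 2" n "val2 g"]
    by (auto simp: div_le_mono)
qed

lemma HB_antimono: "r \<le> s \<Longrightarrow> HB n s \<subseteq> HB n r"
  by (rule lift_Suc_antimono_le[of "HB n"]) (rule HB_Suc)

lemma HB_0: "HB n 0 = copies n N1"
  by (auto simp: HB_def)

lemma copies_Suc_HB: "copies (Suc n) N1 \<subseteq> HB n r"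
  using HB_vals[OF vals_of_ker] by auto

lemma HB_top: "HB n (2 ^ Suc n) = copies (Suc n) N1"
proof
  show "HB n (2 ^ Suc n) \<subseteq> copies (Suc n) N1"
  proof
    fix g assume "g \<in> HB n (2 ^ Suc n)"
    then show "g \<in> copies (Suc n) N1"
    proof (rule HB_obtain)
      fix f0 f1 f2 assume f: "vals n g f0 f1 f2" "Wfil (Suc n) (2 ^ Suc n) f0" "Wfil (Suc n) (2 ^ Suc n) f1"
        "Wfil n (2 ^ Suc n div 2) f2"
      show ?thesis
        by (rule vals_ker, rule vals_cong[OF f(1)])
          (use f(2-4) Wfil_top[OF order_refl, of "Suc n"] Wfil_top[OF order_refl, of n] in auto)
    qed
  qed
qed (rule copies_Suc_HB)

text \<open>Weights from 3 on are cut into blocks 2^m + 1 + r with r < 2^m and m = n + 1, so weight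
  3 is the start of the first block. The decomposition is unique by \<open>block_unique\<close>,
  hence the existential selects one \<open>HB\<close>.\<close>

definition Hs :: "nat \<Rightarrow> (word \<Rightarrow> word) set" where
  "Hs k = (if k < 2 then GG else if k = 2 then H2
    else {g. \<exists>n r. r < 2 ^ Suc n \<and> k = 2 ^ Suc n + 1 + r \<and> g \<in> HB n r})"

lemma block_unique:
  assumes "(2::nat) ^ m + r = 2 ^ n + s" "r < 2 ^ m" "s < 2 ^ n"
  shows "m = n"
proof (rule ccontr)
  have *: False if "i < j" "(2::nat) ^ i + r = 2 ^ j + s" "r < 2 ^ i" for i j r s :: nat
  proof -
    have "(2::nat) ^ Suc i \<le> 2 ^ j" using that(1) by (intro power_increasing) auto
    then show False using that(2,3) by simp
  qed
  assume "m \<noteq> n"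
  then consider "m < n" | "n < m" by linarith
  then show False using *[of m n r s] *[of n m s r] assms by cases auto
qed

lemma Hs_block:
  assumes "r < 2 ^ Suc n"
  shows "Hs (2 ^ Suc n + 1 + r) = HB n r"
proof -
  have k: "\<not> 2 ^ Suc n + 1 + r < 2" "2 ^ Suc n + 1 + r \<noteq> 2"
  proof -
    have "(2::nat) \<le> 2 ^ Suc n" by simp
    then show "\<not> 2 ^ Suc n + 1 + r < 2" "2 ^ Suc n + 1 + r \<noteq> 2" by linarith+
  qed
  have "(\<exists>n' r'. r' < 2 ^ Suc n' \<and> 2 ^ Suc n + 1 + r = 2 ^ Suc n' + 1 + r' \<and> g \<in> HB n' r') \<longleftrightarrow> g \<in> HB n r" for g
  proof
    assume "\<exists>n' r'. r' < 2 ^ Suc n' \<and> 2 ^ Suc n + 1 + r = 2 ^ Suc n' + 1 + r' \<and> g \<in> HB n' r'"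
    then obtain n' r' where a: "r' < 2 ^ Suc n'" "2 ^ Suc n + 1 + r = 2 ^ Suc n' + 1 + r'" "g \<in> HB n' r'" by blast
    have "Suc n = Suc n'" by (rule block_unique[of "Suc n" r "Suc n'" r']) (use a assms in auto)
    then show "g \<in> HB n r" using a by simp
  qed (use assms in blast)
  then show ?thesis unfolding Hs_def using k by auto
qed

text \<open>The end r = 2^m of one block is the start of the next: there all coordinates must
  vanish, which leaves N_(m+1).\<close>

lemma Hs_block_le:
  assumes "r \<le> 2 ^ Suc n"
  shows "Hs (2 ^ Suc n + 1 + r) = HB n r"
proof (cases "r = 2 ^ Suc n")
  case True
  have "Hs (2 ^ Suc (Suc n) + 1 + 0) = HB (Suc n) 0" by (rule Hs_block) simp
  then show ?thesis unfolding True HB_top HB_0 by (simp add: algebra_simps)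
next
  case False
  then show ?thesis using assms by (intro Hs_block) simp
qed

lemma Hs_cases:
  fixes k :: nat
  assumes "3 \<le> k"
  obtains n r where "r < 2 ^ Suc n" "k = 2 ^ Suc n + 1 + r"
proof -
  have "1 \<le> k - 1" using assms by linarith
  from ex_power_ivl1[OF le_refl this] obtain m where m: "2 ^ m \<le> k - 1" "k - 1 < 2 ^ (m + 1)"
    by blast
  have "m \<noteq> 0" using m(2) assms by (intro notI) simp
  then obtain n where n: "m = Suc n" using not0_implies_Suc by blast
  show thesis by (rule that[of "k - 1 - 2 ^ Suc n" n]) (use m n assms in auto)
qed

lemma Hs_01 [simp]: "Hs 0 = GG" "Hs (Suc 0) = GG" "Hs 2 = H2"
  by (simp_all add: Hs_def)

lemma Hs_3: "Hs 3 = N1"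
  using Hs_block[of 0 0] by (simp add: HB_0 numeral_3_eq_3 numeral_2_eq_2)

lemma Hs_normal: "Hs k \<lhd> Gt"
proof -
  consider "k = 0" | "k = Suc 0" | "k = 2" | "3 \<le> k" by linarith
  then show ?thesis
  proof cases
    case 4
    then obtain n r where "r < 2 ^ Suc n" "k = 2 ^ Suc n + 1 + r" by (rule Hs_cases)
    then show ?thesis using Hs_block HB_normal by metis
  qed (simp_all add: H2_normal Gt.normal_self)
qed

lemma commutator_from_gens:
  assumes M: "M \<lhd> Gt" and N: "N \<lhd> Gt"
    and c: "\<And>h t. h \<in> M \<Longrightarrow> t \<in> gens \<Longrightarrow> commutator Gt h t \<in> N"
    and h: "h \<in> M" and g: "g \<in> GG"
  shows "commutator Gt h g \<in> N"
proof -
  let ?C = "{g \<in> GG. \<forall>h\<in>M. commutator Gt g h \<in> N}"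
  have C: "?C \<lhd> Gt" by (rule Gt.centralizer_mod_normal[OF M N])
  have t: "t \<in> ?C" if "t \<in> gens" for t
    using normal.commutator_mem_swap[OF N gens_GG[OF that] normal_GG[OF M]] c[OF _ that] gens_GG[OF that] by auto
  have "g \<in> ?C" using g
  proof (induction g rule: GG_left_induct)
    case id show ?case by (rule normal_id[OF C])
  next
    case (comp t g) show ?case by (rule normal_comp[OF C t[OF comp(1)] comp(3)])
  qed
  then show ?thesis using normal.commutator_mem_swap[OF N normal_GG[OF M h] g] h by blast
qed

text \<open>It suffices to commute with generators. In weights 1 and 2 the defining parities are
  invariant under conjugation and cancel in the commutator; inside a block the coordinates become
  differences, which are one step deeper.\<close>

lemma Hs_commutator:
  assumes "h \<in> Hs k" "g \<in> GG"
  shows "commutator Gt h g \<in> Hs (Suc k)"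
proof (rule commutator_from_gens[OF Hs_normal Hs_normal _ assms])
  fix h t assume h: "h \<in> Hs k" and t: "t \<in> gens"
  have tG: "t \<in> GG" and hG: "h \<in> GG" using gens_GG[OF t] normal_GG[OF Hs_normal h] by auto
  have c: "commutator Gt h t = h \<circ> (t \<circ> inv\<^bsub>Gt\<^esub> h \<circ> t)"
    using commutator_Gt[OF hG tG] gens_inv[OF t] by (simp add: comp_assoc)
  have cG: "commutator Gt h t \<in> GG" using hG tG by simp
  consider "k = 0" | "k = Suc 0" | "k = 2" | "3 \<le> k" by linarith
  then show "commutator Gt h t \<in> Hs (Suc k)"
  proof cases
    case 1
    then show ?thesis using cG by simp
  next
    case 2
    have "sg j (commutator Gt h t) = 0" for j
      unfolding c using hG tG by (simp add: sg_comp sg_inv add_ac)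
    then show ?thesis using 2 cG by (simp add: H2_def numeral_2_eq_2[symmetric])
  next
    case 3
    then have h2: "h \<in> H2" using h by simp
    have i2: "inv\<^bsub>Gt\<^esub> h \<in> H2" using normal_inv[OF H2_normal h2] .
    have ti2: "t \<circ> inv\<^bsub>Gt\<^esub> h \<circ> t \<in> H2" using normal_conj_gen[OF H2_normal t i2] .
    have "sg j (sec 0 (commutator Gt h t)) = 0" if "j \<in> {0, Suc 0, 2}" for j
    proof -
      have "sg j (sec 0 (commutator Gt h t)) = sg j (sec 0 h) + sg j (sec 0 (t \<circ> inv\<^bsub>Gt\<^esub> h \<circ> t))"
        unfolding c by (rule ssg_comp) (use h2 ti2 in \<open>auto simp: H2_def\<close>)
      also have "sg j (sec 0 (t \<circ> inv\<^bsub>Gt\<^esub> h \<circ> t)) = sg j (sec 0 h)"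
        using ssg_conj[OF i2 t that] ssg_inv[of h j 0] h2 by (simp add: H2_def)
      finally show ?thesis by simp
    qed
    moreover have "commutator Gt h t \<in> H2" unfolding c by (rule normal_comp[OF H2_normal h2 ti2])
    moreover have "Suc k = 3" using 3 by simp
    ultimately show ?thesis by (simp add: Hs_3 N1_def HI_def)
  next
    case 4
    then obtain n r where k: "r < 2 ^ Suc n" "k = 2 ^ Suc n + 1 + r" by (rule Hs_cases)
    have "h \<in> HB n r" using h Hs_block k by simp
    then show ?thesis
    proof (rule HB_obtain)
      fix f0 f1 f2 assume f: "vals n h f0 f1 f2" "Wfil (Suc n) r f0" "Wfil (Suc n) r f1" "Wfil n (r div 2) f2"
      \<comment> \<open>The \<gamma> coordinate gains a full step of its own depth, while the halved
        index asks for at most that.\<close>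
      have "Wfil n (Suc r div 2) (\<lambda>\<sigma>. f2 (t \<sigma>) + f2 \<sigma>)"
        by (rule Wfil_antimono[OF _ Wfil_act[OF t f(4)]]) simp
      then have "commutator Gt h t \<in> HB n (Suc r)"
        unfolding HB_vals[OF vals_commutator[OF f(1) t]] using Wfil_act[OF t f(2)] Wfil_act[OF t f(3)] by simp
      moreover have "Hs (Suc k) = HB n (Suc r)"
        using Hs_block_le[of "Suc r" n] k by simp
      ultimately show ?thesis by simp
    qed
  qed
qed

lemma Hs_Suc: "Hs (Suc k) \<subseteq> Hs k"
proof -
  consider "k = 0" | "k = Suc 0" | "k = 2" | "3 \<le> k" by linarith
  then show ?thesis
  proof cases
    case 2 then show ?thesis using H2_GG by (auto simp: numeral_2_eq_2[symmetric])
  next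
    case 3
    then have "Suc k = 3" by simp
    then show ?thesis using 3 by (auto simp: Hs_3 N1_def HI_def)
  next
    case 4
    then obtain n r where k: "r < 2 ^ Suc n" "k = 2 ^ Suc n + 1 + r" by (rule Hs_cases)
    then show ?thesis using HB_Suc[of n r] Hs_block[of r n] Hs_block_le[of "Suc r" n] by simp
  qed simp
qed

lemma Hs_antimono: "i \<le> j \<Longrightarrow> Hs j \<subseteq> Hs i"
  by (rule lift_Suc_antimono_le[of Hs]) (rule Hs_Suc)

section \<open>Generation of the series\<close>

lemma at_vertex_comp: "at_vertex \<sigma> (g \<circ> h) = at_vertex \<sigma> g \<circ> at_vertex \<sigma> h"
proof (induction \<sigma>)
  case (Cons z \<sigma>)
  then show ?case using bit_cases01[of z] by auto
qed simp

lemma at_vertex_append: "at_vertex (\<sigma> @ [0]) g = at_vertex \<sigma> (pr g id)"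
  "at_vertex (\<sigma> @ [1]) g = at_vertex \<sigma> (pr id g)"
proof (induction \<sigma>)
  case (Cons z \<sigma>)
  {
    case 1 then show ?case using Cons bit_cases01[of z] by auto
  next
    case 2 then show ?case using Cons bit_cases01[of z] by auto
  }
qed simp_all

lemma at_vertex_copies: "g \<in> Q \<Longrightarrow> id \<in> Q \<Longrightarrow> at_vertex \<sigma> g \<in> copies (length \<sigma>) Q"
  unfolding at_vertex_fp by (rule fp_copies)

lemma N1_decomp:
  assumes "p \<in> N1"
  shows "\<exists>k\<in>Kt. \<exists>k'\<in>Kt. p = pr k k' \<or> p = pr k k' \<circ> xx2"
proof -
  obtain g h where p: "p = pr g h" "g \<in> H2" "h \<in> H2" "ee g = ee h" using assms by (rule N1_pr)
  show ?thesis
  proof (cases "ee g = 0")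
    case True
    then have "g \<in> Kt" "h \<in> Kt" using p by (simp_all add: Kt_H2)
    then show ?thesis using p(1) by blast
  next
    case False
    then have e: "ee g = 1" "ee h = 1" using p(4) by simp_all
    have "g \<circ> zz \<in> Kt" "h \<circ> zz \<in> Kt" using H2_zz p e by auto
    moreover have "p = pr (g \<circ> zz) (h \<circ> zz) \<circ> xx2" unfolding p(1) xx2_pr by (simp add: comp_assoc)
    ultimately show ?thesis by blast
  qed
qed

lemma copies_N1_subset:
  assumes R: "R \<lhd> Gt"
    and K: "\<And>\<sigma> k. length \<sigma> = Suc m \<Longrightarrow> k \<in> Kt \<Longrightarrow> at_vertex \<sigma> k \<in> R"
    and x: "\<And>\<sigma>. length \<sigma> = m \<Longrightarrow> at_vertex \<sigma> xx2 \<in> R"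
  shows "copies m N1 \<subseteq> R"
proof (rule copies_subset)
  show "g \<circ> h \<in> R" if "g \<in> R" "h \<in> R" for g h by (rule normal_comp[OF R that])
  fix \<sigma> :: word and q assume l: "length \<sigma> = m" and q: "q \<in> N1"
  obtain k k' where k: "k \<in> Kt" "k' \<in> Kt" "q = pr k k' \<or> q = pr k k' \<circ> xx2" using N1_decomp[OF q] by blast
  have "at_vertex \<sigma> (pr k id) \<in> R" "at_vertex \<sigma> (pr id k') \<in> R"
    unfolding at_vertex_append[symmetric] using K k(1,2) l by simp_all
  then have "at_vertex \<sigma> (pr k id \<circ> pr id k') \<in> R" unfolding at_vertex_comp by (rule normal_comp[OF R])
  then have 1: "at_vertex \<sigma> (pr k k') \<in> R" by simp
  show "at_vertex \<sigma> q \<in> R"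
    using k(3) 1 normal_comp[OF R 1 x[OF l]] by (auto simp: at_vertex_comp)
qed

section \<open>Diagonal elements and the entry into the next block\<close>

abbreviation allp :: "nat \<Rightarrow> (word \<Rightarrow> word) \<Rightarrow> word \<Rightarrow> word" where
  "allp m u \<equiv> fp m u (\<lambda>\<sigma>. 1)"

lemma a_allp: "act_a \<circ> allp (Suc m) u \<circ> act_a = allp (Suc m) u"
  by simp

text \<open>One step up the rightmost branch: b, c, d are the second sections of d, b, c, whose
  first sections are 1, a, 1.\<close>

lemma bcd_lift:
  assumes "t \<in> {act_b, act_c, act_d}"
  obtains s t' where "t' = pr s t" "t' \<in> {act_b, act_c, act_d}" "s = id \<or> s = act_a"
proof -
  from assms consider "t = act_b" | "t = act_c" | "t = act_d" by blast
  then show thesis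
  proof cases
    case 1 show ?thesis by (rule that[of act_d id]) (simp_all add: 1 act_pr(3)[symmetric])
  next
    case 2 show ?thesis by (rule that[of act_b act_a]) (simp_all add: 2 act_pr(1)[symmetric])
  next
    case 3 show ?thesis by (rule that[of act_c id]) (simp_all add: 3 act_pr(2)[symmetric])
  qed
qed

lemma allp_yy_self: "allp m yy \<circ> allp m yy = id"
  by (simp add: fp_square)

text \<open>True even for \<open>m = 0\<close>, as y = (b, b) has equal halves. For x this fails at
  the root, where a inverts it, and its diagonal is therefore used from level one on.\<close>

lemma a_allp_yy: "act_a \<circ> allp m yy \<circ> act_a = allp m yy"
proof (cases m)
  case 0
  have "act_a \<circ> yy \<circ> act_a = yy" unfolding yy_pr by simp
  then show ?thesis using 0 by simp
qed simp

text \<open>Beside the rightmost branch the chosen generator acts trivially or as a, which commutes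
  with the diagonal element. Only the commutator at the end of the branch is left, where b and y
  give (x, 1).\<close>

lemma commutator_allp_yy:
  "\<exists>t\<in>{act_b, act_c, act_d}. t \<circ> allp m yy \<circ> t \<circ> allp m yy = at_vertex (replicate m 1) (pr xx id)"
proof (induction m)
  case 0
  show ?case using commutator_yy_b by (intro bexI[of _ act_b]) simp_all
next
  case (Suc m)
  then obtain t where t: "t \<in> {act_b, act_c, act_d}"
    "t \<circ> allp m yy \<circ> t \<circ> allp m yy = at_vertex (replicate m 1) (pr xx id)" by blast
  obtain s t' where t': "t' = pr s t" "t' \<in> {act_b, act_c, act_d}" "s = id \<or> s = act_a"
    using bcd_lift[OF t(1)] by blast
  have "s \<circ> allp m yy \<circ> s = allp m yy" using t'(3) a_allp_yy by auto
  then have "s \<circ> allp m yy \<circ> s \<circ> allp m yy = id" using allp_yy_self by simp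
  then have "t' \<circ> allp (Suc m) yy \<circ> t' \<circ> allp (Suc m) yy = at_vertex (replicate (Suc m) 1) (pr xx id)"
    using t(2) unfolding t'(1) by simp
  then show ?case using t'(2) by blast
qed

abbreviation ixx :: "word \<Rightarrow> word" where "ixx \<equiv> inv\<^bsub>Gt\<^esub> xx"

lemma fp_comp: "fp m u f \<circ> fp m v f = fp m (u \<circ> v) f"
  by (induction m arbitrary: f) simp_all

lemma xx_ixx: "xx \<circ> ixx = id" "ixx \<circ> xx = id"
  using Gt_inv_comp[of xx] by simp_all

text \<open>The same descent, ending with b = (a, c) against (x, x). Since a conjugates x to its
  inverse, the first entry becomes x^2; the second is the commutator of x and c, equal to (1,
  y).\<close>

lemma commutator_allp_xx:
  "\<exists>t\<in>{act_b, act_c, act_d}. allp (Suc m) xx \<circ> t \<circ> allp (Suc m) ixx \<circ> t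
    = at_vertex (replicate m 1) (pr xx2 (pr id yy))"
proof (induction m)
  case 0
  have "act_a \<circ> ixx \<circ> act_a = xx" unfolding inv_xx unfolding xx_pr by simp
  then have "xx \<circ> act_a \<circ> ixx \<circ> act_a = xx2" unfolding xx2_eq by (simp add: comp_assoc)
  then have "pr xx xx \<circ> pr act_a act_c \<circ> pr ixx ixx \<circ> pr act_a act_c = pr xx2 (pr id yy)"
    using commutator_xx_c by simp
  then show ?case unfolding act_pr(1)[symmetric] by (intro bexI[of _ act_b]) simp_all
next
  case (Suc m)
  then obtain t where t: "t \<in> {act_b, act_c, act_d}"
    "allp (Suc m) xx \<circ> t \<circ> allp (Suc m) ixx \<circ> t = at_vertex (replicate m 1) (pr xx2 (pr id yy))" by blast
  obtain s t' where t': "t' = pr s t" "t' \<in> {act_b, act_c, act_d}" "s = id \<or> s = act_a"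
    using bcd_lift[OF t(1)] by blast
  have "s \<circ> allp (Suc m) ixx \<circ> s = allp (Suc m) ixx" using t'(3) a_allp by auto
  then have "allp (Suc m) xx \<circ> (s \<circ> allp (Suc m) ixx \<circ> s) = id" using fp_comp[of "Suc m" xx _ ixx] xx_ixx by simp
  then have s: "allp (Suc m) xx \<circ> s \<circ> allp (Suc m) ixx \<circ> s = id" by (simp only: comp_assoc)
  have "allp (Suc (Suc m)) xx \<circ> t' \<circ> allp (Suc (Suc m)) ixx \<circ> t'
      = pr (allp (Suc m) xx \<circ> s \<circ> allp (Suc m) ixx \<circ> s) (allp (Suc m) xx \<circ> t \<circ> allp (Suc m) ixx \<circ> t)"
    unfolding t'(1) by simp
  also have "\<dots> = at_vertex (replicate (Suc m) 1) (pr xx2 (pr id yy))"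
    unfolding s t(2) by simp
  finally show ?case using t'(2) by blast
qed

text \<open>The constant function is the last basis vector, the product of all 1 - X_i. So diagonal
  elements lie in the last layer of their block.\<close>

lemma Wfil_one: "Wfil n (2 ^ n - 1) (\<lambda>\<sigma>. 1)"
proof (induction n)
  case (Suc n)
  have "1 \<le> (2::nat) ^ n" by simp
  then have "2 ^ Suc n - 1 = Suc (2 * (2 ^ n - 1 :: nat))"
    unfolding power_Suc by linarith
  then show ?case using Suc by (simp only: Wfil_double1) simp
qed simp

lemma allp_HB: "allp (Suc n) xx \<in> HB n (2 ^ Suc n - 1)" "allp (Suc n) yy \<in> HB n (2 ^ Suc n - 1)"
  unfolding HB_vals[OF vals_X] HB_vals[OF vals_Y] by (intro conjI Wfil_one Wfil_zero)+

text \<open>Squares of single entries x supply x^2 at every vertex of level n + 1. Commutators of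
  the diagonals supply one x, and after removal of an x^2 one y, on level n + 2, and
  \<open>Kt_at_vertex\<close> spreads them over that level.\<close>

lemma block_start_generated:
  assumes R: "R \<lhd> Gt"
    and c: "\<And>h g. h \<in> HB n (2 ^ Suc n - 1) \<Longrightarrow> g \<in> GG \<Longrightarrow> commutator Gt h g \<in> R"
    and sq: "\<And>u. u \<in> copies n N1 \<Longrightarrow> u \<circ> u \<in> R"
  shows "copies (Suc n) N1 \<subseteq> R"
proof -
  have XG: "allp (Suc n) xx \<in> GG" and YG: "allp (Suc n) yy \<in> GG"
    using allp_HB HB_normal normal_GG by blast+
  have bG: "t \<in> GG" "t \<in> gens" if "t \<in> {act_b, act_c, act_d}" for t using that by (auto simp: gens_def)
  have x2: "at_vertex \<sigma> xx2 \<in> R" if l: "length \<sigma> = Suc n" for \<sigma>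
  proof -
    have "at_vertex \<sigma> xx \<in> copies (Suc n) Kt"
      using at_vertex_copies[OF Kt_xx(1) normal_id[OF Kt_normal], of \<sigma>] l by simp
    from sq[OF copies_Kt_N1[OF this]] show ?thesis by (simp add: at_vertex_comp xx2_eq)
  qed
  obtain t where t: "t \<in> {act_b, act_c, act_d}"
    "t \<circ> allp (Suc n) yy \<circ> t \<circ> allp (Suc n) yy = at_vertex (replicate (Suc n) 1) (pr xx id)"
    using commutator_allp_yy by blast
  have iY: "inv\<^bsub>Gt\<^esub> (allp (Suc n) yy) = allp (Suc n) yy" by (rule Gt_inv_eq[OF YG YG allp_yy_self])
  have "commutator Gt t (allp (Suc n) yy) \<in> R"
    using c[OF allp_HB(2) bG(1)[OF t(1)]] normal.commutator_mem_swap[OF R bG(1)[OF t(1)] YG] by blast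
  moreover have "commutator Gt t (allp (Suc n) yy) = t \<circ> allp (Suc n) yy \<circ> t \<circ> allp (Suc n) yy"
    using commutator_Gt[OF bG(1)[OF t(1)] YG] gens_inv[OF bG(2)[OF t(1)]] iY by simp
  ultimately have X: "at_vertex (replicate (Suc n) 1 @ [0]) xx \<in> R"
    unfolding at_vertex_append t(2) by simp
  obtain s where s: "s \<in> {act_b, act_c, act_d}"
    "allp (Suc n) xx \<circ> s \<circ> allp (Suc n) ixx \<circ> s = at_vertex (replicate n 1) (pr xx2 (pr id yy))"
    using commutator_allp_xx by blast
  have XIX: "allp (Suc n) ixx \<circ> allp (Suc n) xx = id" unfolding fp_comp xx_ixx by simp
  have "allp (Suc n) ixx \<in> copies (Suc n) Kt"
    by (rule fp_copies) (simp_all add: normal_inv[OF Kt_normal] Kt_xx normal_id[OF Kt_normal])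
  then have IXG: "allp (Suc n) ixx \<in> GG" using copies_Kt normal_GG[OF Kt_normal] by blast
  have iX: "inv\<^bsub>Gt\<^esub> (allp (Suc n) xx) = allp (Suc n) ixx" by (rule Gt_inv_eq[OF XG IXG XIX])
  have "commutator Gt (allp (Suc n) xx) s = allp (Suc n) xx \<circ> s \<circ> allp (Suc n) ixx \<circ> s"
    using commutator_Gt[OF XG bG(1)[OF s(1)]] gens_inv[OF bG(2)[OF s(1)]] iX by simp
  then have Y1: "at_vertex (replicate n 1) (pr xx2 (pr id yy)) \<in> R"
    using c[OF allp_HB(1) bG(1)[OF s(1)]] s(2) by simp
  \<comment> \<open>The surplus entry x^2 in \<open>Y1\<close> is cancelled by the same entry
    standing alone.\<close>
  have x2s: "xx2 \<circ> xx2 = id" unfolding xx2_pr by simp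
  have "at_vertex (replicate n 1) (pr xx2 id) \<in> R"
    unfolding at_vertex_append[symmetric] by (rule x2) simp
  from normal_comp[OF R this Y1] have "at_vertex (replicate n 1) (pr id (pr id yy)) \<in> R"
    unfolding at_vertex_comp[symmetric] by (simp add: x2s)
  then have "at_vertex ((replicate n 1 @ [1]) @ [1]) yy \<in> R" unfolding at_vertex_append .
  then have K: "at_vertex \<sigma> k \<in> R" if "length \<sigma> = Suc (Suc n)" "k \<in> Kt" for \<sigma> k
    by (intro Kt_at_vertex[OF _ R X _ that(2)]) (simp_all add: that(1))
  show ?thesis by (rule copies_N1_subset[OF R K x2])
qed

text \<open>For odd offset the half weight \<open>(k + 1) div 2\<close> has offset
  \<open>r div 2\<close> in the preceding block, where \<open>f\<close> is placed in the \<alpha>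
  coordinate; squaring moves it to \<gamma>. If n = 0 the half weight is 2 and x itself lies in
  \<open>H2\<close>.\<close>

lemma R_square_X:
  assumes "\<And>u. u \<in> Hs ((k + 1) div 2) \<Longrightarrow> u \<circ> u \<in> R"
  and "k = 2 ^ Suc n + 1 + r" "odd r" "r < 2 ^ Suc n" "Wfil n (r div 2) f"
  shows "fp n xx2 f \<in> R"
proof -
  have "fp n xx f \<in> Hs ((k + 1) div 2)"
  proof (cases n)
    case 0
    then have "(k + 1) div 2 = 2" using assms by (auto simp: elim!: oddE)
    moreover have "xx \<in> H2" using Kt_xx(1) by (simp add: Kt_H2)
    ultimately show ?thesis using 0 normal_id[OF H2_normal] by simp
  next
    case (Suc n')
    obtain s where s: "r = 2 * s + 1" using assms(3) by (rule oddE)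
    have "(k + 1) div 2 = 2 ^ Suc n' + 1 + r div 2" unfolding assms(2) s Suc by simp
    moreover have "r div 2 < 2 ^ Suc n'" using assms(4) unfolding Suc by simp
    moreover have "fp n xx f \<in> HB n' (r div 2)" using HB_vals[OF vals_X, of n' f] assms(5) Suc by simp
    ultimately show ?thesis using Hs_block by simp
  qed
  from assms(1)[OF this] show ?thesis by (simp add: fp_square xx2_eq)
qed

text \<open>\<open>A\<close>, \<open>B\<close>, \<open>C\<close> are additive equivariant maps, in
  practice one identity and two zeros, so that one proof serves all three coordinates.
  \<open>P\<close> lifts functions to the group, and generator differences are realized by
  commutators of these lifts.\<close>

lemma commutators_realize:
  assumes R: "R \<lhd> Gt" and t: "\<And>f. Wfil m r f \<Longrightarrow> P f \<in> H \<and> vals n (P f) (A f) (B f) (C f)"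
    and c: "\<And>h g. h \<in> H \<Longrightarrow> g \<in> GG \<Longrightarrow> commutator Gt h g \<in> R"
    and lin: "\<And>T f g. T \<in> {A, B, C} \<Longrightarrow> T (\<lambda>\<sigma>. f \<sigma> + g \<sigma>) = (\<lambda>\<sigma>. T f \<sigma> + T g \<sigma>)"
    and act: "\<And>T f t. T \<in> {A, B, C} \<Longrightarrow> t \<in> gens \<Longrightarrow> T (\<lambda>\<sigma>. f (t \<sigma>)) = (\<lambda>\<sigma>. T f (t \<sigma>))"
    and cong: "\<And>f g e. (\<And>\<sigma>. length \<sigma> = m \<Longrightarrow> f \<sigma> = g \<sigma>) \<Longrightarrow> vals n e (A f) (B f) (C f) \<Longrightarrow> vals n e (A g) (B g) (C g)"
    and f: "Wfil m (Suc r) f"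
  shows "\<exists>e\<in>R. vals n e (A f) (B f) (C f)"
proof -
  have T: "A \<in> {A, B, C}" "B \<in> {A, B, C}" "C \<in> {A, B, C}" by simp_all
  have "\<exists>e\<in>R. vals n e (A f) (B f) (C f)" if "Wdiff m' r' f" "m' = m" "r' = r" for m' r' f
    using that
  proof (induction m' r' f rule: Wdiff.induct)
    case (base m' r' f t)
    then have p: "P f \<in> H" "vals n (P f) (A f) (B f) (C f)" using assms(2)[of f] by auto
    have "commutator Gt (P f) t \<in> R" using c p(1) gens_GG[OF base(2)] by blast
    moreover have "vals n (commutator Gt (P f) t) (A (\<lambda>\<sigma>. f (t \<sigma>) + f \<sigma>)) (B (\<lambda>\<sigma>. f (t \<sigma>) + f \<sigma>)) (C (\<lambda>\<sigma>. f (t \<sigma>) + f \<sigma>))"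
      using vals_commutator[OF p(2) base(2)]
      by (simp only: lin[OF T(1), of "\<lambda>\<sigma>. f (t \<sigma>)" f] lin[OF T(2), of "\<lambda>\<sigma>. f (t \<sigma>)" f]
          lin[OF T(3), of "\<lambda>\<sigma>. f (t \<sigma>)" f] act[OF T(1) base(2)] act[OF T(2) base(2)] act[OF T(3) base(2)])
    ultimately show ?case by blast
  next
    case (add m' r' f g)
    then obtain e e' where e: "e \<in> R" "vals n e (A f) (B f) (C f)" "e' \<in> R" "vals n e' (A g) (B g) (C g)" by blast
    have "vals n (e \<circ> e') (A (\<lambda>\<sigma>. f \<sigma> + g \<sigma>)) (B (\<lambda>\<sigma>. f \<sigma> + g \<sigma>)) (C (\<lambda>\<sigma>. f \<sigma> + g \<sigma>))"
      using vals_comp[OF e(2,4)] by (simp only: lin[OF T(1)] lin[OF T(2)] lin[OF T(3)])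
    then show ?case using normal_comp[OF R e(1,3)] by blast
  next
    case (cong m' r' f g)
    then obtain e where "e \<in> R" "vals n e (A f) (B f) (C f)" by blast
    then show ?case using assms(6)[of f g e] cong.hyps(2) cong.prems(1) by blast
  qed
  then show ?thesis using Wfil_imp_Wdiff[OF f] by blast
qed

text \<open>The start of the next block is shown to lie in \<open>R\<close> beforehand; after that
  only the coordinates matter, and each of the three is realized separately.\<close>

lemma block_generated:
  assumes R: "R \<lhd> Gt" and r: "Suc r < 2 ^ Suc n" and k: "k = 2 ^ Suc n + 1 + Suc r"
    and c: "\<And>h g. h \<in> HB n r \<Longrightarrow> g \<in> GG \<Longrightarrow> commutator Gt h g \<in> R"
    and sq: "\<And>u. u \<in> Hs ((k + 1) div 2) \<Longrightarrow> u \<circ> u \<in> R"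
  shows "HB n (Suc r) \<subseteq> R"
proof -
  have N: "copies (Suc n) N1 \<subseteq> R"
  proof (rule block_start_generated[OF R])
    show "commutator Gt h g \<in> R" if "h \<in> HB n (2 ^ Suc n - 1)" "g \<in> GG" for h g
    proof -
      have "r \<le> 2 ^ Suc n - 1" using r by linarith
      then show ?thesis using c HB_antimono[of r "2 ^ Suc n - 1" n] that by blast
    qed
    show "u \<circ> u \<in> R" if "u \<in> copies n N1" for u
    proof (rule sq)
      have "copies n N1 = Hs (2 ^ Suc n + 1)" using Hs_block[of 0 n] by (simp add: HB_0)
      moreover have "(k + 1) div 2 \<le> 2 ^ Suc n + 1" using k r by simp
      ultimately show "u \<in> Hs ((k + 1) div 2)" using Hs_antimono that by blast
    qed
  qed
  have X: "\<exists>e\<in>R. vals n e f (\<lambda>_. 0) (\<lambda>_. 0)" if "Wfil (Suc n) (Suc r) f" for f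
    by (rule commutators_realize[OF R, of "Suc n" r "fp (Suc n) xx" "HB n r" n "\<lambda>f. f" "\<lambda>f _. 0" "\<lambda>f _. 0"])
      (use c that in \<open>auto simp: HB_vals[OF vals_X] vals_X simp del: fp.simps elim: vals_cong\<close>)
  have Y: "\<exists>e\<in>R. vals n e (\<lambda>_. 0) f (\<lambda>_. 0)" if "Wfil (Suc n) (Suc r) f" for f
    by (rule commutators_realize[OF R, of "Suc n" r "fp (Suc n) yy" "HB n r" n "\<lambda>f _. 0" "\<lambda>f. f" "\<lambda>f _. 0"])
      (use c that in \<open>auto simp: HB_vals[OF vals_Y] vals_Y simp del: fp.simps elim: vals_cong\<close>)
  have Z: "\<exists>e\<in>R. vals n e (\<lambda>_. 0) (\<lambda>_. 0) f" if f: "Wfil n (Suc r div 2) f" for f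
  proof (cases "odd (Suc r)")
    case True
    \<comment> \<open>At an odd offset the \<gamma> depth is the same as one offset earlier, whereas
      commutators would raise it; the missing layer comes from squares.\<close>
    then have "fp n xx2 f \<in> R" by (intro R_square_X[OF sq k _ r f])
    then show ?thesis using vals_Z by blast
  next
    case False
    then have "even (Suc r)" by blast
    then obtain s' where s': "Suc r = 2 * s'" by (rule evenE)
    then obtain s where s: "Suc r = 2 * Suc s" by (cases s') simp_all
    \<comment> \<open>At an even offset the \<gamma> depth has just grown by one, which is the gain
      made by commutators.\<close>
    have f': "Wfil n (Suc s) f" using f s by simp
    have rs: "r div 2 = s" using s by presburger
    show ?thesis
      by (rule commutators_realize[OF R, of n s "fp n xx2" "HB n r" n "\<lambda>f _. 0" "\<lambda>f _. 0" "\<lambda>f. f"])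
        (use c f' rs in \<open>auto simp: HB_vals[OF vals_Z] vals_Z simp del: fp.simps elim: vals_cong\<close>)
  qed
  show ?thesis
  proof
    fix g assume "g \<in> HB n (Suc r)"
    then show "g \<in> R"
    proof (rule HB_obtain)
      fix f0 f1 f2 assume f: "vals n g f0 f1 f2" "Wfil (Suc n) (Suc r) f0" "Wfil (Suc n) (Suc r) f1"
        "Wfil n (Suc r div 2) f2"
      obtain e0 where e0: "e0 \<in> R" "vals n e0 f0 (\<lambda>_. 0) (\<lambda>_. 0)" using X[OF f(2)] by blast
      obtain e1 where e1: "e1 \<in> R" "vals n e1 (\<lambda>_. 0) f1 (\<lambda>_. 0)" using Y[OF f(3)] by blast
      obtain e2 where e2: "e2 \<in> R" "vals n e2 (\<lambda>_. 0) (\<lambda>_. 0) f2" using Z[OF f(4)] by blast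
      define e where "e = e0 \<circ> e1 \<circ> e2"
      have eR: "e \<in> R" unfolding e_def by (intro normal_comp[OF R] e0 e1 e2)
      have ev: "vals n e f0 f1 f2"
        unfolding e_def by (rule vals_cong[OF vals_comp[OF vals_comp[OF e0(2) e1(2)] e2(2)]]) simp_all
      have "inv\<^bsub>Gt\<^esub> e \<circ> g \<in> R" using vals_quot[OF f(1) ev] N by blast
      from normal_comp[OF R eR this] have "(e \<circ> inv\<^bsub>Gt\<^esub> e) \<circ> g \<in> R" by (simp add: comp_assoc)
      then show "g \<in> R" using Gt_inv_comp(2)[OF normal_GG[OF R eR]] by simp
    qed
  qed
qed

lemma Hs_generated:
  assumes k2: "2 \<le> k" and R: "R \<lhd> Gt"
    and c: "\<And>h g. h \<in> Hs (k - 1) \<Longrightarrow> g \<in> GG \<Longrightarrow> commutator Gt h g \<in> R"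
    and sq: "\<And>u. u \<in> Hs ((k + 1) div 2) \<Longrightarrow> u \<circ> u \<in> R"
  shows "Hs k \<subseteq> R"
proof -
  consider "k = 2" | "k = 3" | "4 \<le> k" using k2 by linarith
  then show ?thesis
  proof cases
    case 1
    have c1: "commutator Gt h g \<in> R" if "h \<in> GG" "g \<in> GG" for h g using c 1 that by simp
    have K: "Kt \<subseteq> R" unfolding Kt_def
      by (rule normal_closure_least[OF R]) (simp add: xx_def yy_def c1)
    have z: "zz \<in> R" using c1[of act_a act_c] by (simp add: commutator_Gt zz_def)
    have "H2 \<subseteq> R"
    proof
      fix g assume g: "g \<in> H2"
      show "g \<in> R"
      proof (cases "ee g = 0")
        case True then show ?thesis using g K by (auto simp: Kt_H2)
      next
        case False
        then have "g \<circ> zz \<in> R" using H2_zz[OF g] K by auto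
        from normal_comp[OF R this z] show ?thesis by (simp add: comp_assoc)
      qed
    qed
    then show ?thesis using 1 by simp
  next
    case 2
    have c2: "commutator Gt h g \<in> R" if "h \<in> H2" "g \<in> GG" for h g using c 2 that by simp
    have sq2: "u \<circ> u \<in> R" if "u \<in> H2" for u using sq 2 that by simp
    have xy: "xx \<in> H2" "yy \<in> H2" using Kt_xx by (simp_all add: Kt_H2)
    have x2: "xx2 \<in> R" using sq2[OF xy(1)] by (simp add: xx2_eq)
    have "commutator Gt xx act_c \<in> R" by (rule c2[OF xy(1)]) simp
    then have Y: "at_vertex [1] yy \<in> R" using commutator_xx_c by (simp add: commutator_Gt)
    have iy: "inv\<^bsub>Gt\<^esub> yy = yy" by (rule Gt_inv_eq) simp_all
    have "commutator Gt act_b yy \<in> R"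
      using c2[OF xy(2), of act_b] normal.commutator_mem_swap[OF R, of act_b yy] by simp
    then have X: "at_vertex [0] xx \<in> R" using commutator_yy_b iy by (simp add: commutator_Gt)
    have "copies 0 N1 \<subseteq> R"
    proof (rule copies_N1_subset[OF R])
      show "at_vertex \<sigma> k \<in> R" if "length \<sigma> = Suc 0" "k \<in> Kt" for \<sigma> k
        by (rule Kt_at_vertex[OF _ R X Y that(2)]) (simp_all add: that(1))
      show "at_vertex \<sigma> xx2 \<in> R" if "length \<sigma> = 0" for \<sigma> using x2 that by simp
    qed
    then show ?thesis using 2 by (simp add: Hs_3)
  next
    case 3
    then have "3 \<le> k" by simp
    then obtain n r where k: "r < 2 ^ Suc n" "k = 2 ^ Suc n + 1 + r" by (rule Hs_cases)
    show ?thesis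
    proof (cases r)
      case (Suc r')
      have "HB n (Suc r') \<subseteq> R"
      proof (rule block_generated[OF R, of r' n k])
        show "commutator Gt h g \<in> R" if "h \<in> HB n r'" "g \<in> GG" for h g
          using c Hs_block[of r' n] k Suc that by simp
      qed (use k Suc sq in auto)
      then show ?thesis unfolding k(2) Hs_block[OF k(1)] unfolding Suc .
    next
      case 0
      then obtain n' where n: "n = Suc n'" using k 3 by (cases n) auto
      have "copies (Suc n') N1 \<subseteq> R"
      proof (rule block_start_generated[OF R])
        have "k - 1 = 2 ^ Suc n' + 1 + (2 ^ Suc n' - 1)" using k 0 n by simp
        moreover have "Hs (2 ^ Suc n' + 1 + (2 ^ Suc n' - 1)) = HB n' (2 ^ Suc n' - 1)"
          by (rule Hs_block) simp
        ultimately have e: "Hs (k - 1) = HB n' (2 ^ Suc n' - 1)" by simp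
        show "commutator Gt h g \<in> R" if "h \<in> HB n' (2 ^ Suc n' - 1)" "g \<in> GG" for h g
          using c that unfolding e by blast
        \<comment> \<open>Half the weight of a block start, rounded up, is the start of the
          preceding block.\<close>
        have "(k + 1) div 2 = 2 ^ Suc n' + 1 + 0" using k 0 n by simp
        then have "Hs ((k + 1) div 2) = copies n' N1" using Hs_block[of 0 n'] by (simp add: HB_0)
        then show "u \<circ> u \<in> R" if "u \<in> copies n' N1" for u using sq that by simp
      qed
      then show ?thesis using Hs_block[OF k(1)] k(2) 0 n by (simp add: HB_0)
    qed
  qed
qed

section \<open>Generators of the layers and their squares\<close>

lemma generate_quot:
  assumes S: "S \<subseteq> GG" and w: "w \<in> generate Gt (S \<union> M)" and M: "M \<subseteq> GG"
    and g: "inv\<^bsub>Gt\<^esub> w \<circ> g \<in> M" "g \<in> GG"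
  shows "g \<in> generate Gt (S \<union> M)"
proof -
  have sub: "S \<union> M \<subseteq> GG" using S M by blast
  have wG: "w \<in> GG" by (rule Gt.generate_in_carrier[OF sub w])
  have "w \<otimes>\<^bsub>Gt\<^esub> (inv\<^bsub>Gt\<^esub> w \<circ> g) \<in> generate Gt (S \<union> M)"
    by (rule generate.eng[OF w]) (rule generate.incl, use g in simp)
  moreover have "w \<otimes>\<^bsub>Gt\<^esub> (inv\<^bsub>Gt\<^esub> w \<circ> g) = (w \<circ> inv\<^bsub>Gt\<^esub> w) \<circ> g"
    using wG g(2) by (simp add: Gt_mult comp_assoc)
  ultimately show ?thesis using Gt_inv_comp(2)[OF wG] by simp
qed

lemma generate_comp:
  assumes "S \<subseteq> GG" "v \<in> generate Gt S" "w \<in> generate Gt S"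
  shows "v \<circ> w \<in> generate Gt S"
  using generate.eng[OF assms(2,3)] Gt_mult[OF Gt.generate_in_carrier[OF assms(1,2)] Gt.generate_in_carrier[OF assms(1,3)]]
  by simp

lemma Wfil_step_ex:
  assumes "r < 2 ^ n" "Wfil n r f"
  obtains b where "b = 0 \<or> b = (1::bit)" "Wfil n (Suc r) (\<lambda>\<sigma>. f \<sigma> + b * vfun n r \<sigma>)"
proof -
  from Wfil_step[OF assms] show thesis
  proof
    assume "Wfil n (Suc r) f" then show thesis by (intro that[of 0]) simp_all
  next
    assume "Wfil n (Suc r) (\<lambda>\<sigma>. f \<sigma> + vfun n r \<sigma>)" then show thesis by (intro that[of 1]) simp_all
  qed
qed

lemma bit_scale_fp: "b = 0 \<or> b = (1::bit) \<Longrightarrow> fp m u (\<lambda>\<sigma>. b * f \<sigma>) = id \<or> fp m u (\<lambda>\<sigma>. b * f \<sigma>) = fp m u f"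
  by auto

text \<open>One multiple of a basis vector has to be removed in each coordinate; the \<gamma> depth
  moves only when \<open>r\<close> is odd, so otherwise \<open>b2 = 0\<close> will do.\<close>

lemma HB_step:
  assumes r: "r < 2 ^ Suc n" and g: "g \<in> HB n r"
  shows "\<exists>b0 b1 b2. (odd r \<or> b2 = 0) \<and>
    inv\<^bsub>Gt\<^esub> (fp (Suc n) xx (\<lambda>\<sigma>. b0 * vfun (Suc n) r \<sigma>) \<circ> fp (Suc n) yy (\<lambda>\<sigma>. b1 * vfun (Suc n) r \<sigma>) \<circ>
      fp n xx2 (\<lambda>\<sigma>. b2 * vfun n (r div 2) \<sigma>)) \<circ> g \<in> HB n (Suc r)"
  using g
proof (rule HB_obtain)
  fix f0 f1 f2 assume f: "vals n g f0 f1 f2" "Wfil (Suc n) r f0" "Wfil (Suc n) r f1" "Wfil n (r div 2) f2"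
  obtain b0 where b0: "Wfil (Suc n) (Suc r) (\<lambda>\<sigma>. f0 \<sigma> + b0 * vfun (Suc n) r \<sigma>)" using Wfil_step_ex[OF r f(2)] by blast
  obtain b1 where b1: "Wfil (Suc n) (Suc r) (\<lambda>\<sigma>. f1 \<sigma> + b1 * vfun (Suc n) r \<sigma>)" using Wfil_step_ex[OF r f(3)] by blast
  have r2: "r div 2 < 2 ^ n" using r by simp
  obtain b2 where b2: "odd r \<or> b2 = 0" "Wfil n (Suc r div 2) (\<lambda>\<sigma>. f2 \<sigma> + b2 * vfun n (r div 2) \<sigma>)"
  proof (cases "odd r")
    case True
    then have "Suc r div 2 = Suc (r div 2)" by simp
    then show ?thesis using Wfil_step_ex[OF r2 f(4)] that True by metis
  next
    case False
    then show ?thesis using that[of 0] f(4) by simp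
  qed
  note v = vals_comp[OF vals_inv[OF vals_XYZ[of n "\<lambda>\<sigma>. b0 * vfun (Suc n) r \<sigma>" "\<lambda>\<sigma>. b1 * vfun (Suc n) r \<sigma>"
    "\<lambda>\<sigma>. b2 * vfun n (r div 2) \<sigma>"]] f(1)]
  show ?thesis
    by (intro exI[of _ b0] exI[of _ b1] exI[of _ b2] conjI b2(1))
      (use b0 b1 b2(2) in \<open>simp only: HB_vals[OF v] add.commute simp_thms\<close>)
qed

lemma H2_step:
  assumes g: "g \<in> H2"
  shows "\<exists>u0\<in>{id, zz}. \<exists>u1\<in>{id, xx}. \<exists>u2\<in>{id, yy}. inv\<^bsub>Gt\<^esub> (u0 \<circ> u1 \<circ> u2) \<circ> g \<in> N1"
proof -
  define u0 where "u0 = (if ee g = 1 then zz else id)"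
  define u1 where "u1 = (if sg 0 (sec 0 g) = 1 then xx else id)"
  define u2 where "u2 = (if sg (Suc 0) (sec 0 g) = 1 then yy else id)"
  have u: "u0 \<in> {id, zz}" "u1 \<in> {id, xx}" "u2 \<in> {id, yy}" by (simp_all add: u0_def u1_def u2_def)
  have h2: "u0 \<in> H2" "u1 \<in> H2" "u2 \<in> H2"
    using u zz_H2 Kt_xx normal_id[OF H2_normal] by (auto simp: Kt_H2)
  define w where "w = u0 \<circ> u1 \<circ> u2"
  have w: "w \<in> H2" unfolding w_def by (intro normal_comp[OF H2_normal] h2)
  have iw: "inv\<^bsub>Gt\<^esub> w \<in> H2" by (rule normal_inv[OF H2_normal w])
  have hG: "u \<in> GG \<and> sg 0 u = 0" if "u \<in> H2" for u using that by (simp add: H2_def)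
  have s01: "u0 \<circ> u1 \<in> H2" by (intro normal_comp[OF H2_normal] h2)
  have e: "sg j (sec 0 (inv\<^bsub>Gt\<^esub> w \<circ> g)) = sg j (sec 0 u0) + sg j (sec 0 u1) + sg j (sec 0 u2) + sg j (sec 0 g)" for j
    using ssg_comp[of "inv\<^bsub>Gt\<^esub> w" g j 0] ssg_inv[of w j 0] ssg_comp[of "u0 \<circ> u1" u2 j 0] ssg_comp[of u0 u1 j 0]
      hG[OF iw] hG[OF w] hG[OF g] hG[OF s01] hG[OF h2(1)] hG[OF h2(2)] hG[OF h2(3)] by (simp add: w_def)
  have "inv\<^bsub>Gt\<^esub> w \<circ> g \<in> N1"
    unfolding N1_def HI_def
  proof (intro CollectI conjI ballI)
    show "inv\<^bsub>Gt\<^esub> w \<circ> g \<in> H2" by (rule normal_comp[OF H2_normal iw g])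
    show "sg j (sec 0 (inv\<^bsub>Gt\<^esub> w \<circ> g)) = 0" if "j \<in> {0, Suc 0, 2}" for j
      using that unfolding e u0_def u1_def u2_def by auto
  qed
  then show ?thesis using u unfolding w_def by blast
qed

text \<open>The chosen generators are involutions, except those built from x. In weight 2 the square
  of x has weight 4, and in a block the square of \<open>gX\<close> moves its function to the
  \<gamma> coordinate one level deeper.\<close>

lemma Hs_gens:
  assumes k1: "1 \<le> k"
  shows "\<exists>S. finite S \<and> S \<subseteq> Hs k \<and> Hs k \<subseteq> generate Gt (S \<union> Hs (Suc k)) \<and> (\<forall>u\<in>S. u \<circ> u \<in> Hs (2 * k))"
proof -
  have HG: "Hs j \<subseteq> GG" for j using normal_GG[OF Hs_normal] by blast
  consider "k = 1" | "k = 2" | "3 \<le> k" using k1 by linarith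
  then show ?thesis
  proof cases
    case 1
    have sub: "gens \<union> Hs (Suc k) \<subseteq> GG" using gens_GG HG by blast
    have "g \<in> generate Gt (gens \<union> Hs (Suc k))" if "g \<in> GG" for g
      using that
    proof (induction g rule: GG_left_induct)
      case id
      show ?case using generate.one[of Gt "gens \<union> Hs (Suc k)"] by (simp add: Gt_one)
    next
      case (comp t g)
      show ?case by (rule generate_comp[OF sub _ comp(3)]) (rule generate.incl, use comp(1) in simp)
    qed
    then have sub2: "GG \<subseteq> generate Gt (gens \<union> Hs (Suc k))" by blast
    have kG: "Hs k = GG" using 1 by simp
    have "gens \<subseteq> GG" using gens_GG by blast
    moreover have "u \<circ> u \<in> Hs (2 * k)" if "u \<in> gens" for u
      using gens_self[OF that] normal_id[OF Hs_normal] by simp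
    moreover have "finite gens" by (simp add: gens_def)
    ultimately show ?thesis using sub2 unfolding kG by blast
  next
    case 2
    have h: "zz \<in> H2" "xx \<in> H2" "yy \<in> H2" using zz_H2 Kt_xx by (simp_all add: Kt_H2)
    have sub: "{zz, xx, yy} \<union> Hs (Suc k) \<subseteq> GG" using h H2_GG HG by blast
    have gi: "u \<in> generate Gt ({zz, xx, yy} \<union> Hs (Suc k))" if "u \<in> {id, zz, xx, yy}" for u
      using that generate.one[of Gt "{zz, xx, yy} \<union> Hs (Suc k)"] by (auto simp: Gt_one intro: generate.incl)
    have k3: "Hs (Suc k) = N1" using 2 Hs_3 by simp
    have "g \<in> generate Gt ({zz, xx, yy} \<union> Hs (Suc k))" if g: "g \<in> H2" for g
    proof -
      obtain u0 u1 u2 where u: "u0 \<in> {id, zz}" "u1 \<in> {id, xx}" "u2 \<in> {id, yy}"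
        "inv\<^bsub>Gt\<^esub> (u0 \<circ> u1 \<circ> u2) \<circ> g \<in> N1" using H2_step[OF g] by blast
      have w: "u0 \<circ> u1 \<circ> u2 \<in> generate Gt ({zz, xx, yy} \<union> Hs (Suc k))"
        by (intro generate_comp[OF sub] gi) (use u in auto)
      show ?thesis by (rule generate_quot[OF _ w]) (use sub u(4) k3 H2_GG[OF g] in auto)
    qed
    moreover have "xx \<circ> xx \<in> Hs (2 * k)"
    proof -
      have "Hs (2 * k) = HB 0 1" using Hs_block[of 1 0] 2 by simp
      moreover have "fp 0 xx2 (\<lambda>_. 1) \<in> HB 0 1" by (simp add: HB_vals[OF vals_Z] del: fp.simps)
      ultimately show ?thesis by (simp add: xx2_eq)
    qed
    ultimately show ?thesis using 2 h normal_id[OF Hs_normal]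
      by (intro exI[of _ "{zz, xx, yy}"]) auto
  next
    case 3
    then have "3 \<le> k" by simp
    then obtain n r where k: "r < 2 ^ Suc n" "k = 2 ^ Suc n + 1 + r" by (rule Hs_cases)
    have Hk: "Hs k = HB n r" "Hs (Suc k) = HB n (Suc r)"
      using Hs_block[OF k(1)] Hs_block_le[of "Suc r" n] k by simp_all
    have r2: "r div 2 < 2 ^ n" using k(1) by simp
    define gX gY gZ where "gX = fp (Suc n) xx (vfun (Suc n) r)" and "gY = fp (Suc n) yy (vfun (Suc n) r)"
      and "gZ = fp n xx2 (vfun n (r div 2))"
    have v: "Wfil (Suc n) r (vfun (Suc n) r)" "Wfil n (r div 2) (vfun n (r div 2))"
      by (rule Wfil_vfun[OF k(1)], rule Wfil_vfun[OF r2])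
    have S: "{gX, gY, gZ} \<subseteq> Hs k"
      unfolding Hk gX_def gY_def gZ_def using v by (simp add: HB_vals[OF vals_X] HB_vals[OF vals_Y] HB_vals[OF vals_Z] del: fp.simps)
    have sub: "{gX, gY, gZ} \<union> Hs (Suc k) \<subseteq> GG" using S HG by blast
    have gi: "u \<in> generate Gt ({gX, gY, gZ} \<union> Hs (Suc k))" if "u = id \<or> u \<in> {gX, gY, gZ}" for u
      using that generate.one[of Gt "{gX, gY, gZ} \<union> Hs (Suc k)"] by (auto simp: Gt_one intro: generate.incl)
    have "g \<in> generate Gt ({gX, gY, gZ} \<union> Hs (Suc k))" if g: "g \<in> Hs k" for g
    proof -
      obtain b0 b1 b2 where b: "inv\<^bsub>Gt\<^esub> (fp (Suc n) xx (\<lambda>\<sigma>. b0 * vfun (Suc n) r \<sigma>) \<circ> fp (Suc n) yy (\<lambda>\<sigma>. b1 * vfun (Suc n) r \<sigma>) \<circ>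
        fp n xx2 (\<lambda>\<sigma>. b2 * vfun n (r div 2) \<sigma>)) \<circ> g \<in> HB n (Suc r)"
        using HB_step[OF k(1), of g] g Hk by blast
      have w: "fp (Suc n) xx (\<lambda>\<sigma>. b0 * vfun (Suc n) r \<sigma>) \<circ> fp (Suc n) yy (\<lambda>\<sigma>. b1 * vfun (Suc n) r \<sigma>) \<circ>
        fp n xx2 (\<lambda>\<sigma>. b2 * vfun n (r div 2) \<sigma>) \<in> generate Gt ({gX, gY, gZ} \<union> Hs (Suc k))"
      proof (intro generate_comp[OF sub] gi)
        show "fp (Suc n) xx (\<lambda>\<sigma>. b0 * vfun (Suc n) r \<sigma>) = id \<or> fp (Suc n) xx (\<lambda>\<sigma>. b0 * vfun (Suc n) r \<sigma>) \<in> {gX, gY, gZ}"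
          using bit_scale_fp[OF bit_cases01[of b0], of "Suc n" xx "vfun (Suc n) r"] unfolding gX_def by blast
        show "fp (Suc n) yy (\<lambda>\<sigma>. b1 * vfun (Suc n) r \<sigma>) = id \<or> fp (Suc n) yy (\<lambda>\<sigma>. b1 * vfun (Suc n) r \<sigma>) \<in> {gX, gY, gZ}"
          using bit_scale_fp[OF bit_cases01[of b1], of "Suc n" yy "vfun (Suc n) r"] unfolding gY_def by blast
        show "fp n xx2 (\<lambda>\<sigma>. b2 * vfun n (r div 2) \<sigma>) = id \<or> fp n xx2 (\<lambda>\<sigma>. b2 * vfun n (r div 2) \<sigma>) \<in> {gX, gY, gZ}"
          using bit_scale_fp[OF bit_cases01[of b2], of n xx2 "vfun n (r div 2)"] unfolding gZ_def by blast
      qed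
      show ?thesis by (rule generate_quot[OF _ w]) (use sub b Hk g HG in auto)
    qed
    moreover have "gX \<circ> gX \<in> Hs (2 * k)"
    proof -
      \<comment> \<open>Doubling the weight sends offset r to the odd offset 2r + 1 of the next
        block, where the \<gamma> depth is again r.\<close>
      have "2 * k = 2 ^ Suc (Suc n) + 1 + Suc (2 * r)" using k by simp
      moreover have "Suc (2 * r) < 2 ^ Suc (Suc n)" using k(1) by simp
      ultimately have e: "Hs (2 * k) = HB (Suc n) (Suc (2 * r))" using Hs_block by metis
      show ?thesis unfolding e gX_def fp_square xx2_eq[symmetric]
        using v by (simp add: HB_vals[OF vals_Z] del: fp.simps)
    qed
    moreover have "gY \<circ> gY = id" "gZ \<circ> gZ = id"
      unfolding gY_def gZ_def fp_square by (simp_all add: xx2_pr del: fp.simps)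
    ultimately show ?thesis using S normal_id[OF Hs_normal]
      by (intro exI[of _ "{gX, gY, gZ}"]) auto
  qed
qed

interpretation RS: series_alg Gt Hs
proof (intro series_alg.intro restricted_series.intro restricted_series_axioms.intro group_alg.intro group_Gt)
  show "Hs n \<lhd> Gt" for n by (rule Hs_normal)
  show "Hs (Suc n) \<subseteq> Hs n" for n by (rule Hs_Suc)
  show "commutator Gt h g \<in> Hs (Suc n)" if "h \<in> Hs n" "g \<in> GG" for h g n by (rule Hs_commutator[OF that])
  show "Hs n \<subseteq> R" if "2 \<le> n" "R \<lhd> Gt" "\<And>h g. h \<in> Hs (n - 1) \<Longrightarrow> g \<in> GG \<Longrightarrow> commutator Gt h g \<in> R"
    "\<And>u. u \<in> Hs ((n + 1) div 2) \<Longrightarrow> u \<otimes>\<^bsub>Gt\<^esub> u \<in> R" for n R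
    by (rule Hs_generated[OF that(1,2)]) (use that(3,4) normal_GG[OF Hs_normal] Gt_mult in \<open>force+\<close>)
  show "\<exists>S. finite S \<and> S \<subseteq> Hs k \<and> Hs k \<subseteq> generate Gt (S \<union> Hs (Suc k)) \<and> (\<forall>u\<in>S. u \<otimes>\<^bsub>Gt\<^esub> u \<in> Hs (2 * k))"
    if k: "1 \<le> k" for k
  proof -
    obtain S where S: "finite S" "S \<subseteq> Hs k" "Hs k \<subseteq> generate Gt (S \<union> Hs (Suc k))" "\<forall>u\<in>S. u \<circ> u \<in> Hs (2 * k)"
      using Hs_gens[OF k] by blast
    have "u \<otimes>\<^bsub>Gt\<^esub> u = u \<circ> u" if "u \<in> S" for u
      using Gt_mult[of u u] normal_GG[OF Hs_normal, of u k] S(2) that by blast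
    then show ?thesis using S by (intro exI[of _ S]) simp
  qed
qed simp_all

theorem dim_subgroup_Gt: "1 \<le> n \<Longrightarrow> dim_subgroup Gt n = Hs n"
  by (rule RS.dim_subgroup_eq)

section \<open>The modules of multilinear polynomials\<close>

abbreviation lkp where "lkp \<equiv> Poly_Mapping.lookup"
abbreviation sing where "sing \<equiv> Poly_Mapping.single"

text \<open>\<open>of_nat\<close> into bits reduces exponents modulo two; variables are numbered
  from 1 and letters from 0.\<close>

definition parity :: "nat \<Rightarrow> (nat \<Rightarrow>\<^sub>0 nat) \<Rightarrow> word \<Rightarrow> bool" where
  "parity n t \<sigma> \<longleftrightarrow> (\<forall>j<n. of_nat (lkp t (Suc j)) = \<sigma> ! j)"

text \<open>The coefficient of the squarefree monomial of the word once all X_i^2 are set to 1: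
  monomials with the same exponent parities are merged.\<close>

definition red :: "nat \<Rightarrow> mpoly2 \<Rightarrow> word \<Rightarrow> bit" where
  "red n p \<sigma> = (\<Sum>t\<in>Poly_Mapping.keys p. if parity n t \<sigma> then lkp p t else 0)"

lemma red_add: "red n (p + q) \<sigma> = red n p \<sigma> + red n q \<sigma>"
  unfolding red_def by (rule setsum_keys_plus_distrib) simp_all

lemma red_0 [simp]: "red n 0 \<sigma> = 0"
  by (simp add: red_def)

lemma red_single: "red n (sing t c) \<sigma> = (if parity n t \<sigma> then c else 0)"
  by (simp add: red_def)

lemma red_sum: "red n (\<Sum>x\<in>A. f x) \<sigma> = (\<Sum>x\<in>A. red n (f x) \<sigma>)"
  by (induction A rule: infinite_finite_induct) (simp_all add: red_add)

lemma sum_singles: fixes p :: mpoly2 shows "(\<Sum>t\<in>Poly_Mapping.keys p. sing t (lkp p t)) = p"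
  by (rule poly_mapping_eqI)
    (simp add: lookup_sum lookup_single when_def sum.delta in_keys_iff)

lemma singles_induct:
  fixes p :: mpoly2
  assumes "P 0" "\<And>p q. P p \<Longrightarrow> P q \<Longrightarrow> P (p + q)" "\<And>t. t \<in> Poly_Mapping.keys p \<Longrightarrow> P (sing t (lkp p t))"
  shows "P p"
proof -
  have "P (\<Sum>t\<in>B. sing t (lkp p t))" if "finite B" "B \<subseteq> Poly_Mapping.keys p" for B
    using that by (induction B) (simp_all add: assms)
  from this[of "Poly_Mapping.keys p"] show ?thesis by (simp add: sum_singles)
qed

lemma red_scalar: "red n (scalar c * p) \<sigma> = c * red n p \<sigma>"
proof (induction p rule: singles_induct)
  case (2 p q)
  then show ?case by (simp only: distrib_left red_add)
next
  case (3 t)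
  then show ?case by (simp add: scalar_def mult_single red_single)
qed simp

section \<open>Squarefree representatives modulo the ideal\<close>

definition flip :: "nat \<Rightarrow> word \<Rightarrow> word" where
  "flip j \<sigma> = \<sigma>[j := 1 + \<sigma> ! j]"

lemma length_flip [simp]: "length (flip j \<sigma>) = length \<sigma>"
  by (simp add: flip_def)

lemma nth_flip: "j < length \<sigma> \<Longrightarrow> flip j \<sigma> ! k = (if k = j then 1 + \<sigma> ! j else \<sigma> ! k)"
  by (auto simp: flip_def nth_list_update)

lemma flip_flip [simp]: "j < length \<sigma> \<Longrightarrow> flip j (flip j \<sigma>) = \<sigma>"
  by (simp add: flip_def)

lemma red_Xv:
  assumes "j < n" "length \<sigma> = n"
  shows "red n (Xv (Suc j) * p) \<sigma> = red n p (flip j \<sigma>)"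
proof (induction p rule: singles_induct)
  case (2 p q)
  then show ?case by (simp only: distrib_left red_add)
next
  case (3 t)
  have "parity n (sing (Suc j) 1 + t) \<sigma> \<longleftrightarrow> parity n t (flip j \<sigma>)"
    unfolding parity_def
  proof (intro all_cong)
    fix k assume "k < n"
    have "1 + (x::bit) = y \<longleftrightarrow> x = 1 + y" for x y using bit_cases01[of x] bit_cases01[of y] by auto
    then show "(of_nat (lkp (sing (Suc j) 1 + t) (Suc k)) = \<sigma> ! k) = (of_nat (lkp t (Suc k)) = flip j \<sigma> ! k)"
      using assms by (simp add: nth_flip lookup_add lookup_single when_def)
  qed
  then show ?case by (simp add: Xv_def mult_single red_single)
qed simp

lemma red_Xv_square:
  assumes "j < n" "length \<sigma> = n"
  shows "red n (Xv (Suc j) ^ 2 * p) \<sigma> = red n p \<sigma>"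
  using red_Xv[of j n \<sigma>] red_Xv[of j n "flip j \<sigma>"] assms by (simp add: power2_eq_square mult.assoc)

lemma bit_poly_add_self [simp]: "(p :: mpoly2) + p = 0"
  by (rule poly_mapping_eqI) (simp only: lookup_add bit_add_self lookup_zero)

lemma bit_poly_add_cancel [simp]: "(p :: mpoly2) + (p + q) = q"
  by (simp only: add.assoc[symmetric] bit_poly_add_self add_0)

lemma bit_poly_minus [simp]: "- p = (p :: mpoly2)" "q - p = q + p"
proof -
  show "- p = p" by (rule minus_unique) (rule bit_poly_add_self)
  then show "q - p = q + p" by (simp only: diff_conv_add_uminus)
qed

lemma poly_ring_simps [simp]:
  "x \<otimes>\<^bsub>poly_ring n\<^esub> y = x * y" "x \<oplus>\<^bsub>poly_ring n\<^esub> y = x + y"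
  "\<one>\<^bsub>poly_ring n\<^esub> = 1" "\<zero>\<^bsub>poly_ring n\<^esub> = 0"
  by (simp_all add: poly_ring_def)

abbreviation PR :: "nat \<Rightarrow> mpoly2 set" where "PR n \<equiv> carrier (poly_ring n)"

lemma PR_iff: "p \<in> PR n \<longleftrightarrow> (\<forall>t\<in>Poly_Mapping.keys p. Poly_Mapping.keys t \<subseteq> {1..n})"
  by (simp add: poly_ring_def)

lemma PR_closed [simp]: "0 \<in> PR n" "1 \<in> PR n" "p \<in> PR n \<Longrightarrow> q \<in> PR n \<Longrightarrow> p + q \<in> PR n"
  "p \<in> PR n \<Longrightarrow> q \<in> PR n \<Longrightarrow> p * q \<in> PR n"
proof -
  show "0 \<in> PR n" "1 \<in> PR n" unfolding PR_iff by simp_all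
  show "p + q \<in> PR n" if "p \<in> PR n" "q \<in> PR n"
    using that keys_add[of p q] unfolding PR_iff by blast
  show "p * q \<in> PR n" if "p \<in> PR n" "q \<in> PR n"
    unfolding PR_iff
  proof
    fix t assume "t \<in> Poly_Mapping.keys (p * q)"
    then obtain a b where t: "t = a + b" "a \<in> Poly_Mapping.keys p" "b \<in> Poly_Mapping.keys q"
      using keys_mult[of p q] by blast
    then have "Poly_Mapping.keys a \<subseteq> {1..n}" "Poly_Mapping.keys b \<subseteq> {1..n}"
      using that unfolding PR_iff by blast+
    then show "Poly_Mapping.keys t \<subseteq> {1..n}" using keys_add[of a b] t(1) by blast
  qed
qed

lemma PR_scalar [simp]: "scalar c \<in> PR n"
  by (simp add: PR_iff scalar_def)

lemma PR_Xv [simp]: "i \<in> {1..n} \<Longrightarrow> Xv i \<in> PR n"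
  by (simp add: PR_iff Xv_def)

lemma PR_power [simp]: "p \<in> PR n \<Longrightarrow> p ^ k \<in> PR n"
  by (induction k) simp_all

lemma PR_sum: "(\<And>x. x \<in> A \<Longrightarrow> f x \<in> PR n) \<Longrightarrow> (\<Sum>x\<in>A. f x) \<in> PR n"
  by (induction A rule: infinite_finite_induct) simp_all

lemma PR_prod: "(\<And>x. x \<in> A \<Longrightarrow> f x \<in> PR n) \<Longrightarrow> (\<Prod>x\<in>A. f x) \<in> PR n"
  by (induction A rule: infinite_finite_induct) simp_all

lemma poly_ring_cring: "cring (poly_ring n)"
proof (intro cringI abelian_groupI comm_monoidI)
  show "\<exists>y\<in>PR n. y \<oplus>\<^bsub>poly_ring n\<^esub> x = \<zero>\<^bsub>poly_ring n\<^esub>" if "x \<in> PR n" for x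
    using that by (intro bexI[of _ x]) simp_all
qed (simp_all add: algebra_simps del: bit_poly_minus)

interpretation PR: cring "poly_ring n" for n
  by (rule poly_ring_cring)

lemma PR_minus: "p \<in> PR n \<Longrightarrow> q \<in> PR n \<Longrightarrow> p \<ominus>\<^bsub>poly_ring n\<^esub> q = p + q"
proof -
  assume p: "p \<in> PR n" and q: "q \<in> PR n"
  have "\<ominus>\<^bsub>poly_ring n\<^esub> q = q" by (rule PR.minus_equality) (simp_all add: q)
  then show ?thesis by (simp add: a_minus_def)
qed

lemma V_gens: "(\<lambda>i. Xv i ^ 2 - 1) ` {1..n} \<subseteq> PR n"
proof
  fix p assume "p \<in> (\<lambda>i. Xv i ^ 2 - 1) ` {1..n}"
  then obtain i where "i \<in> {1..n}" "p = Xv i ^ 2 + 1" by auto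
  then show "p \<in> PR n" by simp
qed

lemma V_ideal: "ideal (V_ideal n) (poly_ring n)"
  unfolding V_ideal_def by (rule PR.genideal_ideal[OF V_gens])

lemma V_ideal_zero: "0 \<in> V_ideal n"
  using additive_subgroup.zero_closed[OF ideal.axioms(1)[OF V_ideal]] by simp

lemma V_ideal_add: "p \<in> V_ideal n \<Longrightarrow> q \<in> V_ideal n \<Longrightarrow> p + q \<in> V_ideal n"
  using additive_subgroup.a_closed[OF ideal.axioms(1)[OF V_ideal]] by fastforce

lemma V_ideal_mult: "p \<in> V_ideal n \<Longrightarrow> q \<in> PR n \<Longrightarrow> q * p \<in> V_ideal n"
  using ideal.I_l_closed[OF V_ideal] by fastforce

lemma V_ideal_red:
  assumes "p \<in> V_ideal n" "length \<sigma> = n"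
  shows "red n p \<sigma> = 0"
proof -
  \<comment> \<open>Quantifying over all multiples makes this set an ideal by construction; that it
    contains the generators is \<open>red_Xv_square\<close>.\<close>
  define K where "K = {p \<in> PR n. \<forall>q\<in>PR n. \<forall>\<sigma>. length \<sigma> = n \<longrightarrow> red n (q * p) \<sigma> = 0}"
  have "ideal K (poly_ring n)"
  proof (rule idealI)
    show "ring (poly_ring n)" by (rule PR.ring_axioms)
    show "subgroup K (add_monoid (poly_ring n))"
    proof (rule PR.add.subgroupI)
      show "K \<subseteq> PR n" by (auto simp: K_def)
      have "0 \<in> K" by (simp add: K_def)
      then show "K \<noteq> {}" by blast
      show "\<ominus>\<^bsub>poly_ring n\<^esub> a \<in> K" if "a \<in> K" for a
      proof -
        have "a \<in> PR n" using that by (simp add: K_def)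
        then have "\<ominus>\<^bsub>poly_ring n\<^esub> a = a" by (intro PR.minus_equality) simp_all
        then show ?thesis using that by simp
      qed
      show "a \<oplus>\<^bsub>poly_ring n\<^esub> b \<in> K" if "a \<in> K" "b \<in> K" for a b
        using that by (simp add: K_def distrib_left red_add)
    qed
    show "x \<otimes>\<^bsub>poly_ring n\<^esub> a \<in> K" if "a \<in> K" "x \<in> PR n" for a x
    proof -
      have "red n (q * (x * a)) \<sigma> = 0" if "q \<in> PR n" "length \<sigma> = n" for q \<sigma>
        using \<open>a \<in> K\<close> \<open>x \<in> PR n\<close> that unfolding mult.assoc[symmetric] K_def by simp
      then show ?thesis using that by (simp add: K_def)
    qed
    then show "a \<otimes>\<^bsub>poly_ring n\<^esub> x \<in> K" if "a \<in> K" "x \<in> PR n" for a x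
      using that by (simp add: mult.commute)
  qed
  moreover have "(\<lambda>i. Xv i ^ 2 - 1) ` {1..n} \<subseteq> K"
  proof
    fix p assume "p \<in> (\<lambda>i. Xv i ^ 2 - 1) ` {1..n}"
    then obtain i where i: "i \<in> {1..n}" "p = Xv i ^ 2 + 1" by auto
    then obtain j where j: "i = Suc j" "j < n" by (cases i) auto
    have "red n (q * p) \<tau> = 0" if "length \<tau> = n" for q \<tau>
    proof -
      have "red n (q * p) \<tau> = red n (Xv i ^ 2 * q) \<tau> + red n q \<tau>"
        unfolding i(2) by (simp add: distrib_left red_add mult.commute)
      then show ?thesis using red_Xv_square[OF j(2) that] j(1) by simp
    qed
    moreover have "p \<in> PR n" using i by simp
    ultimately show "p \<in> K" by (simp add: K_def)
  qed
  ultimately have "V_ideal n \<subseteq> K" unfolding V_ideal_def by (rule PR.genideal_minimal)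
  then have "p \<in> K" using assms(1) by blast
  then have "\<forall>q\<in>PR n. red n (q * p) \<sigma> = 0" using assms(2) unfolding K_def by blast
  then have "red n (1 * p) \<sigma> = 0" using PR_closed(2) by blast
  then show ?thesis by simp
qed

definition supp :: "word \<Rightarrow> nat set" where
  "supp \<sigma> = {i \<in> {1..length \<sigma>}. \<sigma> ! (i - 1) = 1}"

definition mon :: "word \<Rightarrow> mpoly2" where
  "mon \<sigma> = (\<Prod>i\<in>supp \<sigma>. Xv i)"

lemma prod_Xv: "finite S \<Longrightarrow> (\<Prod>i\<in>S. Xv i) = sing (\<Sum>i\<in>S. sing i 1) 1"
  by (induction S rule: finite_induct) (simp_all add: Xv_def mult_single)

lemma lookup_sum_single: "finite S \<Longrightarrow> lkp (\<Sum>i\<in>S. sing i (Suc 0)) k = (if k \<in> S then 1 else 0)"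
  by (simp add: lookup_sum lookup_single when_def sum.delta)

lemma finite_supp [simp]: "finite (supp \<sigma>)"
  by (simp add: supp_def)

lemma mon_single: "mon \<sigma> = sing (\<Sum>i\<in>supp \<sigma>. sing i 1) 1"
  unfolding mon_def by (rule prod_Xv) simp

lemma Suc_supp: "Suc j \<in> supp \<sigma> \<longleftrightarrow> j < length \<sigma> \<and> \<sigma> ! j = 1"
  by (auto simp: supp_def)

lemma red_mon: "length \<sigma> = n \<Longrightarrow> length \<tau> = n \<Longrightarrow> red n (mon \<sigma>) \<tau> = (if \<tau> = \<sigma> then 1 else 0)"
proof -
  assume l: "length \<sigma> = n" "length \<tau> = n"
  have "of_nat (lkp (\<Sum>i\<in>supp \<sigma>. sing i 1) (Suc j)) = \<sigma> ! j" if "j < n" for j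
    using that l bit_cases01[of "\<sigma> ! j"] by (auto simp: lookup_sum_single Suc_supp)
  then have "parity n (\<Sum>i\<in>supp \<sigma>. sing i 1) \<tau> \<longleftrightarrow> \<tau> = \<sigma>"
    unfolding parity_def list_eq_iff_nth_eq using l by auto
  then show ?thesis by (simp add: mon_single red_single)
qed

lemma mon_PR: "length \<sigma> = n \<Longrightarrow> mon \<sigma> \<in> PR n"
  unfolding mon_def by (intro PR_prod) (auto simp: supp_def)

definition comb :: "nat \<Rightarrow> (word \<Rightarrow> bit) \<Rightarrow> mpoly2" where
  "comb n f = (\<Sum>\<sigma> | length \<sigma> = n. scalar (f \<sigma>) * mon \<sigma>)"

lemma finite_words: "finite {\<sigma>::word. length \<sigma> = n}"
proof -
  have "finite {xs. set xs \<subseteq> {0, 1 :: bit} \<and> length xs = n}" by (rule finite_lists_length_eq) simp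
  moreover have "set xs \<subseteq> {0, 1 :: bit}" for xs using bit_cases01 by blast
  ultimately show ?thesis by simp
qed

lemma comb_PR: "comb n f \<in> PR n"
  unfolding comb_def by (intro PR_sum) (simp add: mon_PR)

lemma red_comb: "length \<tau> = n \<Longrightarrow> red n (comb n f) \<tau> = f \<tau>"
proof -
  assume l: "length \<tau> = n"
  have "red n (comb n f) \<tau> = (\<Sum>\<sigma> | length \<sigma> = n. if \<tau> = \<sigma> then f \<sigma> else 0)"
    unfolding comb_def red_sum by (rule sum.cong) (simp_all add: red_scalar red_mon l)
  then show ?thesis using l finite_words by (simp add: sum.delta')
qed

lemma scalar_add: "scalar (c + d) = scalar c + scalar d"
  by (simp add: scalar_def single_add)

lemma scalar_simps [simp]: "scalar 0 = 0" "scalar 1 = 1"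
  by (simp_all add: scalar_def)

lemma comb_add: "comb n (\<lambda>\<sigma>. f \<sigma> + g \<sigma>) = comb n f + comb n g"
  unfolding comb_def by (simp add: scalar_add distrib_right sum.distrib)

lemma comb_cong: "(\<And>\<sigma>. length \<sigma> = n \<Longrightarrow> f \<sigma> = g \<sigma>) \<Longrightarrow> comb n f = comb n g"
  unfolding comb_def by (rule sum.cong) simp_all

lemma comb_delta: "length \<sigma> = n \<Longrightarrow> comb n (\<lambda>\<tau>. if \<tau> = \<sigma> then c else 0) = scalar c * mon \<sigma>"
proof -
  assume l: "length \<sigma> = n"
  have "comb n (\<lambda>\<tau>. if \<tau> = \<sigma> then c else 0) = (\<Sum>\<tau> | length \<tau> = n. if \<tau> = \<sigma> then scalar c * mon \<sigma> else 0)"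
    unfolding comb_def by (rule sum.cong) auto
  then show ?thesis using l finite_words by (simp add: sum.delta)
qed

text \<open>Induction on the total degree: as long as some exponent is at least two, X_i^2 is
  replaced by 1.\<close>

lemma single_reduce:
  assumes "Poly_Mapping.keys t \<subseteq> {1..n}"
  shows "\<exists>\<sigma>. length \<sigma> = n \<and> sing t 1 + mon \<sigma> \<in> V_ideal n"
  using assms
proof (induction "\<Sum>i = 1..n. lkp t i" arbitrary: t rule: less_induct)
  case less
  show ?case
  proof (cases "\<exists>i\<in>{1..n}. 2 \<le> lkp t i")
    case False
    define \<sigma> where "\<sigma> = map (\<lambda>j. if lkp t (Suc j) = 1 then 1 else 0 :: bit) [0..<n]"
    have "t = (\<Sum>i\<in>supp \<sigma>. sing i 1)"
    proof (rule poly_mapping_eqI)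
      fix k
      show "lkp t k = lkp (\<Sum>i\<in>supp \<sigma>. sing i 1) k"
      proof (cases "k \<in> {1..n}")
        case True
        then obtain j where j: "k = Suc j" "j < n" by (cases k) auto
        have "lkp t k \<le> 1" using False True by force
        then show ?thesis using j by (auto simp: lookup_sum_single Suc_supp \<sigma>_def)
      next
        case k: False
        then have "lkp t k = 0" using less.prems by (auto simp: in_keys_iff)
        moreover have "k \<notin> supp \<sigma>" using k by (auto simp: supp_def \<sigma>_def)
        ultimately show ?thesis by (simp add: lookup_sum_single)
      qed
    qed
    then have "sing t 1 = mon \<sigma>" unfolding mon_single by simp
    then show ?thesis using V_ideal_zero by (intro exI[of _ \<sigma>]) (simp add: \<sigma>_def)
  next
    case True
    then obtain i where i: "i \<in> {1..n}" "2 \<le> lkp t i" by blast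
    define t' where "t' = t - sing i 2"
    have l: "lkp t' k = (if k = i then lkp t i - 2 else lkp t k)" for k
      by (simp add: t'_def lookup_minus lookup_single when_def)
    have t: "t = sing i 2 + t'"
      by (rule poly_mapping_eqI) (use i in \<open>auto simp: lookup_add lookup_single l when_def\<close>)
    have k: "Poly_Mapping.keys t' \<subseteq> {1..n}"
      using less.prems by (auto simp: in_keys_iff l split: if_splits)
    have "(\<Sum>i = 1..n. lkp t' i) < (\<Sum>i = 1..n. lkp t i)"
      by (rule sum_strict_mono_ex1) (use i in \<open>auto simp: l\<close>)
    from less.hyps[OF this k] obtain \<sigma> where s: "length \<sigma> = n" "sing t' 1 + mon \<sigma> \<in> V_ideal n" by blast
    have "(Xv i ^ 2 - 1) \<in> V_ideal n"
      unfolding V_ideal_def using PR.genideal_self[OF V_gens] i(1) by blast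
    then have "Xv i ^ 2 + 1 \<in> V_ideal n" by simp
    then have "sing t' 1 * (Xv i ^ 2 + 1) \<in> V_ideal n" by (rule V_ideal_mult) (use k in \<open>simp add: PR_iff\<close>)
    moreover have "Xv i ^ 2 = sing (sing i 2) 1"
      by (simp add: Xv_def power2_eq_square mult_single single_add[symmetric] numeral_2_eq_2)
    then have "sing t' 1 * (Xv i ^ 2 + 1) = sing t 1 + sing t' 1"
      by (simp add: distrib_left mult_single t add.commute)
    ultimately have "sing t 1 + sing t' 1 \<in> V_ideal n" by simp
    from V_ideal_add[OF this s(2)] have "sing t 1 + mon \<sigma> \<in> V_ideal n" by (simp only: add.assoc bit_poly_add_cancel)
    then show ?thesis using s(1) by blast
  qed
qed

text \<open>It is enough to find some combination of squarefree monomials congruent to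
  \<open>p\<close>: \<open>red\<close> vanishes on the ideal and reads off coefficients, so the
  combination must be the one with coefficients \<open>red n p\<close>.\<close>

lemma reduce:
  assumes "p \<in> PR n"
  shows "p + comb n (red n p) \<in> V_ideal n"
proof -
  have "\<exists>f. p + comb n f \<in> V_ideal n"
  proof (induction p rule: singles_induct)
    case 1
    have "comb n (\<lambda>_. 0) = 0" by (simp add: comb_def)
    then show ?case using V_ideal_zero by (intro exI[of _ "\<lambda>_. 0"]) simp
  next
    case (2 p q)
    then obtain f g where fg: "p + comb n f \<in> V_ideal n" "q + comb n g \<in> V_ideal n" by blast
    have e: "p + q + comb n (\<lambda>\<sigma>. f \<sigma> + g \<sigma>) = (p + comb n f) + (q + comb n g)"
      unfolding comb_add by (simp add: ac_simps)
    then show ?case using V_ideal_add[OF fg] by (intro exI[of _ "\<lambda>\<sigma>. f \<sigma> + g \<sigma>"]) (simp only: e)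
  next
    case (3 t)
    have "lkp p t = 1" using bit_cases01[of "lkp p t"] 3 by (auto simp: in_keys_iff)
    moreover have "Poly_Mapping.keys t \<subseteq> {1..n}" using assms 3 by (simp add: PR_iff)
    then obtain \<sigma> where s: "length \<sigma> = n" "sing t 1 + mon \<sigma> \<in> V_ideal n" using single_reduce by blast
    ultimately show ?case using comb_delta[OF s(1), of 1] by (intro exI[of _ "\<lambda>\<tau>. if \<tau> = \<sigma> then 1 else 0"]) simp
  qed
  then obtain f where f: "p + comb n f \<in> V_ideal n" by blast
  have "f \<sigma> = red n p \<sigma>" if "length \<sigma> = n" for \<sigma>
    using V_ideal_red[OF f that] red_comb[OF that, of f] by (simp add: red_add bit_add_eq_0)
  then have "comb n f = comb n (red n p)" by (rule comb_cong)
  then show ?thesis using f by simp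
qed

lemma V_class_eq_iff:
  assumes "p \<in> PR n" "q \<in> PR n"
  shows "V_class n p = V_class n q \<longleftrightarrow> (\<forall>\<sigma>. length \<sigma> = n \<longrightarrow> red n p \<sigma> = red n q \<sigma>)"
proof -
  have "V_class n p = V_class n q \<longleftrightarrow> p + q \<in> V_ideal n"
    unfolding V_class_def using PR.quotient_eq_iff_same_a_r_cos[OF V_ideal assms] PR_minus[OF assms] by simp
  also have "\<dots> \<longleftrightarrow> (\<forall>\<sigma>. length \<sigma> = n \<longrightarrow> red n p \<sigma> = red n q \<sigma>)"
  proof
    assume "p + q \<in> V_ideal n"
    then show "\<forall>\<sigma>. length \<sigma> = n \<longrightarrow> red n p \<sigma> = red n q \<sigma>"
      using V_ideal_red by (metis red_add bit_add_eq_0)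
  next
    assume "\<forall>\<sigma>. length \<sigma> = n \<longrightarrow> red n p \<sigma> = red n q \<sigma>"
    then have "comb n (red n p) = comb n (red n q)" by (intro comb_cong) simp
    moreover have "(p + comb n (red n p)) + (q + comb n (red n q)) \<in> V_ideal n"
      using V_ideal_add[OF reduce[OF assms(1)] reduce[OF assms(2)]] by simp
    ultimately show "p + q \<in> V_ideal n" by (simp add: ac_simps)
  qed
  finally show ?thesis .
qed

section \<open>The modules V_n identified with functions on words\<close>

definition Vfun :: "nat \<Rightarrow> (word \<Rightarrow> bit) \<Rightarrow> mpoly2 set" where
  "Vfun n f = V_class n (comb n f)"

lemma Vfun_eq_iff: "Vfun n f = Vfun n g \<longleftrightarrow> (\<forall>\<sigma>. length \<sigma> = n \<longrightarrow> f \<sigma> = g \<sigma>)"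
  unfolding Vfun_def V_class_eq_iff[OF comb_PR comb_PR] by (simp add: red_comb)

lemma V_class_Vfun: "p \<in> PR n \<Longrightarrow> V_class n p = Vfun n (red n p)"
  unfolding Vfun_def by (simp add: V_class_eq_iff comb_PR red_comb)

lemma V_carrier: "carrier (V n) = range (Vfun n)"
proof -
  have "carrier (V n) = V_class n ` PR n"
    by (auto simp: V_def FactRing_def A_RCOSETS_def' V_class_def)
  also have "\<dots> = range (Vfun n)"
  proof (rule Set.equalityI)
    show "V_class n ` PR n \<subseteq> range (Vfun n)" using V_class_Vfun by blast
    show "range (Vfun n) \<subseteq> V_class n ` PR n" using comb_PR by (auto simp: Vfun_def)
  qed
  finally show ?thesis .
qed

lemma V_add: "Vfun n f \<oplus>\<^bsub>V n\<^esub> Vfun n g = Vfun n (\<lambda>\<sigma>. f \<sigma> + g \<sigma>)"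
  unfolding V_def FactRing_def Vfun_def V_class_def comb_add
  using ideal.a_rcos_sum[OF V_ideal comb_PR comb_PR, of n f g] by simp

lemma V_zero: "\<zero>\<^bsub>V n\<^esub> = Vfun n (\<lambda>_. 0)"
proof -
  have "comb n (\<lambda>_. 0) = 0" by (simp add: comb_def)
  then show ?thesis
    unfolding V_def FactRing_def Vfun_def V_class_def
    using PR.a_coset_add_zero[OF additive_subgroup.a_subset[OF ideal.axioms(1)[OF V_ideal]], of n] by simp
qed

lemma V_monom_Vfun: "V_monom \<sigma> = Vfun (length \<sigma>) (\<lambda>\<tau>. if \<tau> = \<sigma> then 1 else 0)"
  unfolding V_monom_def Vfun_def comb_delta[OF refl] mon_def supp_def by simp

text \<open>The product expands into all squarefree monomials with support in \<open>S\<close>. A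
  new factor 1 + X_i adds the function with letter i flipped, and of a word and its flip only the
  one with letter i equal to 0 was counted before.\<close>

lemma red_prod_one_plus:
  assumes "length \<sigma> = n" "finite S" "S \<subseteq> {1..n}"
  shows "red n (\<Prod>i\<in>S. 1 + Xv i) \<sigma> = (if supp \<sigma> \<subseteq> S then 1 else 0)"
  using assms(2,3,1)
proof (induction S arbitrary: \<sigma> rule: finite_induct)
  case empty
  have "supp (replicate n 0) = {}" by (auto simp: supp_def)
  then have "mon (replicate n 0) = 1" by (simp add: mon_def)
  then have "red n 1 \<sigma> = (if \<sigma> = replicate n 0 then 1 else 0)"
    using red_mon[of "replicate n 0" n \<sigma>] empty by simp
  moreover have "\<sigma> = replicate n 0 \<longleftrightarrow> supp \<sigma> \<subseteq> {}"
  proof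
    assume "supp \<sigma> \<subseteq> {}"
    then have "\<sigma> ! j = 0" if "j < n" for j
      using Suc_supp[of j \<sigma>] bit_cases01[of "\<sigma> ! j"] that empty by auto
    then show "\<sigma> = replicate n 0" using empty by (intro nth_equalityI) auto
  qed (auto simp: supp_def)
  ultimately show ?case by simp
next
  case (insert i S)
  then obtain j where j: "i = Suc j" "j < n" by (cases i) auto
  have l: "length \<sigma> = n" by fact
  have "red n (\<Prod>i\<in>insert i S. 1 + Xv i) \<sigma>
      = red n (\<Prod>i\<in>S. 1 + Xv i) \<sigma> + red n (\<Prod>i\<in>S. 1 + Xv i) (flip j \<sigma>)"
    using insert(1,2) red_Xv[OF j(2) l] j(1) by (simp add: distrib_right red_add)
  also have "\<dots> = (if supp \<sigma> \<subseteq> S then 1 else 0) + (if supp (flip j \<sigma>) \<subseteq> S then 1 else 0)"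
    using insert l by simp
  also have "\<dots> = (if supp \<sigma> \<subseteq> insert i S then 1 else 0)"
  proof -
    have f: "k \<in> supp (flip j \<sigma>) \<longleftrightarrow> (if k = i then \<sigma> ! j = 0 else k \<in> supp \<sigma>)" for k
      using j l bit_cases01[of "\<sigma> ! j"] by (cases k) (auto simp: supp_def nth_flip)
    have i: "i \<in> supp \<sigma> \<longleftrightarrow> \<sigma> ! j = 1" using j l by (simp add: Suc_supp)
    show ?thesis
    proof (cases "\<sigma> ! j = 1")
      case True
      then have "i \<in> supp \<sigma>" "supp (flip j \<sigma>) = supp \<sigma> - {i}" using f i by (auto split: if_splits)
      then show ?thesis using insert(2) by auto
    next
      case False
      then have "\<sigma> ! j = 0" using bit_cases01[of "\<sigma> ! j"] by blast
      then have "i \<notin> supp \<sigma>" "i \<in> supp (flip j \<sigma>)" using f i by auto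
      then show ?thesis using insert(2) by auto
    qed
  qed
  finally show ?case .
qed

text \<open>The closed form needed for the comparison with products of 1 - X_i: a word contributes
  when its support is contained in the set of binary digits 1 of \<open>r\<close>.\<close>

lemma vfun_iff: "length \<sigma> = n \<Longrightarrow> vfun n r \<sigma> = (if \<forall>j<n. \<sigma> ! j = 1 \<longrightarrow> odd (r div 2 ^ j) then 1 else 0)"
proof (induction n arbitrary: r \<sigma>)
  case (Suc n)
  obtain z \<tau> where s: "\<sigma> = z # \<tau>" "length \<tau> = n" using Suc.prems by (auto simp: length_Suc_conv)
  have "(\<forall>j<Suc n. \<sigma> ! j = 1 \<longrightarrow> odd (r div 2 ^ j))
      \<longleftrightarrow> (z = 1 \<longrightarrow> odd r) \<and> (\<forall>j<n. \<tau> ! j = 1 \<longrightarrow> odd (r div 2 div 2 ^ j))"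
    unfolding s(1) by (simp add: All_less_Suc2 div_mult2_eq)
  moreover have "(z = 1 \<longrightarrow> odd r) \<longleftrightarrow> \<not> (even r \<and> z = 1)" by blast
  ultimately have "(\<forall>j<Suc n. \<sigma> ! j = 1 \<longrightarrow> odd (r div 2 ^ j))
      \<longleftrightarrow> \<not> (even r \<and> z = 1) \<and> (\<forall>j<n. \<tau> ! j = 1 \<longrightarrow> odd (r div 2 div 2 ^ j))" by blast
  then show ?case unfolding vfun.simps s(1) list.sel Suc.IH[OF s(2)] by (simp only: if_not_P split: if_splits) auto
qed simp

lemma v_poly_PR: "v_poly n r \<in> PR n"
  unfolding v_poly_def by (intro PR_prod PR_power) simp

lemma red_v_poly:
  assumes "length \<sigma> = n"
  shows "red n (v_poly n r) \<sigma> = vfun n r \<sigma>"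
proof -
  define S where "S = {i \<in> {1..n}. odd (r div 2 ^ (i - 1))}"
  have S: "finite S" "S \<subseteq> {1..n}" by (auto simp: S_def)
  have "v_poly n r = (\<Prod>i = 1..n. if i \<in> S then 1 + Xv i else 1)"
    unfolding v_poly_def by (rule prod.cong) (auto simp: S_def odd_iff_mod_2_eq_one even_iff_mod_2_eq_zero)
  also have "\<dots> = (\<Prod>i\<in>S. 1 + Xv i)"
    using S(2) prod.inter_restrict[of "{1..n}" "\<lambda>i. 1 + Xv i" S] by (simp add: Int_absorb1)
  finally have "red n (v_poly n r) \<sigma> = (if supp \<sigma> \<subseteq> S then 1 else 0)"
    using red_prod_one_plus[OF assms S] by simp
  also have "supp \<sigma> \<subseteq> S \<longleftrightarrow> (\<forall>j<n. \<sigma> ! j = 1 \<longrightarrow> odd (r div 2 ^ j))"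
  proof
    assume s: "supp \<sigma> \<subseteq> S"
    show "\<forall>j<n. \<sigma> ! j = 1 \<longrightarrow> odd (r div 2 ^ j)"
    proof (intro allI impI)
      fix j assume "j < n" "\<sigma> ! j = 1"
      then have "Suc j \<in> S" using s Suc_supp[of j \<sigma>] assms by blast
      then show "odd (r div 2 ^ j)" by (simp add: S_def)
    qed
  next
    assume o: "\<forall>j<n. \<sigma> ! j = 1 \<longrightarrow> odd (r div 2 ^ j)"
    show "supp \<sigma> \<subseteq> S"
    proof
      fix i assume "i \<in> supp \<sigma>"
      then have "i \<in> {1..n}" "\<sigma> ! (i - 1) = 1" using assms by (auto simp: supp_def)
      moreover have "i - 1 < n" using calculation(1) by auto
      ultimately show "i \<in> S" using o by (simp add: S_def)
    qed
  qed
  finally show ?thesis using vfun_iff[OF assms] by simp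
qed

lemma V_sub_iff: "Vfun n f \<in> V_sub n r \<longleftrightarrow> Wfil n r f"
proof -
  have e: "Vfun n f = V_class n (\<Sum>j = r..<2 ^ n. scalar (c j) * v_poly n j)
      \<longleftrightarrow> (\<forall>\<sigma>. length \<sigma> = n \<longrightarrow> f \<sigma> = (\<Sum>j = r..<2 ^ n. c j * vfun n j \<sigma>))" for c
  proof -
    have "(\<Sum>j = r..<2 ^ n. scalar (c j) * v_poly n j) \<in> PR n" by (intro PR_sum) (simp add: v_poly_PR)
    then show ?thesis
      unfolding Vfun_def by (simp add: V_class_eq_iff comb_PR red_comb red_sum red_scalar red_v_poly)
  qed
  then show ?thesis unfolding Wfil_span V_sub_def by blast
qed

section \<open>The coordinate isomorphism\<close>

definition abv :: "nat \<Rightarrow> (word \<Rightarrow> word) \<Rightarrow> mpoly2 set \<times> mpoly2 set \<times> mpoly2 set" where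
  "abv n g = (Vfun (Suc n) (val 0 g), Vfun (Suc n) (val (Suc 0) g), Vfun n (val2 g))"

lemma abv_vals: "vals n g f0 f1 f2 \<Longrightarrow> abv n g = (Vfun (Suc n) f0, Vfun (Suc n) f1, Vfun n f2)"
  by (simp add: abv_def vals_def Vfun_eq_iff)

abbreviation VV where
  "VV n \<equiv> add_monoid (V (Suc n)) \<times>\<times> add_monoid (V (Suc n)) \<times>\<times> add_monoid (V n)"

abbreviation GN where "GN n \<equiv> Gt\<lparr>carrier := copies n N1\<rparr>"

lemma copies_N1_subgroup: "subgroup (copies n N1) Gt"
  using normal_imp_subgroup[OF HB_normal[of n 0]] unfolding HB_0 .

lemma GN_group: "group (GN n)"
  by (rule Gt.subgroup_imp_group[OF copies_N1_subgroup])

lemma VV_group: "group (VV n)"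
proof -
  have "ring (V k)" for k unfolding V_def by (rule ideal.quotient_is_ring[OF V_ideal])
  then have "group (add_monoid (V k))" for k by (intro abelian_group.a_group ring.is_abelian_group)
  then show ?thesis by (intro DirProd_group)
qed

lemma VV_simps: "(C, D, E) \<otimes>\<^bsub>VV n\<^esub> (C', D', E') = (C \<oplus>\<^bsub>V (Suc n)\<^esub> C', D \<oplus>\<^bsub>V (Suc n)\<^esub> D', E \<oplus>\<^bsub>V n\<^esub> E')"
  "\<one>\<^bsub>VV n\<^esub> = (Vfun (Suc n) (\<lambda>_. 0), Vfun (Suc n) (\<lambda>_. 0), Vfun n (\<lambda>_. 0))"
  "carrier (VV n) = range (Vfun (Suc n)) \<times> range (Vfun (Suc n)) \<times> range (Vfun n)"
  by (simp_all add: DirProd_def V_carrier V_zero)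

lemma abv_comp:
  assumes "g \<in> copies n N1" "h \<in> copies n N1"
  shows "abv n (g \<circ> h) = abv n g \<otimes>\<^bsub>VV n\<^esub> abv n h"
  unfolding abv_vals[OF vals_comp[OF vals_self[OF assms(1)] vals_self[OF assms(2)]]]
  unfolding abv_def VV_simps V_add ..

lemma GN_mult: "g \<in> copies n N1 \<Longrightarrow> h \<in> copies n N1 \<Longrightarrow> g \<otimes>\<^bsub>GN n\<^esub> h = g \<circ> h"
  using Gt_mult[of g h] copies_N1_GG by simp

lemma abv_hom: "group_hom (GN n) (VV n) (abv n)"
proof (intro group_hom.intro GN_group VV_group group_hom_axioms.intro homI)
  show "abv n g \<in> carrier (VV n)" for g by (simp add: VV_simps V_carrier abv_def)
  show "abv n (g \<otimes>\<^bsub>GN n\<^esub> h) = abv n g \<otimes>\<^bsub>VV n\<^esub> abv n h" if "g \<in> carrier (GN n)" "h \<in> carrier (GN n)" for g h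
    using that abv_comp[of g n h] GN_mult[of g n h] by simp
qed

lemma abv_eq_one: "g \<in> copies n N1 \<Longrightarrow> abv n g = \<one>\<^bsub>VV n\<^esub> \<longleftrightarrow> g \<in> copies (Suc n) N1"
proof -
  assume g: "g \<in> copies n N1"
  have "abv n g = \<one>\<^bsub>VV n\<^esub> \<longleftrightarrow> vals n g (\<lambda>_. 0) (\<lambda>_. 0) (\<lambda>_. 0)"
    using g unfolding abv_def VV_simps prod.inject Vfun_eq_iff vals_def by blast
  then show ?thesis using vals_ker vals_of_ker by blast
qed

lemma copies_N1_Suc: "copies (Suc n) N1 \<subseteq> copies n N1"
  using vals_copies[OF vals_of_ker] by blast

lemma abv_kernel: "kernel (GN n) (VV n) (abv n) = copies (Suc n) N1"
  using abv_eq_one copies_N1_Suc by (fastforce simp: kernel_def)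

lemma abv_surj: "abv n ` carrier (GN n) = carrier (VV n)"
proof
  show "abv n ` carrier (GN n) \<subseteq> carrier (VV n)" by (auto simp: VV_simps V_carrier abv_def)
  show "carrier (VV n) \<subseteq> abv n ` carrier (GN n)"
  proof
    fix C assume "C \<in> carrier (VV n)"
    then obtain f0 f1 f2 where C: "C = (Vfun (Suc n) f0, Vfun (Suc n) f1, Vfun n f2)" unfolding VV_simps by blast
    show "C \<in> abv n ` carrier (GN n)"
      using abv_vals[OF vals_XYZ, of n f0 f1 f2] vals_copies[OF vals_XYZ, of n f0 f1 f2]
      unfolding C by (intro image_eqI[OF sym]) simp_all
  qed
qed

lemma abv_coset:
  assumes g: "g \<in> copies n N1"
  shows "the_elem (abv n ` (copies (Suc n) N1 #>\<^bsub>Gt\<^esub> g)) = abv n g"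
proof -
  have e: "abv n (l \<otimes>\<^bsub>Gt\<^esub> g) = abv n g" if l: "l \<in> copies (Suc n) N1" for l
  proof -
    have "vals n (l \<circ> g) (val 0 g) (val (Suc 0) g) (val2 g)"
      by (rule vals_cong[OF vals_comp[OF vals_of_ker[OF l] vals_self[OF g]]]) simp_all
    then show ?thesis using abv_vals abv_def Gt_mult[OF copies_N1_GG[OF l] copies_N1_GG[OF g]] by simp
  qed
  have "id \<in> copies (Suc n) N1" by (rule id_copies[OF normal_id[OF N1_normal]])
  moreover have "abv n ` (copies (Suc n) N1 #>\<^bsub>Gt\<^esub> g) = (\<lambda>l. abv n (l \<otimes>\<^bsub>Gt\<^esub> g)) ` copies (Suc n) N1"
    unfolding r_coset_def by (simp add: image_UN UNION_singleton_eq_range image_image)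
  moreover have "\<dots> = (\<lambda>l. abv n g) ` copies (Suc n) N1" by (rule image_cong[OF refl e])
  ultimately have "abv n ` (copies (Suc n) N1 #>\<^bsub>Gt\<^esub> g) = {abv n g}" by auto
  then show ?thesis by simp
qed

lemma Nt_Suc1: "Nt (Suc n + 1) = copies (Suc n) N1"
  using Nt_Suc[of "Suc n"] by simp

lemma abv_at_vertex:
  "length \<sigma> = Suc n \<Longrightarrow> at_vertex \<sigma> xx \<in> copies n N1 \<and> abv n (at_vertex \<sigma> xx) = (V_monom \<sigma>, \<zero>\<^bsub>V (Suc n)\<^esub>, \<zero>\<^bsub>V n\<^esub>)"
  "length \<sigma> = Suc n \<Longrightarrow> at_vertex \<sigma> yy \<in> copies n N1 \<and> abv n (at_vertex \<sigma> yy) = (\<zero>\<^bsub>V (Suc n)\<^esub>, V_monom \<sigma>, \<zero>\<^bsub>V n\<^esub>)"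
  "length \<tau> = n \<Longrightarrow> at_vertex \<tau> xx2 \<in> copies n N1 \<and> abv n (at_vertex \<tau> xx2) = (\<zero>\<^bsub>V (Suc n)\<^esub>, \<zero>\<^bsub>V (Suc n)\<^esub>, V_monom \<tau>)"
  using vals_copies[OF vals_X] abv_vals[OF vals_X] vals_copies[OF vals_Y] abv_vals[OF vals_Y]
    vals_copies[OF vals_Z] abv_vals[OF vals_Z]
  by (simp_all only: at_vertex_fp V_monom_Vfun V_zero)

lemma is_abg_abv: "is_abg (Suc n) (\<lambda>C. the_elem (abv n ` C))"
  unfolding is_abg_def Nt_Suc1 diff_Suc_1 Nt_Suc
proof (intro conjI allI impI)
  show "(\<lambda>C. the_elem (abv n ` C)) \<in> iso (GN n Mod copies (Suc n) N1) (VV n)"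
    using group_hom.FactGroup_iso_set[OF abv_hom abv_surj] unfolding abv_kernel .
next
  fix \<sigma> :: word
  show "the_elem (abv n ` (copies (Suc n) N1 #>\<^bsub>Gt\<^esub> at_vertex \<sigma> xx)) = (V_monom \<sigma>, \<zero>\<^bsub>V (Suc n)\<^esub>, \<zero>\<^bsub>V n\<^esub>)"
    "the_elem (abv n ` (copies (Suc n) N1 #>\<^bsub>Gt\<^esub> at_vertex \<sigma> yy)) = (\<zero>\<^bsub>V (Suc n)\<^esub>, V_monom \<sigma>, \<zero>\<^bsub>V n\<^esub>)"
    if "length \<sigma> = Suc n"
    using abv_at_vertex(1,2)[OF that] by (simp_all only: abv_coset)
  show "the_elem (abv n ` (copies (Suc n) N1 #>\<^bsub>Gt\<^esub> at_vertex \<sigma> xx2)) = (\<zero>\<^bsub>V (Suc n)\<^esub>, \<zero>\<^bsub>V (Suc n)\<^esub>, V_monom \<sigma>)"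
    if "length \<sigma> = n"
    using abv_at_vertex(3)[OF that] by (simp only: abv_coset)
qed

lemma word_fun_induct:
  assumes zero: "P (\<lambda>_. 0)" and add: "\<And>f g. P f \<Longrightarrow> P g \<Longrightarrow> P (\<lambda>\<sigma>. f \<sigma> + g \<sigma>)"
    and delta: "\<And>\<sigma>. length \<sigma> = n \<Longrightarrow> P (\<lambda>\<tau>. if \<tau> = \<sigma> then 1 else 0)"
    and cong: "\<And>f g. P f \<Longrightarrow> (\<And>\<sigma>. length \<sigma> = n \<Longrightarrow> f \<sigma> = g \<sigma>) \<Longrightarrow> P g"
  shows "P (f :: word \<Rightarrow> bit)"
proof -
  have "P (\<lambda>\<tau>. if \<tau> \<in> A then f \<tau> else 0)" if "finite A" "A \<subseteq> {\<sigma>. length \<sigma> = n}" for A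
    using that
  proof (induction A)
    case empty
    then show ?case using zero by simp
  next
    case (insert \<sigma> A)
    then have IH: "P (\<lambda>\<tau>. if \<tau> \<in> A then f \<tau> else 0)" and l: "length \<sigma> = n" by simp_all
    show ?case
    proof (cases "f \<sigma> = 0")
      case True
      show ?thesis by (rule cong[OF IH]) (use True in auto)
    next
      case False
      then have f1: "f \<sigma> = 1" using bit_cases01[of "f \<sigma>"] by blast
      show ?thesis by (rule cong[OF add[OF IH delta[OF l]]]) (use f1 insert(2) in auto)
    qed
  qed
  from this[OF finite_words[of n]] have "P (\<lambda>\<tau>. if \<tau> \<in> {\<sigma>. length \<sigma> = n} then f \<tau> else 0)" by blast
  then show ?thesis by (rule cong) simp
qed

text \<open>The prescribed values fix \<open>\<phi>\<close> on single entries x, y and x^2, which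
  generate N_m modulo N_(m+1). Hence whichever isomorphism \<open>abg\<close> selects, on cosets it
  is given by the explicit parities.\<close>

lemma is_abg_unique:
  assumes \<phi>: "is_abg (Suc n) \<phi>" and g: "g \<in> copies n N1"
  shows "\<phi> (copies (Suc n) N1 #>\<^bsub>Gt\<^esub> g) = abv n g"
proof -
  let ?L = "copies (Suc n) N1"
  define F where "F g = \<phi> (?L #>\<^bsub>Gt\<^esub> g)" for g
  note p = \<phi>[unfolded is_abg_def Nt_Suc1 diff_Suc_1 Nt_Suc]
  have hom: "\<phi> \<in> hom (GN n Mod ?L) (VV n)" using p by (auto simp: iso_def)
  have nor: "?L \<lhd> GN n" using group_hom.normal_kernel[OF abv_hom] unfolding abv_kernel .
  have cos: "?L #>\<^bsub>GN n\<^esub> g = ?L #>\<^bsub>Gt\<^esub> g" for g by (simp add: r_coset_def)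
  note c = normal.r_coset_hom_Mod[OF nor, unfolded cos]
  have F_comp: "F (g \<circ> h) = F g \<otimes>\<^bsub>VV n\<^esub> F h" if "g \<in> copies n N1" "h \<in> copies n N1" for g h
  proof -
    have "?L #>\<^bsub>Gt\<^esub> (g \<circ> h) = (?L #>\<^bsub>Gt\<^esub> g) \<otimes>\<^bsub>GN n Mod ?L\<^esub> (?L #>\<^bsub>Gt\<^esub> h)"
      using hom_mult[OF c, of g h] GN_mult[OF that] that by simp
    then show ?thesis
      unfolding F_def using hom_mult[OF hom hom_in_carrier[OF c] hom_in_carrier[OF c], of g h] that by simp
  qed
  have F_L: "F l = \<one>\<^bsub>VV n\<^esub>" if l: "l \<in> ?L" for l
  proof -
    have "?L #>\<^bsub>Gt\<^esub> l = ?L" by (rule Gt.coset_join2[OF copies_N1_GG[OF l] copies_N1_subgroup l])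
    then show ?thesis
      unfolding F_def using hom_one[OF hom normal.factorgroup_is_group[OF nor] VV_group] by simp
  qed
  define R where "R = {g \<in> copies n N1. F g = abv n g}"
  have R_comp: "g \<circ> h \<in> R" if "g \<in> R" "h \<in> R" for g h
    using that F_comp abv_comp copies_N1_comp unfolding R_def by simp
  have R_L: "l \<in> R" if "l \<in> ?L" for l
    using F_L[OF that] abv_eq_one[of l n] copies_N1_Suc that unfolding R_def by fastforce
  have id: "vals n id (\<lambda>_. 0) (\<lambda>_. 0) (\<lambda>_. 0)" "id \<in> R"
    by (rule vals_id, rule R_L[OF id_copies[OF normal_id[OF N1_normal]]])
  have R_vertex: "at_vertex \<sigma> xx \<in> R" "at_vertex \<sigma> yy \<in> R" if "length \<sigma> = Suc n" for \<sigma>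
    using p abv_at_vertex[of \<sigma> n] that unfolding R_def F_def by simp_all
  have R_vertex2: "at_vertex \<sigma> xx2 \<in> R" if "length \<sigma> = n" for \<sigma>
    using p abv_at_vertex(3)[of \<sigma> n] that unfolding R_def F_def by simp
  have vals_add: "\<exists>e\<in>R. vals n e (\<lambda>\<sigma>. f0 \<sigma> + k0 \<sigma>) (\<lambda>\<sigma>. f1 \<sigma> + k1 \<sigma>) (\<lambda>\<sigma>. f2 \<sigma> + k2 \<sigma>)"
    if "\<exists>e\<in>R. vals n e f0 f1 f2" "\<exists>e\<in>R. vals n e k0 k1 k2" for f0 f1 f2 k0 k1 k2
    using that R_comp vals_comp by blast
  have X: "\<exists>e\<in>R. vals n e f (\<lambda>_. 0) (\<lambda>_. 0)" for f
  proof (rule word_fun_induct[where P = "\<lambda>f. \<exists>e\<in>R. vals n e f (\<lambda>_. 0) (\<lambda>_. 0)" and n = "Suc n"])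
    show "\<exists>e\<in>R. vals n e (\<lambda>\<tau>. if \<tau> = \<sigma> then 1 else 0) (\<lambda>_. 0) (\<lambda>_. 0)" if "length \<sigma> = Suc n" for \<sigma>
      using vals_X R_vertex(1)[OF that] unfolding at_vertex_fp that by blast
    show "\<exists>e\<in>R. vals n e (\<lambda>\<sigma>. f \<sigma> + g \<sigma>) (\<lambda>_. 0) (\<lambda>_. 0)"
      if "\<exists>e\<in>R. vals n e f (\<lambda>_. 0) (\<lambda>_. 0)" "\<exists>e\<in>R. vals n e g (\<lambda>_. 0) (\<lambda>_. 0)" for f g
      using vals_add[OF that] by simp
    show "\<exists>e\<in>R. vals n e g (\<lambda>_. 0) (\<lambda>_. 0)"
      if f: "\<exists>e\<in>R. vals n e f (\<lambda>_. 0) (\<lambda>_. 0)" and eq: "\<And>\<sigma>. length \<sigma> = Suc n \<Longrightarrow> f \<sigma> = g \<sigma>" for f g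
      using f eq unfolding vals_def by auto
  qed (use id in blast)
  have Y: "\<exists>e\<in>R. vals n e (\<lambda>_. 0) f (\<lambda>_. 0)" for f
  proof (rule word_fun_induct[where P = "\<lambda>f. \<exists>e\<in>R. vals n e (\<lambda>_. 0) f (\<lambda>_. 0)" and n = "Suc n"])
    show "\<exists>e\<in>R. vals n e (\<lambda>_. 0) (\<lambda>\<tau>. if \<tau> = \<sigma> then 1 else 0) (\<lambda>_. 0)" if "length \<sigma> = Suc n" for \<sigma>
      using vals_Y R_vertex(2)[OF that] unfolding at_vertex_fp that by blast
    show "\<exists>e\<in>R. vals n e (\<lambda>_. 0) (\<lambda>\<sigma>. f \<sigma> + g \<sigma>) (\<lambda>_. 0)"
      if "\<exists>e\<in>R. vals n e (\<lambda>_. 0) f (\<lambda>_. 0)" "\<exists>e\<in>R. vals n e (\<lambda>_. 0) g (\<lambda>_. 0)" for f g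
      using vals_add[OF that] by simp
    show "\<exists>e\<in>R. vals n e (\<lambda>_. 0) g (\<lambda>_. 0)"
      if f: "\<exists>e\<in>R. vals n e (\<lambda>_. 0) f (\<lambda>_. 0)" and eq: "\<And>\<sigma>. length \<sigma> = Suc n \<Longrightarrow> f \<sigma> = g \<sigma>" for f g
      using f eq unfolding vals_def by auto
  qed (use id in blast)
  have Z: "\<exists>e\<in>R. vals n e (\<lambda>_. 0) (\<lambda>_. 0) f" for f
  proof (rule word_fun_induct[where P = "\<lambda>f. \<exists>e\<in>R. vals n e (\<lambda>_. 0) (\<lambda>_. 0) f" and n = n])
    show "\<exists>e\<in>R. vals n e (\<lambda>_. 0) (\<lambda>_. 0) (\<lambda>\<tau>. if \<tau> = \<sigma> then 1 else 0)" if "length \<sigma> = n" for \<sigma>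
      using vals_Z R_vertex2[OF that] unfolding at_vertex_fp that by blast
    show "\<exists>e\<in>R. vals n e (\<lambda>_. 0) (\<lambda>_. 0) (\<lambda>\<sigma>. f \<sigma> + g \<sigma>)"
      if "\<exists>e\<in>R. vals n e (\<lambda>_. 0) (\<lambda>_. 0) f" "\<exists>e\<in>R. vals n e (\<lambda>_. 0) (\<lambda>_. 0) g" for f g
      using vals_add[OF that] by simp
    show "\<exists>e\<in>R. vals n e (\<lambda>_. 0) (\<lambda>_. 0) g"
      if f: "\<exists>e\<in>R. vals n e (\<lambda>_. 0) (\<lambda>_. 0) f" and eq: "\<And>\<sigma>. length \<sigma> = n \<Longrightarrow> f \<sigma> = g \<sigma>" for f g
      using f eq unfolding vals_def by auto
  qed (use id in blast)
  obtain e where e: "e \<in> R" "vals n e (val 0 g) (val (Suc 0) g) (val2 g)"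
    using vals_add[OF vals_add[OF X[of "val 0 g"] Y[of "val (Suc 0) g"]] Z[of "val2 g"]] by auto
  have eG: "e \<in> GG" using copies_N1_GG[OF vals_copies[OF e(2)]] .
  have "inv\<^bsub>Gt\<^esub> e \<circ> g \<in> R" by (rule R_L[OF vals_quot[OF vals_self[OF g] e(2)]])
  from R_comp[OF e(1) this] have "(e \<circ> inv\<^bsub>Gt\<^esub> e) \<circ> g \<in> R" by (simp only: comp_assoc)
  then show ?thesis using Gt_inv_comp(2)[OF eG] unfolding R_def F_def by simp
qed

lemma abg_preimage_HB:
  "abg_preimage (Suc n) (V_sub (Suc n) r) (V_sub (Suc n) r) (V_sub n (r div 2)) = HB n r"
proof -
  have "is_abg (Suc n) (abg (Suc n))" unfolding abg_def by (rule someI[of "is_abg (Suc n)", OF is_abg_abv])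
  from is_abg_unique[OF this] show ?thesis
    unfolding abg_preimage_def HB_def Nt_Suc1 Nt_Suc by (auto simp: abv_def V_sub_iff)
qed

section \<open>Ranks\<close>

lemma F2_simps [simp]: "carrier F2 = UNIV" "x \<otimes>\<^bsub>F2\<^esub> y = x * y" "x \<oplus>\<^bsub>F2\<^esub> y = x + y" "\<one>\<^bsub>F2\<^esub> = 1" "\<zero>\<^bsub>F2\<^esub> = 0"
  by (simp_all add: F2_def)

lemma F2_field: "field F2"
proof -
  interpret cring F2
  proof (intro cringI abelian_groupI comm_monoidI)
    show "\<exists>y\<in>carrier F2. y \<oplus>\<^bsub>F2\<^esub> x = \<zero>\<^bsub>F2\<^esub>" for x by (intro bexI[of _ x]) simp_all
  qed (simp_all add: algebra_simps)
  have "1 \<in> Units F2"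
    unfolding Units_def F2_simps mem_Collect_eq by (intro conjI UNIV_I bexI[of _ "1::bit"] mult_1_left)
  moreover have "0 \<notin> Units F2"
  proof
    assume "0 \<in> Units F2"
    then obtain y :: bit where "y * 0 = 1" unfolding Units_def F2_simps by blast
    then show False by (simp only: mult_zero_right zero_neq_one)
  qed
  ultimately have "x \<in> Units F2 \<longleftrightarrow> x \<in> carrier F2 - {\<zero>\<^bsub>F2\<^esub>}" for x
    using bit_cases01[of x] unfolding F2_simps by blast
  then show ?thesis by (intro cring_fieldI Set.set_eqI)
qed

text \<open>Additive functionals that separate points, together with a dual family, make that family
  a basis. Over the field with two elements additivity already implies linearity.\<close>

lemma dim_F2I:
  fixes T (structure)
  assumes "abelian_group T"
    and s0: "\<And>C. C \<in> carrier T \<Longrightarrow> (0::bit) \<odot> C = \<zero>" and s1: "\<And>C. C \<in> carrier T \<Longrightarrow> 1 \<odot> C = C"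
    and dbl: "\<And>C. C \<in> carrier T \<Longrightarrow> C \<oplus> C = \<zero>"
    and ladd: "\<And>j C D. j < d \<Longrightarrow> C \<in> carrier T \<Longrightarrow> D \<in> carrier T \<Longrightarrow> l j (C \<oplus> D) = l j C + (l j D :: bit)"
    and sep: "\<And>C. C \<in> carrier T \<Longrightarrow> (\<And>j. j < d \<Longrightarrow> l j C = 0) \<Longrightarrow> C = \<zero>"
    and e: "\<And>j. j < d \<Longrightarrow> e j \<in> carrier T"
    and dual: "\<And>i j. i < d \<Longrightarrow> j < d \<Longrightarrow> l i (e j) = (if i = j then 1 else 0)"
  shows "vectorspace.dim F2 T = d"
proof -
  interpret T: abelian_group T by fact
  interpret F2: field F2 by (rule F2_field)
  have sm: "a \<odot> C = (if a = 0 then \<zero> else C)" if "C \<in> carrier T" for a C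
    using bit_cases01[of a] s0 s1 that by auto
  have "module F2 T"
  proof (rule moduleI)
    show "cring F2" by (rule F2.is_cring)
    show "abelian_group T" by fact
    show "a \<odot> x \<in> carrier T" if "x \<in> carrier T" for a x using that by (simp add: sm)
    show "(a \<oplus>\<^bsub>F2\<^esub> b) \<odot> x = a \<odot> x \<oplus> b \<odot> x" if x: "x \<in> carrier T" for a b x
    proof -
      have "b \<noteq> 0 \<Longrightarrow> b = 1" "a \<noteq> 0 \<Longrightarrow> a = 1" using bit_cases01[of b] bit_cases01[of a] by blast+
      then show ?thesis using dbl[OF x] x by (cases "a = 0"; cases "b = 0") (simp_all add: sm del: one_add_one)
    qed
    show "a \<odot> (x \<oplus> y) = a \<odot> x \<oplus> a \<odot> y" if "x \<in> carrier T" "y \<in> carrier T" for a x y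
      using that by (simp add: sm)
    show "(a \<otimes>\<^bsub>F2\<^esub> b) \<odot> x = a \<odot> (b \<odot> x)" if "x \<in> carrier T" for a b x using that by (simp add: sm)
    show "\<one>\<^bsub>F2\<^esub> \<odot> x = x" if "x \<in> carrier T" for x using that by (simp add: s1)
  qed
  then interpret vectorspace F2 T by (intro vectorspace.intro F2_field)
  have l0: "l j \<zero> = 0" if "j < d" for j
    using ladd[OF that, of \<zero> \<zero>] by simp
  have lsm: "l j (a \<odot> C) = a * l j C" if "j < d" "C \<in> carrier T" for j a C
    using that bit_cases01[of a] by (auto simp: sm l0)
  have llin: "l j (lincomb a B) = (\<Sum>v\<in>B. a v * l j v)" if "finite B" "B \<subseteq> carrier T" "j < d" for j a B
    using that(1,2)
  proof (induction B)
    case (insert v B)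
    have "lincomb a (insert v B) = a v \<odot> v \<oplus> lincomb a B"
      unfolding lincomb_def using insert by (intro T.finsum_insert) (auto simp: sm)
    moreover have "lincomb a B \<in> carrier T" unfolding lincomb_def using insert by (intro T.finsum_closed) (auto simp: sm)
    moreover have "a v \<odot> v \<in> carrier T" using insert by (simp add: sm)
    ultimately show ?case using insert ladd[OF that(3)] lsm[OF that(3)] by simp
  qed (simp add: lincomb_def l0 that(3))
  have inj: "inj_on e {..<d}"
  proof (rule inj_onI)
    fix i j assume "i \<in> {..<d}" "j \<in> {..<d}" "e i = e j"
    then show "i = j" using dual[of i i] dual[of i j] by (auto split: if_splits)
  qed
  define B where "B = e ` {..<d}"
  have B: "finite B" "B \<subseteq> carrier T" using e by (auto simp: B_def)
  have coord: "l j (lincomb a B) = a (e j)" if "j < d" for a j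
  proof -
    have "l j (lincomb a B) = (\<Sum>i<d. a (e i) * l j (e i))"
      unfolding llin[OF B that] unfolding B_def by (simp add: sum.reindex[OF inj] comp_apply)
    also have "\<dots> = (\<Sum>i<d. if j = i then a (e i) else 0)"
      by (rule sum.cong) (use dual that in auto)
    finally show ?thesis using that by (simp add: sum.delta')
  qed
  have closed: "lincomb a B \<in> carrier T" for a
    unfolding lincomb_def using B by (intro T.finsum_closed) (auto simp: sm)
  have "lin_indpt B"
  proof (rule finite_lin_indpt2[OF B])
    show "\<forall>v\<in>B. a v = \<zero>\<^bsub>F2\<^esub>" if "lincomb a B = \<zero>" for a
      using coord[of _ a] l0 that by (auto simp: B_def)
  qed
  moreover have "gen_set B"
  proof (rule Set.equalityI)
    show "span B \<subseteq> carrier T" unfolding finite_span[OF B] using closed by blast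
    show "carrier T \<subseteq> span B"
    proof
      fix C assume C: "C \<in> carrier T"
      define a where "a v = l (the_inv_into {..<d} e v) C" for v
      have a: "a (e j) = l j C" if "j < d" for j
        using the_inv_into_f_f[OF inj, of j] that by (simp add: a_def)
      have "C \<oplus> lincomb a B = \<zero>"
      proof (rule sep)
        show "C \<oplus> lincomb a B \<in> carrier T" using C closed by simp
        show "l j (C \<oplus> lincomb a B) = 0" if "j < d" for j
          using ladd[OF that C closed] coord[OF that] a[OF that] by simp
      qed
      then have "(C \<oplus> lincomb a B) \<oplus> lincomb a B = lincomb a B" using closed by simp
      then have "C = lincomb a B" using dbl[OF closed] C closed[of a] by (simp add: T.a_assoc)
      then show "C \<in> span B" unfolding finite_span[OF B] by auto
    qed
  qed
  ultimately have "basis B" using B(2) by (simp add: basis_def)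
  then have "dim = card B" by (rule dim_basis[OF B(1)])
  then show ?thesis by (simp add: B_def card_image[OF inj])
qed

section \<open>The tensor product with the field of two elements\<close>

definition Lam :: "('k \<Rightarrow> bit) \<Rightarrow> ('k \<Rightarrow>\<^sub>0 int) \<Rightarrow> bit" where
  "Lam w c = (\<Sum>x\<in>Poly_Mapping.keys c. of_int (Poly_Mapping.lookup c x) * w x)"

lemma Lam_add: "Lam w (c + c') = Lam w c + Lam w c'"
  unfolding Lam_def by (rule setsum_keys_plus_distrib) (simp_all add: distrib_right)

lemma Lam_0 [simp]: "Lam w 0 = 0"
  by (simp add: Lam_def)

lemma Lam_minus: "Lam w (c - c') = Lam w c + Lam w c'"
  using Lam_add[of w "c - c'" c'] by (simp add: add.commute)

lemma Lam_uminus: "Lam w (- c) = Lam w c"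
  using Lam_minus[of w 0 c] by simp

lemma Lam_frag_of [simp]: "Lam w (frag_of x) = w x"
  by (simp add: Lam_def)

text \<open>The functionals make \<open>M\<close> elementary abelian, and every class of the tensor
  product is represented by a single pair \<open>(g, 1)\<close>. Extended additively by
  \<open>Lam\<close>, the functionals vanish on the bilinearity relations and serve as
  coordinates.\<close>

lemma rank_eq:
  fixes M :: "('a, 'b) monoid_scheme" (structure)
  assumes "group M"
    and hom: "\<And>j g h. j < d \<Longrightarrow> g \<in> carrier M \<Longrightarrow> h \<in> carrier M \<Longrightarrow> \<psi> j (g \<otimes> h) = \<psi> j g + (\<psi> j h :: bit)"
    and sep: "\<And>g. g \<in> carrier M \<Longrightarrow> (\<And>j. j < d \<Longrightarrow> \<psi> j g = 0) \<Longrightarrow> g = \<one>"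
    and u: "\<And>j. j < d \<Longrightarrow> u j \<in> carrier M"
    and dual: "\<And>i j. i < d \<Longrightarrow> j < d \<Longrightarrow> \<psi> i (u j) = (if i = j then 1 else 0)"
  shows "rank M = d"
proof -
  interpret M: group M by fact
  define S where "S = carrier M \<times> (UNIV :: bit set)"
  define F where "F = free_Abelian_group S"
  define R where "R = tensor_rels M"
  define P :: "('a \<times> bit \<Rightarrow>\<^sub>0 int) set" where "P = {frag_of (g \<otimes> h, t) - frag_of (g, t) - frag_of (h, t) | g h t. g \<in> carrier M \<and> h \<in> carrier M} \<union>
      {frag_of (g, s + t) - frag_of (g, s) - frag_of (g, t) | g s t. g \<in> carrier M}"
  have FT: "tensor_free M = F" by (simp add: tensor_free_def F_def S_def)
  have RP: "R = generate F P" by (simp add: R_def tensor_rels_def FT P_def)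
  interpret F: comm_group F unfolding F_def by (rule abelian_free_Abelian_group)
  have F_iff: "c \<in> carrier F \<longleftrightarrow> Poly_Mapping.keys c \<subseteq> S" for c by (simp add: F_def)
  have Fs [simp]: "c \<otimes>\<^bsub>F\<^esub> c' = c + c'" "\<one>\<^bsub>F\<^esub> = 0" for c c' by (simp_all add: F_def)
  have F_inv: "inv\<^bsub>F\<^esub> c = - c" if "c \<in> carrier F" for c using that by (simp add: F_def)
  have F_diff: "c - c' \<in> carrier F" if "c \<in> carrier F" "c' \<in> carrier F" for c c'
    using F.m_closed[OF that(1) F.inv_closed[OF that(2)]] F_inv[OF that(2)] by simp
  have F_of: "g \<in> carrier M \<Longrightarrow> frag_of (g, t) \<in> carrier F" for g t by (simp add: F_def S_def)
  have PF: "P \<subseteq> carrier F" unfolding P_def by (auto intro!: F_diff F_of M.m_closed)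
  have sub: "subgroup R F" unfolding RP by (rule F.generate_is_subgroup[OF PF])
  have nor: "R \<lhd> F" by (rule F.subgroup_imp_normal[OF sub])
  interpret R: normal R F by (rule nor)
  have R_F: "r \<in> R \<Longrightarrow> r \<in> carrier F" for r using subgroup.subset[OF sub] by blast
  have R0: "0 \<in> R" using subgroup.one_closed[OF sub] by simp
  have R_add: "r + r' \<in> R" if "r \<in> R" "r' \<in> R" for r r' using subgroup.m_closed[OF sub that] by simp
  have R_neg: "- r \<in> R" if "r \<in> R" for r using subgroup.m_inv_closed[OF sub that] F_inv[OF R_F[OF that]] by simp
  have R_diff: "r - r' \<in> R" if "r \<in> R" "r' \<in> R" for r r' using R_add[OF that(1) R_neg[OF that(2)]] by simp
  have Rg: "frag_of (g \<otimes> h, t) - frag_of (g, t) - frag_of (h, t) \<in> R" if "g \<in> carrier M" "h \<in> carrier M" for g h t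
    unfolding RP by (rule generate.incl) (use that in \<open>auto simp: P_def\<close>)
  have Rt: "frag_of (g, s + t) - frag_of (g, s) - frag_of (g, t) \<in> R" if "g \<in> carrier M" for g s t
    unfolding RP by (rule generate.incl) (use that in \<open>auto simp: P_def\<close>)
  have Rz: "frag_of (g, 0) \<in> R" if "g \<in> carrier M" for g
    using R_neg[OF Rt[OF that, of 0 0]] by simp
  have R2: "frag_of (g, t) + frag_of (g, t) \<in> R" if "g \<in> carrier M" for g t
    using R_diff[OF Rz[OF that] Rt[OF that, of t t]] by (simp add: algebra_simps)
  have R1: "frag_of (\<one>, t) \<in> R" for t
    using R_neg[OF Rg[of \<one> \<one> t]] by simp
  have dblR: "c + c \<in> R" if "c \<in> carrier F" for c
    using that unfolding F_iff
  proof (induction c rule: frag_induction)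
    case (one x)
    then show ?case using R2[of "fst x" "snd x"] by (auto simp: S_def)
  next
    case (diff c c')
    have e: "(c - c') + (c - c') = (c + c) - (c' + c')" by (simp add: algebra_simps)
    show ?case unfolding e by (rule R_diff[OF diff])
  qed (simp add: R0)
  have rep: "\<exists>g\<in>carrier M. c - frag_of (g, 1) \<in> R" if "c \<in> carrier F" for c
    using that unfolding F_iff
  proof (induction c rule: frag_induction)
    case zero
    show ?case using R_neg[OF R1[of 1]] by (intro bexI[of _ \<one>]) simp_all
  next
    case (one x)
    then obtain g t where x: "x = (g, t)" "g \<in> carrier M" by (auto simp: S_def)
    show ?case
    proof (cases "t = 0")
      case True
      then show ?thesis using R_diff[OF Rz[OF x(2)] R1[of 1]] x by (intro bexI[of _ \<one>]) simp_all
    next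
      case False
      then have "t = 1" using bit_cases01[of t] by blast
      then show ?thesis using R0 x by (intro bexI[of _ g]) simp_all
    qed
  next
    case (diff c c')
    then obtain g h where g: "g \<in> carrier M" "c - frag_of (g, 1) \<in> R" and h: "h \<in> carrier M" "c' - frag_of (h, 1) \<in> R" by blast
    \<comment> \<open>\<open>g \<otimes> h\<close> stands for the quotient of \<open>g\<close> by
      \<open>h\<close>: the discrepancy is twice \<open>(h, 1)\<close>, which is a relation.\<close>
    have "(c - frag_of (g, 1)) - (c' - frag_of (h, 1)) -
        (frag_of (g \<otimes> h, 1) - frag_of (g, 1) - frag_of (h, 1)) - (frag_of (h, 1) + frag_of (h, 1))
      = c - c' - frag_of (g \<otimes> h, 1)" by (simp add: algebra_simps)
    moreover have "(c - frag_of (g, 1)) - (c' - frag_of (h, 1)) -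
        (frag_of (g \<otimes> h, 1) - frag_of (g, 1) - frag_of (h, 1)) - (frag_of (h, 1) + frag_of (h, 1)) \<in> R"
      by (intro R_diff g(2) h(2) Rg[OF g(1) h(1)] R2[OF h(1)])
    ultimately show ?case using M.m_closed[OF g(1) h(1)] by (intro bexI[of _ "g \<otimes> h"]) simp_all
  qed
  define w where "w j x = snd x * \<psi> j (fst x)" for j and x :: "'a \<times> bit"
  have LR: "Lam (w j) r = 0" if j: "j < d" and r: "r \<in> R" for j r
    using r unfolding RP
  proof (induction r rule: generate.induct)
    case one
    then show ?case by simp
  next
    case i: (incl r)
    then show ?case using hom[OF j] by (auto simp: P_def Lam_minus w_def distrib_left distrib_right add_ac)
  next
    case i: (inv r)
    have "Lam (w j) r = 0"
      using i hom[OF j] by (auto simp: P_def Lam_minus w_def distrib_left distrib_right add_ac)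
    moreover have "r \<in> carrier F" using i PF by blast
    ultimately show ?case by (simp only: F_inv Lam_uminus)
  next
    case (eng r r')
    then show ?case by (simp add: Lam_add)
  qed
  define q where "q c = R #>\<^bsub>F\<^esub> c" for c
  have q_elem: "x \<in> q c \<longleftrightarrow> x - c \<in> R" for x c
  proof
    assume "x \<in> q c" then show "x - c \<in> R" by (auto simp: q_def r_coset_def)
  next
    assume "x - c \<in> R"
    then show "x \<in> q c" unfolding q_def r_coset_def by (auto intro!: bexI[of _ "x - c"])
  qed
  have q_R: "c \<in> R \<Longrightarrow> q c = R" for c unfolding q_def by (rule F.coset_join2[OF R_F sub])
  let ?T = "tensor_F2 M"
  have carr: "carrier ?T = q ` carrier F" by (auto simp: tensor_F2_def FT R_def[symmetric] FactGroup_def RCOSETS_def q_def)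
  have zeroT: "\<zero>\<^bsub>?T\<^esub> = q 0" using q_R[OF R0] by (simp add: tensor_F2_def FT R_def[symmetric] FactGroup_def)
  have addT: "q c \<oplus>\<^bsub>?T\<^esub> q c' = q (c + c')" if "c \<in> carrier F" "c' \<in> carrier F" for c c'
    using R.rcos_sum[OF that] by (simp add: tensor_F2_def FT R_def[symmetric] FactGroup_def q_def)
  have Fadd: "c + c' \<in> carrier F" if "c \<in> carrier F" "c' \<in> carrier F" for c c' using F.m_closed[OF that] by simp
  have F0: "0 \<in> carrier F" using F.one_closed by simp
  \<comment> \<open>The value does not depend on the representative, since \<open>Lam (w j)\<close>
    vanishes on \<open>R\<close> by \<open>LR\<close>.\<close>
  define l where "l j C = Lam (w j) (SOME c. c \<in> C)" for j C
  have l: "l j (q c) = Lam (w j) c" if j: "j < d" for j c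
  proof -
    have "c \<in> q c" by (simp add: q_elem R0)
    then have "(SOME c'. c' \<in> q c) \<in> q c" by (rule someI)
    then have "Lam (w j) ((SOME c'. c' \<in> q c) - c) = 0" unfolding q_elem by (rule LR[OF j])
    then show ?thesis by (simp add: l_def Lam_minus bit_add_eq_0)
  qed
  have "vectorspace.dim F2 ?T = d"
  proof (rule dim_F2I[where l = l and e = "\<lambda>j. q (frag_of (u j, 1))"])
    show "abelian_group ?T"
    proof (rule abelian_groupI)
      show "\<exists>y\<in>carrier ?T. y \<oplus>\<^bsub>?T\<^esub> x = \<zero>\<^bsub>?T\<^esub>" if "x \<in> carrier ?T" for x
        using that dblR q_R[OF R0] q_R[OF dblR] unfolding carr zeroT by (auto simp: addT intro!: bexI)
    qed (auto simp: carr zeroT addT Fadd F0 add_ac)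
    fix C assume C: "C \<in> carrier ?T"
    then obtain c where c: "C = q c" "c \<in> carrier F" unfolding carr by blast
    show "C \<oplus>\<^bsub>?T\<^esub> C = \<zero>\<^bsub>?T\<^esub>" using c q_R[OF dblR[OF c(2)]] q_R[OF R0] by (simp add: addT zeroT)
    show "1 \<odot>\<^bsub>?T\<^esub> C = C"
    proof -
      have i: "frag_extend (\<lambda>(g, t). frag_of (g, t)) x = x" for x :: "'a \<times> bit \<Rightarrow>\<^sub>0 int"
      proof -
        have "(\<lambda>(g, t). frag_of (g, t)) = (frag_of :: 'a \<times> bit \<Rightarrow> _)" by (rule ext) auto
        then show ?thesis by (simp only: frag_expansion[symmetric])
      qed
      have "C \<in> rcosets\<^bsub>F\<^esub> R" using c by (auto simp: q_def RCOSETS_def)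
      then have "R <#>\<^bsub>F\<^esub> C = C" by (rule R.rcosets_mult_eq)
      then show ?thesis by (simp add: tensor_F2_def FT R_def[symmetric] i)
    qed
    have absorb: "R <#>\<^bsub>F\<^esub> Y = R" if Y: "Y \<subseteq> R" "x \<in> Y" for Y x
    proof
      show "R <#>\<^bsub>F\<^esub> Y \<subseteq> R" using R_add Y(1) by (auto simp: set_mult_def)
      show "R \<subseteq> R <#>\<^bsub>F\<^esub> Y"
      proof
        fix r assume "r \<in> R"
        then have "r - x \<in> R" using R_diff Y by blast
        moreover have "r = (r - x) \<otimes>\<^bsub>F\<^esub> x" by simp
        ultimately show "r \<in> R <#>\<^bsub>F\<^esub> Y" unfolding set_mult_def using Y(2) by blast
      qed
    qed
    show "0 \<odot>\<^bsub>?T\<^esub> C = \<zero>\<^bsub>?T\<^esub>"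
    proof -
      let ?D = "frag_extend (\<lambda>(g, t). frag_of (g, 0 :: bit))"
      have D: "?D x \<in> R" if "x \<in> carrier F" for x
        using that unfolding F_iff
      proof (induction x rule: frag_induction)
        case (one x)
        then show ?case using Rz[of "fst x"] by (auto simp: S_def split: prod.splits)
      next
        case (diff x y)
        then show ?case using R_diff by (simp add: frag_extend_diff)
      qed (simp add: R0)
      have "c \<in> C" using c(1) by (simp add: q_elem R0)
      moreover have CF: "x \<in> carrier F" if "x \<in> C" for x
        using Fadd[OF R_F c(2), of "x - c"] that unfolding c(1) q_elem by simp
      ultimately have "R <#>\<^bsub>F\<^esub> ?D ` C = R"
      proof -
        have "?D c \<in> ?D ` C" using \<open>c \<in> C\<close> by (rule imageI)
        moreover have "?D ` C \<subseteq> R" using D CF by blast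
        ultimately show ?thesis by (rule absorb[rotated])
      qed
      then show ?thesis using q_R[OF R0] zeroT by (simp add: tensor_F2_def FT R_def[symmetric])
    qed
    show "C = \<zero>\<^bsub>?T\<^esub>" if "\<And>j. j < d \<Longrightarrow> l j C = 0"
    proof -
      obtain g where g: "g \<in> carrier M" "c - frag_of (g, 1) \<in> R" using rep[OF c(2)] by blast
      have "\<psi> j g = 0" if j: "j < d" for j
        using LR[OF j g(2)] l[OF j, of c] \<open>\<And>j. j < d \<Longrightarrow> l j C = 0\<close>[OF j] c(1) by (simp add: Lam_minus w_def)
      then have "g = \<one>" by (rule sep[OF g(1)])
      with g(2) have "c - frag_of (\<one>, 1) \<in> R" by simp
      from R_add[OF this R1[of 1]] have "c \<in> R" by (simp only: diff_add_cancel)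
      then show ?thesis using q_R[OF R0] q_R c(1) zeroT by simp
    qed
    fix D assume "D \<in> carrier ?T"
    then obtain c' where c': "D = q c'" "c' \<in> carrier F" unfolding carr by blast
    show "l j (C \<oplus>\<^bsub>?T\<^esub> D) = l j C + l j D" if "j < d" for j
      using c c' l[OF that] by (simp add: addT Lam_add)
  next
    show "q (frag_of (u j, 1)) \<in> carrier ?T" if "j < d" for j unfolding carr using F_of u that by blast
    show "l i (q (frag_of (u j, 1))) = (if i = j then 1 else 0)" if "i < d" "j < d" for i j
      using l[OF that(1)] dual[OF that] by (simp add: w_def)
  qed
  then show ?thesis by (simp add: rank_def)
qed

lemma rank_Mod:
  fixes G (structure)
  assumes "group G" and K: "K \<lhd> G"
    and hom: "\<And>j g h. j < d \<Longrightarrow> g \<in> carrier G \<Longrightarrow> h \<in> carrier G \<Longrightarrow> \<psi> j (g \<otimes> h) = \<psi> j g + (\<psi> j h :: bit)"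
    and ker: "\<And>g. g \<in> carrier G \<Longrightarrow> g \<in> K \<longleftrightarrow> (\<forall>j<d. \<psi> j g = 0)"
    and u: "\<And>j. j < d \<Longrightarrow> u j \<in> carrier G"
    and dual: "\<And>i j. i < d \<Longrightarrow> j < d \<Longrightarrow> \<psi> i (u j) = (if i = j then 1 else 0)"
  shows "rank (G Mod K) = d"
proof -
  interpret G: group G by fact
  interpret K: normal K G by fact
  define p where "p j C = \<psi> j (SOME g. g \<in> C)" for j C
  have p: "p j (K #> g) = \<psi> j g" if j: "j < d" and g: "g \<in> carrier G" for j g
  proof -
    have "g \<in> K #> g" by (rule G.rcos_self[OF g K.is_subgroup])
    then have "(SOME h. h \<in> K #> g) \<in> K #> g" by (rule someI)
    then obtain k where k: "(SOME h. h \<in> K #> g) = k \<otimes> g" "k \<in> K" by (auto simp: r_coset_def)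
    have "k \<in> carrier G" using k(2) K.subset by blast
    then show ?thesis using k hom[OF j _ g, of k] ker[of k] j by (simp add: p_def)
  qed
  have cos: "\<exists>g\<in>carrier G. C = K #> g" if "C \<in> carrier (G Mod K)" for C
    using that by (auto simp: FactGroup_def RCOSETS_def)
  show ?thesis
  proof (rule rank_eq[where \<psi> = p and u = "\<lambda>j. K #> u j"])
    show "group (G Mod K)" by (rule K.factorgroup_is_group)
    show "p j (C \<otimes>\<^bsub>G Mod K\<^esub> D) = p j C + p j D"
      if j: "j < d" and "C \<in> carrier (G Mod K)" "D \<in> carrier (G Mod K)" for j C D
    proof -
      obtain g h where g: "g \<in> carrier G" "C = K #> g" and h: "h \<in> carrier G" "D = K #> h"
        using cos \<open>C \<in> carrier (G Mod K)\<close> \<open>D \<in> carrier (G Mod K)\<close> by meson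
      have "C \<otimes>\<^bsub>G Mod K\<^esub> D = K #> (g \<otimes> h)"
        using K.rcos_sum[OF g(1) h(1)] g(2) h(2) by (simp add: FactGroup_def)
      then show ?thesis using p[OF j] g h hom[OF j g(1) h(1)] by simp
    qed
    show "C = \<one>\<^bsub>G Mod K\<^esub>" if C: "C \<in> carrier (G Mod K)" and z: "\<And>j. j < d \<Longrightarrow> p j C = 0" for C
    proof -
      obtain g where g: "g \<in> carrier G" "C = K #> g" using cos[OF C] by blast
      then have "g \<in> K" using ker[OF g(1)] z p by simp
      then show ?thesis using G.coset_join2[OF g(1) K.is_subgroup] g(2) by (simp add: FactGroup_def)
    qed
    show "K #> u j \<in> carrier (G Mod K)" if "j < d" for j
      using u[OF that] by (auto simp: FactGroup_def RCOSETS_def)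
    show "p i (K #> u j) = (if i = j then 1 else 0)" if "i < d" "j < d" for i j
      using p[OF that(1) u[OF that(2)]] dual[OF that] by simp
  qed
qed

text \<open>For a function of depth \<open>r\<close> this is its coefficient at v_n^r, that is, its
  class in the one-dimensional quotient by depth r + 1.\<close>

definition cf :: "nat \<Rightarrow> nat \<Rightarrow> (word \<Rightarrow> bit) \<Rightarrow> bit" where
  "cf n r f = (if Wfil n (Suc r) f then 0 else 1)"

text \<open>Two functions of depth \<open>r\<close> that are not of depth r + 1 both agree with
  \<open>vfun n r\<close> modulo depth r + 1, so their sum is of that depth.\<close>

lemma cf_add:
  assumes r: "r < 2 ^ n" and f: "Wfil n r f" and g: "Wfil n r g"
  shows "cf n r (\<lambda>\<sigma>. f \<sigma> + g \<sigma>) = cf n r f + cf n r g"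
proof -
  have e: "Wfil n (Suc r) (\<lambda>\<sigma>. f \<sigma> + g \<sigma>) \<longleftrightarrow> Wfil n (Suc r) g" if "Wfil n (Suc r) f" for f g
  proof
    assume "Wfil n (Suc r) (\<lambda>\<sigma>. f \<sigma> + g \<sigma>)"
    from Wfil_add[OF that this] show "Wfil n (Suc r) g" by simp
  qed (rule Wfil_add[OF that])
  show ?thesis
  proof (cases "Wfil n (Suc r) f")
    case True
    then show ?thesis using e[OF True, of g] by (simp add: cf_def)
  next
    case nf: False
    show ?thesis
    proof (cases "Wfil n (Suc r) g")
      case True
      then show ?thesis using e[OF True, of f] nf by (simp add: cf_def add.commute)
    next
      case False
      have "Wfil n (Suc r) (\<lambda>\<sigma>. f \<sigma> + vfun n r \<sigma>)" "Wfil n (Suc r) (\<lambda>\<sigma>. g \<sigma> + vfun n r \<sigma>)"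
        using Wfil_step[OF r f] Wfil_step[OF r g] nf False by blast+
      from Wfil_add[OF this] have "Wfil n (Suc r) (\<lambda>\<sigma>. f \<sigma> + g \<sigma>)" by (simp add: add_ac)
      then show ?thesis using nf False by (simp add: cf_def)
    qed
  qed
qed

lemma cf_cong: "(\<And>\<sigma>. length \<sigma> = n \<Longrightarrow> f \<sigma> = g \<sigma>) \<Longrightarrow> cf n r f = cf n r g"
  unfolding cf_def using Wfil_cong[of n f g "Suc r"] by simp

lemma cf_zero: "cf n r (\<lambda>_. 0) = 0"
  by (simp add: cf_def Wfil_zero)

lemma cf_vfun: "r < 2 ^ n \<Longrightarrow> cf n r (vfun n r) = 1"
  by (simp add: cf_def not_Wfil_vfun)

section \<open>Ranks of the factors of the series\<close>

lemma rank_quotient: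
  assumes H: "subgroup H Gt" and K: "K \<lhd> Gt" "K \<subseteq> H"
    and hom: "\<And>j g h. j < d \<Longrightarrow> g \<in> H \<Longrightarrow> h \<in> H \<Longrightarrow> \<psi> j (g \<circ> h) = \<psi> j g + (\<psi> j h :: bit)"
    and ker: "\<And>g. g \<in> H \<Longrightarrow> g \<in> K \<longleftrightarrow> (\<forall>j<d. \<psi> j g = 0)"
    and u: "\<And>j. j < d \<Longrightarrow> u j \<in> H"
    and dual: "\<And>i j. i < d \<Longrightarrow> j < d \<Longrightarrow> \<psi> i (u j) = (if i = j then 1 else 0)"
  shows "rank (Gt\<lparr>carrier := H\<rparr> Mod K) = d"
proof (rule rank_Mod[where \<psi> = \<psi> and u = u])
  show "group (Gt\<lparr>carrier := H\<rparr>)" by (rule Gt.subgroup_imp_group[OF H])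
  show "K \<lhd> Gt\<lparr>carrier := H\<rparr>" by (rule Gt.normal_restrict_supergroup[OF H K])
  show "\<psi> j (g \<otimes>\<^bsub>Gt\<lparr>carrier := H\<rparr>\<^esub> h) = \<psi> j g + \<psi> j h"
    if "j < d" "g \<in> carrier (Gt\<lparr>carrier := H\<rparr>)" "h \<in> carrier (Gt\<lparr>carrier := H\<rparr>)" for j g h
  proof -
    have gh: "g \<in> H" "h \<in> H" using that by simp_all
    then have "g \<in> GG" "h \<in> GG" using subgroup.subset[OF H] by blast+
    then show ?thesis using hom[OF that(1) gh] Gt_mult[of g h] by simp
  qed
qed (use ker u dual in simp_all)

lemma less_2_cases_sum: "(\<forall>j<2. P j) \<longleftrightarrow> P 0 \<and> P (Suc 0)" "(\<forall>j<3. P j) \<longleftrightarrow> P 0 \<and> P (Suc 0) \<and> P 2"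
  "(\<forall>j<4. P j) \<longleftrightarrow> P 0 \<and> P (Suc 0) \<and> P 2 \<and> P 3"
  by (auto simp: numeral_eq_Suc less_Suc_eq)

lemma less_numeral_cases:
  "j < (2::nat) \<Longrightarrow> j = 0 \<or> j = Suc 0" "j < (3::nat) \<Longrightarrow> j = 0 \<or> j = Suc 0 \<or> j = 2"
  "j < (4::nat) \<Longrightarrow> j = 0 \<or> j = Suc 0 \<or> j = 2 \<or> j = 3"
  by linarith+

lemma Hs_subgroup: "subgroup (Hs k) Gt"
  by (rule normal_imp_subgroup[OF Hs_normal])

text \<open>The order a, b, d, c of the dual family follows the levels: level 2 detects d and level
  3 detects c.\<close>

lemma rank_1: "rank (Gt\<lparr>carrier := Hs 1\<rparr> Mod Hs 2) = 4"
proof (rule rank_quotient[where \<psi> = sg and u = "\<lambda>j. [act_a, act_b, act_d, act_c] ! j"])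
  show "Hs 2 \<subseteq> Hs 1" using Hs_Suc[of 1] by (simp only: Suc_1)
  show "sg j (g \<circ> h) = sg j g + sg j h" if "g \<in> Hs 1" "h \<in> Hs 1" for j g h
    using that sg_comp[of g h j] by simp
  show "g \<in> Hs 2 \<longleftrightarrow> (\<forall>j<4. sg j g = 0)" if "g \<in> Hs 1" for g
    using that unfolding less_2_cases_sum Hs_01 by (simp add: H2_def del: sg_numeral)
  show "[act_a, act_b, act_d, act_c] ! j \<in> Hs 1" if "j < 4" for j
    using less_numeral_cases(3)[OF that] by auto
  show "sg i ([act_a, act_b, act_d, act_c] ! j) = (if i = j then 1 else 0)" if "i < 4" "j < 4" for i j
    using less_numeral_cases(3)[OF that(1)] less_numeral_cases(3)[OF that(2)] by (elim disjE) simp_all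
qed (rule Hs_subgroup, rule Hs_normal)

lemma rank_2: "rank (Gt\<lparr>carrier := Hs 2\<rparr> Mod Hs 3) = 3"
proof (rule rank_quotient[where \<psi> = "\<lambda>j g. sg j (sec 0 g)" and u = "\<lambda>j. [xx, yy, zz] ! j"])
  show "Hs 3 \<subseteq> Hs 2" using Hs_Suc[of 2] by (simp only: eval_nat_numeral)
  show "sg j (sec 0 (g \<circ> h)) = sg j (sec 0 g) + sg j (sec 0 h)" if "g \<in> Hs 2" "h \<in> Hs 2" for j g h
    using that ssg_comp[of g h j 0] by (simp add: H2_def)
  show "g \<in> Hs 3 \<longleftrightarrow> (\<forall>j<3. sg j (sec 0 g) = 0)" if "g \<in> Hs 2" for g
    using that unfolding less_2_cases_sum Hs_01 Hs_3 by (simp add: N1_def HI_def del: sg_numeral)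
  show "[xx, yy, zz] ! j \<in> Hs 2" if "j < 3" for j
    using less_numeral_cases(2)[OF that] Kt_xx zz_H2 by (auto simp: Kt_H2)
  show "sg i (sec 0 ([xx, yy, zz] ! j)) = (if i = j then 1 else 0)" if "i < 3" "j < 3" for i j
    using less_numeral_cases(2)[OF that(1)] less_numeral_cases(2)[OF that(2)]
    by (elim disjE) (simp_all del: sg_numeral)
qed (rule Hs_subgroup, rule Hs_normal)

text \<open>The \<gamma> depth changes only between an odd offset and the following even one, so the
  third functional counts exactly for odd \<open>r\<close>.\<close>

lemma rank_block:
  assumes r: "r < 2 ^ Suc n"
  shows "rank (Gt\<lparr>carrier := HB n r\<rparr> Mod HB n (Suc r)) = (if odd r then 3 else 2)"
proof -
  have r2: "r div 2 < 2 ^ n" using r by simp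
  define \<psi> where "\<psi> j g = (if j = 0 then cf (Suc n) r (val 0 g) else if j = Suc 0 then cf (Suc n) r (val (Suc 0) g)
    else cf n (r div 2) (val2 g))" for j :: nat and g
  define u where "u j = (if j = 0 then fp (Suc n) xx (vfun (Suc n) r)
    else if j = Suc 0 then fp (Suc n) yy (vfun (Suc n) r) else fp n xx2 (vfun n (r div 2)))" for j :: nat
  have pv: "\<psi> j g = (if j = 0 then cf (Suc n) r f0 else if j = Suc 0 then cf (Suc n) r f1 else cf n (r div 2) f2)"
    if "vals n g f0 f1 f2" for g f0 f1 f2 j
    using cf_cong[of "Suc n" "val 0 g" f0 r] cf_cong[of "Suc n" "val (Suc 0) g" f1 r] cf_cong[of n "val2 g" f2 "r div 2"] that
    by (simp add: \<psi>_def vals_def)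
  have v: "Wfil (Suc n) r (vfun (Suc n) r)" "Wfil n (r div 2) (vfun n (r div 2))"
    by (rule Wfil_vfun[OF r], rule Wfil_vfun[OF r2])
  have u: "u j \<in> HB n r" for j
    unfolding u_def using v Wfil_zero HB_vals[OF vals_X] HB_vals[OF vals_Y] HB_vals[OF vals_Z] by (simp del: fp.simps vfun.simps)
  have dual: "\<psi> i (u j) = (if i = j then 1 else 0)" if "i < 3" "j < 3" for i j
    using less_numeral_cases(2)[OF that(1)] less_numeral_cases(2)[OF that(2)]
    by (elim disjE) (simp_all add: u_def pv[OF vals_X] pv[OF vals_Y] pv[OF vals_Z] cf_zero cf_vfun[OF r] cf_vfun[OF r2] del: fp.simps vfun.simps)
  have hom: "\<psi> j (g \<circ> h) = \<psi> j g + \<psi> j h" if "g \<in> HB n r" "h \<in> HB n r" for j g h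
  proof (rule HB_obtain[OF that(1)], rule HB_obtain[OF that(2)])
    fix f0 f1 f2 k0 k1 k2
    assume f: "vals n g f0 f1 f2" "Wfil (Suc n) r f0" "Wfil (Suc n) r f1" "Wfil n (r div 2) f2"
      and k: "vals n h k0 k1 k2" "Wfil (Suc n) r k0" "Wfil (Suc n) r k1" "Wfil n (r div 2) k2"
    show ?thesis
      unfolding pv[OF vals_comp[OF f(1) k(1)]] pv[OF f(1)] pv[OF k(1)]
      using cf_add[OF r f(2) k(2)] cf_add[OF r f(3) k(3)] cf_add[OF r2 f(4) k(4)] by simp
  qed
  have ker: "g \<in> HB n (Suc r) \<longleftrightarrow> \<psi> 0 g = 0 \<and> \<psi> (Suc 0) g = 0 \<and> (odd r \<longrightarrow> \<psi> 2 g = 0)" if g: "g \<in> HB n r" for g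
  proof (rule HB_obtain[OF g])
    fix f0 f1 f2
    assume f: "vals n g f0 f1 f2" "Wfil (Suc n) r f0" "Wfil (Suc n) r f1" "Wfil n (r div 2) f2"
    have z: "cf m s k = 0 \<longleftrightarrow> Wfil m (Suc s) k" for m s k by (simp add: cf_def)
    have "odd r \<Longrightarrow> Suc r div 2 = Suc (r div 2)" "even r \<Longrightarrow> Suc r div 2 = r div 2" by simp_all
    then show ?thesis unfolding HB_vals[OF f(1)] pv[OF f(1)] using f(4) by (cases "odd r") (simp_all add: z)
  qed
  note sub = normal_imp_subgroup[OF HB_normal]
  have le: "HB n (Suc r) \<subseteq> HB n r" by (rule HB_antimono) simp
  show ?thesis
  proof (cases "odd r")
    case True
    have "rank (Gt\<lparr>carrier := HB n r\<rparr> Mod HB n (Suc r)) = 3"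
      by (rule rank_quotient[where \<psi> = \<psi> and u = u, OF sub HB_normal le])
        (use hom ker u dual True in \<open>simp_all add: less_2_cases_sum\<close>)
    then show ?thesis using True by simp
  next
    case False
    have "rank (Gt\<lparr>carrier := HB n r\<rparr> Mod HB n (Suc r)) = 2"
      by (rule rank_quotient[where \<psi> = \<psi> and u = u, OF sub HB_normal le])
        (use hom ker u dual False in \<open>simp_all add: less_2_cases_sum\<close>)
    then show ?thesis using False by simp
  qed
qed

lemma rank_Hs:
  assumes "1 \<le> i"
  shows "rank (Gt\<lparr>carrier := Hs i\<rparr> Mod Hs (i + 1)) = (if i = 1 then 4 else if even i then 3 else 2)"
proof -
  consider "i = 1" | "i = 2" | "3 \<le> i" using assms by linarith
  then show ?thesis
  proof cases
    case 1
    then show ?thesis using rank_1 by (simp only: one_add_one) simp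
  next
    case 2
    have "(2::nat) + 1 = 3" by simp
    then show ?thesis using rank_2 2 by (simp only:) simp
  next
    case 3
    then obtain n r where k: "r < 2 ^ Suc n" "i = 2 ^ Suc n + 1 + r" by (rule Hs_cases)
    have "i + 1 = 2 ^ Suc n + 1 + Suc r" using k(2) by simp
    then have e: "Hs (i + 1) = HB n (Suc r)" "Hs i = HB n r"
      using Hs_block_le[of "Suc r" n] Hs_block[OF k(1)] k by simp_all
    \<comment> \<open>Block starts are odd weights, so the offsets at which \<gamma> contributes are
      the even weights.\<close>
    have "even i \<longleftrightarrow> odd r" "i \<noteq> 1" using k(2) by simp_all
    then show ?thesis unfolding e rank_block[OF k(1)] by simp
  qed
qed

theorem theorem7p6:
  shows "(\<forall>m\<ge>1. dim_subgroup Gt (2 ^ m + 1) = Nt m) \<and>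
    (\<forall>m\<ge>1. \<forall>r\<le>2 ^ m.
       dim_subgroup Gt (2 ^ m + 1 + r) =
         (if even r then abg_preimage m (V_sub m r) (V_sub m r) (V_sub (m - 1) (r div 2))
          else abg_preimage m (V_sub m r) (V_sub m r) (V_sub (m - 1) ((r - 1) div 2)))) \<and>
    (\<forall>i\<ge>1. rank (Gt\<lparr>carrier := dim_subgroup Gt i\<rparr> Mod dim_subgroup Gt (i + 1)) =
       (if i = 1 then 4 else if even i then 3 else 2))"
proof (intro conjI allI impI)
  have pos: "1 \<le> 2 ^ m + 1 + r" for m r :: nat by simp
  fix m :: nat assume "1 \<le> m"
  then obtain n where m: "m = Suc n" by (cases m) auto
  have D: "dim_subgroup Gt (2 ^ m + 1 + r) = HB n r" if "r \<le> 2 ^ m" for r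
    unfolding dim_subgroup_Gt[OF pos] using that unfolding m by (rule Hs_block_le)
  show "dim_subgroup Gt (2 ^ m + 1) = Nt m"
    using D[of 0] by (simp add: m HB_0 Nt_Suc)
  fix r :: nat assume r: "r \<le> 2 ^ m"
  \<comment> \<open>The two cases of the statement have the same rounded half, so
    \<open>HB n r\<close> matches both.\<close>
  have "odd r \<Longrightarrow> (r - 1) div 2 = r div 2" by (elim oddE) simp
  then have "(if even r then abg_preimage m (V_sub m r) (V_sub m r) (V_sub (m - 1) (r div 2))
      else abg_preimage m (V_sub m r) (V_sub m r) (V_sub (m - 1) ((r - 1) div 2))) =
      abg_preimage (Suc n) (V_sub (Suc n) r) (V_sub (Suc n) r) (V_sub n (r div 2))"
    unfolding m by simp
  then show "dim_subgroup Gt (2 ^ m + 1 + r) =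
      (if even r then abg_preimage m (V_sub m r) (V_sub m r) (V_sub (m - 1) (r div 2))
       else abg_preimage m (V_sub m r) (V_sub m r) (V_sub (m - 1) ((r - 1) div 2)))"
    unfolding D[OF r] abg_preimage_HB by (rule sym)
next
  fix i :: nat assume i: "1 \<le> i"
  have i': "1 \<le> i + 1" by simp
  show "rank (Gt\<lparr>carrier := dim_subgroup Gt i\<rparr> Mod dim_subgroup Gt (i + 1)) =
      (if i = 1 then 4 else if even i then 3 else 2)"
    unfolding dim_subgroup_Gt[OF i] dim_subgroup_Gt[OF i'] by (rule rank_Hs[OF i])
qed

end
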